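(* Let $d\ge1$ and let $\mathcal{B}$, $\mathcal{B}_0$, $\mathcal{B}_\ast$, $\mathrm{UC}$ be the spaces on $(0,1)^d$ defined in the context. Then $\mathcal{B}_0^\ast=\mathcal{B}_\ast$ and $\mathcal{B}_0^{\ast\ast}=\mathcal{B}_\ast^\ast=\mathcal{B}$, isometrically via the $L^2((0,1)^d)$-pairing. Precisely, let $1<p<d/(d-1)$ ($1<p<\infty$ if $d=1$), $X=L^p((0,1)^d)/\mathbb{C}$, and identify $X^\ast$ with $\{g\in L^{p'}((0,1)^d):\int g\,dx=0\}$, $1/p+1/p'=1$, through the pairing $(f,g)\mapsto\int_{(0,1)^d}fg\,dx$. Then: 1. The map sending $g\in X^\ast\subset\mathcal{B}_\ast$ to the functional $f\mapsto\int_{(0,1)^d} fg\,dx$ on $\mathcal{B}_0$ extends to an isometric isomorphism of $\mathcal{B}_\ast$ onto $\mathcal{B}_0^\ast$. 2. There is an isometric isomorphism $J$ of $\mathcal{B}$ onto $\mathcal{B}_\ast^\ast$ with $Jf(g)=\int_{(0,1)^d}fg\,dx$ for $f\in\mathcal{B}$ and $g\in X^\ast\subset\mathcal{B}_\ast$. 3. If $I:\mathcal{B}_0\to X$ is the inclusion operator, then $I^{\ast\ast}:\mathcal{B}_0^{\ast\ast}\to X^{\ast\ast}=X$ maps $\mathcal{B}_0^{\ast\ast}$ isometrically onto $\mathcal{B}$. Moreover, for any $f\in\mathcal{B}$, $$\operatorname{dist}(f,\mathcal{B}_0)=\operatorname{dist}(f,\mathrm{UC})=\min_{g\in\mathcal{B}_0}\|f-g\|_{\mathcal{B}}=\varlimsup_{\varepsilon\to0}\,[f]_\varepsilon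 ,$$ where distances are taken in the norm of $\mathcal{B}$; in particular the minimum is attained.
   Context: An $\varepsilon$-cube is an open cube $Q_\varepsilon$ in $\mathbb{R}^d$ with sides of length $\varepsilon$ parallel to the coordinate axes; $|Q_\varepsilon|=\varepsilon^d$, while $|\mathcal{F}_\varepsilon|$ denotes the cardinality of a collection $\mathcal{F}_\varepsilon$. For (complex-valued) $f\in L^1((0,1)^d)$ let $f_{Q}=\frac1{|Q|}\int_Q f\,dx$. For $0<\varepsilon\le1$ set $$[f]_\varepsilon=\varepsilon^{d-1}\sup_{\mathcal{F}_\varepsilon}\sum_{Q_\varepsilon\in\mathcal{F}_\varepsilon}\frac1{|Q_\varepsilon|}\int_{Q_\varepsilon}|f(x)-f_{Q_\varepsilon}|\,dx ,$$ where the supremum is over all collections $\mathcal{F}_\varepsilon$ of mutually disjoint $\varepsilon$-cubes contained in $(0,1)^d$ with $|\mathcal{F}_\varepsilon|\le\varepsilon^{1-d}$. Define $\|f\|_{\mathcal{B}}=\sup_{0<\varepsilon\le1}[f]_\varepsilon$ and $\mathcal{B}=\{f\in L^1((0,1)^d):\|f\|_{\mathcal{B}}<\infty\}$, with functions identified modulo additive constants, so that $\|\cdot\|_{\mathcal{B}}$ is a norm. It is known that $\mathcal{B}$ is continuously contained in $L^p((0,1)^d)/\mathbb{C}$ for $1<p<d/(d-1)$ ($1<p<\infty$ if $d=1$). $\mathcal{B}_0=\{f\in\mathcal{B}:\varlimsup_{\varepsilon\to0}[f]_\varepsilon=0\}$, with the norm of $\mathcal{B}$. $\mathrm{UC}\subset\mathcal{B}_0$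 is the space of uniformly continuous functions on $(0,1)^d$, modulo constants. $\mathcal{B}_\ast$ is the following (isometric) predual of $\mathcal{B}$: the subspace of $\mathcal{B}^\ast$, with the norm of $\mathcal{B}^\ast$, of all functionals of the form $f\mapsto\sum_{n=1}^\infty\lambda_n\int_{(0,1)^d}fg_n\,dx$ with $(\lambda_n)\in\ell^1$, where each $g_n$ is a function for which there exist $\varepsilon=\varepsilon_n\in(0,1]$ and a collection $\mathcal{F}_\varepsilon$ of mutually disjoint $\varepsilon$-cubes in $(0,1)^d$ with $|\mathcal{F}_\varepsilon|\le\varepsilon^{1-d}$ such that $g_n=0$ a.e. outside $\bigcup_{Q_\varepsilon\in\mathcal{F}_\varepsilon}Q_\varepsilon$ and, for every $Q_\varepsilon\in\mathcal{F}_\varepsilon$, $|g_n|\le\varepsilon^{d-1}/|Q_\varepsilon|$ on $Q_\varepsilon$ and $\int_{Q_\varepsilon}g_n\,dx=0$. A mean-zero $g\in L^{p'}((0,1)^d)$ is regarded as an element of $\mathcal{B}_\ast$ via the functional $f\mapsto\int fg\,dx$ on $\mathcal{B}$; all such functionals belong to $\mathcal{B}_\ast$. *)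

theory Defs
  imports "HOL-Analysis.Analysis"
begin

text \<open>
  All spaces below are spaces of functions \<open>'x \<Rightarrow> complex\<close>: a carrier together with a seminorm.
  Spaces of functions modulo constants (and modulo null sets) are represented by their
  representatives, the seminorm vanishing exactly on the functions that are identified with \<open>0\<close>
  (see \<open>B_norm_eq_0_iff\<close> below).  Bounded functionals do not depend on the choice of
  representatives.
\<close>

subsection \<open>Complex seminormed spaces, duals and adjoints\<close>

definition clinear_functional_on :: "('x \<Rightarrow> complex) set \<Rightarrow> (('x \<Rightarrow> complex) \<Rightarrow> complex) \<Rightarrow> bool" where
  "clinear_functional_on V \<phi> \<longleftrightarrow>
     (\<forall>f\<in>V. \<forall>g\<in>V. \<forall>a b. \<phi> (\<lambda>x. a * f x + b * g x) = a * \<phi> f + b * \<phi> g)"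

definition clinear_map_on ::
  "('x \<Rightarrow> complex) set \<Rightarrow> (('x \<Rightarrow> complex) \<Rightarrow> ('y \<Rightarrow> complex)) \<Rightarrow> bool" where
  "clinear_map_on V T \<longleftrightarrow>
     (\<forall>f\<in>V. \<forall>g\<in>V. \<forall>a b. T (\<lambda>x. a * f x + b * g x) = (\<lambda>y. a * T f y + b * T g y))"

text \<open>
  Functionals are extended by \<open>0\<close> outside the carrier, so that equality of functionals is equality
  on the carrier and the dual is again a vector space under pointwise operations.
\<close>

definition dual_space ::
  "('x \<Rightarrow> complex) set \<Rightarrow> (('x \<Rightarrow> complex) \<Rightarrow> real) \<Rightarrow> (('x \<Rightarrow> complex) \<Rightarrow> complex) set" where
  "dual_space V N =
     {\<phi>. clinear_functional_on V \<phi> \<and> (\<exists>C. \<forall>f\<in>V. cmod (\<phi> f) \<le> C * N f) \<and> (\<forall>f. f \<notin> V \<longrightarrow> \<phi> f = 0)}"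

definition dual_norm ::
  "('x \<Rightarrow> complex) set \<Rightarrow> (('x \<Rightarrow> complex) \<Rightarrow> real) \<Rightarrow> (('x \<Rightarrow> complex) \<Rightarrow> complex) \<Rightarrow> real" where
  "dual_norm V N \<phi> = (SUP f\<in>{f \<in> V. N f \<le> 1}. cmod (\<phi> f))"

text \<open>Injectivity modulo functions of seminorm \<open>0\<close> follows from linearity and isometry.\<close>

definition isometric_isomorphism ::
  "('x \<Rightarrow> complex) set \<Rightarrow> (('x \<Rightarrow> complex) \<Rightarrow> real) \<Rightarrow>
   ('y \<Rightarrow> complex) set \<Rightarrow> (('y \<Rightarrow> complex) \<Rightarrow> real) \<Rightarrow>
   (('x \<Rightarrow> complex) \<Rightarrow> ('y \<Rightarrow> complex)) \<Rightarrow> bool" where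
  "isometric_isomorphism V N W M T \<longleftrightarrow>
     clinear_map_on V T \<and> T ` V = W \<and> (\<forall>f\<in>V. M (T f) = N f)"

definition adjoint_op ::
  "('x \<Rightarrow> complex) set \<Rightarrow> (('x \<Rightarrow> complex) \<Rightarrow> ('y \<Rightarrow> complex)) \<Rightarrow>
   (('y \<Rightarrow> complex) \<Rightarrow> complex) \<Rightarrow> (('x \<Rightarrow> complex) \<Rightarrow> complex)" where
  "adjoint_op V T \<psi> = (\<lambda>f. if f \<in> V then \<psi> (T f) else 0)"

definition canonical_embedding ::
  "('x \<Rightarrow> complex) set \<Rightarrow> (('x \<Rightarrow> complex) \<Rightarrow> real) \<Rightarrow>
   ('x \<Rightarrow> complex) \<Rightarrow> (('x \<Rightarrow> complex) \<Rightarrow> complex) \<Rightarrow> complex" where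
  "canonical_embedding V N f = (\<lambda>\<psi>. if \<psi> \<in> dual_space V N then \<psi> f else 0)"


subsection \<open>Lebesgue spaces on the open unit cube\<close>

abbreviation unit_cube :: "(real^'n) set" where
  "unit_cube \<equiv> box 0 1"

abbreviation cube_measure :: "(real^'n) measure" where
  "cube_measure \<equiv> lebesgue_on unit_cube"

definition L1_space :: "(real^'n \<Rightarrow> complex) set" where
  "L1_space = {f. integrable cube_measure f}"

definition Lp_space :: "real \<Rightarrow> (real^'n \<Rightarrow> complex) set" where
  "Lp_space p = {f \<in> borel_measurable cube_measure. integrable cube_measure (\<lambda>x. cmod (f x) powr p)}"

definition Lp_norm :: "real \<Rightarrow> (real^'n \<Rightarrow> complex) \<Rightarrow> real" where
  "Lp_norm p f = (\<integral>x. cmod (f x) powr p \<partial>cube_measure) powr (1 / p)"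

definition Lp_mod_norm :: "real \<Rightarrow> (real^'n \<Rightarrow> complex) \<Rightarrow> real" where
  "Lp_mod_norm p f = (INF c. Lp_norm p (\<lambda>x. f x + c))"

definition Lp_mean_zero :: "real \<Rightarrow> (real^'n \<Rightarrow> complex) set" where
  "Lp_mean_zero q = {g \<in> Lp_space q. (\<integral>x. g x \<partial>cube_measure) = 0}"

definition pairing_functional ::
  "(real^'n \<Rightarrow> complex) set \<Rightarrow> (real^'n \<Rightarrow> complex) \<Rightarrow> (real^'n \<Rightarrow> complex) \<Rightarrow> complex" where
  "pairing_functional V g = (\<lambda>f. if f \<in> V then \<integral>x. f x * g x \<partial>cube_measure else 0)"


subsection \<open>The spaces \<open>B\<close>, \<open>B\<^sub>0\<close>, \<open>UC\<close> and \<open>B\<^sub>*\<close>\<close>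

definition eps_cube :: "real \<Rightarrow> (real^'n) set \<Rightarrow> bool" where
  "eps_cube \<epsilon> Q \<longleftrightarrow> (\<exists>a. Q = box a (\<chi> i. a $ i + \<epsilon>))"

definition cube_families :: "real \<Rightarrow> (real^'n) set set set" where
  "cube_families \<epsilon> =
     {\<F>. (\<forall>Q\<in>\<F>. eps_cube \<epsilon> Q \<and> Q \<subseteq> unit_cube) \<and> disjoint \<F> \<and>
         finite \<F> \<and> real (card \<F>) \<le> \<epsilon> powr (1 - real CARD('n))}"

definition average :: "(real^'n) set \<Rightarrow> (real^'n \<Rightarrow> complex) \<Rightarrow> complex" where
  "average Q f = (LINT x:Q|lebesgue. f x) / of_real (measure lebesgue Q)"

definition osc :: "real \<Rightarrow> (real^'n \<Rightarrow> complex) \<Rightarrow> ennreal" where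
  "osc \<epsilon> f = (SUP \<F>\<in>cube_families \<epsilon>. ennreal (\<epsilon> ^ (CARD('n) - 1) *
      (\<Sum>Q\<in>\<F>. 1 / measure lebesgue Q * (LINT x:Q|lebesgue. cmod (f x - average Q f)))))"

definition B_enorm :: "(real^'n \<Rightarrow> complex) \<Rightarrow> ennreal" where
  "B_enorm f = (SUP \<epsilon>\<in>{0<..1}. osc \<epsilon> f)"

definition B_norm :: "(real^'n \<Rightarrow> complex) \<Rightarrow> real" where
  "B_norm f = enn2real (B_enorm f)"

definition B_space :: "(real^'n \<Rightarrow> complex) set" where
  "B_space = {f \<in> L1_space. B_enorm f < \<infinity>}"

definition limsup_osc :: "(real^'n \<Rightarrow> complex) \<Rightarrow> ennreal" where
  "limsup_osc f = Limsup (at_right 0) (\<lambda>\<epsilon>. osc \<epsilon> f)"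

definition B0_space :: "(real^'n \<Rightarrow> complex) set" where
  "B0_space = {f \<in> B_space. limsup_osc f = 0}"

definition UC_space :: "(real^'n \<Rightarrow> complex) set" where
  "UC_space = {f. uniformly_continuous_on unit_cube f}"

text \<open>Distances use the extended norm, so that a function outside \<open>B\<close> is at distance \<open>\<infinity>\<close>
  rather than at the default value \<open>0\<close>.\<close>

definition B_dist :: "(real^'n \<Rightarrow> complex) \<Rightarrow> (real^'n \<Rightarrow> complex) set \<Rightarrow> ennreal" where
  "B_dist f A = (INF g\<in>A. B_enorm (\<lambda>x. f x - g x))"

definition atom :: "(real^'n \<Rightarrow> complex) \<Rightarrow> bool" where
  "atom g \<longleftrightarrow> g \<in> borel_measurable cube_measure \<and>
     (\<exists>\<epsilon>. 0 < \<epsilon> \<and> \<epsilon> \<le> 1 \<and> (\<exists>\<F>\<in>cube_families \<epsilon>.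
        (AE x in cube_measure. x \<notin> \<Union>\<F> \<longrightarrow> g x = 0) \<and>
        (\<forall>Q\<in>\<F>. (\<forall>x\<in>Q. cmod (g x) \<le> \<epsilon> ^ (CARD('n) - 1) / measure lebesgue Q) \<and>
               (LINT x:Q|lebesgue. g x) = 0)))"

definition B_predual :: "((real^'n \<Rightarrow> complex) \<Rightarrow> complex) set" where
  "B_predual = {\<phi> \<in> dual_space B_space B_norm.
     \<exists>c g. summable (\<lambda>n. cmod (c n)) \<and> (\<forall>n. atom (g n)) \<and>
       (\<forall>f\<in>B_space. \<phi> f = (\<Sum>n::nat. c n * (\<integral>x. f x * g n x \<partial>cube_measure)))}"

abbreviation B_predual_norm :: "((real^'n \<Rightarrow> complex) \<Rightarrow> complex) \<Rightarrow> real" where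
  "B_predual_norm \<equiv> dual_norm B_space B_norm"


subsection \<open>The seminorm of \<open>B\<close> is a norm modulo constants\<close>

lemma measure_box_cart:
  fixes a :: "real^'n"
  assumes "0 \<le> \<epsilon>"
  shows "measure lebesgue (box a (\<chi> i. a $ i + \<epsilon>)) = \<epsilon> ^ CARD('n)"
proof -
  have "measure lebesgue (box a (\<chi> i. a $ i + \<epsilon>)) = measure lborel (cbox a (\<chi> i. a $ i + \<epsilon>))"
    by (simp add: measure_lborel_box_eq measure_lborel_cbox_eq)
  also have "\<dots> = (\<Prod>i\<in>UNIV. (\<chi> i. a $ i + \<epsilon>) $ i - a $ i)"
    using assms by (intro content_cbox_cart) (auto simp: interval_ne_empty_cart)
  finally show ?thesis
    by simp
qed

lemma unit_cube_eq: "(unit_cube :: (real^'n) set) = box 0 (\<chi> i. 0 $ i + 1)"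
  by (simp add: one_vec_def)

lemma eps_cube_unit_cube: "eps_cube 1 unit_cube"
  unfolding eps_cube_def by (rule exI) (rule unit_cube_eq)

lemma measure_unit_cube: "measure lebesgue (unit_cube :: (real^'n) set) = 1"
  unfolding unit_cube_eq by (subst measure_box_cart) auto

lemma B_norm_eq_0_iff:
  fixes f :: "real^'n \<Rightarrow> complex"
  assumes f: "f \<in> B_space"
  shows "B_norm f = 0 \<longleftrightarrow> (\<exists>c. AE x in cube_measure. f x = c)"
proof
  assume "B_norm f = 0"
  then have "B_enorm f = 0"
    using f by (auto simp: B_norm_def B_space_def enn2real_eq_0_iff)
  moreover have "osc 1 f \<le> B_enorm f"
    unfolding B_enorm_def by (intro SUP_upper) auto
  ultimately have osc0: "osc 1 f = 0"
    by simp
  let ?m = "average unit_cube f"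
  have "{unit_cube} \<in> (cube_families 1 :: (real^'n) set set set)"
    unfolding cube_families_def using eps_cube_unit_cube by auto
  then have "ennreal (1 ^ (CARD('n) - 1) * (\<Sum>Q\<in>{unit_cube}. 1 / measure lebesgue Q *
      (LINT x:Q|lebesgue. cmod (f x - average Q f)))) \<le> osc 1 f"
    unfolding osc_def by (rule SUP_upper)
  then have "(LINT x:unit_cube|lebesgue. cmod (f x - ?m)) \<le> 0"
    using osc0 measure_unit_cube[where 'n='n] by (simp add: ennreal_eq_0_iff)
  then have le0: "(\<integral>x. cmod (f x - ?m) \<partial>cube_measure) \<le> 0"
    by (simp add: set_lebesgue_integral_def integral_restrict_space)
  have "finite_measure (cube_measure :: (real^'n) measure)"
    by (rule finite_measure_lebesgue_on) auto
  then have int: "integrable cube_measure (\<lambda>x. cmod (f x - ?m))"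
    using f by (auto simp: B_space_def L1_space_def finite_measure.integrable_const)
  moreover have "(\<integral>x. cmod (f x - ?m) \<partial>cube_measure) = 0"
    using le0 by (simp add: antisym)
  ultimately have "AE x in cube_measure. cmod (f x - ?m) = 0"
    by (subst (asm) integral_nonneg_eq_0_iff_AE) auto
  then show "\<exists>c. AE x in cube_measure. f x = c"
    by auto
next
  assume "\<exists>c. AE x in cube_measure. f x = c"
  then obtain c where "AE x in cube_measure. f x = c" ..
  then have c: "AE x in lebesgue. x \<in> unit_cube \<longrightarrow> f x = c"
    by (simp add: AE_restrict_space_iff)
  have cube: "(LINT x:Q|lebesgue. cmod (f x - average Q f)) = 0"
    if "0 < \<epsilon>" "\<F> \<in> cube_families \<epsilon>" "Q \<in> \<F>" for \<epsilon> \<F> and Q :: "(real^'n) set"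
  proof -
    have sub: "Q \<subseteq> unit_cube"
      using that unfolding cube_families_def by auto
    have "eps_cube \<epsilon> Q"
      using that unfolding cube_families_def by auto
    then obtain a where Q: "Q = box a (\<chi> i. a $ i + \<epsilon>)"
      unfolding eps_cube_def by (elim exE)
    have ms: "Q \<in> sets lebesgue"
      by (simp add: Q)
    have pos: "measure lebesgue Q \<noteq> 0"
      unfolding Q using that by (subst measure_box_cart) auto
    have on_Q: "AE x in lebesgue. x \<in> Q \<longrightarrow> f x = c"
      using c by eventually_elim (use sub in auto)
    have aeQ: "AE x in lebesgue_on Q. f x = c"
      using on_Q ms by (simp add: AE_restrict_space_iff)
    have "(LINT x:Q|lebesgue. f x) = (\<integral>x. f x \<partial>lebesgue_on Q)"
      using ms by (simp add: set_lebesgue_integral_def integral_restrict_space)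
    also have "\<dots> = (\<integral>x. c \<partial>lebesgue_on Q)"
    proof (rule integral_cong_AE)
      show "f \<in> borel_measurable (lebesgue_on Q)"
        using f sub measurable_restrict_mono[of f lebesgue unit_cube borel Q]
        by (simp add: B_space_def L1_space_def borel_measurable_integrable)
    qed (use aeQ in auto)
    also have "\<dots> = of_real (measure lebesgue Q) * c"
      using ms by (simp add: measure_restrict_space scaleR_conv_of_real)
    finally have avg: "average Q f = c"
      using pos by (simp add: average_def)
    have "(LINT x:Q|lebesgue. cmod (f x - c)) = 0"
      unfolding set_lebesgue_integral_def
    proof (rule integral_eq_zero_AE)
      show "AE x in lebesgue. indicator Q x *\<^sub>R cmod (f x - c) = 0"
        using on_Q by eventually_elim (auto simp: indicator_def)
    qed
    then show ?thesis
      by (simp add: avg)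
  qed
  have "osc \<epsilon> f = 0" if "\<epsilon> \<in> {0<..1}" for \<epsilon>
  proof -
    have "osc \<epsilon> f \<le> 0"
      unfolding osc_def
    proof (rule SUP_least)
      fix \<F> :: "(real^'n) set set"
      assume "\<F> \<in> cube_families \<epsilon>"
      then have "(\<Sum>Q\<in>\<F>. 1 / measure lebesgue Q *
          (LINT x:Q|lebesgue. cmod (f x - average Q f))) = 0"
        using that cube[of \<epsilon> \<F>] by (intro sum.neutral) auto
      then show "ennreal (\<epsilon> ^ (CARD('n) - 1) * (\<Sum>Q\<in>\<F>. 1 / measure lebesgue Q *
          (LINT x:Q|lebesgue. cmod (f x - average Q f)))) \<le> 0"
        by simp
    qed
    then show ?thesis
      by simp
  qed
  then have "B_enorm f \<le> 0"
    unfolding B_enorm_def by (intro SUP_least) auto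
  then show "B_norm f = 0"
    by (simp add: B_norm_def)
qed

end

theory Submission
  imports Defs
begin

text \<open>
  A stopping-time argument on dyadic cubes gives \<open>B \<subseteq> L\<^sup>p\<close>.  By Hahn--Banach and \<open>L\<^sup>p\<close>-duality, a mean-zero
  \<open>g\<close> is a limit in \<open>L\<^sup>q\<close> of combinations of atoms whose total weight is controlled by the norm of \<open>g\<close> in
  \<open>B\<^sup>*\<close>; iterating, the closure of these \<open>g\<close> in \<open>B\<^sup>*\<close> consists of atomic series, so it is \<open>B\<^sub>*\<close>.  Averaging
  over the contractions \<open>x \<mapsto> (1 - u) x + u y\<close> of the cube approximates \<open>f \<in> B\<close> by uniformly continuous
  functions with almost no increase of the norm; hence the unit ball of \<open>B\<^sub>0\<close> norms \<open>B\<^sub>*\<close>.  Conversely,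
  \<open>B\<^sub>0\<close> embeds into a \<open>c\<^sub>0\<close>-sum over dyadic bands of scales, and a functional on it is an absolutely
  convergent sum of functionals on single bands, each given by a mean-zero function.  For the
  distance formula, the average of smoothings at widely separated scales is close to \<open>f\<close> at coarse scales,
  while at any fine scale all but one of the smoothings either are close to \<open>f\<close> or barely oscillate.
\<close>

text \<open>Atoms decide which functionals form \<open>B_predual\<close>, but its norm is the
  operator norm on \<open>B_space\<close>. The functions that test oscillation exactly are
  \<open>2 * g\<close> with \<open>g\<close> an atom, and separation by Hahn--Banach loses a further
  constant. Such constants are harmless for membership, while each isometry is read off from the
  functions \<open>2 * g\<close>. The L^p embedding makes functionals concrete: those bounded on L^p
  or L^q are integrals, and \<open>B_space\<close> is recovered inside L^p by testing with atoms.
  The range of p reflects the exponent 1/d in the level set inequality. Convolution would leave the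
  cube; a contraction respects admissible families, because the cardinality bound eps^(1-d) does not
  decrease when cubes shrink. One smoothing does not give the distance formula: at scales where it
  passes from imitating f to being flat, the difference is only bounded by about twice the norm of
  f. With n smoothings this loss is paid once out of n. What remains is an arbitrarily small excess;
  the minimum is attained because a correction costs only as much as the present excess, so that the
  corrections form a convergent series.\<close>

type_synonym 'n cfun = "real^'n \<Rightarrow> complex"

abbreviation cube_integral :: "(real^'n \<Rightarrow> 'b::{banach, second_countable_topology}) \<Rightarrow> 'b"
  (binder \<open>CINT \<close> 10) where
  "(CINT x. f x) \<equiv> \<integral>x. f x \<partial>cube_measure"

section \<open>Seminormed spaces of functions and their duals\<close>

text \<open>One inequality for linear combinations packs the triangle inequality together with the
  upper half of homogeneity; the lower half follows by scaling back. The carrier is included, so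
  that subspaces, quotients by null functions and dual spaces all fit the same interface.\<close>

definition cseminorm_on :: "('x \<Rightarrow> complex) set \<Rightarrow> (('x \<Rightarrow> complex) \<Rightarrow> real) \<Rightarrow> bool" where
  "cseminorm_on V N \<longleftrightarrow> (\<lambda>x. 0) \<in> V \<and>
     (\<forall>f\<in>V. \<forall>g\<in>V. \<forall>a b. (\<lambda>x. a * f x + b * g x) \<in> V \<and>
        N (\<lambda>x. a * f x + b * g x) \<le> cmod a * N f + cmod b * N g) \<and>
     (\<forall>f\<in>V. 0 \<le> N f)"

lemma cseminorm_onI:
  assumes "(\<lambda>x. 0) \<in> V"
    and "\<And>f g a b. f \<in> V \<Longrightarrow> g \<in> V \<Longrightarrow> (\<lambda>x. a * f x + b * g x) \<in> V"
    and "\<And>f g a b. f \<in> V \<Longrightarrow> g \<in> V \<Longrightarrow> N (\<lambda>x. a * f x + b * g x) \<le> cmod a * N f + cmod b * N g"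
    and "\<And>f. f \<in> V \<Longrightarrow> 0 \<le> N f"
  shows "cseminorm_on V N"
  using assms unfolding cseminorm_on_def by blast

context
  fixes V :: "('x \<Rightarrow> complex) set" and N :: "('x \<Rightarrow> complex) \<Rightarrow> real"
  assumes sn: "cseminorm_on V N"
begin

lemma cseminorm_zero_mem: "(\<lambda>x. 0) \<in> V"
  using sn unfolding cseminorm_on_def by blast

lemma cseminorm_nonneg: "f \<in> V \<Longrightarrow> 0 \<le> N f"
  using sn unfolding cseminorm_on_def by blast

lemma cseminorm_lincomb_mem: "f \<in> V \<Longrightarrow> g \<in> V \<Longrightarrow> (\<lambda>x. a * f x + b * g x) \<in> V"
  using sn unfolding cseminorm_on_def by blast

lemma cseminorm_lincomb: "f \<in> V \<Longrightarrow> g \<in> V \<Longrightarrow> N (\<lambda>x. a * f x + b * g x) \<le> cmod a * N f + cmod b * N g"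
  using sn unfolding cseminorm_on_def by blast

lemma cseminorm_add_mem: "f \<in> V \<Longrightarrow> g \<in> V \<Longrightarrow> (\<lambda>x. f x + g x) \<in> V"
  using cseminorm_lincomb_mem[of f g 1 1] by simp

lemma cseminorm_diff_mem: "f \<in> V \<Longrightarrow> g \<in> V \<Longrightarrow> (\<lambda>x. f x - g x) \<in> V"
  using cseminorm_lincomb_mem[of f g 1 "-1"] by simp

lemma cseminorm_scale_mem: "f \<in> V \<Longrightarrow> (\<lambda>x. a * f x) \<in> V"
  using cseminorm_lincomb_mem[of f f a 0] by simp

lemma cseminorm_add: "f \<in> V \<Longrightarrow> g \<in> V \<Longrightarrow> N (\<lambda>x. f x + g x) \<le> N f + N g"
  using cseminorm_lincomb[of f g 1 1] by simp

lemma cseminorm_diff: "f \<in> V \<Longrightarrow> g \<in> V \<Longrightarrow> N (\<lambda>x. f x - g x) \<le> N f + N g"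
  using cseminorm_lincomb[of f g 1 "-1"] by simp

lemma cseminorm_scale_le: "f \<in> V \<Longrightarrow> N (\<lambda>x. a * f x) \<le> cmod a * N f"
  using cseminorm_lincomb[of f f a 0] by simp

lemma cseminorm_zero: "N (\<lambda>x. 0) = 0"
  using cseminorm_scale_le[OF cseminorm_zero_mem, of 0] cseminorm_nonneg[OF cseminorm_zero_mem] by simp

lemma cseminorm_sum_mem:
  assumes "\<And>i. i \<in> I \<Longrightarrow> F i \<in> V"
  shows "(\<lambda>x. \<Sum>i\<in>I. F i x) \<in> V"
  using assms
proof (induction I rule: infinite_finite_induct)
  case (insert i I)
  then show ?case
    using cseminorm_add_mem[of "F i" "\<lambda>x. \<Sum>i\<in>I. F i x"] by simp
qed (simp_all add: cseminorm_zero_mem)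

lemma cseminorm_sum:
  assumes "\<And>i. i \<in> I \<Longrightarrow> F i \<in> V"
  shows "N (\<lambda>x. \<Sum>i\<in>I. F i x) \<le> (\<Sum>i\<in>I. N (F i))"
  using assms
proof (induction I rule: infinite_finite_induct)
  case (insert i I)
  have "N (\<lambda>x. \<Sum>i\<in>insert i I. F i x) = N (\<lambda>x. F i x + (\<Sum>i\<in>I. F i x))"
    using insert by simp
  also have "\<dots> \<le> N (F i) + N (\<lambda>x. \<Sum>i\<in>I. F i x)"
    using insert by (intro cseminorm_add cseminorm_sum_mem) auto
  finally show ?case
    using insert by simp
qed (simp_all add: cseminorm_zero)

lemma cseminorm_lincomb_sum_mem:
  assumes "\<And>i. i \<in> I \<Longrightarrow> F i \<in> V"
  shows "(\<lambda>x. \<Sum>i\<in>I. c i * F i x) \<in> V"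
  using cseminorm_sum_mem[of I "\<lambda>i x. c i * F i x"] cseminorm_scale_mem assms by auto

end

lemma clinear_functional_onD:
  "clinear_functional_on V \<phi> \<Longrightarrow> f \<in> V \<Longrightarrow> g \<in> V \<Longrightarrow>
     \<phi> (\<lambda>x. a * f x + b * g x) = a * \<phi> f + b * \<phi> g"
  unfolding clinear_functional_on_def by blast

lemma clinear_functional_on_add:
  "clinear_functional_on V \<phi> \<Longrightarrow> f \<in> V \<Longrightarrow> g \<in> V \<Longrightarrow> \<phi> (\<lambda>x. f x + g x) = \<phi> f + \<phi> g"
  using clinear_functional_onD[of V \<phi> f g 1 1] by simp

lemma clinear_functional_on_diff:
  "clinear_functional_on V \<phi> \<Longrightarrow> f \<in> V \<Longrightarrow> g \<in> V \<Longrightarrow> \<phi> (\<lambda>x. f x - g x) = \<phi> f - \<phi> g"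
  using clinear_functional_onD[of V \<phi> f g 1 "-1"] by simp

lemma clinear_functional_on_scale:
  "clinear_functional_on V \<phi> \<Longrightarrow> f \<in> V \<Longrightarrow> \<phi> (\<lambda>x. a * f x) = a * \<phi> f"
  using clinear_functional_onD[of V \<phi> f f a 0] by simp

lemma clinear_functional_on_zero:
  "clinear_functional_on V \<phi> \<Longrightarrow> f \<in> V \<Longrightarrow> \<phi> (\<lambda>x. 0) = 0"
  using clinear_functional_onD[of V \<phi> f f 0 0] by simp

lemma clinear_functional_on_lincomb_sum:
  assumes "cseminorm_on V N" "clinear_functional_on V \<phi>" "\<And>i. i \<in> I \<Longrightarrow> F i \<in> V"
  shows "\<phi> (\<lambda>x. \<Sum>i\<in>I. c i * F i x) = (\<Sum>i\<in>I. c i * \<phi> (F i))"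
  using assms(3)
proof (induction I rule: infinite_finite_induct)
  case (insert i I)
  have "\<phi> (\<lambda>x. \<Sum>i\<in>insert i I. c i * F i x) = \<phi> (\<lambda>x. c i * F i x + 1 * (\<Sum>i\<in>I. c i * F i x))"
    using insert by simp
  also have "\<dots> = c i * \<phi> (F i) + 1 * \<phi> (\<lambda>x. \<Sum>i\<in>I. c i * F i x)"
    using insert by (intro clinear_functional_onD[OF assms(2)] cseminorm_lincomb_sum_mem[OF assms(1)]) auto
  finally show ?case
    using insert by simp
qed (simp_all add: clinear_functional_on_zero[OF assms(2) cseminorm_zero_mem[OF assms(1)]])

lemma dual_spaceD:
  assumes "\<phi> \<in> dual_space V N"
  shows "clinear_functional_on V \<phi>" "\<exists>C. \<forall>f\<in>V. cmod (\<phi> f) \<le> C * N f" "\<And>f. f \<notin> V \<Longrightarrow> \<phi> f = 0"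
  using assms unfolding dual_space_def by blast+

lemma dual_spaceI:
  assumes "clinear_functional_on V \<phi>" "\<And>f. f \<in> V \<Longrightarrow> cmod (\<phi> f) \<le> C * N f" "\<And>f. f \<notin> V \<Longrightarrow> \<phi> f = 0"
  shows "\<phi> \<in> dual_space V N"
  using assms unfolding dual_space_def by blast

lemma dual_norm_upper:
  assumes "cseminorm_on V N" "\<phi> \<in> dual_space V N" "f \<in> V" "N f \<le> 1"
  shows "cmod (\<phi> f) \<le> dual_norm V N \<phi>"
proof -
  obtain C where C: "\<forall>f\<in>V. cmod (\<phi> f) \<le> C * N f"
    using dual_spaceD(2)[OF assms(2)] by blast
  have "cmod (\<phi> g) \<le> \<bar>C\<bar>" if "g \<in> V" "N g \<le> 1" for g
  proof -
    have "C * N g \<le> \<bar>C\<bar> * 1"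
      using that cseminorm_nonneg[OF assms(1) that(1)] by (intro mult_mono) auto
    then show ?thesis using C that by force
  qed
  then have "bdd_above ((\<lambda>f. cmod (\<phi> f)) ` {f \<in> V. N f \<le> 1})"
    by (intro bdd_aboveI2[where M="\<bar>C\<bar>"]) auto
  then show ?thesis
    unfolding dual_norm_def using assms by (intro cSUP_upper) auto
qed

lemma dual_norm_nonneg:
  assumes "cseminorm_on V N" "\<phi> \<in> dual_space V N"
  shows "0 \<le> dual_norm V N \<phi>"
  using dual_norm_upper[OF assms cseminorm_zero_mem[OF assms(1)]] cseminorm_zero[OF assms(1)]
    norm_ge_zero[of "\<phi> (\<lambda>x. 0)"] by linarith

lemma dual_bound:
  assumes sn: "cseminorm_on V N" and \<phi>: "\<phi> \<in> dual_space V N" and f: "f \<in> V"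
  shows "cmod (\<phi> f) \<le> dual_norm V N \<phi> * N f"
proof (cases "N f = 0")
  \<comment> \<open>Where the seminorm vanishes, normalising is impossible and the supremum over the
    unit ball is of no help; some bound \<open>C * N f\<close> exists and already forces the value
    0.\<close>
  case True
  then show ?thesis
    using dual_spaceD(2)[OF \<phi>] f by (metis mult_zero_right)
next
  case False
  then have pos: "N f > 0"
    using cseminorm_nonneg[OF sn f] by simp
  let ?g = "\<lambda>x. of_real (1 / N f) * f x"
  have "N ?g \<le> cmod (of_real (1 / N f)) * N f"
    by (rule cseminorm_scale_le[OF sn f])
  also have "\<dots> = 1"
    using pos by (simp add: norm_divide)
  finally have "cmod (\<phi> ?g) \<le> dual_norm V N \<phi>"
    by (intro dual_norm_upper[OF sn \<phi>] cseminorm_scale_mem[OF sn f]) auto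
  moreover have "\<phi> ?g = of_real (1 / N f) * \<phi> f"
    by (rule clinear_functional_on_scale[OF dual_spaceD(1)[OF \<phi>] f])
  ultimately have "cmod (of_real (1 / N f) * \<phi> f) \<le> dual_norm V N \<phi>"
    by simp
  then show ?thesis
    using pos by (simp add: norm_mult norm_divide pos_divide_le_eq)
qed

lemma dual_norm_le:
  assumes sn: "cseminorm_on V N" and "0 \<le> C" "\<And>f. f \<in> V \<Longrightarrow> cmod (\<phi> f) \<le> C * N f"
  shows "dual_norm V N \<phi> \<le> C"
  unfolding dual_norm_def
proof (rule cSUP_least)
  show "{f \<in> V. N f \<le> 1} \<noteq> {}"
    using cseminorm_zero_mem[OF sn] cseminorm_zero[OF sn] by force
  fix f assume f: "f \<in> {f \<in> V. N f \<le> 1}"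
  then have "C * N f \<le> C * 1"
    using assms(2) by (intro mult_left_mono) auto
  then show "cmod (\<phi> f) \<le> C"
    using assms(3)[of f] f by auto
qed

text \<open>Functionals are again complex functions, so the dual is a space of the same kind.
  Biduals and the dual of \<open>B_predual\<close> are then covered by the lemmas on duals.\<close>

lemma cseminorm_dual:
  assumes sn: "cseminorm_on V N"
  shows "cseminorm_on (dual_space V N) (dual_norm V N)"
proof (rule cseminorm_onI)
  show "(\<lambda>f. 0) \<in> dual_space V N"
    by (rule dual_spaceI[where C=0]) (auto simp: clinear_functional_on_def)
next
  fix \<phi> \<psi> a b
  assume \<phi>: "\<phi> \<in> dual_space V N" and \<psi>: "\<psi> \<in> dual_space V N"
  have bd: "cmod (a * \<phi> f + b * \<psi> f) \<le> (cmod a * dual_norm V N \<phi> + cmod b * dual_norm V N \<psi>) * N f"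
    if "f \<in> V" for f
  proof -
    have "cmod (a * \<phi> f + b * \<psi> f) \<le> cmod a * cmod (\<phi> f) + cmod b * cmod (\<psi> f)"
      by (metis norm_mult norm_triangle_ineq)
    also have "\<dots> \<le> cmod a * (dual_norm V N \<phi> * N f) + cmod b * (dual_norm V N \<psi> * N f)"
      using dual_bound[OF sn \<phi> that] dual_bound[OF sn \<psi> that] by (intro add_mono mult_left_mono) auto
    finally show ?thesis by (simp add: algebra_simps)
  qed
  show "(\<lambda>f. a * \<phi> f + b * \<psi> f) \<in> dual_space V N"
    using dual_spaceD(1,3)[OF \<phi>] dual_spaceD(1,3)[OF \<psi>]
    by (intro dual_spaceI[OF _ bd]) (auto simp: clinear_functional_on_def algebra_simps)
  show "dual_norm V N (\<lambda>f. a * \<phi> f + b * \<psi> f) \<le> cmod a * dual_norm V N \<phi> + cmod b * dual_norm V N \<psi>"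
    by (intro dual_norm_le[OF sn _ bd]) (auto intro!: add_nonneg_nonneg mult_nonneg_nonneg dual_norm_nonneg[OF sn] \<phi> \<psi>)
next
  show "0 \<le> dual_norm V N \<phi>" if "\<phi> \<in> dual_space V N" for \<phi>
    using dual_norm_nonneg[OF sn that] .
qed

subsection \<open>The Hahn--Banach theorem\<close>

text \<open>Homogeneity is demanded as an inequality, which is what survives infima; equality is
  recovered in \<open>sublinear_scale\<close> by scaling with 1/t.\<close>

definition sublinear_on :: "('x \<Rightarrow> complex) set \<Rightarrow> (('x \<Rightarrow> complex) \<Rightarrow> real) \<Rightarrow> bool" where
  "sublinear_on V q \<longleftrightarrow>
     (\<forall>f\<in>V. \<forall>g\<in>V. q (\<lambda>x. f x + g x) \<le> q f + q g) \<and>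
     (\<forall>f\<in>V. \<forall>t::real. 0 \<le> t \<longrightarrow> q (\<lambda>x. of_real t * f x) \<le> t * q f)"

lemma sublinear_onD:
  assumes "sublinear_on V q" "f \<in> V"
  shows "g \<in> V \<Longrightarrow> q (\<lambda>x. f x + g x) \<le> q f + q g" "0 \<le> t \<Longrightarrow> q (\<lambda>x. of_real t * f x) \<le> t * q f"
  using assms unfolding sublinear_on_def by blast+

lemma unimodular_rotation:
  obtains u where "cmod u = 1" "u * z = of_real (cmod z)"
proof (cases "z = 0")
  case True
  then show ?thesis using that[of 1] by simp
next
  case False
  show ?thesis
  proof
    show "cmod (cnj z / of_real (cmod z)) = 1"
      using False by (simp add: norm_divide)
    show "cnj z / of_real (cmod z) * z = of_real (cmod z)"
      using False complex_norm_square[of z] by (simp add: field_simps power2_eq_square)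
  qed
qed

text \<open>Near-minimisers are taken with error e / (t + 1) instead of e / t, which spares a case
  distinction for t = 0.\<close>

lemma scaled_epsilon:
  fixes t :: real
  assumes "0 \<le> t" "0 < e" "a < b + e / (t + 1)"
  shows "t * a \<le> t * b + e"
proof -
  have "t * a \<le> t * (b + e / (t + 1))" using assms by (intro mult_left_mono) auto
  also have "\<dots> \<le> t * b + e" using assms by (simp add: field_simps)
  finally show ?thesis .
qed

lemma cINF_lessD:
  fixes f :: "'a \<Rightarrow> real"
  shows "A \<noteq> {} \<Longrightarrow> (INF x\<in>A. f x) < z \<Longrightarrow> \<exists>x\<in>A. f x < z"
  using cInf_lessD[of "f ` A" z] by auto

context
  fixes V :: "('x \<Rightarrow> complex) set"
  assumes zero: "(\<lambda>x. 0) \<in> V"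
    and lin: "\<And>f g a b. f \<in> V \<Longrightarrow> g \<in> V \<Longrightarrow> (\<lambda>x. a * f x + b * g x) \<in> V"
begin

lemma sub_add: "f \<in> V \<Longrightarrow> g \<in> V \<Longrightarrow> (\<lambda>x. f x + g x) \<in> V"
  using lin[of f g 1 1] by simp

lemma sub_scale: "f \<in> V \<Longrightarrow> (\<lambda>x. a * f x) \<in> V"
  using lin[of f f a 0] by simp

lemma sub_neg: "f \<in> V \<Longrightarrow> (\<lambda>x. - f x) \<in> V"
  using sub_scale[of f "-1"] by simp

lemma sublinear_zero: "sublinear_on V q \<Longrightarrow> q (\<lambda>x. 0) = 0"
  using sublinear_onD(2)[of V q "\<lambda>x. 0" 0] sublinear_onD(1)[of V q "\<lambda>x. 0" "\<lambda>x. 0"] zero by simp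

lemma sublinear_scale:
  assumes q: "sublinear_on V q" and f: "f \<in> V" and t: "0 \<le> t"
  shows "q (\<lambda>x. of_real t * f x) = t * q f"
proof (cases "t = 0")
  case False
  have "q (\<lambda>x. of_real (1 / t) * (of_real t * f x)) \<le> 1 / t * q (\<lambda>x. of_real t * f x)"
    using t by (intro sublinear_onD(2)[OF q sub_scale[OF f]]) simp
  then show ?thesis
    using False t sublinear_onD(2)[OF q f t] by (simp add: field_simps)
qed (simp add: sublinear_zero[OF q])

lemma sublinear_neg_ge:
  assumes "sublinear_on V q" "f \<in> V"
  shows "- q (\<lambda>x. - f x) \<le> q f"
  using sublinear_onD(1)[OF assms sub_neg[OF assms(2)]] sublinear_zero[OF assms(1)] by simp

text \<open>
  A minimal sublinear functional is linear, and minimal ones exist by Zorn's lemma; this replaces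
  the usual one-dimensional extension step.
\<close>

lemma minimal_sublinear_exists:
  assumes p: "sublinear_on V p"
  obtains q where "sublinear_on V q" "\<And>f. f \<in> V \<Longrightarrow> q f \<le> p f"
    "\<And>r f. sublinear_on V r \<Longrightarrow> (\<And>g. g \<in> V \<Longrightarrow> r g \<le> q g) \<Longrightarrow> f \<in> V \<Longrightarrow> r f = q f"
proof -
  \<comment> \<open>Values outside \<open>V\<close> are pinned to 0; otherwise functionals that
    agree on \<open>V\<close> would be distinct and the order would not be antisymmetric.\<close>
  define A where "A = {q. sublinear_on V q \<and> (\<forall>f\<in>V. q f \<le> p f) \<and> (\<forall>f. f \<notin> V \<longrightarrow> q f = 0)}"
  define R where "R = {(q, r). q \<in> A \<and> r \<in> A \<and> (\<forall>f\<in>V. r f \<le> q f)}"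
  have ne: "(\<lambda>f. if f \<in> V then p f else 0) \<in> A"
    using p sub_add sub_scale unfolding A_def sublinear_on_def by auto
  have po: "Partial_order R"
  proof -
    have "R \<subseteq> A \<times> A" "\<forall>q\<in>A. (q, q) \<in> R"
      unfolding R_def by auto
    moreover have "antisym R"
    proof (rule antisymI)
      fix q r assume "(q, r) \<in> R" "(r, q) \<in> R"
      then have "q f = r f" for f
        unfolding R_def A_def by (cases "f \<in> V") (auto intro: antisym)
      then show "q = r" by auto
    qed
    moreover have "trans R"
      unfolding R_def by (intro transI) (auto intro: order_trans)
    moreover have "Field R = A"
      using calculation unfolding Field_def by auto
    ultimately show ?thesis
      unfolding partial_order_on_def preorder_on_def refl_on_def by auto
  qed
  have Field: "Field R = A"
    unfolding Field_def R_def by auto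
  have "\<exists>q\<in>Field R. \<forall>r\<in>Field R. (q, r) \<in> R \<longrightarrow> r = q"
  proof (rule Zorns_po_lemma[OF po])
    fix C assume C: "C \<in> Chains R"
    show "\<exists>u\<in>Field R. \<forall>a\<in>C. (a, u) \<in> R"
    proof (cases "C = {}")
      case True
      then show ?thesis using ne Field by auto
    next
      case False
      have CA: "C \<subseteq> A"
        using C unfolding Chains_def R_def by auto
      have comp: "(\<forall>f\<in>V. r f \<le> q f) \<or> (\<forall>f\<in>V. q f \<le> r f)" if "q \<in> C" "r \<in> C" for q r
        using C that unfolding Chains_def R_def by auto
      \<comment> \<open>The pointwise infimum along the chain is finite, because every member
        \<open>q\<close> satisfies - p (- f) <= - q (- f) <= q f.\<close>
      define u where "u f = (if f \<in> V then INF q\<in>C. q f else 0)" for f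
      have bdd: "bdd_below ((\<lambda>q. q f) ` C)" if "f \<in> V" for f
      proof (rule bdd_belowI2[where m="- p (\<lambda>x. - f x)"])
        fix q assume "q \<in> C"
        then have "q \<in> A" using CA by auto
        then show "- p (\<lambda>x. - f x) \<le> q f"
          using sublinear_neg_ge[of q f] sub_neg[OF that] that unfolding A_def by force
      qed
      have u_le: "u f \<le> q f" if "q \<in> C" "f \<in> V" for q f
        unfolding u_def using that bdd by (auto intro!: cINF_lower)
      have "u \<in> A"
        unfolding A_def sublinear_on_def
      proof (intro CollectI conjI ballI allI impI)
        fix f g assume f: "f \<in> V" and g: "g \<in> V"
        show "u (\<lambda>x. f x + g x) \<le> u f + u g"
        proof (rule field_le_epsilon)
          fix e :: real assume e: "0 < e"
          obtain q where q: "q \<in> C" "q f < u f + e / 2"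
            using e f cINF_lessD[OF False, of "\<lambda>q. q f" "u f + e/2"] unfolding u_def by auto
          obtain r where r: "r \<in> C" "r g < u g + e / 2"
            using e g cINF_lessD[OF False, of "\<lambda>q. q g" "u g + e/2"] unfolding u_def by auto
          \<comment> \<open>Of two members of a chain one lies below the other, and this one is a
            near-minimiser for \<open>f\<close> and for \<open>g\<close> simultaneously.\<close>
          obtain s where s: "s \<in> C" "s f \<le> q f" "s g \<le> r g"
            using comp[OF q(1) r(1)] q r f g by auto
          have "u (\<lambda>x. f x + g x) \<le> s (\<lambda>x. f x + g x)"
            by (rule u_le[OF s(1) sub_add[OF f g]])
          also have "\<dots> \<le> s f + s g"
            using s(1) CA f g unfolding A_def by (auto intro!: sublinear_onD)
          finally show "u (\<lambda>x. f x + g x) \<le> u f + u g + e"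
            using s q r by auto
        qed
      next
        fix f and t :: real assume f: "f \<in> V" and t: "0 \<le> t"
        show "u (\<lambda>x. of_real t * f x) \<le> t * u f"
        proof (rule field_le_epsilon)
          fix e :: real assume e: "0 < e"
          obtain q where q: "q \<in> C" "q f < u f + e / (t + 1)"
            using e t f cINF_lessD[OF False, of "\<lambda>q. q f" "u f + e / (t + 1)"] unfolding u_def by auto
          have "u (\<lambda>x. of_real t * f x) \<le> q (\<lambda>x. of_real t * f x)"
            by (rule u_le[OF q(1) sub_scale[OF f]])
          also have "\<dots> \<le> t * q f"
            using q(1) CA f t unfolding A_def by (auto intro!: sublinear_onD(2)[where V=V])
          also have "\<dots> \<le> t * u f + e"
            by (rule scaled_epsilon[OF t e q(2)])
          finally show "u (\<lambda>x. of_real t * f x) \<le> t * u f + e" .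
        qed
      next
        fix f assume "f \<in> V"
        obtain q where "q \<in> C" using False by auto
        then show "u f \<le> p f"
          using u_le[of q f] CA \<open>f \<in> V\<close> unfolding A_def by force
      qed (simp add: u_def)
      then show ?thesis
        using u_le CA Field unfolding R_def by (intro bexI[of _ u]) auto
    qed
  qed
  then obtain q where q: "q \<in> A" "\<And>r. r \<in> A \<Longrightarrow> (q, r) \<in> R \<Longrightarrow> r = q"
    using Field by auto
  show thesis
  proof
    show "sublinear_on V q" "\<And>f. f \<in> V \<Longrightarrow> q f \<le> p f"
      using q(1) unfolding A_def by auto
    fix r f assume r: "sublinear_on V r" "\<And>g. g \<in> V \<Longrightarrow> r g \<le> q g" and f: "f \<in> V"
    let ?r = "\<lambda>f. if f \<in> V then r f else 0"
    have "sublinear_on V ?r"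
      using r sub_add sub_scale unfolding sublinear_on_def by auto
    moreover have "r g \<le> p g" if "g \<in> V" for g
      using r(2)[OF that] q(1) that unfolding A_def by force
    ultimately have "?r \<in> A"
      unfolding A_def by simp
    moreover have "(q, ?r) \<in> R"
    proof -
      have "\<forall>f\<in>V. ?r f \<le> q f"
      proof
        fix f assume "f \<in> V"
        then show "?r f \<le> q f"
          using r(2)[OF \<open>f \<in> V\<close>] by (simp only: if_True)
      qed
      with q(1) \<open>?r \<in> A\<close> show ?thesis
        unfolding R_def mem_Collect_eq prod.case by (intro conjI)
    qed
    ultimately have "?r = q"
      by (rule q(2))
    then show "r f = q f"
      using fun_cong[OF \<open>?r = q\<close>, of f] f by (simp only: if_True)
  qed
qed

text \<open>The infimum over t >= 0 of q (h + t g) - t q g is sublinear in h and lies below q, so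
  minimality makes it equal to q. The choice t = 1 then gives q f <= q (f + g) - q g, the missing
  half of additivity.\<close>

lemma minimal_sublinear_additive:
  assumes q: "sublinear_on V q"
    and min: "\<And>r f. sublinear_on V r \<Longrightarrow> (\<And>g. g \<in> V \<Longrightarrow> r g \<le> q g) \<Longrightarrow> f \<in> V \<Longrightarrow> r f = q f"
    and f: "f \<in> V" and g: "g \<in> V"
  shows "q (\<lambda>x. f x + g x) = q f + q g"
proof (rule antisym)
  show "q (\<lambda>x. f x + g x) \<le> q f + q g"
    by (rule sublinear_onD(1)[OF q f g])
  define r where "r h = (INF t\<in>{0::real..}. q (\<lambda>x. h x + of_real t * g x) - t * q g)" for h
  have lower: "- q (\<lambda>x. - h x) \<le> q (\<lambda>x. h x + of_real t * g x) - t * q g" if "h \<in> V" "0 \<le> t" for h t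
  proof -
    have "q (\<lambda>x. of_real t * g x) = q (\<lambda>x. (h x + of_real t * g x) + - h x)"
      by simp
    also have "\<dots> \<le> q (\<lambda>x. h x + of_real t * g x) + q (\<lambda>x. - h x)"
      by (rule sublinear_onD(1)[OF q sub_add[OF that(1) sub_scale[OF g]] sub_neg[OF that(1)]])
    finally show ?thesis
      using sublinear_scale[OF q g that(2)] by simp
  qed
  have bdd: "bdd_below ((\<lambda>t. q (\<lambda>x. h x + of_real t * g x) - t * q g) ` {0..})" if "h \<in> V" for h
    using lower[OF that] by (intro bdd_belowI2) auto
  have r_le: "r h \<le> q (\<lambda>x. h x + of_real t * g x) - t * q g" if "h \<in> V" "0 \<le> t" for h t
    unfolding r_def using bdd[OF that(1)] that by (intro cINF_lower) auto
  have ex: "\<exists>t\<ge>0. q (\<lambda>x. h x + of_real t * g x) - t * q g < r h + e" if "h \<in> V" "0 < e" for h e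
    using cINF_lessD[of "{0..}" "\<lambda>t. q (\<lambda>x. h x + of_real t * g x) - t * q g" "r h + e"] that
    unfolding r_def by auto
  have "sublinear_on V r"
    unfolding sublinear_on_def
  proof (intro conjI ballI allI impI)
    fix h k assume h: "h \<in> V" and k: "k \<in> V"
    show "r (\<lambda>x. h x + k x) \<le> r h + r k"
    proof (rule field_le_epsilon)
      fix e :: real assume e: "0 < e"
      obtain s where s: "s \<ge> 0" "q (\<lambda>x. h x + of_real s * g x) - s * q g < r h + e / 2"
        using ex[OF h] e by (metis half_gt_zero)
      obtain t where t: "t \<ge> 0" "q (\<lambda>x. k x + of_real t * g x) - t * q g < r k + e / 2"
        using ex[OF k] e by (metis half_gt_zero)
      have "r (\<lambda>x. h x + k x) \<le> q (\<lambda>x. (h x + k x) + of_real (s + t) * g x) - (s + t) * q g"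
        using s t by (intro r_le sub_add h k) auto
      also have "(\<lambda>x. (h x + k x) + of_real (s + t) * g x) =
          (\<lambda>x. (h x + of_real s * g x) + (k x + of_real t * g x))"
        by (auto simp: algebra_simps)
      also have "q \<dots> \<le> q (\<lambda>x. h x + of_real s * g x) + q (\<lambda>x. k x + of_real t * g x)"
        by (intro sublinear_onD[OF q] sub_add sub_scale h k g)
      finally show "r (\<lambda>x. h x + k x) \<le> r h + r k + e"
        using s t by (simp add: algebra_simps)
    qed
  next
    fix h and s :: real assume h: "h \<in> V" and s: "0 \<le> s"
    show "r (\<lambda>x. of_real s * h x) \<le> s * r h"
    proof (rule field_le_epsilon)
      fix e :: real assume e: "0 < e"
      then have "0 < e / (s + 1)" using s by simp
      with ex[OF h] obtain t where t: "t \<ge> 0" "q (\<lambda>x. h x + of_real t * g x) - t * q g < r h + e / (s + 1)"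
        by blast
      have "r (\<lambda>x. of_real s * h x) \<le> q (\<lambda>x. of_real s * h x + of_real (s * t) * g x) - (s * t) * q g"
        using s t by (intro r_le sub_scale h) auto
      also have "(\<lambda>x. of_real s * h x + of_real (s * t) * g x) = (\<lambda>x. of_real s * (h x + of_real t * g x))"
        by (auto simp: algebra_simps)
      also have "q \<dots> \<le> s * q (\<lambda>x. h x + of_real t * g x)"
        using s by (intro sublinear_onD[OF q] sub_add sub_scale h g)
      also have "s * q (\<lambda>x. h x + of_real t * g x) - s * t * q g = s * (q (\<lambda>x. h x + of_real t * g x) - t * q g)"
        by (simp add: algebra_simps)
      also have "\<dots> \<le> s * r h + e"
        by (rule scaled_epsilon[OF s e t(2)])
      finally show "r (\<lambda>x. of_real s * h x) \<le> s * r h + e" by simp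
    qed
  qed
  moreover have "r h \<le> q h" if "h \<in> V" for h
    using r_le[OF that, of 0] by simp
  ultimately have "r f = q f"
    using f min by blast
  then show "q f + q g \<le> q (\<lambda>x. f x + g x)"
    using r_le[OF f, of 1] by simp
qed

end

theorem complex_Hahn_Banach:
  assumes sn: "cseminorm_on V N" and sub: "cseminorm_on W N" "W \<subseteq> V"
    and \<phi>: "clinear_functional_on W \<phi>" and bd: "\<And>f. f \<in> W \<Longrightarrow> cmod (\<phi> f) \<le> N f"
  obtains \<Phi> where "clinear_functional_on V \<Phi>" "\<And>f. f \<in> V \<Longrightarrow> cmod (\<Phi> f) \<le> N f"
    "\<And>f. f \<in> W \<Longrightarrow> \<Phi> f = \<phi> f"
proof -
  note zero = cseminorm_zero_mem[OF sn] and lin = cseminorm_lincomb_mem[OF sn]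
  note zeroW = cseminorm_zero_mem[OF sub(1)] and addW = cseminorm_add_mem[OF sub(1)]
    and scaleW = cseminorm_scale_mem[OF sub(1)]
  have WV: "w \<in> V" if "w \<in> W" for w using that sub by auto
  \<comment> \<open>Infimal convolution of the seminorm with the real part of \<open>\<phi>\<close>.
    A real-linear functional below \<open>p\<close> is below \<open>N\<close> (take w = 0) and below
    Re \<open>\<phi>\<close> on \<open>W\<close> (take w = f); the second bound, applied to w and -
    w, is an equality.\<close>
  define p where "p f = (INF w\<in>W. N (\<lambda>x. f x - w x) + Re (\<phi> w))" for f
  have lower: "- N f \<le> N (\<lambda>x. f x - w x) + Re (\<phi> w)" if "f \<in> V" "w \<in> W" for f w
  proof -
    have "N (\<lambda>x. - w x) \<le> N (\<lambda>x. f x - w x) + N f"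
      using cseminorm_diff[OF sn cseminorm_diff_mem[OF sn that(1) WV[OF that(2)]] that(1)] by simp
    moreover have "\<phi> (\<lambda>x. - w x) = - \<phi> w"
      using clinear_functional_on_scale[OF \<phi> that(2), of "-1"] by simp
    then have "- Re (\<phi> w) \<le> N (\<lambda>x. - w x)"
      using bd[OF scaleW[OF that(2), of "-1"]] complex_Re_le_cmod[of "\<phi> (\<lambda>x. - w x)"] by simp
    ultimately show ?thesis by linarith
  qed
  have bdd: "bdd_below ((\<lambda>w. N (\<lambda>x. f x - w x) + Re (\<phi> w)) ` W)" if "f \<in> V" for f
    using lower[OF that] by (intro bdd_belowI2) auto
  have p_le: "p f \<le> N (\<lambda>x. f x - w x) + Re (\<phi> w)" if "f \<in> V" "w \<in> W" for f w
    unfolding p_def using bdd that by (intro cINF_lower) auto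
  have ex: "\<exists>w\<in>W. N (\<lambda>x. f x - w x) + Re (\<phi> w) < p f + e" if "f \<in> V" "0 < e" for f e
    using cINF_lessD[of W "\<lambda>w. N (\<lambda>x. f x - w x) + Re (\<phi> w)" "p f + e"] that zeroW
    unfolding p_def by auto
  have phi_zero: "\<phi> (\<lambda>x. 0) = 0"
    by (rule clinear_functional_on_zero[OF \<phi> zeroW])
  have sublin: "sublinear_on V p"
    unfolding sublinear_on_def
  proof (intro conjI ballI allI impI)
    fix f g assume f: "f \<in> V" and g: "g \<in> V"
    show "p (\<lambda>x. f x + g x) \<le> p f + p g"
    proof (rule field_le_epsilon)
      fix e :: real assume e: "0 < e"
      obtain v where v: "v \<in> W" "N (\<lambda>x. f x - v x) + Re (\<phi> v) < p f + e / 2"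
        using ex[OF f] e by (metis half_gt_zero)
      obtain w where w: "w \<in> W" "N (\<lambda>x. g x - w x) + Re (\<phi> w) < p g + e / 2"
        using ex[OF g] e by (metis half_gt_zero)
      have "p (\<lambda>x. f x + g x) \<le> N (\<lambda>x. (f x + g x) - (v x + w x)) + Re (\<phi> (\<lambda>x. v x + w x))"
        by (intro p_le cseminorm_add_mem[OF sn] f g addW v w)
      also have "(\<lambda>x. (f x + g x) - (v x + w x)) = (\<lambda>x. (f x - v x) + (g x - w x))"
        by auto
      also have "N \<dots> \<le> N (\<lambda>x. f x - v x) + N (\<lambda>x. g x - w x)"
        by (intro cseminorm_add[OF sn] cseminorm_diff_mem[OF sn] f g WV v w)
      finally show "p (\<lambda>x. f x + g x) \<le> p f + p g + e"
        using v w clinear_functional_on_add[OF \<phi> v(1) w(1)] by simp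
    qed
  next
    fix f and t :: real assume f: "f \<in> V" and t: "0 \<le> t"
    show "p (\<lambda>x. of_real t * f x) \<le> t * p f"
    proof (rule field_le_epsilon)
      fix e :: real assume e: "0 < e"
      then have "0 < e / (t + 1)" using t by simp
      with ex[OF f] obtain w where w: "w \<in> W" "N (\<lambda>x. f x - w x) + Re (\<phi> w) < p f + e / (t + 1)"
        by blast
      have "p (\<lambda>x. of_real t * f x) \<le> N (\<lambda>x. of_real t * f x - of_real t * w x) + Re (\<phi> (\<lambda>x. of_real t * w x))"
        by (intro p_le cseminorm_scale_mem[OF sn] f scaleW w)
      also have "(\<lambda>x. of_real t * f x - of_real t * w x) = (\<lambda>x. of_real t * (f x - w x))"
        by (auto simp: algebra_simps)
      also have "N \<dots> \<le> t * N (\<lambda>x. f x - w x)"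
        using cseminorm_scale_le[OF sn cseminorm_diff_mem[OF sn f WV[OF w(1)]], of "of_real t"] t by simp
      also have "t * N (\<lambda>x. f x - w x) + Re (\<phi> (\<lambda>x. of_real t * w x)) = t * (N (\<lambda>x. f x - w x) + Re (\<phi> w))"
        by (simp add: clinear_functional_on_scale[OF \<phi> w(1)] algebra_simps)
      also have "\<dots> \<le> t * p f + e"
        by (rule scaled_epsilon[OF t e w(2)])
      finally show "p (\<lambda>x. of_real t * f x) \<le> t * p f + e" by simp
    qed
  qed
  obtain U where U: "sublinear_on V U" "\<And>f. f \<in> V \<Longrightarrow> U f \<le> p f"
    "\<And>r f. sublinear_on V r \<Longrightarrow> (\<And>g. g \<in> V \<Longrightarrow> r g \<le> U g) \<Longrightarrow> f \<in> V \<Longrightarrow> r f = U f"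
    using minimal_sublinear_exists[OF zero lin sublin] by blast
  have add: "U (\<lambda>x. f x + g x) = U f + U g" if "f \<in> V" "g \<in> V" for f g
  proof (rule minimal_sublinear_additive[where V=V, OF zero _ U(1) _ that])
    show "(\<lambda>x. a * f x + b * g x) \<in> V" if "f \<in> V" "g \<in> V" for f g a b
      by (rule lin[OF that])
    show "r f = U f" if "sublinear_on V r" "\<And>g. g \<in> V \<Longrightarrow> r g \<le> U g" "f \<in> V" for r f
      by (rule U(3)[where r=r and f=f, OF that])
  qed
  have neg: "U (\<lambda>x. - f x) = - U f" if "f \<in> V" for f
  proof -
    have "U (\<lambda>x. 0) = 0"
      using add[OF zero zero] by simp
    moreover have "(\<lambda>x. f x + - f x) = (\<lambda>x. 0)" "(\<lambda>x. - f x) \<in> V"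
      using cseminorm_scale_mem[OF sn that, of "-1"] by auto
    ultimately show ?thesis
      using add[OF that, of "\<lambda>x. - f x"] by simp
  qed
  have Us: "U (\<lambda>x. of_real t * f x) = t * U f" if "f \<in> V" "0 \<le> t" for f t
  proof (rule sublinear_scale[OF zero _ U(1) that])
    show "(\<lambda>x. a * f x + b * g x) \<in> V" if "f \<in> V" "g \<in> V" for f g a b
      by (rule lin[OF that])
  qed
  have scale: "U (\<lambda>x. of_real t * f x) = t * U f" if "f \<in> V" for f t
  proof (cases "t \<ge> 0")
    case False
    then have "U (\<lambda>x. - (of_real (- t) * f x)) = - ((- t) * U f)"
      using neg[OF cseminorm_scale_mem[OF sn that, of "of_real (- t)"]] Us[OF that, of "- t"] by simp
    then show ?thesis by simp
  qed (rule Us[OF that])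
  have U_le: "U f \<le> N f" if "f \<in> V" for f
    using U(2)[OF that] p_le[OF that zeroW] phi_zero by simp
  have UW: "U w = Re (\<phi> w)" if "w \<in> W" for w
  proof (rule antisym)
    have le: "U w \<le> Re (\<phi> w)" if "w \<in> W" for w
      using U(2)[OF WV[OF that]] p_le[OF WV[OF that] that] cseminorm_zero[OF sn] by simp
    show "U w \<le> Re (\<phi> w)" by (rule le[OF that])
    have "U (\<lambda>x. - w x) \<le> Re (\<phi> (\<lambda>x. - w x))"
      using le[OF scaleW[OF that, of "-1"]] by simp
    then show "Re (\<phi> w) \<le> U w"
      using neg[OF WV[OF that]] clinear_functional_on_scale[OF \<phi> that, of "-1"] by simp
  qed
  \<comment> \<open>The usual complexification f -> U f - i U (i f), the only complex-linear
    functional with real part \<open>U\<close>.\<close>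
  define \<Phi> where "\<Phi> f = Complex (U f) (- U (\<lambda>x. \<i> * f x))" for f
  have iV: "(\<lambda>x. a * f x) \<in> V" if "f \<in> V" for f a
    by (rule cseminorm_scale_mem[OF sn that])
  have \<Phi>_scale: "\<Phi> (\<lambda>x. a * f x) = a * \<Phi> f" if f: "f \<in> V" for f a
  proof -
    have dec: "(\<lambda>x. a * f x) = (\<lambda>x. of_real (Re a) * f x + of_real (Im a) * (\<i> * f x))"
      by (rule ext) (metis (no_types) complex_eq distrib_right mult.assoc mult.commute)
    have dec2: "(\<lambda>x. \<i> * (a * f x)) = (\<lambda>x. of_real (Re a) * (\<i> * f x) + of_real (- Im a) * f x)"
      by (rule ext) (auto simp: complex_eq_iff algebra_simps)
    have "U (\<lambda>x. a * f x) = Re a * U f + Im a * U (\<lambda>x. \<i> * f x)"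
      unfolding dec using f by (simp only: add iV scale)
    moreover have "U (\<lambda>x. \<i> * (a * f x)) = Re a * U (\<lambda>x. \<i> * f x) + (- Im a) * U f"
      unfolding dec2 using f by (simp only: add iV scale)
    ultimately show ?thesis
      unfolding \<Phi>_def by (auto simp: complex_eq_iff algebra_simps)
  qed
  have \<Phi>_add: "\<Phi> (\<lambda>x. f x + g x) = \<Phi> f + \<Phi> g" if "f \<in> V" "g \<in> V" for f g
  proof -
    have "(\<lambda>x. \<i> * (f x + g x)) = (\<lambda>x. \<i> * f x + \<i> * g x)"
      by (auto simp: algebra_simps)
    then show ?thesis
      unfolding \<Phi>_def using that by (simp add: add iV complex_eq_iff)
  qed
  show thesis
  proof
    show "clinear_functional_on V \<Phi>"
      unfolding clinear_functional_on_def using \<Phi>_add \<Phi>_scale iV by simp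
    show "cmod (\<Phi> f) \<le> N f" if f: "f \<in> V" for f
    proof -
      \<comment> \<open>Rotating \<open>f\<close> until its value is real and nonnegative reduces
        the bound on the modulus to the bound on the real part \<open>U\<close>.\<close>
      obtain a where a: "cmod a = 1" "a * \<Phi> f = of_real (cmod (\<Phi> f))"
        by (rule unimodular_rotation)
      have "cmod (\<Phi> f) = Re (\<Phi> (\<lambda>x. a * f x))"
        using \<Phi>_scale[OF f] a by simp
      also have "\<dots> = U (\<lambda>x. a * f x)"
        by (simp add: \<Phi>_def)
      also have "\<dots> \<le> N f"
        using U_le[OF iV[OF f, of a]] cseminorm_scale_le[OF sn f, of a] a by simp
      finally show ?thesis .
    qed
    show "\<Phi> f = \<phi> f" if "f \<in> W" for f
    proof -
      have "U (\<lambda>x. \<i> * f x) = Re (\<i> * \<phi> f)"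
        using UW[OF scaleW[OF that]] clinear_functional_on_scale[OF \<phi> that] by simp
      then show ?thesis
        by (simp add: \<Phi>_def UW[OF that] complex_eq_iff)
    qed
  qed
qed

subsection \<open>Signed measures\<close>

text \<open>
  The positive variation of \<open>\<nu>\<close> is a finite measure, and \<open>\<nu>\<close> is the difference of the
  positive variations of \<open>\<nu>\<close> and \<open>-\<nu>\<close>.
\<close>

lemma signed_Radon_Nikodym_pos:
  fixes \<nu> :: "'a set \<Rightarrow> real"
  assumes fin: "finite_measure M"
    and add: "\<And>A B. A \<in> sets M \<Longrightarrow> B \<in> sets M \<Longrightarrow> A \<inter> B = {} \<Longrightarrow> \<nu> (A \<union> B) = \<nu> A + \<nu> B"
    and sums: "\<And>A :: nat \<Rightarrow> 'a set. range A \<subseteq> sets M \<Longrightarrow> disjoint_family A \<Longrightarrow> (\<lambda>i. \<nu> (A i)) sums \<nu> (\<Union>i. A i)"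
    and bd: "\<And>A. A \<in> sets M \<Longrightarrow> \<bar>\<nu> A\<bar> \<le> K"
    and null: "\<And>A. A \<in> null_sets M \<Longrightarrow> \<nu> A = 0"
  obtains g where "integrable M g"
    "\<And>A. A \<in> sets M \<Longrightarrow> (\<integral>x. indicator A x * g x \<partial>M) = (SUP B\<in>{B \<in> sets M. B \<subseteq> A}. \<nu> B)"
proof -
  interpret finite_measure M by fact
  define v where "v A = (SUP B\<in>{B \<in> sets M. B \<subseteq> A}. \<nu> B)" for A
  have nu0: "\<nu> {} = 0"
    using null by simp
  have bdd: "bdd_above (\<nu> ` {B \<in> sets M. B \<subseteq> A})" for A
    using bd by (intro bdd_aboveI2[where M=K]) (auto simp: abs_le_iff)
  have v_upper: "\<nu> B \<le> v A" if "B \<in> sets M" "B \<subseteq> A" for A B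
    unfolding v_def using bdd that by (intro cSUP_upper) auto
  have v_least: "v A \<le> c" if "\<And>B. B \<in> sets M \<Longrightarrow> B \<subseteq> A \<Longrightarrow> \<nu> B \<le> c" for A c
    unfolding v_def by (rule cSUP_least) (use that in auto)
  have v_ex: "\<exists>B\<in>sets M. B \<subseteq> A \<and> v A - e < \<nu> B" if "0 < e" for A e
  proof (rule ccontr)
    assume "\<not> ?thesis"
    then have "v A \<le> v A - e"
      by (intro v_least) (auto simp: not_less)
    then show False using that by simp
  qed
  have v_nonneg: "0 \<le> v A" for A
    using v_upper[of "{}" A] nu0 by simp
  have v_mono: "v A \<le> v B" if "A \<subseteq> B" for A B
    using that by (intro v_least v_upper) auto
  have v_super: "v A + v B \<le> v (A \<union> B)" if disj: "A \<inter> B = {}" for A B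
  proof (rule field_le_epsilon)
    fix e :: real assume e: "0 < e"
    obtain C where C: "C \<in> sets M" "C \<subseteq> A" "v A - e / 2 < \<nu> C"
      using v_ex[of "e/2" A] e by auto
    obtain D where D: "D \<in> sets M" "D \<subseteq> B" "v B - e / 2 < \<nu> D"
      using v_ex[of "e/2" B] e by auto
    have "C \<inter> D = {}"
      using C D disj by blast
    then have "\<nu> C + \<nu> D = \<nu> (C \<union> D)"
      using add[OF C(1) D(1)] by simp
    also have "\<dots> \<le> v (A \<union> B)"
      using C D by (intro v_upper) auto
    finally show "v A + v B \<le> v (A \<union> B) + e"
      using C D by simp
  qed
  have v_sum: "(\<Sum>i<n. v (A i)) \<le> v (\<Union>i<n. A i)" if "disjoint_family A" for A :: "nat \<Rightarrow> 'a set" and n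
  proof (induction n)
    case (Suc n)
    have "A n \<inter> A i = {}" if "i < n" for i
      using \<open>disjoint_family A\<close> that unfolding disjoint_family_on_def by (metis UNIV_I less_irrefl)
    then have "(\<Union>i<n. A i) \<inter> A n = {}"
      by auto
    from v_super[OF this] Suc show ?case
      by (simp add: lessThan_Suc Un_commute)
  qed (simp add: v_nonneg)
  have v_sums: "(\<lambda>i. v (A i)) sums v (\<Union>i. A i)"
    if A: "range A \<subseteq> sets M" "disjoint_family A" for A :: "nat \<Rightarrow> 'a set"
  proof -
    have partial: "(\<Sum>i<n. v (A i)) \<le> v (\<Union>i. A i)" for n
      by (rule order_trans[OF v_sum[OF A(2)] v_mono]) auto
    have summ: "summable (\<lambda>i. v (A i))"
      using partial v_nonneg by (intro summableI_nonneg_bounded) auto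
    have le: "(\<Sum>i. v (A i)) \<le> v (\<Union>i. A i)"
      by (rule suminf_le_const[OF summ partial])
    \<comment> \<open>Any competitor \<open>B\<close> is cut along the sets \<open>A i\<close>;
      countable additivity of \<open>\<nu>\<close> on the pieces gives the upper bound.\<close>
    have "v (\<Union>i. A i) \<le> (\<Sum>i. v (A i))"
    proof (rule v_least)
      fix B assume B: "B \<in> sets M" "B \<subseteq> (\<Union>i. A i)"
      have "(\<lambda>i. \<nu> (B \<inter> A i)) sums \<nu> (\<Union>i. B \<inter> A i)"
        using A B by (intro sums) (auto simp: disjoint_family_on_def)
      moreover have "(\<Union>i. B \<inter> A i) = B"
        using B by auto
      ultimately have s: "(\<lambda>i. \<nu> (B \<inter> A i)) sums \<nu> B"
        by simp
      have "\<nu> (B \<inter> A i) \<le> v (A i)" for i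
        using A B by (intro v_upper) auto
      from sums_le[OF this s summable_sums[OF summ]] show "\<nu> B \<le> (\<Sum>i. v (A i))" .
    qed
    with le summ show ?thesis
      by (simp add: sums_iff)
  qed
  define N where "N = measure_of (space M) (sets M) (\<lambda>A. ennreal (v A))"
  have setsN: "sets N = sets M" "space N = space M"
    unfolding N_def by simp_all
  have v0: "v {} = 0"
    using v_nonneg[of "{}"] nu0 by (intro antisym v_least) auto
  have emN: "emeasure N A = ennreal (v A)" if "A \<in> sets M" for A
    unfolding N_def
  proof (rule emeasure_measure_of_sigma)
    show "sigma_algebra (space M) (sets M)" by (rule sets.sigma_algebra_axioms)
    show "positive (sets M) (\<lambda>A. ennreal (v A))"
      by (simp add: positive_def v0)
    show "countably_additive (sets M) (\<lambda>A. ennreal (v A))"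
      by (intro countably_additiveI suminf_ennreal_eq v_nonneg v_sums)
  qed (rule that)
  have "absolutely_continuous M N"
    unfolding absolutely_continuous_def
  proof
    fix A assume A: "A \<in> null_sets M"
    have "v A \<le> 0"
    proof (rule v_least)
      fix B assume "B \<in> sets M" "B \<subseteq> A"
      then have "B \<in> null_sets M"
        using A by (metis null_sets_subset)
      then show "\<nu> B \<le> 0" using null by simp
    qed
    then have "v A = 0"
      using v_nonneg[of A] by simp
    then show "A \<in> null_sets N"
      using A emN setsN by (auto simp: null_sets_def)
  qed
  then obtain f where f: "f \<in> borel_measurable M" "density M f = N"
    using Radon_Nikodym[of N] setsN by auto
  have nnA: "(\<integral>\<^sup>+x. f x * indicator A x \<partial>M) = ennreal (v A)" if "A \<in> sets M" for A
    using emeasure_density[OF f(1) that] emN[OF that] f(2) by simp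
  have "(\<integral>\<^sup>+x. f x \<partial>M) = (\<integral>\<^sup>+x. f x * indicator (space M) x \<partial>M)"
    by (intro nn_integral_cong) auto
  then have "(\<integral>\<^sup>+x. f x \<partial>M) \<noteq> \<infinity>"
    using nnA[of "space M"] by simp
  then have fin: "AE x in M. f x \<noteq> \<infinity>"
    using f(1) by (intro nn_integral_PInf_AE) auto
  define g where "g x = enn2real (f x)" for x
  have gm: "g \<in> borel_measurable M"
    unfolding g_def using f(1) by measurable
  have fg: "AE x in M. f x = ennreal (g x)"
    using fin by eventually_elim (simp add: g_def less_top)
  have g0: "0 \<le> g x" for x
    by (simp add: g_def)
  have nng: "(\<integral>\<^sup>+x. ennreal (indicator A x * g x) \<partial>M) = ennreal (v A)" if "A \<in> sets M" for A
    unfolding nnA[OF that, symmetric] using fg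
    by (intro nn_integral_cong_AE) (auto elim!: eventually_mono simp: indicator_def)
  show thesis
  proof
    show "integrable M g"
    proof (rule integrableI_nonneg)
      have "(\<integral>\<^sup>+x. ennreal (g x) \<partial>M) = (\<integral>\<^sup>+x. ennreal (indicator (space M) x * g x) \<partial>M)"
        by (intro nn_integral_cong) auto
      then show "(\<integral>\<^sup>+x. ennreal (g x) \<partial>M) < \<infinity>"
        using nng[of "space M"] by simp
    qed (use gm g0 in auto)
    show "(\<integral>x. indicator A x * g x \<partial>M) = (SUP B\<in>{B \<in> sets M. B \<subseteq> A}. \<nu> B)" if "A \<in> sets M" for A
      using nng[OF that] gm g0 that v_nonneg unfolding v_def
      by (subst integral_eq_nn_integral) (auto simp: zero_le_mult_iff)
  qed
qed

text \<open>Complementation of \<open>B\<close> in \<open>A\<close> exchanges the two suprema: the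
  variation of \<open>\<nu>\<close> on \<open>A\<close> is \<open>\<nu> A\<close> plus the variation
  of -\<open>\<nu>\<close>. The difference of the two densities therefore represents
  \<open>\<nu>\<close>, without a Hahn decomposition.\<close>

lemma signed_Radon_Nikodym:
  fixes \<nu> :: "'a set \<Rightarrow> real"
  assumes fin: "finite_measure M"
    and add: "\<And>A B. A \<in> sets M \<Longrightarrow> B \<in> sets M \<Longrightarrow> A \<inter> B = {} \<Longrightarrow> \<nu> (A \<union> B) = \<nu> A + \<nu> B"
    and sums: "\<And>A :: nat \<Rightarrow> 'a set. range A \<subseteq> sets M \<Longrightarrow> disjoint_family A \<Longrightarrow> (\<lambda>i. \<nu> (A i)) sums \<nu> (\<Union>i. A i)"
    and bd: "\<And>A. A \<in> sets M \<Longrightarrow> \<bar>\<nu> A\<bar> \<le> K"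
    and null: "\<And>A. A \<in> null_sets M \<Longrightarrow> \<nu> A = 0"
  obtains g where "integrable M g" "\<And>A. A \<in> sets M \<Longrightarrow> (\<integral>x. indicator A x * g x \<partial>M) = \<nu> A"
proof -
  obtain g where g: "integrable M g"
    "\<And>A. A \<in> sets M \<Longrightarrow> (\<integral>x. indicator A x * g x \<partial>M) = (SUP B\<in>{B \<in> sets M. B \<subseteq> A}. \<nu> B)"
    using signed_Radon_Nikodym_pos[OF fin add sums bd null] by blast
  obtain h where h: "integrable M h"
    "\<And>A. A \<in> sets M \<Longrightarrow> (\<integral>x. indicator A x * h x \<partial>M) = (SUP B\<in>{B \<in> sets M. B \<subseteq> A}. - \<nu> B)"
    using signed_Radon_Nikodym_pos[of M "\<lambda>A. - \<nu> A" K] fin add sums_minus[OF sums] bd null by auto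
  have eq: "(SUP B\<in>{B \<in> sets M. B \<subseteq> A}. \<nu> B) = \<nu> A + (SUP B\<in>{B \<in> sets M. B \<subseteq> A}. - \<nu> B)"
    (is "?P = _ + ?Q") if A: "A \<in> sets M" for A
  proof -
    have bdd: "bdd_above (\<nu> ` {B \<in> sets M. B \<subseteq> A})" "bdd_above ((\<lambda>B. - \<nu> B) ` {B \<in> sets M. B \<subseteq> A})"
      using bd by (intro bdd_aboveI2[where M=K]; auto simp: abs_le_iff)+
    have split: "\<nu> B = \<nu> A - \<nu> (A - B)" if "B \<in> sets M" "B \<subseteq> A" for B
    proof -
      have "\<nu> (B \<union> (A - B)) = \<nu> B + \<nu> (A - B)"
        using A that by (intro add) auto
      moreover have "B \<union> (A - B) = A" using that by auto
      ultimately show ?thesis by simp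
    qed
    have "?P \<le> \<nu> A + ?Q"
    proof (rule cSUP_least)
      fix B assume B: "B \<in> {B \<in> sets M. B \<subseteq> A}"
      have "- \<nu> (A - B) \<le> ?Q"
        using A B by (intro cSUP_upper bdd) auto
      then show "\<nu> B \<le> \<nu> A + ?Q" using split B by auto
    qed (use A in auto)
    moreover have "?Q \<le> ?P - \<nu> A"
    proof (rule cSUP_least)
      fix B assume B: "B \<in> {B \<in> sets M. B \<subseteq> A}"
      have "\<nu> (A - B) \<le> ?P"
        using A B by (intro cSUP_upper bdd) auto
      then show "- \<nu> B \<le> ?P - \<nu> A" using split B by auto
    qed (use A in auto)
    ultimately show ?thesis by simp
  qed
  show thesis
  proof
    show "integrable M (\<lambda>x. g x - h x)"
      using g h by simp
    show "(\<integral>x. indicator A x * (g x - h x) \<partial>M) = \<nu> A" if A: "A \<in> sets M" for A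
    proof -
      have "integrable M (\<lambda>x. indicator A x * g x)" "integrable M (\<lambda>x. indicator A x * h x)"
        using integrable_mult_indicator[OF A g(1)] integrable_mult_indicator[OF A h(1)] by simp_all
      then have "(\<integral>x. indicator A x * (g x - h x) \<partial>M) = (\<integral>x. indicator A x * g x \<partial>M) - (\<integral>x. indicator A x * h x \<partial>M)"
        by (simp add: right_diff_distrib)
      then show ?thesis
        using g(2)[OF A] h(2)[OF A] eq[OF A] by simp
    qed
  qed
qed

subsection \<open>\<open>L\<^sup>p\<close> spaces\<close>

lemma finite_cube_measure: "finite_measure (cube_measure :: (real^'n) measure)"
  by (rule finite_measure_lebesgue_on) auto

lemma measure_cube_measure: "measure (cube_measure :: (real^'n) measure) unit_cube = 1"
  using measure_unit_cube[where 'n='n] by (simp add: measure_restrict_space)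

lemma integrable_const_cube: "integrable (cube_measure :: (real^'n) measure) (\<lambda>x. c :: 'b :: {banach, second_countable_topology})"
  by (rule finite_measure.integrable_const[OF finite_cube_measure])

lemma integral_const_cube: "(\<integral>x. c \<partial>(cube_measure :: (real^'n) measure)) = (c :: 'b :: {banach, second_countable_topology})"
  using measure_cube_measure[where 'n='n] by (subst lebesgue_integral_const) simp

lemma integrable_bounded_cube:
  fixes f :: "real^'n \<Rightarrow> 'b :: {banach, second_countable_topology}"
  assumes "f \<in> borel_measurable cube_measure" "\<And>x. x \<in> unit_cube \<Longrightarrow> norm (f x) \<le> K"
  shows "integrable cube_measure f"
  using assms by (intro finite_measure.integrable_const_bound[OF finite_cube_measure, of _ K]) auto

lemma Lp_spaceD:
  assumes "f \<in> Lp_space p"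
  shows "f \<in> borel_measurable cube_measure" "integrable cube_measure (\<lambda>x. cmod (f x) powr p)"
  using assms unfolding Lp_space_def by auto

lemma Lp_norm_nonneg: "0 \<le> Lp_norm p f"
  by (simp add: Lp_norm_def)

lemma Lp_norm_powr:
  assumes "0 < p"
  shows "Lp_norm p f powr p = (CINT x. cmod (f x) powr p)"
proof -
  have "0 \<le> (CINT x. cmod (f x) powr p)"
    by (intro integral_nonneg_AE) auto
  then show ?thesis
    using assms by (simp add: Lp_norm_def powr_powr)
qed

lemma Lp_norm_le:
  assumes "0 < p" "0 \<le> s" "(CINT x. cmod (f x) powr p) \<le> s powr p"
  shows "Lp_norm p f \<le> s"
proof (rule ccontr)
  assume "\<not> Lp_norm p f \<le> s"
  then have "s powr p < Lp_norm p f powr p"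
    using assms by (intro powr_less_mono2) auto
  then show False
    using assms Lp_norm_powr[of p f] by simp
qed

lemma powr_add_le:
  fixes a b :: real
  assumes "0 < p" "0 \<le> a" "0 \<le> b"
  shows "(a + b) powr p \<le> 2 powr p * (a powr p + b powr p)"
proof -
  have "(a + b) powr p \<le> (2 * max a b) powr p"
    using assms by (intro powr_mono2) auto
  also have "\<dots> = 2 powr p * max a b powr p"
    using assms by (simp add: powr_mult)
  also have "max a b powr p \<le> a powr p + b powr p"
    by (simp add: max_def)
  finally show ?thesis by simp
qed

text \<open>Convexity is invoked at positive arguments. When one argument is 0, the claim reduces to
  w^p <= w for w in [0,1].\<close>

lemma powr_convex_combination:
  fixes a b u v :: real
  assumes "1 \<le> p" "0 \<le> a" "0 \<le> b" "0 \<le> u" "0 \<le> v" "u + v = 1"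
  shows "(u * a + v * b) powr p \<le> u * a powr p + v * b powr p"
proof -
  have contr: "w * c powr p \<ge> (w * c) powr p" if "0 \<le> w" "w \<le> 1" "0 \<le> c" for w c :: real
  proof -
    have "w powr p \<le> w powr 1"
      using that assms powr_mono'[of 1 p w] by simp
    then show ?thesis
      using that by (simp add: powr_mult mult_right_mono)
  qed
  show ?thesis
  proof (cases "a = 0 \<or> b = 0")
    case True
    then show ?thesis
      using contr[of u a] contr[of v b] assms by auto
  next
    case False
    have "u = 1 - v" using assms by simp
    then show ?thesis
      using False convex_onD[OF powr_convex[OF assms(1)], of v a b] assms(2-5)
      by (simp add: \<open>u = 1 - v\<close>)
  qed
qed

lemma Lp_lincomb:
  assumes p: "0 < p" and f: "f \<in> Lp_space p" and g: "g \<in> Lp_space p"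
  shows "(\<lambda>x. a * f x + b * g x) \<in> Lp_space p"
proof -
  note m[measurable] = Lp_spaceD(1)[OF f] Lp_spaceD(1)[OF g]
  have meas: "(\<lambda>x. a * f x + b * g x) \<in> borel_measurable cube_measure"
    by measurable
  have "integrable cube_measure (\<lambda>x. cmod (a * f x + b * g x) powr p)"
  proof (rule Bochner_Integration.integrable_bound)
    show "integrable cube_measure (\<lambda>x. 2 powr p * (cmod a powr p * cmod (f x) powr p + cmod b powr p * cmod (g x) powr p))"
      using Lp_spaceD(2)[OF f] Lp_spaceD(2)[OF g] by auto
    have "cmod (a * f x + b * g x) powr p \<le> 2 powr p * (cmod a powr p * cmod (f x) powr p + cmod b powr p * cmod (g x) powr p)" for x
    proof -
      have "cmod (a * f x + b * g x) powr p \<le> (cmod a * cmod (f x) + cmod b * cmod (g x)) powr p"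
        using p by (intro powr_mono2) (auto simp: norm_mult[symmetric] norm_triangle_ineq)
      also have "\<dots> \<le> 2 powr p * ((cmod a * cmod (f x)) powr p + (cmod b * cmod (g x)) powr p)"
        using p by (intro powr_add_le) auto
      finally show ?thesis by (simp add: powr_mult)
    qed
    then show "AE x in cube_measure. norm (cmod (a * f x + b * g x) powr p)
        \<le> norm (2 powr p * (cmod a powr p * cmod (f x) powr p + cmod b powr p * cmod (g x) powr p))"
      by (intro AE_I2) (auto intro: order_trans)
  qed (use meas in measurable)
  with meas show ?thesis
    by (simp add: Lp_space_def)
qed

lemma Lp_norm_scale: "0 < p \<Longrightarrow> Lp_norm p (\<lambda>x. a * f x) = cmod a * Lp_norm p f"
  by (simp add: Lp_norm_def norm_mult powr_mult powr_powr integral_nonneg_AE)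

text \<open>Minkowski's inequality by convexity of the power: f/s and g/t are combined with weights
  s/(s+t) and t/(s+t). Taking s and t slightly above the two norms keeps them positive when a norm
  vanishes.\<close>

lemma Lp_norm_add:
  assumes p: "1 \<le> p" and f: "f \<in> Lp_space p" and g: "g \<in> Lp_space p"
  shows "Lp_norm p (\<lambda>x. f x + g x) \<le> Lp_norm p f + Lp_norm p g"
proof (rule field_le_epsilon)
  fix e :: real assume e: "0 < e"
  define s where "s = Lp_norm p f + e / 2"
  define t where "t = Lp_norm p g + e / 2"
  have pos: "0 < s" "0 < t"
    using e Lp_norm_nonneg[of p f] Lp_norm_nonneg[of p g] by (auto simp: s_def t_def)
  have le: "(CINT x. cmod (h x) powr p) \<le> r powr p" if "Lp_norm p h \<le> r" for r and h :: "real^'b \<Rightarrow> complex"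
    using p that Lp_norm_nonneg[of p h] by (subst Lp_norm_powr[symmetric]) (auto intro!: powr_mono2)
  have "Lp_norm p (\<lambda>x. f x + g x) \<le> s + t"
  proof (rule Lp_norm_le)
    have "(CINT x. cmod (f x + g x) powr p)
        \<le> (CINT x. (s + t) powr p * (s / (s + t) * (cmod (f x) powr p / s powr p) + t / (s + t) * (cmod (g x) powr p / t powr p)))"
    proof (rule integral_mono)
      show "integrable cube_measure (\<lambda>x. cmod (f x + g x) powr p)"
        using Lp_lincomb[OF _ f g, of 1 1] p by (simp add: Lp_space_def)
      show "integrable cube_measure (\<lambda>x. (s + t) powr p * (s / (s + t) * (cmod (f x) powr p / s powr p) + t / (s + t) * (cmod (g x) powr p / t powr p)))"
        using Lp_spaceD(2)[OF f] Lp_spaceD(2)[OF g] by auto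
      fix x
      have st: "s / (s + t) + t / (s + t) = 1"
        using pos by (simp add: add_divide_distrib[symmetric])
      have "cmod (f x + g x) \<le> cmod (f x) + cmod (g x)"
        by (rule norm_triangle_ineq)
      also have "\<dots> = (s + t) * (s / (s + t) * (cmod (f x) / s) + t / (s + t) * (cmod (g x) / t))"
        using pos by (simp add: distrib_left)
      finally have "cmod (f x + g x) \<le> (s + t) * (s / (s + t) * (cmod (f x) / s) + t / (s + t) * (cmod (g x) / t))" .
      then have "cmod (f x + g x) powr p \<le> ((s + t) * (s / (s + t) * (cmod (f x) / s) + t / (s + t) * (cmod (g x) / t))) powr p"
        using p by (intro powr_mono2) auto
      also have "\<dots> = (s + t) powr p * (s / (s + t) * (cmod (f x) / s) + t / (s + t) * (cmod (g x) / t)) powr p"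
        by (rule powr_mult)
      also have "\<dots> \<le> (s + t) powr p * (s / (s + t) * (cmod (f x) / s) powr p + t / (s + t) * (cmod (g x) / t) powr p)"
        using p pos st by (intro mult_left_mono powr_convex_combination) auto
      finally show "cmod (f x + g x) powr p \<le> (s + t) powr p * (s / (s + t) * (cmod (f x) powr p / s powr p) + t / (s + t) * (cmod (g x) powr p / t powr p))"
        using pos by (simp add: powr_divide)
    qed
    also have "\<dots> = (s + t) powr p * (s / (s + t) * ((CINT x. cmod (f x) powr p) / s powr p)
        + t / (s + t) * ((CINT x. cmod (g x) powr p) / t powr p))"
      using Lp_spaceD(2)[OF f] Lp_spaceD(2)[OF g] by simp
    also have "\<dots> \<le> (s + t) powr p * (s / (s + t) * 1 + t / (s + t) * 1)"
      using le[of f s] le[of g t] e pos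
      by (intro mult_left_mono add_mono) (auto simp: s_def t_def divide_le_eq)
    also have "\<dots> = (s + t) powr p"
      using pos by (simp add: add_divide_distrib[symmetric])
    finally show "(CINT x. cmod (f x + g x) powr p) \<le> (s + t) powr p" .
  qed (use p pos in auto)
  then show "Lp_norm p (\<lambda>x. f x + g x) \<le> Lp_norm p f + Lp_norm p g + e"
    by (simp add: s_def t_def)
qed

lemma Lp_bounded:
  assumes "f \<in> borel_measurable cube_measure" "\<And>x. x \<in> unit_cube \<Longrightarrow> cmod (f x) \<le> K" "0 < p"
  shows "f \<in> Lp_space p"
proof -
  have [measurable]: "f \<in> borel_measurable cube_measure" by fact
  have "integrable cube_measure (\<lambda>x. cmod (f x) powr p)"
  proof (rule integrable_bounded_cube)
    show "norm (cmod (f x) powr p) \<le> K powr p" if "x \<in> unit_cube" for x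
      using assms(2)[OF that] assms(3) by (simp add: powr_mono2)
  qed measurable
  then show ?thesis
    using assms(1) by (simp add: Lp_space_def)
qed

lemma cseminorm_Lp: "1 \<le> p \<Longrightarrow> cseminorm_on (Lp_space p) (Lp_norm p)"
proof (rule cseminorm_onI)
  assume p: "1 \<le> p"
  show "(\<lambda>x. 0) \<in> Lp_space p"
    using p by (intro Lp_bounded[where K=0]) auto
  fix f g :: "real^'a \<Rightarrow> complex" and a b assume fg: "f \<in> Lp_space p" "g \<in> Lp_space p"
  show "(\<lambda>x. a * f x + b * g x) \<in> Lp_space p"
    using fg p by (intro Lp_lincomb) auto
  have "(\<lambda>x. a * f x) \<in> Lp_space p" "(\<lambda>x. b * g x) \<in> Lp_space p"
    using Lp_lincomb[OF _ fg, of a 0] Lp_lincomb[OF _ fg, of 0 b] p by auto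
  from Lp_norm_add[OF p this] show "Lp_norm p (\<lambda>x. a * f x + b * g x) \<le> cmod a * Lp_norm p f + cmod b * Lp_norm p g"
    using p by (simp add: Lp_norm_scale)
qed (rule Lp_norm_nonneg)

lemma Lp_const: "0 < p \<Longrightarrow> (\<lambda>x. c) \<in> Lp_space p"
  by (rule Lp_bounded[where K="cmod c"]) auto

lemma Lp_norm_const: "0 < p \<Longrightarrow> Lp_norm p (\<lambda>x :: real^'n. c) = cmod c"
  by (simp only: Lp_norm_def integral_const_cube powr_powr) simp

text \<open>Young's inequality for f/s and g/t, with s and t strictly above the norms; letting both
  decrease to the norms covers the case of norm 0 as well.\<close>

lemma Holder:
  assumes p: "1 < p" and q: "1 / p + 1 / q = 1" and f: "f \<in> Lp_space p" and g: "g \<in> Lp_space q"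
  shows "integrable cube_measure (\<lambda>x. f x * g x)"
    and "(CINT x. cmod (f x * g x)) \<le> Lp_norm p f * Lp_norm q g"
    and "cmod (CINT x. f x * g x) \<le> Lp_norm p f * Lp_norm q g"
proof -
  have q1: "1 < q"
  proof -
    have "1 / p < 1" "0 < 1 / p" using p by auto
    then have "0 < 1 / q" "1 / q < 1" using q by linarith+
    then show ?thesis by (simp add: zero_less_divide_iff divide_less_eq)
  qed
  note [measurable] = Lp_spaceD(1)[OF f] Lp_spaceD(1)[OF g]
  have Y: "a * b \<le> a powr p / p + b powr q / q" if "0 \<le> a" "0 \<le> b" for a b :: real
    by (rule Youngs_inequality[OF p q1 q that])
  have bd: "integrable cube_measure (\<lambda>x. cmod (f x) powr p / p + cmod (g x) powr q / q)"
    using Lp_spaceD(2)[OF f] Lp_spaceD(2)[OF g] by auto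
  show int: "integrable cube_measure (\<lambda>x. f x * g x)"
    using bd Y[of "cmod (f _)" "cmod (g _)"] p q1
    by (intro Bochner_Integration.integrable_bound[OF bd]) (auto intro!: AE_I2 simp: norm_mult)
  have int': "integrable cube_measure (\<lambda>x. cmod (f x * g x))"
    using int by simp
  have le: "(CINT x. cmod (f x * g x)) \<le> s * t" if st: "s > Lp_norm p f" "t > Lp_norm q g" for s t
  proof -
    have pos: "0 < s" "0 < t"
      using st Lp_norm_nonneg[of p f] Lp_norm_nonneg[of q g] by auto
    have "(CINT x. cmod (f x * g x)) \<le>
        (CINT x. s * t * (cmod (f x) powr p / s powr p / p + cmod (g x) powr q / t powr q / q))"
    proof (rule integral_mono[OF int'])
      show "integrable cube_measure (\<lambda>x. s * t * (cmod (f x) powr p / s powr p / p + cmod (g x) powr q / t powr q / q))"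
        using Lp_spaceD(2)[OF f] Lp_spaceD(2)[OF g] by auto
      fix x
      have "cmod (f x * g x) = s * t * ((cmod (f x) / s) * (cmod (g x) / t))"
        using pos by (simp add: norm_mult)
      also have "\<dots> \<le> s * t * ((cmod (f x) / s) powr p / p + (cmod (g x) / t) powr q / q)"
        using pos by (intro mult_left_mono Y) auto
      finally show "cmod (f x * g x) \<le> s * t * (cmod (f x) powr p / s powr p / p + cmod (g x) powr q / t powr q / q)"
        using pos by (simp add: powr_divide)
    qed
    also have "\<dots> = s * t * ((CINT x. cmod (f x) powr p) / s powr p / p + (CINT x. cmod (g x) powr q) / t powr q / q)"
      using Lp_spaceD(2)[OF f] Lp_spaceD(2)[OF g] by simp
    also have "\<dots> \<le> s * t * (1 / p + 1 / q)"
    proof -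
      have "(CINT x. cmod (f x) powr p) \<le> s powr p"
        using st Lp_norm_nonneg[of p f] p by (subst Lp_norm_powr[symmetric]) (auto intro!: powr_mono2)
      moreover have "(CINT x. cmod (g x) powr q) \<le> t powr q"
        using st Lp_norm_nonneg[of q g] q1 by (subst Lp_norm_powr[symmetric]) (auto intro!: powr_mono2)
      ultimately show ?thesis
        using pos p q1 by (intro mult_left_mono add_mono divide_right_mono) (auto simp: divide_le_eq)
    qed
    finally show ?thesis using q by simp
  qed
  show "(CINT x. cmod (f x * g x)) \<le> Lp_norm p f * Lp_norm q g" (is "?I \<le> _")
  proof (rule tendsto_lowerbound)
    show "((\<lambda>e. (Lp_norm p f + e) * (Lp_norm q g + e)) \<longlongrightarrow> Lp_norm p f * Lp_norm q g) (at_right 0)"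
      by (auto intro!: tendsto_eq_intros)
    show "\<forall>\<^sub>F e in at_right 0. ?I \<le> (Lp_norm p f + e) * (Lp_norm q g + e)"
      using eventually_at_right_less[of 0] by eventually_elim (auto intro!: le)
  qed simp
  then show "cmod (CINT x. f x * g x) \<le> Lp_norm p f * Lp_norm q g"
    by (rule order_trans[OF integral_norm_bound])
qed

lemma conjugate_exponent:
  assumes "1 < p" "1 / p + 1 / q = 1"
  shows "1 < (q :: real)" "(q - 1) * p = q" "1 / q + 1 / p = 1"
proof -
  have "1 / p < 1" "0 < 1 / p" using assms by auto
  then have "0 < 1 / q" "1 / q < 1" using assms by linarith+
  then show q1: "1 < q"
    by (simp add: zero_less_divide_iff divide_less_eq)
  show "(q - 1) * p = q"
    using assms q1 by (simp add: field_simps)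
  show "1 / q + 1 / p = 1"
    using assms by simp
qed

lemma Lp_L1:
  assumes p: "1 < p" and f: "f \<in> Lp_space p"
  shows "f \<in> L1_space" and "(CINT x. cmod (f x)) \<le> Lp_norm p f"
proof -
  define q where "q = p / (p - 1)"
  have q: "1 / p + 1 / q = 1" "0 < q"
    using p by (auto simp: q_def field_simps)
  from Holder[OF p q(1) f Lp_const[OF q(2), of 1]]
  show "f \<in> L1_space" "(CINT x. cmod (f x)) \<le> Lp_norm p f"
    using q by (auto simp: L1_space_def Lp_norm_const)
qed

text \<open>The factor 2 is the one that comes with approximation by simple functions in
  \<open>borel_measurable_implies_sequence_metric\<close>. It makes 3 |f| a majorant for the
  differences in dominated convergence.\<close>

lemma Lp_dominated:
  assumes p: "1 < p" and f: "f \<in> Lp_space p" and F: "\<And>i. F i \<in> borel_measurable cube_measure"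
    and lim: "\<And>x. x \<in> unit_cube \<Longrightarrow> (\<lambda>i. F i x) \<longlonglongrightarrow> f x"
    and bd: "\<And>i x. x \<in> unit_cube \<Longrightarrow> cmod (F i x) \<le> 2 * cmod (f x)"
  shows "F i \<in> Lp_space p" and "(\<lambda>i. Lp_norm p (\<lambda>x. F i x - f x)) \<longlonglongrightarrow> 0"
proof -
  note [measurable] = F Lp_spaceD(1)[OF f]
  show "F i \<in> Lp_space p" for i
  proof -
    have "integrable cube_measure (\<lambda>x. cmod (F i x) powr p)"
    proof (rule Bochner_Integration.integrable_bound)
      show "integrable cube_measure (\<lambda>x. 2 powr p * cmod (f x) powr p)"
        using Lp_spaceD(2)[OF f] by auto
      show "AE x in cube_measure. norm (cmod (F i x) powr p) \<le> norm (2 powr p * cmod (f x) powr p)"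
        using p bd by (intro AE_I2) (auto simp: powr_mult[symmetric] intro!: powr_mono2)
    qed measurable
    then show ?thesis using F by (simp add: Lp_space_def)
  qed
  have "(\<lambda>i. \<integral>x. cmod (F i x - f x) powr p \<partial>cube_measure) \<longlonglongrightarrow> (\<integral>x. 0 \<partial>(cube_measure :: (real^'a) measure))"
  proof (rule integral_dominated_convergence)
    show "integrable cube_measure (\<lambda>x. 3 powr p * cmod (f x) powr p)"
      using Lp_spaceD(2)[OF f] by auto
    show "AE x in cube_measure. (\<lambda>i. cmod (F i x - f x) powr p) \<longlonglongrightarrow> 0"
    proof (rule AE_I2)
      fix x :: "real^'a" assume "x \<in> space cube_measure"
      then have "(\<lambda>i. cmod (F i x - f x)) \<longlonglongrightarrow> 0"
        using lim[of x] by (simp add: LIM_zero_iff tendsto_norm_zero)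
      from tendsto_powr'[OF this tendsto_const, of p] show "(\<lambda>i. cmod (F i x - f x) powr p) \<longlonglongrightarrow> 0"
        using p by auto
    qed
    show "AE x in cube_measure. norm (cmod (F i x - f x) powr p) \<le> 3 powr p * cmod (f x) powr p" for i
    proof (rule AE_I2)
      fix x :: "real^'a" assume "x \<in> space cube_measure"
      then have "cmod (F i x - f x) \<le> 3 * cmod (f x)"
        using bd[of x i] norm_triangle_ineq4[of "F i x" "f x"] by simp
      then show "norm (cmod (F i x - f x) powr p) \<le> 3 powr p * cmod (f x) powr p"
        using p by (auto simp: powr_mult[symmetric] intro!: powr_mono2)
    qed
  qed measurable
  then have "(\<lambda>i. \<integral>x. cmod (F i x - f x) powr p \<partial>cube_measure) \<longlonglongrightarrow> 0"
    by simp
  from tendsto_powr'[OF this tendsto_const, of "1 / p"] show "(\<lambda>i. Lp_norm p (\<lambda>x. F i x - f x)) \<longlonglongrightarrow> 0"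
    unfolding Lp_norm_def using p by auto
qed

subsection \<open>Duality of \<open>L\<^sup>p\<close> spaces\<close>

lemma Lp_norm_0_AE:
  assumes "1 \<le> p" "AE x in cube_measure. f x = 0"
  shows "Lp_norm p f = 0"
proof -
  have "(CINT x. cmod (f x) powr p) = 0"
    using assms by (intro integral_eq_zero_AE) (auto elim!: eventually_mono)
  then show ?thesis by (simp add: Lp_norm_def)
qed

lemma Lp_functional_cong_AE:
  assumes p: "1 \<le> p" and L: "clinear_functional_on (Lp_space p) L" "\<And>f. f \<in> Lp_space p \<Longrightarrow> cmod (L f) \<le> C * Lp_norm p f"
    and fg: "f \<in> Lp_space p" "g \<in> Lp_space p" "AE x in cube_measure. f x = g x"
  shows "L f = L g"
proof -
  have "cmod (L (\<lambda>x. f x - g x)) \<le> C * Lp_norm p (\<lambda>x. f x - g x)"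
    by (intro L cseminorm_diff_mem[OF cseminorm_Lp] p fg)
  also have "Lp_norm p (\<lambda>x. f x - g x) = 0"
    using fg(3) by (intro Lp_norm_0_AE[OF p]) (auto elim!: eventually_mono)
  finally show ?thesis
    using clinear_functional_on_diff[OF L(1) fg(1,2)] by simp
qed

lemma Lp_functional_dominated:
  assumes p: "1 < p" and L: "clinear_functional_on (Lp_space p) L" "\<And>f. f \<in> Lp_space p \<Longrightarrow> cmod (L f) \<le> C * Lp_norm p f"
    and f: "f \<in> Lp_space p" and F: "\<And>i. F i \<in> borel_measurable cube_measure"
    and lim: "\<And>x. x \<in> unit_cube \<Longrightarrow> (\<lambda>i. F i x) \<longlonglongrightarrow> f x"
    and bd: "\<And>i x. x \<in> unit_cube \<Longrightarrow> cmod (F i x) \<le> 2 * cmod (f x)"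
  shows "(\<lambda>i. L (F i)) \<longlonglongrightarrow> L f"
proof -
  note D = Lp_dominated[OF p f F lim bd]
  have "(\<lambda>i. C * Lp_norm p (\<lambda>x. F i x - f x)) \<longlonglongrightarrow> C * 0"
    by (intro tendsto_intros D)
  then have "(\<lambda>i. C * Lp_norm p (\<lambda>x. F i x - f x)) \<longlonglongrightarrow> 0"
    by simp
  then have "(\<lambda>i. L (F i) - L f) \<longlonglongrightarrow> 0"
  proof (rule Lim_null_comparison[rotated])
    show "\<forall>\<^sub>F i in sequentially. cmod (L (F i) - L f) \<le> C * Lp_norm p (\<lambda>x. F i x - f x)"
    proof (rule always_eventually, rule allI)
      fix i
      have "(\<lambda>x. F i x - f x) \<in> Lp_space p"
        using p by (intro cseminorm_diff_mem[OF cseminorm_Lp] D f) auto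
      from L(2)[OF this] show "cmod (L (F i) - L f) \<le> C * Lp_norm p (\<lambda>x. F i x - f x)"
        using clinear_functional_on_diff[OF L(1) D(1) f, of i] by simp
    qed
  qed
  then show ?thesis by (rule LIM_zero_cancel)
qed

lemma borel_measurable_cnj_sgn: "(\<lambda>z :: complex. cnj (sgn z)) \<in> borel_measurable borel"
proof -
  have "cnj \<in> borel_measurable borel"
    by (intro borel_measurable_continuous_onI continuous_on_cnj continuous_on_id)
  moreover have "(\<lambda>z :: complex. sgn z) \<in> borel_measurable borel"
    unfolding sgn_div_norm by measurable
  ultimately show ?thesis
    using measurable_compose by blast
qed

text \<open>Evaluating \<open>L\<close> on indicators gives a complex measure: countable additivity
  is dominated convergence in L^p, and null sets are sent to 0. Densities of its real and imaginary
  parts form \<open>g\<close>. That \<open>g\<close> lies in L^q is a separate matter, settled by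
  testing \<open>L\<close> with the extremal functions of Hoelder's inequality.\<close>

theorem Lp_Riesz:
  fixes L :: "'n::finite cfun \<Rightarrow> complex"
  assumes p: "1 < p" and q: "1 / p + 1 / q = 1"
    and L: "clinear_functional_on (Lp_space p) L" "\<And>f. f \<in> Lp_space p \<Longrightarrow> cmod (L f) \<le> C * Lp_norm p f"
  obtains g where "g \<in> Lp_space q" "\<And>f. f \<in> Lp_space p \<Longrightarrow> L f = (CINT x. f x * g x)"
proof -
  let ?M = "cube_measure :: (real^'n) measure"
  define \<iota> :: "(real^'n) set \<Rightarrow> 'n cfun" where "\<iota> A x = indicator A x" for A x
  have p1: "1 \<le> p" using p by simp
  note q1 = conjugate_exponent[OF p q]
  note fin = finite_cube_measure[where 'n='n]
  have chi: "\<iota> A \<in> Lp_space p" if "A \<in> sets ?M" for A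
    unfolding \<iota>_def using that p by (intro Lp_bounded[where K=1]) (auto simp: indicator_def)
  have chim: "\<iota> A \<in> borel_measurable ?M" if "A \<in> sets ?M" for A
    using Lp_spaceD(1)[OF chi[OF that]] .
  have add: "L (\<iota> (A \<union> B)) = L (\<iota> A) + L (\<iota> B)" if "A \<in> sets ?M" "B \<in> sets ?M" "A \<inter> B = {}" for A B
  proof -
    have "\<iota> (A \<union> B) = (\<lambda>x. \<iota> A x + \<iota> B x)"
      using that(3) by (intro ext) (auto simp: \<iota>_def indicator_def)
    then show ?thesis
      using clinear_functional_on_add[OF L(1) chi[OF that(1)] chi[OF that(2)]] by simp
  qed
  have sums: "(\<lambda>i. L (\<iota> (A i))) sums L (\<iota> (\<Union>i. A i))"
    if A: "range A \<subseteq> sets ?M" "disjoint_family A" for A :: "nat \<Rightarrow> (real^'n) set"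
  proof -
    have part: "L (\<iota> (\<Union>i<n. A i)) = (\<Sum>i<n. L (\<iota> (A i)))" for n
    proof (induction n)
      case 0
      have "\<iota> {} = (\<lambda>x. 0)" by (auto simp: \<iota>_def)
      then show ?case
        using clinear_functional_on_zero[OF L(1) chi[of "{}"]] by simp
    next
      case (Suc n)
      have "A n \<inter> A i = {}" if "i < n" for i
        using A(2) that unfolding disjoint_family_on_def by (metis UNIV_I less_irrefl)
      then have "(\<Union>i<n. A i) \<inter> A n = {}"
        by auto
      then have "L (\<iota> ((\<Union>i<n. A i) \<union> A n)) = L (\<iota> (\<Union>i<n. A i)) + L (\<iota> (A n))"
        using A by (intro add) auto
      with Suc show ?case
        by (simp add: lessThan_Suc Un_commute)
    qed
    have "(\<lambda>n. L (\<iota> (\<Union>i<n. A i))) \<longlonglongrightarrow> L (\<iota> (\<Union>i. A i))"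
    proof (rule Lp_functional_dominated[OF p L])
      show "\<iota> (\<Union>i. A i) \<in> Lp_space p" "\<iota> (\<Union>i<n. A i) \<in> borel_measurable ?M" for n
        using A by (auto intro!: chi chim)
      show "(\<lambda>n. \<iota> (\<Union>i<n. A i) x) \<longlonglongrightarrow> \<iota> (\<Union>i. A i) x" for x
      proof (cases "x \<in> (\<Union>i. A i)")
        case True
        then obtain k where k: "x \<in> A k" by auto
        show ?thesis
        proof (rule tendsto_eventually)
          show "\<forall>\<^sub>F n in sequentially. \<iota> (\<Union>i<n. A i) x = \<iota> (\<Union>i. A i) x"
            using eventually_gt_at_top[of k] by eventually_elim (use k in \<open>auto simp: \<iota>_def indicator_def\<close>)
        qed
      qed (auto simp: \<iota>_def indicator_def)
      show "cmod (\<iota> (\<Union>i<n. A i) x) \<le> 2 * cmod (\<iota> (\<Union>i. A i) x)" for n x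
        by (auto simp: \<iota>_def indicator_def)
    qed
    then show ?thesis
      unfolding sums_def part .
  qed
  have bd: "cmod (L (\<iota> A)) \<le> \<bar>C\<bar>" if A: "A \<in> sets ?M" for A
  proof -
    have "Lp_norm p (\<iota> A) \<le> 1"
    proof (rule Lp_norm_le)
      have "(CINT x. cmod (\<iota> A x) powr p) \<le> (\<integral>x. 1 \<partial>?M)"
        using chi[OF A, THEN Lp_spaceD(2)] p
        by (intro integral_mono integrable_const_cube) (auto simp: \<iota>_def indicator_def)
      then show "(CINT x. cmod (\<iota> A x) powr p) \<le> 1 powr p"
        by (simp only: integral_const_cube powr_one_eq_one)
    qed (use p in auto)
    then have "C * Lp_norm p (\<iota> A) \<le> \<bar>C\<bar> * 1"
      by (intro mult_mono) (auto simp: Lp_norm_nonneg)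
    then show ?thesis
      using L(2)[OF chi[OF A]] by simp
  qed
  have null: "L (\<iota> A) = 0" if A: "A \<in> null_sets ?M" for A
  proof -
    have "AE x in ?M. x \<notin> A" by (rule AE_not_in[OF A])
    then have "L (\<iota> A) = L (\<iota> {})"
      using A by (intro Lp_functional_cong_AE[OF p1 L] chi) (auto elim!: eventually_mono simp: \<iota>_def)
    moreover have "\<iota> {} = (\<lambda>x. 0)" by (auto simp: \<iota>_def)
    ultimately show ?thesis
      using clinear_functional_on_zero[OF L(1) chi[of "{}"]] by simp
  qed
  obtain g1 where g1: "integrable ?M g1" "\<And>A. A \<in> sets ?M \<Longrightarrow> (CINT x. indicator A x * g1 x) = Re (L (\<iota> A))"
  proof (rule signed_Radon_Nikodym[OF fin, where \<nu>="\<lambda>A. Re (L (\<iota> A))" and K="\<bar>C\<bar>"])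
    show "\<bar>Re (L (\<iota> A))\<bar> \<le> \<bar>C\<bar>" if "A \<in> sets ?M" for A
      using bd[OF that] abs_Re_le_cmod order_trans by blast
  qed (auto simp: add null intro!: sums_Re sums)
  obtain g2 where g2: "integrable ?M g2" "\<And>A. A \<in> sets ?M \<Longrightarrow> (CINT x. indicator A x * g2 x) = Im (L (\<iota> A))"
  proof (rule signed_Radon_Nikodym[OF fin, where \<nu>="\<lambda>A. Im (L (\<iota> A))" and K="\<bar>C\<bar>"])
    show "\<bar>Im (L (\<iota> A))\<bar> \<le> \<bar>C\<bar>" if "A \<in> sets ?M" for A
      using bd[OF that] abs_Im_le_cmod order_trans by blast
  qed (auto simp: add null intro!: sums_Im sums)
  define g where "g x = Complex (g1 x) (g2 x)" for x
  have g_eq: "g = (\<lambda>x. of_real (g1 x) + \<i> * of_real (g2 x))"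
    by (auto simp: g_def complex_eq_iff)
  have gint: "integrable ?M g"
    unfolding g_eq using g1(1) g2(1) by (intro Bochner_Integration.integrable_add integrable_mult_right integrable_of_real)
  then have gm[measurable]: "g \<in> borel_measurable ?M" by simp
  have int_ind: "integrable ?M (\<lambda>x. \<iota> A x * h x)" if "A \<in> sets ?M" "integrable ?M h" for A h
  proof -
    have "(\<lambda>x. indicator A x *\<^sub>R h x) = (\<lambda>x. \<iota> A x * h x)"
      by (intro ext) (auto simp: \<iota>_def indicator_def)
    then show ?thesis
      using integrable_mult_indicator[OF that] by simp
  qed
  have gA: "(CINT x. \<iota> A x * g x) = L (\<iota> A)" if A: "A \<in> sets ?M" for A
  proof (rule complex_eqI)
    note i = int_ind[OF A gint]
    have "Re (CINT x. \<iota> A x * g x) = (CINT x. Re (\<iota> A x * g x))"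
      using integral_Re[OF i] by simp
    also have "\<dots> = (CINT x. indicator A x * g1 x)"
      by (intro arg_cong[where f="integral\<^sup>L ?M"] ext) (auto simp: \<iota>_def g_def indicator_def)
    finally show "Re (CINT x. \<iota> A x * g x) = Re (L (\<iota> A))"
      using g1(2)[OF A] by simp
    have "Im (CINT x. \<iota> A x * g x) = (CINT x. Im (\<iota> A x * g x))"
      using integral_Im[OF i] by simp
    also have "\<dots> = (CINT x. indicator A x * g2 x)"
      by (intro arg_cong[where f="integral\<^sup>L ?M"] ext) (auto simp: \<iota>_def g_def indicator_def)
    finally show "Im (CINT x. \<iota> A x * g x) = Im (L (\<iota> A))"
      using g2(2)[OF A] by simp
  qed
  have simple: "L s = (CINT x. s x * g x)" if s: "simple_function ?M s" "s \<in> Lp_space p" for s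
  proof -
    define A where "A y = s -` {y} \<inter> space ?M" for y
    have A: "A y \<in> sets ?M" for y
      unfolding A_def using s(1) by (rule simple_functionD)
    let ?I = "s ` space ?M"
    have rep: "s x = (\<Sum>y\<in>?I. y * \<iota> (A y) x)" if "x \<in> space ?M" for x
    proof -
      have "s x = (\<Sum>y\<in>?I. indicator (A y) x *\<^sub>R y)"
        unfolding A_def by (rule simple_function_indicator_representation_banach[OF s(1) that])
      also have "\<dots> = (\<Sum>y\<in>?I. y * \<iota> (A y) x)"
        by (intro sum.cong refl) (auto simp: \<iota>_def indicator_def)
      finally show ?thesis .
    qed
    have mem: "(\<lambda>x. \<Sum>y\<in>?I. y * \<iota> (A y) x) \<in> Lp_space p"
      by (intro cseminorm_lincomb_sum_mem[OF cseminorm_Lp[OF p1]] chi A)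
    have "L s = L (\<lambda>x. \<Sum>y\<in>?I. y * \<iota> (A y) x)"
      by (rule Lp_functional_cong_AE[OF p1 L s(2) mem AE_I2[OF rep]])
    also have "\<dots> = (\<Sum>y\<in>?I. y * L (\<iota> (A y)))"
      by (intro clinear_functional_on_lincomb_sum[OF cseminorm_Lp[OF p1] L(1)] chi A)
    also have "\<dots> = (\<Sum>y\<in>?I. CINT x. y * (\<iota> (A y) x * g x))"
      by (intro sum.cong refl) (simp add: gA A int_ind gint)
    also have "\<dots> = (CINT x. (\<Sum>y\<in>?I. y * (\<iota> (A y) x * g x)))"
      by (intro Bochner_Integration.integral_sum[symmetric] integrable_mult_right int_ind A gint)
    also have "\<dots> = (CINT x. s x * g x)"
    proof (rule Bochner_Integration.integral_cong[OF refl])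
      fix x assume "x \<in> space ?M"
      then show "(\<Sum>y\<in>?I. y * (\<iota> (A y) x * g x)) = s x * g x"
        by (simp only: rep sum_distrib_right mult.assoc)
    qed
    finally show ?thesis .
  qed
  \<comment> \<open>Integrability of the product has to be a hypothesis here, as \<open>g\<close> is
    so far only known to be in L^1. The truncated test functions below satisfy it; once
    \<open>g\<close> is in L^q it is automatic.\<close>
  have rep: "L f = (CINT x. f x * g x)" if f: "f \<in> Lp_space p" and fg: "integrable ?M (\<lambda>x. f x * g x)" for f
  proof -
    note [measurable] = Lp_spaceD(1)[OF f]
    obtain F where F: "\<And>i. simple_function ?M (F i)" "\<And>x. x \<in> space ?M \<Longrightarrow> (\<lambda>i. F i x) \<longlonglongrightarrow> f x"
      "\<And>i x. x \<in> space ?M \<Longrightarrow> dist (F i x) 0 \<le> 2 * dist (f x) 0"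
      using borel_measurable_implies_sequence_metric[OF Lp_spaceD(1)[OF f], of 0] by blast
    have Fm[measurable]: "F i \<in> borel_measurable ?M" for i
      using F(1) by (rule borel_measurable_simple_function)
    have bd: "cmod (F i x) \<le> 2 * cmod (f x)" if "x \<in> unit_cube" for i x
      using F(3)[of x i] that by simp
    have lim: "(\<lambda>i. F i x) \<longlonglongrightarrow> f x" if "x \<in> unit_cube" for x
      using F(2)[of x] that by simp
    have "(\<lambda>i. L (F i)) \<longlonglongrightarrow> L f"
      by (rule Lp_functional_dominated[OF p L f Fm lim bd])
    moreover have "L (F i) = (CINT x. F i x * g x)" for i
      by (rule simple[OF F(1) Lp_dominated(1)[OF p f Fm lim bd]])
    moreover have "(\<lambda>i. \<integral>x. F i x * g x \<partial>?M) \<longlonglongrightarrow> (CINT x. f x * g x)"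
    proof (rule integral_dominated_convergence)
      show "integrable ?M (\<lambda>x. 2 * cmod (f x * g x))"
        using fg by (intro integrable_mult_right integrable_norm)
      show "AE x in ?M. (\<lambda>i. F i x * g x) \<longlonglongrightarrow> f x * g x"
        using lim by (intro AE_I2 tendsto_intros) auto
      show "AE x in ?M. norm (F i x * g x) \<le> 2 * cmod (f x * g x)" for i
      proof (rule AE_I2)
        fix x :: "real^'n" assume "x \<in> space ?M"
        then have "cmod (F i x) * cmod (g x) \<le> 2 * cmod (f x) * cmod (g x)"
          using bd[of x i] by (intro mult_right_mono) auto
        then show "norm (F i x * g x) \<le> 2 * cmod (f x * g x)"
          by (simp add: norm_mult)
      qed
    qed measurable
    ultimately show ?thesis
      using LIMSEQ_unique by auto
  qed
  have gq: "g \<in> Lp_space q"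
  proof -
    let ?J = "\<lambda>k x. indicator {x. cmod (g x) \<le> real k} x * cmod (g x) powr q :: real"
    define I where "I k = (CINT x. ?J k x)" for k :: nat
    have Im[measurable]: "(\<lambda>x. indicator {x. cmod (g x) \<le> real k} x :: real) \<in> borel_measurable ?M" for k
      by measurable
    have Im'[measurable]: "(\<lambda>x. indicator {x. cmod (g x) \<le> real k} x :: complex) \<in> borel_measurable ?M" for k
      by measurable
    have Iint: "integrable ?M (?J k)" for k
    proof (rule integrable_bounded_cube)
      show "norm (?J k x) \<le> real k powr q" for x
        using q1 by (auto simp: indicator_def intro!: powr_mono2)
    qed measurable
    have I0: "0 \<le> I k" for k
      unfolding I_def by (intro integral_nonneg_AE) (auto simp: indicator_def)
    have Ibd: "I k \<le> \<bar>C\<bar> powr q" for k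
    proof -
      \<comment> \<open>Extremal function for Hoelder's inequality, cut off where |g| > k: there f g
        = |g|^q and, as (q - 1) p = q, also |f|^p = |g|^q. Boundedness of \<open>L\<close> becomes I
        <= |C| I^(1/p), and the cut-off makes I finite, so that I^(1/p) may be cancelled.\<close>
      define f where "f x = indicator {x. cmod (g x) \<le> real k} x * of_real (cmod (g x) powr (q - 1)) * cnj (sgn (g x))" for x
      have "(\<lambda>x. cnj (sgn (g x))) \<in> borel_measurable ?M"
        by (rule measurable_compose[OF gm borel_measurable_cnj_sgn])
      then have fm: "f \<in> borel_measurable ?M"
        unfolding f_def by measurable
      have cf: "cmod (f x) = indicator {x. cmod (g x) \<le> real k} x * cmod (g x) powr (q - 1)" for x
        using q1 by (auto simp: f_def norm_mult indicator_def norm_sgn)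
      have fp: "f \<in> Lp_space p"
      proof (rule Lp_bounded[OF fm])
        show "cmod (f x) \<le> real k powr (q - 1)" for x
          unfolding cf using q1 by (auto simp: indicator_def intro!: powr_mono2)
      qed (use p in auto)
      have fge: "f x * g x = of_real (?J k x)" for x
      proof (cases "g x = 0")
        case False
        have "cnj (sgn (g x)) * g x = of_real (cmod (g x))"
          using False complex_norm_square[of "g x"]
          by (simp add: sgn_div_norm scaleR_conv_of_real power2_eq_square field_simps)
        moreover have "cmod (g x) powr (q - 1) * cmod (g x) = cmod (g x) powr q"
          using powr_add[of "cmod (g x)" "q - 1" 1] by simp
        ultimately show ?thesis
          by (simp add: f_def mult.assoc of_real_mult[symmetric] indicator_def del: of_real_mult)
      qed (simp add: f_def)
      have "integrable ?M (\<lambda>x. f x * g x)"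
        unfolding fge using Iint by (intro integrable_of_real)
      from rep[OF fp this] have "L f = of_real (I k)"
        unfolding fge I_def by (simp only: integral_complex_of_real)
      then have "I k \<le> \<bar>C\<bar> * Lp_norm p f"
        using L(2)[OF fp] I0[of k] Lp_norm_nonneg[of p f] mult_right_mono[OF abs_ge_self[of C], of "Lp_norm p f"] by simp
      also have "Lp_norm p f = I k powr (1 / p)"
        unfolding Lp_norm_def cf I_def using q1 p
        by (intro arg_cong[where f="\<lambda>t. t powr (1 / p)"] arg_cong[where f="integral\<^sup>L ?M"] ext)
           (auto simp: indicator_def powr_powr)
      finally have le: "I k \<le> \<bar>C\<bar> * I k powr (1 / p)" .
      show ?thesis
      proof (cases "I k = 0")
        case False
        then have pos: "I k > 0" using I0[of k] by simp
        have "I k powr (1 / q) * I k powr (1 / p) \<le> \<bar>C\<bar> * I k powr (1 / p)"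
          using le pos q q1 by (simp add: powr_add[symmetric] add.commute)
        then have "I k powr (1 / q) \<le> \<bar>C\<bar>"
          using pos by simp
        then have "(I k powr (1 / q)) powr q \<le> \<bar>C\<bar> powr q"
          using q1 by (intro powr_mono2) auto
        then show ?thesis
          using pos q1 by (simp add: powr_powr)
      qed simp
    qed
    have "integrable ?M (\<lambda>x. cmod (g x) powr q)"
    \<comment> \<open>The bound on \<open>I k\<close> is uniform in k, so Fatou's lemma removes the
      cut-off.\<close>
    proof (rule integrableI_nonneg)
      have "(\<integral>\<^sup>+x. liminf (\<lambda>k. ennreal (?J k x)) \<partial>?M)
          \<le> liminf (\<lambda>k. \<integral>\<^sup>+x. ennreal (?J k x) \<partial>?M)"
        by (rule nn_integral_liminf) measurable
      also have "\<dots> \<le> liminf (\<lambda>k::nat. ennreal (\<bar>C\<bar> powr q))"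
      proof (rule Liminf_mono, rule always_eventually, rule allI)
        fix k
        have "(\<integral>\<^sup>+x. ennreal (?J k x) \<partial>?M) = ennreal (I k)"
          unfolding I_def by (intro nn_integral_eq_integral Iint) (auto simp: indicator_def)
        then show "(\<integral>\<^sup>+x. ennreal (?J k x) \<partial>?M) \<le> ennreal (\<bar>C\<bar> powr q)"
          using Ibd[of k] by (simp add: ennreal_leI)
      qed
      also have "\<dots> = ennreal (\<bar>C\<bar> powr q)"
        by (simp add: Liminf_const)
      also have "(\<lambda>x. liminf (\<lambda>k. ennreal (?J k x))) = (\<lambda>x. ennreal (cmod (g x) powr q))"
      proof
        fix x
        have "(\<lambda>k. ennreal (?J k x)) \<longlonglongrightarrow> ennreal (cmod (g x) powr q)"
        proof (rule tendsto_eventually)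
          have "\<forall>\<^sub>F k in sequentially. cmod (g x) \<le> real k"
            using filterlim_real_sequentially by (simp add: filterlim_at_top)
          then show "\<forall>\<^sub>F k in sequentially. ennreal (?J k x) = ennreal (cmod (g x) powr q)"
            by eventually_elim (simp add: indicator_def)
        qed
        then show "liminf (\<lambda>k. ennreal (?J k x)) = ennreal (cmod (g x) powr q)"
          by (intro lim_imp_Liminf) auto
      qed
      finally show "(\<integral>\<^sup>+x. ennreal (cmod (g x) powr q) \<partial>?M) < \<infinity>"
        by (rule le_less_trans) simp
    qed auto
    then show ?thesis
      using gm by (simp add: Lp_space_def)
  qed
  show thesis
    by (rule that[OF gq rep[OF _ Holder(1)[OF p q _ gq]]])
qed

section \<open>L^p modulo constants: its dual and its reflexivity\<close>

lemma Lp_mod_norm_le: "Lp_mod_norm p f \<le> Lp_norm p (\<lambda>x. f x + c)"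
  unfolding Lp_mod_norm_def using Lp_norm_nonneg by (intro cINF_lower bdd_belowI2[where m=0]) auto

lemma Lp_mod_norm_nonneg: "0 \<le> Lp_mod_norm p f"
  unfolding Lp_mod_norm_def using Lp_norm_nonneg by (intro cINF_greatest) auto

lemma cseminorm_Lp_mod: "1 \<le> p \<Longrightarrow> cseminorm_on (Lp_space p) (Lp_mod_norm p)"
proof (rule cseminorm_onI)
  assume p: "1 \<le> p"
  note sn = cseminorm_Lp[OF p]
  show "(\<lambda>x. 0) \<in> Lp_space p" by (rule cseminorm_zero_mem[OF sn])
  fix f g :: "real^'a \<Rightarrow> complex" and a b assume f: "f \<in> Lp_space p" and g: "g \<in> Lp_space p"
  show "(\<lambda>x. a * f x + b * g x) \<in> Lp_space p" by (rule cseminorm_lincomb_mem[OF sn f g])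
  have ex: "\<exists>c. Lp_norm p (\<lambda>x. h x + c) < Lp_mod_norm p h + e" if "0 < e" for e and h :: "real^'a \<Rightarrow> complex"
    using cINF_lessD[of UNIV "\<lambda>c. Lp_norm p (\<lambda>x. h x + c)" "Lp_mod_norm p h + e"] that
    unfolding Lp_mod_norm_def by auto
  show "Lp_mod_norm p (\<lambda>x. a * f x + b * g x) \<le> cmod a * Lp_mod_norm p f + cmod b * Lp_mod_norm p g"
  proof (rule tendsto_lowerbound)
    show "((\<lambda>e. cmod a * (Lp_mod_norm p f + e) + cmod b * (Lp_mod_norm p g + e)) \<longlongrightarrow>
        cmod a * Lp_mod_norm p f + cmod b * Lp_mod_norm p g) (at_right 0)"
      by (auto intro!: tendsto_eq_intros)
    show "\<forall>\<^sub>F e in at_right 0. Lp_mod_norm p (\<lambda>x. a * f x + b * g x) \<le> cmod a * (Lp_mod_norm p f + e) + cmod b * (Lp_mod_norm p g + e)"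
      using eventually_at_right_less[of 0]
    proof eventually_elim
      fix e :: real assume e: "0 < e"
      obtain c where c: "Lp_norm p (\<lambda>x. f x + c) < Lp_mod_norm p f + e" using ex[OF e] by blast
      obtain d where d: "Lp_norm p (\<lambda>x. g x + d) < Lp_mod_norm p g + e" using ex[OF e] by blast
      have "Lp_mod_norm p (\<lambda>x. a * f x + b * g x) \<le> Lp_norm p (\<lambda>x. (a * f x + b * g x) + (a * c + b * d))"
        by (rule Lp_mod_norm_le)
      also have "\<dots> = Lp_norm p (\<lambda>x. a * (f x + c) + b * (g x + d))"
        by (simp add: algebra_simps)
      also have "\<dots> \<le> cmod a * Lp_norm p (\<lambda>x. f x + c) + cmod b * Lp_norm p (\<lambda>x. g x + d)"
        using p by (intro cseminorm_lincomb[OF sn] cseminorm_add_mem[OF sn] f g Lp_const) auto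
      also have "\<dots> \<le> cmod a * (Lp_mod_norm p f + e) + cmod b * (Lp_mod_norm p g + e)"
        using c d by (intro add_mono mult_left_mono) auto
      finally show "Lp_mod_norm p (\<lambda>x. a * f x + b * g x) \<le> cmod a * (Lp_mod_norm p f + e) + cmod b * (Lp_mod_norm p g + e)" .
    qed
  qed simp
qed (rule Lp_mod_norm_nonneg)

lemma Lp_mean_zeroD:
  assumes "g \<in> Lp_mean_zero q"
  shows "g \<in> Lp_space q" "(CINT x. g x) = 0"
  using assms unfolding Lp_mean_zero_def by auto

lemma cseminorm_Lp_mean_zero:
  assumes "1 < q"
  shows "cseminorm_on (Lp_mean_zero q :: 'n::finite cfun set) (Lp_norm q)"
proof -
  have sn: "cseminorm_on (Lp_space q :: 'n cfun set) (Lp_norm q)"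
    using assms by (intro cseminorm_Lp) simp
  show ?thesis
  proof (rule cseminorm_onI)
    show "(\<lambda>x :: real^'n. 0) \<in> Lp_mean_zero q"
      using cseminorm_zero_mem[OF sn] by (simp add: Lp_mean_zero_def)
    fix f g :: "'n cfun" and a b assume fg: "f \<in> Lp_mean_zero q" "g \<in> Lp_mean_zero q"
    have int: "integrable cube_measure f" "integrable cube_measure g"
      using fg Lp_L1(1)[OF assms] by (auto simp: Lp_mean_zero_def L1_space_def)
    show "(\<lambda>x. a * f x + b * g x) \<in> Lp_mean_zero q"
      using fg cseminorm_lincomb_mem[OF sn] int unfolding Lp_mean_zero_def by simp
    show "Lp_norm q (\<lambda>x. a * f x + b * g x) \<le> cmod a * Lp_norm q f + cmod b * Lp_norm q g"
      using fg by (intro cseminorm_lincomb[OF sn]) (auto simp: Lp_mean_zero_def)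
  qed (rule Lp_norm_nonneg)
qed

lemma pairing_add_const:
  assumes p: "1 < p" and q: "1 / p + 1 / q = 1" and f: "f \<in> Lp_space p" and g: "g \<in> Lp_mean_zero q"
  shows "(CINT x. (f x + c) * g x) = (CINT x. f x * g x)"
proof -
  note g' = Lp_mean_zeroD[OF g]
  have "integrable cube_measure g"
    using Lp_L1(1)[OF conjugate_exponent(1)[OF p q] g'(1)] by (simp add: L1_space_def)
  then show ?thesis
    using Holder(1)[OF p q f g'(1)] g'(2) by (simp add: distrib_right)
qed

lemma pairing_mod_norm:
  assumes p: "1 < p" and q: "1 / p + 1 / q = 1" and f: "f \<in> Lp_space p" and g: "g \<in> Lp_mean_zero q"
  shows "cmod (CINT x. f x * g x) \<le> Lp_norm q g * Lp_mod_norm p f"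
proof (cases "Lp_norm q g = 0")
  case True
  then show ?thesis
    using Holder(3)[OF p q f Lp_mean_zeroD(1)[OF g]] by simp
next
  case False
  then have pos: "Lp_norm q g > 0" using Lp_norm_nonneg[of q g] by simp
  have "cmod (CINT x. f x * g x) / Lp_norm q g \<le> Lp_mod_norm p f"
    unfolding Lp_mod_norm_def
  proof (rule cINF_greatest)
    fix c
    have "(\<lambda>x. f x + c) \<in> Lp_space p"
      using p by (intro cseminorm_add_mem[OF cseminorm_Lp] f Lp_const) auto
    from Holder(3)[OF p q this Lp_mean_zeroD(1)[OF g]]
    show "cmod (CINT x. f x * g x) / Lp_norm q g \<le> Lp_norm p (\<lambda>x. f x + c)"
      using pos by (simp add: pairing_add_const[OF p q f g] divide_le_eq)
  qed simp
  then show ?thesis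
    using pos by (simp add: divide_le_eq mult.commute)
qed

lemma clinear_pairing:
  assumes "\<And>f. f \<in> V \<Longrightarrow> integrable cube_measure (\<lambda>x. f x * g x)"
    and "\<And>f h a b. f \<in> V \<Longrightarrow> h \<in> V \<Longrightarrow> (\<lambda>x. a * f x + b * h x) \<in> V"
  shows "clinear_functional_on V (pairing_functional V g)"
  unfolding clinear_functional_on_def pairing_functional_def
proof (intro ballI allI)
  fix f h a b assume fh: "f \<in> V" "h \<in> V"
  have "(CINT x. (a * f x + b * h x) * g x) = (CINT x. a * (f x * g x) + b * (h x * g x))"
    by (simp add: algebra_simps)
  also have "\<dots> = a * (CINT x. f x * g x) + b * (CINT x. h x * g x)"
    using assms(1)[OF fh(1)] assms(1)[OF fh(2)] by simp
  finally show "(if (\<lambda>x. a * f x + b * h x) \<in> V then \<integral>x. (a * f x + b * h x) * g x \<partial>cube_measure else 0) =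
      a * (if f \<in> V then \<integral>x. f x * g x \<partial>cube_measure else 0) + b * (if h \<in> V then \<integral>x. h x * g x \<partial>cube_measure else 0)"
    using fh assms(2) by simp
qed

lemma pairing_Lp_dual:
  assumes p: "1 < p" and q: "1 / p + 1 / q = 1" and g: "g \<in> Lp_mean_zero q"
  shows "pairing_functional (Lp_space p) g \<in> dual_space (Lp_space p) (Lp_mod_norm p)"
    and "dual_norm (Lp_space p) (Lp_mod_norm p) (pairing_functional (Lp_space p) g) \<le> Lp_norm q g"
proof -
  have lin: "clinear_functional_on (Lp_space p) (pairing_functional (Lp_space p) g)"
    using p by (intro clinear_pairing Holder(1)[OF p q _ Lp_mean_zeroD(1)[OF g]] Lp_lincomb) auto
  have bd: "cmod (pairing_functional (Lp_space p) g f) \<le> Lp_norm q g * Lp_mod_norm p f" if "f \<in> Lp_space p" for f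
    using pairing_mod_norm[OF p q that g] that by (simp add: pairing_functional_def)
  show "pairing_functional (Lp_space p) g \<in> dual_space (Lp_space p) (Lp_mod_norm p)"
    by (rule dual_spaceI[OF lin bd]) (auto simp: pairing_functional_def)
  show "dual_norm (Lp_space p) (Lp_mod_norm p) (pairing_functional (Lp_space p) g) \<le> Lp_norm q g"
    using p by (intro dual_norm_le[OF cseminorm_Lp_mod _ bd] Lp_norm_nonneg) auto
qed

lemma Lp_mod_dual:
  fixes q :: real
  assumes p: "1 < p" and q: "1 / p + 1 / q = 1"
  shows "pairing_functional (Lp_space p) ` Lp_mean_zero q = dual_space (Lp_space p :: 'n::finite cfun set) (Lp_mod_norm p)"
proof (intro equalityI subsetI)
  fix \<phi> :: "'n cfun \<Rightarrow> complex"
  assume \<phi>: "\<phi> \<in> dual_space (Lp_space p) (Lp_mod_norm p)"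
  obtain C where C: "\<And>f. f \<in> Lp_space p \<Longrightarrow> cmod (\<phi> f) \<le> C * Lp_mod_norm p f"
    using dual_spaceD(2)[OF \<phi>] by blast
  have bd: "cmod (\<phi> f) \<le> \<bar>C\<bar> * Lp_norm p f" if "f \<in> Lp_space p" for f
  proof -
    have "C * Lp_mod_norm p f \<le> \<bar>C\<bar> * Lp_norm p f"
      using Lp_mod_norm_le[of p f 0] by (intro mult_mono) (auto simp: Lp_mod_norm_nonneg)
    then show ?thesis using C[OF that] by simp
  qed
  obtain g where g: "g \<in> Lp_space q" "\<And>f. f \<in> Lp_space p \<Longrightarrow> \<phi> f = (CINT x. f x * g x)"
    using Lp_Riesz[OF p q dual_spaceD(1)[OF \<phi>] bd] by blast
  \<comment> \<open>Constants have quotient norm 0, so \<open>\<phi>\<close> annihilates them; this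
    is what forces the representing function to have mean zero.\<close>
  have one: "(\<lambda>x. 1) \<in> (Lp_space p :: 'n cfun set)"
    using p by (intro Lp_const) auto
  have "Lp_mod_norm p (\<lambda>x :: real^'n. 1) \<le> Lp_norm p (\<lambda>x :: real^'n. 1 + - 1)"
    by (rule Lp_mod_norm_le)
  also have "\<dots> = 0"
    using p Lp_norm_const[of p 0] by simp
  finally have "Lp_mod_norm p (\<lambda>x :: real^'n. 1) = 0"
    using Lp_mod_norm_nonneg[of p "\<lambda>x :: real^'n. 1"] by simp
  then have "\<phi> (\<lambda>x. 1) = 0"
    using C[OF one] by simp
  then have "(CINT x. g x) = 0"
    using g(2)[OF one] by simp
  then have "g \<in> Lp_mean_zero q"
    using g(1) by (simp add: Lp_mean_zero_def)
  moreover have "\<phi> = pairing_functional (Lp_space p) g"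
    using g(2) dual_spaceD(3)[OF \<phi>] by (auto simp: pairing_functional_def)
  ultimately show "\<phi> \<in> pairing_functional (Lp_space p) ` Lp_mean_zero q" by blast
qed (use pairing_Lp_dual(1)[OF p q] in auto)

text \<open>Subtracting the mean is a projection of L^q onto the mean-zero functions of norm at most
  2. Composing with it extends the functional to all of L^q explicitly, where the Riesz
  representation applies with the exponents exchanged.\<close>

lemma Lp_mean_zero_Riesz:
  fixes \<Lambda> :: "'n::finite cfun \<Rightarrow> complex"
  assumes p: "1 < p" and q: "1 / p + 1 / q = 1"
    and \<Lambda>: "clinear_functional_on (Lp_mean_zero q) \<Lambda>" "\<And>g. g \<in> Lp_mean_zero q \<Longrightarrow> cmod (\<Lambda> g) \<le> C * Lp_norm q g"
  obtains f :: "'n cfun" where "f \<in> Lp_space p" "\<And>g. g \<in> Lp_mean_zero q \<Longrightarrow> \<Lambda> g = (CINT x. f x * g x)"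
proof -
  note q1 = conjugate_exponent[OF p q]
  let ?m = "\<lambda>h :: 'n cfun. \<integral>x. h x \<partial>cube_measure"
  have snq: "cseminorm_on (Lp_space q :: 'n cfun set) (Lp_norm q)"
    using q1 by (intro cseminorm_Lp) auto
  have int: "integrable cube_measure h" if "h \<in> Lp_space q" for h :: "'n cfun"
    using Lp_L1(1)[OF q1(1) that] by (simp add: L1_space_def)
  have mz: "(\<lambda>x. h x - ?m h) \<in> Lp_mean_zero q" if "h \<in> Lp_space q" for h
  proof -
    have "(\<lambda>x. h x - ?m h) \<in> Lp_space q"
      using q1 by (intro cseminorm_diff_mem[OF snq] that Lp_const) auto
    moreover have "(CINT x. h x - ?m h) = ?m h - ?m h"
      using int[OF that] by (simp only: Bochner_Integration.integral_diff integrable_const_cube integral_const_cube)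
    ultimately show ?thesis by (simp add: Lp_mean_zero_def)
  qed
  define L where "L h = \<Lambda> (\<lambda>x. h x - ?m h)" for h
  have "clinear_functional_on (Lp_space q) L"
    unfolding clinear_functional_on_def
  proof (intro ballI allI)
    fix h k :: "'n cfun" and a b assume hk: "h \<in> Lp_space q" "k \<in> Lp_space q"
    have "?m (\<lambda>x. a * h x + b * k x) = a * ?m h + b * ?m k"
      using int[OF hk(1)] int[OF hk(2)] by simp
    then have "L (\<lambda>x. a * h x + b * k x) = \<Lambda> (\<lambda>x. a * (h x - ?m h) + b * (k x - ?m k))"
      unfolding L_def by (simp add: algebra_simps)
    also have "\<dots> = a * L h + b * L k"
      unfolding L_def by (rule clinear_functional_onD[OF \<Lambda>(1) mz[OF hk(1)] mz[OF hk(2)]])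
    finally show "L (\<lambda>x. a * h x + b * k x) = a * L h + b * L k" .
  qed
  moreover have "cmod (L h) \<le> (\<bar>C\<bar> * 2) * Lp_norm q h" if h: "h \<in> Lp_space q" for h
  proof -
    have "Lp_norm q (\<lambda>x. h x - ?m h) \<le> Lp_norm q h + Lp_norm q (\<lambda>x :: real^'n. ?m h)"
      using q1 by (intro cseminorm_diff[OF snq] h Lp_const) auto
    also have "Lp_norm q (\<lambda>x :: real^'n. ?m h) = cmod (?m h)"
      using q1 by (intro Lp_norm_const) auto
    also have "\<dots> \<le> Lp_norm q h"
      using order_trans[OF integral_norm_bound Lp_L1(2)[OF q1(1) h]] .
    finally have "C * Lp_norm q (\<lambda>x. h x - ?m h) \<le> \<bar>C\<bar> * (2 * Lp_norm q h)"
      by (intro mult_mono) (auto simp: Lp_norm_nonneg)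
    then show ?thesis
      using \<Lambda>(2)[OF mz[OF h]] by (simp add: L_def)
  qed
  ultimately obtain f where f: "f \<in> Lp_space p" "\<And>h. h \<in> Lp_space q \<Longrightarrow> L h = (CINT x. h x * f x)"
    using Lp_Riesz[OF q1(1) q1(3)] by blast
  show thesis
  proof (rule that[OF f(1)])
    fix g :: "'n cfun" assume g: "g \<in> Lp_mean_zero q"
    show "\<Lambda> g = (CINT x. f x * g x)"
      using f(2)[OF Lp_mean_zeroD(1)[OF g]] Lp_mean_zeroD(2)[OF g] by (simp add: L_def mult.commute)
  qed
qed

text \<open>Through \<open>Lp_mod_dual\<close>, a functional on the dual becomes a functional on
  mean-zero L^q functions, and \<open>Lp_mean_zero_Riesz\<close> turns it into integration against
  an element of L^p.\<close>

lemma Lp_mod_reflexive: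
  fixes q :: real
  assumes p: "1 < p" and q: "1 / p + 1 / q = 1"
  defines "X \<equiv> Lp_space p :: 'n::finite cfun set"
  shows "canonical_embedding X (Lp_mod_norm p) ` X =
    dual_space (dual_space X (Lp_mod_norm p)) (dual_norm X (Lp_mod_norm p))"
proof (intro equalityI subsetI)
  have sn: "cseminorm_on X (Lp_mod_norm p)"
    unfolding X_def using p by (intro cseminorm_Lp_mod) auto
  note snd = cseminorm_dual[OF sn]
  {
    fix \<Phi> assume "\<Phi> \<in> canonical_embedding X (Lp_mod_norm p) ` X"
    then obtain f where f: "f \<in> X" "\<Phi> = canonical_embedding X (Lp_mod_norm p) f" by auto
    show "\<Phi> \<in> dual_space (dual_space X (Lp_mod_norm p)) (dual_norm X (Lp_mod_norm p))"
    proof (rule dual_spaceI)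
      show "clinear_functional_on (dual_space X (Lp_mod_norm p)) \<Phi>"
        using cseminorm_lincomb_mem[OF snd] by (simp add: clinear_functional_on_def f(2) canonical_embedding_def)
      show "cmod (\<Phi> \<psi>) \<le> Lp_mod_norm p f * dual_norm X (Lp_mod_norm p) \<psi>" if "\<psi> \<in> dual_space X (Lp_mod_norm p)" for \<psi>
        using dual_bound[OF sn that f(1)] that by (simp add: f(2) canonical_embedding_def mult.commute)
    qed (simp add: f(2) canonical_embedding_def)
  }
  fix \<Phi> assume \<Phi>: "\<Phi> \<in> dual_space (dual_space X (Lp_mod_norm p)) (dual_norm X (Lp_mod_norm p))"
  note q1 = conjugate_exponent[OF p q]
  define \<Lambda> where "\<Lambda> g = \<Phi> (pairing_functional X g)" for g
  have mem: "pairing_functional X g \<in> dual_space X (Lp_mod_norm p)" if "g \<in> Lp_mean_zero q" for g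
    unfolding X_def by (rule pairing_Lp_dual(1)[OF p q that])
  have pair_lin: "pairing_functional X (\<lambda>x. a * g x + b * h x) =
      (\<lambda>f. a * pairing_functional X g f + b * pairing_functional X h f)"
    if gh: "g \<in> Lp_mean_zero q" "h \<in> Lp_mean_zero q" for g h :: "'n cfun" and a b
  proof
    fix f :: "'n cfun"
    show "pairing_functional X (\<lambda>x. a * g x + b * h x) f = a * pairing_functional X g f + b * pairing_functional X h f"
    proof (cases "f \<in> X")
      case True
      have "(CINT x. f x * (a * g x + b * h x)) = (CINT x. a * (f x * g x) + b * (f x * h x))"
        by (simp add: algebra_simps)
      also have "\<dots> = a * (CINT x. f x * g x) + b * (CINT x. f x * h x)"
        using True Holder(1)[OF p q _ Lp_mean_zeroD(1)[OF gh(1)], of f] Holder(1)[OF p q _ Lp_mean_zeroD(1)[OF gh(2)], of f]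
        by (simp add: X_def)
      finally show ?thesis using True by (simp add: pairing_functional_def)
    qed (simp add: pairing_functional_def)
  qed
  have "clinear_functional_on (Lp_mean_zero q) \<Lambda>"
    unfolding clinear_functional_on_def \<Lambda>_def
    using pair_lin clinear_functional_onD[OF dual_spaceD(1)[OF \<Phi>] mem mem] by simp
  moreover obtain C where C: "\<And>\<psi>. \<psi> \<in> dual_space X (Lp_mod_norm p) \<Longrightarrow> cmod (\<Phi> \<psi>) \<le> C * dual_norm X (Lp_mod_norm p) \<psi>"
    using dual_spaceD(2)[OF \<Phi>] by blast
  have "cmod (\<Lambda> g) \<le> \<bar>C\<bar> * Lp_norm q g" if g: "g \<in> Lp_mean_zero q" for g
  proof -
    have "C * dual_norm X (Lp_mod_norm p) (pairing_functional X g) \<le> \<bar>C\<bar> * Lp_norm q g"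
      using pairing_Lp_dual(2)[OF p q g] dual_norm_nonneg[OF sn mem[OF g]] unfolding X_def
      by (intro mult_mono) auto
    then show ?thesis using C[OF mem[OF g]] by (simp add: \<Lambda>_def)
  qed
  ultimately obtain f where f: "f \<in> X" "\<And>g. g \<in> Lp_mean_zero q \<Longrightarrow> \<Lambda> g = (CINT x. f x * g x)"
    using Lp_mean_zero_Riesz[OF p q] unfolding X_def by blast
  have "\<Phi> = canonical_embedding X (Lp_mod_norm p) f"
  proof
    fix \<psi>
    show "\<Phi> \<psi> = canonical_embedding X (Lp_mod_norm p) f \<psi>"
    proof (cases "\<psi> \<in> dual_space X (Lp_mod_norm p)")
      case True
      then obtain g where g: "g \<in> Lp_mean_zero q" "\<psi> = pairing_functional X g"
        using Lp_mod_dual[OF p q] unfolding X_def by blast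
      then show ?thesis
        using f True by (auto simp: \<Lambda>_def canonical_embedding_def pairing_functional_def)
    qed (simp add: canonical_embedding_def dual_spaceD(3)[OF \<Phi>])
  qed
  then show "\<Phi> \<in> canonical_embedding X (Lp_mod_norm p) ` X" using f by blast
qed

subsection \<open>Mean oscillations over families of cubes\<close>

definition cube_osc :: "(real^'n) set \<Rightarrow> 'n cfun \<Rightarrow> real" where
  "cube_osc Q f = 1 / measure lebesgue Q * (LINT x:Q|lebesgue. cmod (f x - average Q f))"

definition osc_sum :: "real \<Rightarrow> (real^'n) set set \<Rightarrow> 'n cfun \<Rightarrow> real" where
  "osc_sum r \<F> f = r ^ (CARD('n) - 1) * (\<Sum>Q\<in>\<F>. cube_osc Q f)"

lemma power_card: "(r :: real) ^ CARD('n :: finite) = r * r ^ (CARD('n) - 1)"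
  by (metis Suc_diff_1 power_Suc zero_less_card_finite)

lemma osc_eq: "osc r f = (SUP \<F>\<in>cube_families r. ennreal (osc_sum r \<F> f))"
  by (simp add: osc_def osc_sum_def cube_osc_def)

lemma eps_cubeD:
  fixes Q :: "(real^'n) set"
  assumes "eps_cube r Q" "0 < r"
  shows "Q \<in> sets lebesgue" "measure lebesgue Q = r ^ CARD('n)" "emeasure lebesgue Q < \<infinity>" "open Q" "Q \<noteq> {}"
proof -
  obtain a where Q: "Q = box a (\<chi> i. a $ i + r)"
    using assms(1) unfolding eps_cube_def by (elim exE)
  show "Q \<in> sets lebesgue" "emeasure lebesgue Q < \<infinity>" "open Q"
    unfolding Q using emeasure_lborel_box_finite[of a "\<chi> i. a $ i + r"] open_box by simp_all
  show "measure lebesgue Q = r ^ CARD('n)"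
    unfolding Q using assms(2) by (intro measure_box_cart) simp
  have "(\<chi> i. a $ i + r / 2) \<in> Q"
    unfolding Q using assms(2) by (simp add: mem_box_cart)
  then show "Q \<noteq> {}" by auto
qed

lemma cube_familiesD:
  fixes \<F> :: "(real^'n) set set"
  assumes "\<F> \<in> cube_families r"
  shows "\<And>Q. Q \<in> \<F> \<Longrightarrow> eps_cube r Q" "\<And>Q. Q \<in> \<F> \<Longrightarrow> Q \<subseteq> unit_cube" "disjoint \<F>" "finite \<F>"
    "real (card \<F>) \<le> r powr (1 - real CARD('n))"
  using assms unfolding cube_families_def by auto

lemma cube_measure_cases:
  fixes Q :: "(real^'n) set" and h :: "real^'n \<Rightarrow> 'b :: {banach, second_countable_topology}"
  assumes "Q \<in> sets lebesgue" "Q \<subseteq> unit_cube"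
  shows "(LINT x:Q|lebesgue. h x) = (CINT x. indicator Q x *\<^sub>R h x)"
    and "set_integrable lebesgue Q h \<longleftrightarrow> integrable cube_measure (\<lambda>x. indicator Q x *\<^sub>R h x)"
proof -
  have eq: "(\<lambda>x. indicator unit_cube x *\<^sub>R indicator Q x *\<^sub>R h x) = (\<lambda>x. indicator Q x *\<^sub>R h x)"
    using assms(2) by (auto simp: indicator_def fun_eq_iff)
  show "(LINT x:Q|lebesgue. h x) = (CINT x. indicator Q x *\<^sub>R h x)"
  proof -
    have "(CINT x. indicator Q x *\<^sub>R h x) = (LINT x|lebesgue. indicator unit_cube x *\<^sub>R (indicator Q x *\<^sub>R h x))"
      by (rule integral_restrict_space) simp
    then show ?thesis
      by (simp only: set_lebesgue_integral_def eq)
  qed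
  show "set_integrable lebesgue Q h \<longleftrightarrow> integrable cube_measure (\<lambda>x. indicator Q x *\<^sub>R h x)"
    by (simp add: set_integrable_def integrable_restrict_space eq del: scaleR_scaleR)
qed

lemma set_integrable_cube:
  fixes Q :: "(real^'n) set" and h :: "real^'n \<Rightarrow> 'b :: {banach, second_countable_topology}"
  assumes "Q \<in> sets lebesgue" "Q \<subseteq> unit_cube" "integrable cube_measure h"
  shows "set_integrable lebesgue Q h"
proof -
  have "Q \<in> sets cube_measure"
    using assms by (auto simp: sets_restrict_space image_iff intro!: bexI[of _ Q])
  from integrable_mult_indicator[OF this assms(3)] show ?thesis
    using cube_measure_cases(2)[OF assms(1,2), of h] by simp
qed

lemma set_integrable_const_cube:
  fixes Q :: "(real^'n) set" and c :: "'b :: {banach, second_countable_topology}"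
  assumes "Q \<in> sets lebesgue" "Q \<subseteq> unit_cube"
  shows "set_integrable lebesgue Q (\<lambda>x. c)"
  by (rule set_integrable_cube[OF assms integrable_const_cube])

lemma set_integral_const_cube:
  fixes Q :: "(real^'n) set" and c :: "'b :: {banach, second_countable_topology}"
  assumes "eps_cube r Q" "0 < r"
  shows "(LINT x:Q|lebesgue. c) = measure lebesgue Q *\<^sub>R c"
  using eps_cubeD[OF assms] by (simp add: set_lebesgue_integral_def)

lemma L1_lincomb:
  "f \<in> L1_space \<Longrightarrow> g \<in> L1_space \<Longrightarrow> (\<lambda>x. a * f x + b * g x) \<in> L1_space"
  by (simp add: L1_space_def)

lemma L1_diff: "f \<in> L1_space \<Longrightarrow> g \<in> L1_space \<Longrightarrow> (\<lambda>x. f x - g x) \<in> L1_space"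
  by (simp add: L1_space_def)

lemma L1_const: "(\<lambda>x. c) \<in> L1_space"
  unfolding L1_space_def by (intro CollectI integrable_const_cube)

lemma L1_diff_const: "f \<in> L1_space \<Longrightarrow> (\<lambda>x. f x - c) \<in> L1_space"
  by (intro L1_diff L1_const)

lemma cseminorm_L1: "cseminorm_on (L1_space :: 'n::finite cfun set) (\<lambda>f. \<integral>x. cmod (f x) \<partial>cube_measure)"
proof (rule cseminorm_onI)
  fix f g :: "'n cfun" and a b assume fg: "f \<in> L1_space" "g \<in> L1_space"
  then show "(\<lambda>x. a * f x + b * g x) \<in> L1_space" by (rule L1_lincomb)
  have int: "integrable cube_measure f" "integrable cube_measure g"
    using fg by (auto simp: L1_space_def)
  have "(CINT x. cmod (a * f x + b * g x)) \<le> (CINT x. cmod a * cmod (f x) + cmod b * cmod (g x))"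
    using int by (intro integral_mono integrable_norm Bochner_Integration.integrable_add integrable_mult_right)
      (auto simp: norm_mult[symmetric] norm_triangle_ineq)
  also have "\<dots> = cmod a * (CINT x. cmod (f x)) + cmod b * (CINT x. cmod (g x))"
    using int by simp
  finally show "(CINT x. cmod (a * f x + b * g x)) \<le>
      cmod a * (CINT x. cmod (f x)) + cmod b * (CINT x. cmod (g x))" .
qed (auto simp: L1_space_def intro!: integral_nonneg_AE)

context
  fixes Q :: "(real^'n) set" and r :: real
  assumes Q: "eps_cube r Q" "Q \<subseteq> unit_cube" and eps: "0 < r"
begin

lemma cube_measure_pos: "0 < measure lebesgue Q"
  using eps_cubeD(2)[OF Q(1) eps] eps by simp

lemma cube_set_integrable: "f \<in> L1_space \<Longrightarrow> set_integrable lebesgue Q f"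
  using set_integrable_cube[OF eps_cubeD(1)[OF Q(1) eps] Q(2)] by (simp add: L1_space_def)

lemma cube_set_integrable_const: "set_integrable lebesgue Q (\<lambda>x. c :: 'b :: {banach, second_countable_topology})"
  by (rule set_integrable_const_cube[OF eps_cubeD(1)[OF Q(1) eps] Q(2)])

lemma cube_set_integrable_dist: "f \<in> L1_space \<Longrightarrow> set_integrable lebesgue Q (\<lambda>x. cmod (f x - c))"
  by (intro set_integrable_norm set_integral_diff cube_set_integrable cube_set_integrable_const)

lemma set_integral_eq_average: "(LINT x:Q|lebesgue. f x) = measure lebesgue Q * average Q f"
  using cube_measure_pos by (simp add: average_def)

lemma average_lincomb:
  assumes "f \<in> L1_space" "g \<in> L1_space"
  shows "average Q (\<lambda>x. a * f x + b * g x) = a * average Q f + b * average Q g"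
proof -
  have "(LINT x:Q|lebesgue. a * f x + b * g x) = a * (LINT x:Q|lebesgue. f x) + b * (LINT x:Q|lebesgue. g x)"
    using cube_set_integrable[OF assms(1)] cube_set_integrable[OF assms(2)]
    by (subst set_integral_add) (auto intro: set_integrable_mult_right)
  then show ?thesis
    by (simp add: average_def add_divide_distrib)
qed

lemma average_diff_const:
  assumes "f \<in> L1_space"
  shows "average Q (\<lambda>x. f x - c) = average Q f - c"
proof -
  have "(LINT x:Q|lebesgue. f x - c) = (LINT x:Q|lebesgue. f x) - measure lebesgue Q * c"
    using cube_set_integrable[OF assms] cube_set_integrable_const set_integral_const_cube[OF Q(1) eps, of c]
    by (subst set_integral_diff) (auto simp: scaleR_conv_of_real)
  then show ?thesis
    using cube_measure_pos by (simp add: average_def diff_divide_distrib)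
qed

lemma average_dist_le:
  assumes "f \<in> L1_space"
  shows "cmod (average Q f - c) \<le> 1 / measure lebesgue Q * (LINT x:Q|lebesgue. cmod (f x - c))"
proof -
  have "cmod (average Q f - c) = cmod (LINT x:Q|lebesgue. f x - c) / measure lebesgue Q"
    unfolding average_diff_const[OF assms, symmetric] using cube_measure_pos by (simp add: average_def norm_divide)
  also have "\<dots> \<le> (LINT x:Q|lebesgue. cmod (f x - c)) / measure lebesgue Q"
    using cube_measure_pos
    by (intro divide_right_mono set_integral_norm_bound set_integral_diff cube_set_integrable cube_set_integrable_const assms) auto
  finally show ?thesis by simp
qed

lemma cube_osc_lincomb:
  assumes f: "f \<in> L1_space" and g: "g \<in> L1_space"
  shows "cube_osc Q (\<lambda>x. a * f x + b * g x) \<le> cmod a * cube_osc Q f + cmod b * cube_osc Q g"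
proof -
  have "(LINT x:Q|lebesgue. cmod (a * f x + b * g x - (a * average Q f + b * average Q g)))
      \<le> (LINT x:Q|lebesgue. cmod a * cmod (f x - average Q f) + cmod b * cmod (g x - average Q g))"
  proof (rule set_integral_mono)
    show "set_integrable lebesgue Q (\<lambda>x. cmod (a * f x + b * g x - (a * average Q f + b * average Q g)))"
      by (rule cube_set_integrable_dist[OF L1_lincomb[OF f g]])
    show "set_integrable lebesgue Q (\<lambda>x. cmod a * cmod (f x - average Q f) + cmod b * cmod (g x - average Q g))"
      by (intro set_integral_add set_integrable_mult_right cube_set_integrable_dist f g)
    fix x
    have "a * f x + b * g x - (a * average Q f + b * average Q g) = a * (f x - average Q f) + b * (g x - average Q g)"
      by (simp add: algebra_simps)
    then show "cmod (a * f x + b * g x - (a * average Q f + b * average Q g)) \<le> cmod a * cmod (f x - average Q f) + cmod b * cmod (g x - average Q g)"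
      by (metis norm_mult norm_triangle_ineq)
  qed
  also have "\<dots> = cmod a * (LINT x:Q|lebesgue. cmod (f x - average Q f)) + cmod b * (LINT x:Q|lebesgue. cmod (g x - average Q g))"
    using cube_set_integrable_dist[OF f] cube_set_integrable_dist[OF g]
    by (subst set_integral_add) (auto intro: set_integrable_mult_right)
  finally show ?thesis
    using cube_measure_pos unfolding cube_osc_def average_lincomb[OF f g] by (simp add: field_simps)
qed

text \<open>The mean is the best constant up to a factor 2, since its distance to any
  \<open>c\<close> is at most the mean of |f - c|.\<close>

lemma cube_osc_le:
  assumes f: "f \<in> L1_space"
  shows "cube_osc Q f \<le> 2 / measure lebesgue Q * (LINT x:Q|lebesgue. cmod (f x - c))"
proof -
  have "(LINT x:Q|lebesgue. cmod (f x - average Q f)) \<le> (LINT x:Q|lebesgue. cmod (f x - c) + cmod (average Q f - c))"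
  proof (rule set_integral_mono)
    show "cmod (f x - average Q f) \<le> cmod (f x - c) + cmod (average Q f - c)" for x
      using norm_triangle_ineq4[of "f x - c" "average Q f - c"] by simp
  qed (intro set_integral_add cube_set_integrable_dist cube_set_integrable_const f)+
  also have "\<dots> = (LINT x:Q|lebesgue. cmod (f x - c)) + measure lebesgue Q * cmod (average Q f - c)"
    using cube_set_integrable_dist[OF f] cube_set_integrable_const set_integral_const_cube[OF Q(1) eps, of "cmod (average Q f - c)"]
    by (subst set_integral_add) auto
  also have "measure lebesgue Q * cmod (average Q f - c) \<le> (LINT x:Q|lebesgue. cmod (f x - c))"
    using average_dist_le[OF f, of c] cube_measure_pos by (simp add: pos_le_divide_eq mult.commute)
  finally show ?thesis
    using cube_measure_pos by (simp add: cube_osc_def field_simps)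
qed

lemma cube_osc_le_sup:
  assumes f: "f \<in> L1_space" and bd: "\<And>x y. x \<in> Q \<Longrightarrow> y \<in> Q \<Longrightarrow> cmod (f x - f y) \<le> K"
  shows "cube_osc Q f \<le> K"
proof -
  have avg: "cmod (f x - average Q f) \<le> K" if x: "x \<in> Q" for x
  proof -
    have "cmod (average Q f - f x) \<le> 1 / measure lebesgue Q * (LINT y:Q|lebesgue. cmod (f y - f x))"
      by (rule average_dist_le[OF f])
    also have "(LINT y:Q|lebesgue. cmod (f y - f x)) \<le> (LINT y:Q|lebesgue. K)"
      using bd x by (intro set_integral_mono cube_set_integrable_dist f cube_set_integrable_const) auto
    also have "\<dots> = measure lebesgue Q * K"
      using set_integral_const_cube[OF Q(1) eps, of K] by simp
    finally show ?thesis
      using cube_measure_pos by (simp add: norm_minus_commute divide_right_mono mult_left_mono)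
  qed
  have "(LINT x:Q|lebesgue. cmod (f x - average Q f)) \<le> (LINT x:Q|lebesgue. K)"
    using avg by (intro set_integral_mono cube_set_integrable_dist f cube_set_integrable_const) auto
  also have "\<dots> = measure lebesgue Q * K"
    using set_integral_const_cube[OF Q(1) eps, of K] by simp
  finally show ?thesis
    using cube_measure_pos by (simp add: cube_osc_def divide_le_eq mult.commute)
qed

end

lemma integral_eq_sum_cubes:
  fixes \<F> :: "(real^'n) set set" and h :: "real^'n \<Rightarrow> 'b :: {banach, second_countable_topology}"
  assumes F: "\<F> \<in> cube_families r" and eps: "0 < r" and h: "integrable cube_measure h"
    and AE: "AE x in cube_measure. x \<notin> \<Union>\<F> \<longrightarrow> h x = 0"
  shows "(CINT x. h x) = (\<Sum>Q\<in>\<F>. LINT x:Q|lebesgue. h x)"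
proof -
  note FD = cube_familiesD[OF F]
  note QD = eps_cubeD[OF FD(1) eps]
  have ind: "integrable cube_measure (\<lambda>x. indicator Q x *\<^sub>R h x)" if "Q \<in> \<F>" for Q
    using set_integrable_cube[OF QD(1)[OF that] FD(2)[OF that] h] cube_measure_cases(2)[OF QD(1)[OF that] FD(2)[OF that], of h] by simp
  have one: "(\<Sum>Q\<in>\<F>. indicator Q x *\<^sub>R h x) = h x" if "x \<notin> \<Union>\<F> \<longrightarrow> h x = 0" for x
  proof (cases "x \<in> \<Union>\<F>")
    case True
    then obtain R where R: "R \<in> \<F>" "x \<in> R" by auto
    have "(\<Sum>Q\<in>\<F>. indicator Q x *\<^sub>R h x) = (\<Sum>Q\<in>\<F>. if Q = R then h x else 0)"
    proof (rule sum.cong[OF refl])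
      fix Q assume "Q \<in> \<F>"
      then have "Q = R \<or> x \<notin> Q"
        using R FD(3) unfolding disjoint_def by blast
      then show "indicator Q x *\<^sub>R h x = (if Q = R then h x else 0)"
        using R by auto
    qed
    then show ?thesis
      using R FD(4) by simp
  next
    case False
    then show ?thesis using that by (simp add: sum.neutral)
  qed
  have "(CINT x. h x) = (CINT x. (\<Sum>Q\<in>\<F>. indicator Q x *\<^sub>R h x))"
  proof (rule integral_cong_AE)
    show "AE x in cube_measure. h x = (\<Sum>Q\<in>\<F>. indicator Q x *\<^sub>R h x)"
      using AE by eventually_elim (use one in simp)
  qed (use h ind in auto)
  also have "\<dots> = (\<Sum>Q\<in>\<F>. CINT x. indicator Q x *\<^sub>R h x)"
    using ind by (rule Bochner_Integration.integral_sum)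
  also have "\<dots> = (\<Sum>Q\<in>\<F>. LINT x:Q|lebesgue. h x)"
    by (intro sum.cong refl cube_measure_cases(1)[symmetric] QD(1) FD(2)) auto
  finally show ?thesis .
qed

context
  fixes \<F> :: "(real^'n) set set" and r :: real
  assumes F: "\<F> \<in> cube_families r" and eps: "0 < r"
begin

lemma osc_sum_lincomb:
  assumes f: "f \<in> L1_space" and g: "g \<in> L1_space"
  shows "osc_sum r \<F> (\<lambda>x. a * f x + b * g x) \<le> cmod a * osc_sum r \<F> f + cmod b * osc_sum r \<F> g"
proof -
  have "(\<Sum>Q\<in>\<F>. cube_osc Q (\<lambda>x. a * f x + b * g x)) \<le> (\<Sum>Q\<in>\<F>. cmod a * cube_osc Q f + cmod b * cube_osc Q g)"
    by (intro sum_mono cube_osc_lincomb[OF cube_familiesD(1,2)[OF F] eps f g])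
  also have "\<dots> = cmod a * (\<Sum>Q\<in>\<F>. cube_osc Q f) + cmod b * (\<Sum>Q\<in>\<F>. cube_osc Q g)"
    by (simp add: sum.distrib sum_distrib_left)
  finally have "r ^ (CARD('n) - 1) * (\<Sum>Q\<in>\<F>. cube_osc Q (\<lambda>x. a * f x + b * g x)) \<le>
      r ^ (CARD('n) - 1) * (cmod a * (\<Sum>Q\<in>\<F>. cube_osc Q f) + cmod b * (\<Sum>Q\<in>\<F>. cube_osc Q g))"
    using eps by (intro mult_left_mono) auto
  then show ?thesis
    unfolding osc_sum_def by (simp add: algebra_simps)
qed

text \<open>The weight r^(d-1) exactly cancels the largest admissible number r^(1-d) of
  cubes.\<close>

lemma osc_sum_le_sup:
  assumes "\<And>Q. Q \<in> \<F> \<Longrightarrow> cube_osc Q f \<le> K" "0 \<le> K"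
  shows "osc_sum r \<F> f \<le> K"
proof -
  have "(\<Sum>Q\<in>\<F>. cube_osc Q f) \<le> real (card \<F>) * K"
    using assms(1) by (rule sum_bounded_above)
  then have "osc_sum r \<F> f \<le> r ^ (CARD('n) - 1) * (real (card \<F>) * K)"
    unfolding osc_sum_def using eps by (intro mult_left_mono) auto
  also have "\<dots> \<le> r ^ (CARD('n) - 1) * (r powr (1 - real CARD('n)) * K)"
    using cube_familiesD(5)[OF F] eps assms(2) by (intro mult_left_mono mult_right_mono) auto
  also have "r ^ (CARD('n) - 1) = r powr (real CARD('n) - 1)"
    using eps by (simp add: powr_realpow[symmetric] of_nat_diff Suc_le_eq)
  also have "r powr (real CARD('n) - 1) * (r powr (1 - real CARD('n)) * K) = K"
    using eps by (simp add: mult.assoc[symmetric] powr_add[symmetric])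
  finally show ?thesis .
qed

text \<open>The weight r^(d-1) against the volume r^d of a cube leaves 1/r. Hence each fixed scale
  is continuous for L^1, which is why approximations may be carried out in L^1 as long as the scale
  stays fixed.\<close>

lemma osc_sum_le_L1:
  assumes f: "f \<in> L1_space"
  shows "osc_sum r \<F> f \<le> 2 / r * (CINT x. cmod (f x))"
proof -
  note FD = cube_familiesD[OF F]
  have fi: "integrable cube_measure (\<lambda>x. cmod (f x))"
    using f by (simp add: L1_space_def)
  have U: "\<Union>\<F> \<in> sets cube_measure"
    using FD eps_cubeD(1)[OF FD(1) eps] by (auto simp: sets_restrict_space_iff)
  have "(\<Sum>Q\<in>\<F>. LINT x:Q|lebesgue. cmod (f x)) = (\<Sum>Q\<in>\<F>. LINT x:Q|lebesgue. indicator (\<Union>\<F>) x * cmod (f x))"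
    by (intro sum.cong refl set_lebesgue_integral_cong) (use eps_cubeD(1)[OF FD(1) eps] in \<open>auto simp: indicator_def\<close>)
  also have "\<dots> = (CINT x. indicator (\<Union>\<F>) x * cmod (f x))"
    using integrable_mult_indicator[OF U fi] by (intro integral_eq_sum_cubes[symmetric, OF F eps]) auto
  also have "\<dots> \<le> (CINT x. cmod (f x))"
    using integrable_mult_indicator[OF U fi] by (intro integral_mono fi) (auto simp: indicator_def)
  finally have S: "(\<Sum>Q\<in>\<F>. LINT x:Q|lebesgue. cmod (f x)) \<le> (CINT x. cmod (f x))" .
  have "(\<Sum>Q\<in>\<F>. cube_osc Q f) \<le> (\<Sum>Q\<in>\<F>. 2 / r ^ CARD('n) * (LINT x:Q|lebesgue. cmod (f x)))"
    using cube_osc_le[OF FD(1,2) eps f, of _ 0] eps_cubeD(2)[OF FD(1) eps] by (intro sum_mono) simp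
  also have "\<dots> = 2 / r ^ CARD('n) * (\<Sum>Q\<in>\<F>. LINT x:Q|lebesgue. cmod (f x))"
    by (simp add: sum_distrib_left)
  also have "\<dots> \<le> 2 / r ^ CARD('n) * (CINT x. cmod (f x))"
    using S eps by (intro mult_left_mono) auto
  finally have "osc_sum r \<F> f \<le> r ^ (CARD('n) - 1) * (2 / r ^ CARD('n) * (CINT x. cmod (f x)))"
    unfolding osc_sum_def using eps by (intro mult_left_mono) auto
  also have "\<dots> = 2 / r * (CINT x. cmod (f x))"
    using eps by (simp add: power_card[where 'n='n])
  finally show ?thesis .
qed

end

subsection \<open>Atoms\<close>

lemma L1_mult_bounded:
  assumes f: "f \<in> L1_space" and g: "g \<in> borel_measurable cube_measure" "AE x in cube_measure. cmod (g x) \<le> K"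
  shows "integrable cube_measure (\<lambda>x. f x * g x)"
proof (rule Bochner_Integration.integrable_bound)
  have fi: "integrable cube_measure f"
    using f by (simp add: L1_space_def)
  then show "integrable cube_measure (\<lambda>x. K * cmod (f x))"
    by auto
  show "(\<lambda>x. f x * g x) \<in> borel_measurable cube_measure"
    using g(1) fi by measurable
  show "AE x in cube_measure. norm (f x * g x) \<le> norm (K * cmod (f x))"
    using g(2)
  proof eventually_elim
    fix x assume "cmod (g x) \<le> K"
    then have "cmod (f x) * cmod (g x) \<le> cmod (f x) * \<bar>K\<bar>"
      by (intro mult_left_mono) auto
    then show "norm (f x * g x) \<le> norm (K * cmod (f x))"
      by (simp add: norm_mult abs_mult mult.commute)
  qed
qed

lemma atom_bounded:
  fixes g :: "'n::finite cfun"
  assumes "atom g"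
  shows "g \<in> borel_measurable cube_measure" "\<exists>K. AE x in cube_measure. cmod (g x) \<le> K"
proof -
  obtain r \<F> where e: "0 < r" "r \<le> 1" and F: "\<F> \<in> cube_families r"
    and g: "g \<in> borel_measurable cube_measure" "AE x in cube_measure. x \<notin> \<Union>\<F> \<longrightarrow> g x = 0"
      "\<And>Q x. Q \<in> \<F> \<Longrightarrow> x \<in> Q \<Longrightarrow> cmod (g x) \<le> r ^ (CARD('n) - 1) / measure lebesgue Q"
    using assms unfolding atom_def by blast
  show "g \<in> borel_measurable cube_measure" by (rule g)
  have "AE x in cube_measure. cmod (g x) \<le> r ^ (CARD('n) - 1) / r ^ CARD('n)"
    using g(2)
  proof eventually_elim
    fix x assume x: "x \<notin> \<Union>\<F> \<longrightarrow> g x = 0"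
    show "cmod (g x) \<le> r ^ (CARD('n) - 1) / r ^ CARD('n)"
    proof (cases "x \<in> \<Union>\<F>")
      case True
      then obtain Q where "Q \<in> \<F>" "x \<in> Q" by auto
      then show ?thesis
        using g(3)[of Q x] eps_cubeD(2)[OF cube_familiesD(1)[OF F] e(1), of Q] by simp
    next
      case False
      then show ?thesis using x e by simp
    qed
  qed
  then show "\<exists>K. AE x in cube_measure. cmod (g x) \<le> K" by blast
qed

text \<open>Mean zero on each cube allows f to be replaced by f - f_Q there, and the size condition
  on an atom is precisely the weight of \<open>cube_osc\<close> in \<open>osc_sum\<close>.\<close>

lemma atom_pairing:
  fixes g :: "'n::finite cfun"
  assumes "atom g"
  obtains r \<F> where "0 < r" "r \<le> 1" "\<F> \<in> cube_families r"
    "\<And>f. f \<in> L1_space \<Longrightarrow> cmod (CINT x. f x * g x) \<le> osc_sum r \<F> f"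
proof -
  obtain r \<F> where e: "0 < r" "r \<le> 1" and F: "\<F> \<in> cube_families r"
    and g: "g \<in> borel_measurable cube_measure" "AE x in cube_measure. x \<notin> \<Union>\<F> \<longrightarrow> g x = 0"
      "\<And>Q x. Q \<in> \<F> \<Longrightarrow> x \<in> Q \<Longrightarrow> cmod (g x) \<le> r ^ (CARD('n) - 1) / measure lebesgue Q"
      "\<And>Q. Q \<in> \<F> \<Longrightarrow> (LINT x:Q|lebesgue. g x) = 0"
    using assms unfolding atom_def by blast
  obtain K where K: "AE x in cube_measure. cmod (g x) \<le> K"
    using atom_bounded(2)[OF assms] by blast
  note FD = cube_familiesD[OF F]
  note QD = eps_cubeD[OF FD(1) e(1)]
  show thesis
  proof (rule that[OF e F])
    fix f :: "'n cfun" assume f: "f \<in> L1_space"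
    have fg: "integrable cube_measure (\<lambda>x. (f x - c) * g x)" for c
      by (rule L1_mult_bounded[OF L1_diff_const[OF f] g(1) K])
    have g1: "integrable cube_measure g"
      using L1_mult_bounded[OF L1_const g(1) K, of 1] by simp
    have fg0: "integrable cube_measure (\<lambda>x. f x * g x)"
      using fg[of 0] by simp
    have cube: "cmod (LINT x:Q|lebesgue. f x * g x) \<le> r ^ (CARD('n) - 1) * cube_osc Q f" if Q: "Q \<in> \<F>" for Q
    proof -
      let ?m = "average Q f"
      note si = set_integrable_cube[OF QD(1)[OF Q] FD(2)[OF Q]]
      have "(LINT x:Q|lebesgue. f x * g x) = (LINT x:Q|lebesgue. (f x - ?m) * g x) + ?m * (LINT x:Q|lebesgue. g x)"
        using si[OF fg, of ?m] si[OF g1]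
        by (subst set_integral_mult_right[symmetric], subst set_integral_add(2)[symmetric])
          (auto simp: algebra_simps)
      also have "\<dots> = (LINT x:Q|lebesgue. (f x - ?m) * g x)"
        using g(4)[OF Q] by simp
      also have "cmod \<dots> \<le> (LINT x:Q|lebesgue. cmod ((f x - ?m) * g x))"
        by (rule set_integral_norm_bound[OF si[OF fg]])
      also have "\<dots> \<le> (LINT x:Q|lebesgue. r ^ (CARD('n) - 1) / measure lebesgue Q * cmod (f x - ?m))"
      proof (rule set_integral_mono)
        show "set_integrable lebesgue Q (\<lambda>x. cmod ((f x - ?m) * g x))"
          by (rule set_integrable_norm[OF si[OF fg]])
        show "set_integrable lebesgue Q (\<lambda>x. r ^ (CARD('n) - 1) / measure lebesgue Q * cmod (f x - ?m))"
          by (intro set_integrable_mult_right cube_set_integrable_dist[OF FD(1)[OF Q] FD(2)[OF Q] e(1) f])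
        show "cmod ((f x - ?m) * g x) \<le> r ^ (CARD('n) - 1) / measure lebesgue Q * cmod (f x - ?m)" if "x \<in> Q" for x
          using mult_left_mono[OF g(3)[OF Q that], of "cmod (f x - ?m)"] by (simp add: norm_mult mult.commute)
      qed
      also have "\<dots> = r ^ (CARD('n) - 1) * cube_osc Q f"
        by (simp add: cube_osc_def)
      finally show ?thesis .
    qed
    have "(CINT x. f x * g x) = (\<Sum>Q\<in>\<F>. LINT x:Q|lebesgue. f x * g x)"
      using g(2) by (intro integral_eq_sum_cubes[OF F e(1) fg0]) (auto elim!: eventually_mono)
    also have "cmod \<dots> \<le> (\<Sum>Q\<in>\<F>. r ^ (CARD('n) - 1) * cube_osc Q f)"
      using cube by (rule sum_norm_le)
    also have "\<dots> = osc_sum r \<F> f"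
      by (simp add: osc_sum_def sum_distrib_left)
    finally show "cmod (CINT x. f x * g x) \<le> osc_sum r \<F> f" .
  qed
qed

text \<open>
  The factor \<open>2\<close> appears because \<open>f - f\<^sub>Q\<close> is tested against functions \<open>h\<close> with \<open>\<bar>h\<bar> \<le> 1\<close>
  that need not have mean zero; \<open>h - h\<^sub>Q\<close> is only bounded by \<open>2\<close>.
\<close>

lemma norming_atom:
  fixes f :: "'n::finite cfun"
  assumes e: "0 < r" "r \<le> 1" and F: "\<F> \<in> cube_families r" and f: "f \<in> L1_space"
  obtains g where "atom g" "2 * (CINT x. f x * g x) = of_real (osc_sum r \<F> f)"
    "\<And>k. k \<in> L1_space \<Longrightarrow> cmod (2 * (CINT x. k x * g x)) \<le> osc_sum r \<F> k"
proof -
  note FD = cube_familiesD[OF F]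
  note QD = eps_cubeD[OF FD(1) e(1)]
  define w where "w = r ^ (CARD('n) - 1) / r ^ CARD('n)"
  have w: "w = r ^ (CARD('n) - 1) / measure lebesgue Q" if "Q \<in> \<F>" for Q
    using QD(2)[OF that] by (simp add: w_def)
  have w0: "0 \<le> w" using e by (simp add: w_def)
  have fm: "f \<in> borel_measurable cube_measure"
    using f by (simp add: L1_space_def)
  \<comment> \<open>The conjugate sign of f - f_Q, so that its product with f - f_Q is |f - f_Q|.
    Removing its mean makes it admissible in an atom; the division by 2 below restores the size
    bound.\<close>
  define h where "h Q x = cnj (sgn (f x - average Q f))" for Q x
  have hm: "h Q \<in> borel_measurable cube_measure" for Q
    unfolding h_def by (rule measurable_compose[OF _ borel_measurable_cnj_sgn]) (use fm in measurable)
  have h1: "cmod (h Q x) \<le> 1" for Q x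
    by (simp add: h_def norm_sgn)
  define g where "g x = (\<Sum>Q\<in>\<F>. indicator Q x *\<^sub>R (of_real (w / 2) * (h Q x - average Q (h Q))))" for x
  have sets: "Q \<in> sets cube_measure" if "Q \<in> \<F>" for Q
    using FD(2)[OF that] QD(1)[OF that] by (auto simp: sets_restrict_space_iff)
  have gm: "g \<in> borel_measurable cube_measure"
    unfolding g_def
  proof (rule borel_measurable_sum)
    fix Q assume "Q \<in> \<F>"
    note [measurable] = sets[OF this] hm[of Q]
    show "(\<lambda>x. indicator Q x *\<^sub>R (of_real (w / 2) * (h Q x - average Q (h Q)))) \<in> borel_measurable cube_measure"
      by measurable
  qed
  have gQ: "g x = of_real (w / 2) * (h Q x - average Q (h Q))" if "Q \<in> \<F>" "x \<in> Q" for Q x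
  proof -
    have "g x = (\<Sum>R\<in>\<F>. if R = Q then of_real (w / 2) * (h Q x - average Q (h Q)) else 0)"
      unfolding g_def
    proof (rule sum.cong[OF refl])
      fix R assume "R \<in> \<F>"
      then have "R = Q \<or> x \<notin> R"
        using that FD(3) unfolding disjoint_def by blast
      then show "indicator R x *\<^sub>R (of_real (w / 2) * (h R x - average R (h R))) =
          (if R = Q then of_real (w / 2) * (h Q x - average Q (h Q)) else 0)"
        using that by auto
    qed
    then show ?thesis using that FD(4) by simp
  qed
  have g0: "g x = 0" if "x \<notin> \<Union>\<F>" for x
    using that by (auto simp: g_def intro!: sum.neutral)
  have hL1: "h Q \<in> L1_space" for Q
    using integrable_bounded_cube[OF hm h1] by (simp add: L1_space_def)
  have avg1: "cmod (average Q (h Q)) \<le> 1" if Q: "Q \<in> \<F>" for Q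
  proof -
    note c = FD(1)[OF Q] FD(2)[OF Q] e(1)
    have "cmod (average Q (h Q) - 0) \<le> 1 / measure lebesgue Q * (LINT x:Q|lebesgue. cmod (h Q x - 0))"
      by (rule average_dist_le[OF c hL1])
    also have "(LINT x:Q|lebesgue. cmod (h Q x - 0)) \<le> (LINT x:Q|lebesgue. 1)"
      using h1 by (intro set_integral_mono cube_set_integrable_dist[OF c] hL1 cube_set_integrable_const[OF c]) auto
    also have "\<dots> = measure lebesgue Q"
      using set_integral_const_cube[OF c(1,3), of "1 :: real"] by simp
    finally show ?thesis
      using cube_measure_pos[OF c] by (simp add: divide_right_mono mult_left_mono)
  qed
  have gbd: "cmod (g x) \<le> w" if "Q \<in> \<F>" "x \<in> Q" for Q x
  proof -
    have "cmod (h Q x - average Q (h Q)) \<le> 2"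
      using norm_triangle_ineq4[of "h Q x" "average Q (h Q)"] h1[of Q x] avg1[OF that(1)] by simp
    then have "w / 2 * cmod (h Q x - average Q (h Q)) \<le> w / 2 * 2"
      using w0 by (intro mult_left_mono) auto
    then show ?thesis
      using w0 by (simp add: gQ[OF that] norm_mult)
  qed
  have gK: "AE x in cube_measure. cmod (g x) \<le> w"
    using gbd g0 w0 by (intro AE_I2) (metis UnionE norm_zero)
  have gL1: "integrable cube_measure g"
    using L1_mult_bounded[OF L1_const gm gK, of 1] by simp
  \<comment> \<open>Removal of the mean is self-adjoint on a cube: pairing k with h - h_Q equals
    pairing k - k_Q with h. The factor 2 on the left compensates the division by 2 in
    \<open>g\<close>.\<close>
  have pair: "2 * (CINT x. k x * g x) = (\<Sum>Q\<in>\<F>. of_real w * (LINT x:Q|lebesgue. (k x - average Q k) * h Q x))"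
    if k: "k \<in> L1_space" for k
  proof -
    have kg: "integrable cube_measure (\<lambda>x. k x * g x)"
      by (rule L1_mult_bounded[OF k gm gK])
    have cube: "2 * (LINT x:Q|lebesgue. k x * g x) = of_real w * (LINT x:Q|lebesgue. (k x - average Q k) * h Q x)" if Q: "Q \<in> \<F>" for Q
    proof -
      note c = FD(1)[OF Q] FD(2)[OF Q] e(1)
      note si = set_integrable_cube[OF QD(1)[OF Q] FD(2)[OF Q]]
      have kh: "set_integrable lebesgue Q (\<lambda>x. k x * h Q x)"
        using h1 by (intro si L1_mult_bounded[OF k hm, of _ 1] AE_I2)
      have hQ: "set_integrable lebesgue Q (h Q)" and kQ: "set_integrable lebesgue Q k"
        using cube_set_integrable[OF c] hL1 k by auto
      have "2 * (LINT x:Q|lebesgue. k x * g x) = 2 * (LINT x:Q|lebesgue. of_real (w / 2) * (k x * h Q x - average Q (h Q) * k x))"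
        by (intro arg_cong[where f="\<lambda>t. 2 * t"] set_lebesgue_integral_cong QD(1)[OF Q]) (auto simp: gQ[OF Q] algebra_simps)
      also have "\<dots> = of_real w * (LINT x:Q|lebesgue. k x * h Q x - average Q (h Q) * k x)"
        by simp
      also have "(LINT x:Q|lebesgue. k x * h Q x - average Q (h Q) * k x) = (LINT x:Q|lebesgue. k x * h Q x) - average Q (h Q) * (LINT x:Q|lebesgue. k x)"
        using kh kQ by (subst set_integral_diff) auto
      also have "average Q (h Q) * (LINT x:Q|lebesgue. k x) = average Q k * (LINT x:Q|lebesgue. h Q x)"
        by (simp add: set_integral_eq_average[OF c])
      also have "(LINT x:Q|lebesgue. k x * h Q x) - average Q k * (LINT x:Q|lebesgue. h Q x) = (LINT x:Q|lebesgue. k x * h Q x - average Q k * h Q x)"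
        using kh hQ by (subst set_integral_diff) auto
      finally show ?thesis
        by (simp add: left_diff_distrib)
    qed
    have "2 * (CINT x. k x * g x) = (\<Sum>Q\<in>\<F>. 2 * (LINT x:Q|lebesgue. k x * g x))"
      unfolding sum_distrib_left[symmetric] using g0
      by (intro arg_cong[where f="\<lambda>t. 2 * t"] integral_eq_sum_cubes[OF F e(1) kg]) auto
    also have "\<dots> = (\<Sum>Q\<in>\<F>. of_real w * (LINT x:Q|lebesgue. (k x - average Q k) * h Q x))"
      using cube by (intro sum.cong) auto
    finally show ?thesis .
  qed
  have w_osc: "(\<Sum>Q\<in>\<F>. w * (LINT x:Q|lebesgue. cmod (k x - average Q k))) = osc_sum r \<F> k" for k
    unfolding osc_sum_def cube_osc_def sum_distrib_left by (intro sum.cong refl) (simp add: w)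
  show thesis
  proof
    show "atom g"
      unfolding atom_def
    proof (intro conjI gm exI[of _ r] e bexI[OF _ F] ballI)
      show "AE x in cube_measure. x \<notin> \<Union>\<F> \<longrightarrow> g x = 0"
        using g0 by simp
      fix Q assume Q: "Q \<in> \<F>"
      note c = FD(1)[OF Q] FD(2)[OF Q] e(1)
      show "cmod (g x) \<le> r ^ (CARD('n) - 1) / measure lebesgue Q" if "x \<in> Q" for x
        using gbd[OF Q that] w[OF Q] by simp
      have "(LINT x:Q|lebesgue. g x) = (LINT x:Q|lebesgue. of_real (w / 2) * (h Q x - average Q (h Q)))"
        by (intro set_lebesgue_integral_cong QD(1)[OF Q]) (auto simp: gQ[OF Q])
      also have "\<dots> = of_real (w / 2) * (measure lebesgue Q * (average Q (\<lambda>x. h Q x - average Q (h Q))))"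
        by (simp add: set_integral_eq_average[OF c, symmetric])
      also have "average Q (\<lambda>x. h Q x - average Q (h Q)) = 0"
        by (simp add: average_diff_const[OF c hL1])
      finally show "(LINT x:Q|lebesgue. g x) = 0" by simp
    qed
    have ff: "(f x - average Q f) * h Q x = of_real (cmod (f x - average Q f))" for Q x
      using complex_norm_square[of "f x - average Q f"]
      by (cases "f x - average Q f = 0") (auto simp: h_def sgn_div_norm scaleR_conv_of_real power2_eq_square field_simps)
    show "2 * (CINT x. f x * g x) = of_real (osc_sum r \<F> f)"
      unfolding pair[OF f] ff w_osc[symmetric]
      by (simp add: set_lebesgue_integral_def scaleR_conv_of_real of_real_mult[symmetric] del: of_real_mult)
    fix k :: "'n cfun" assume k: "k \<in> L1_space"
    show "cmod (2 * (CINT x. k x * g x)) \<le> osc_sum r \<F> k"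
      unfolding pair[OF k] w_osc[symmetric]
    proof (rule sum_norm_le)
      fix Q assume Q: "Q \<in> \<F>"
      note c = FD(1)[OF Q] FD(2)[OF Q] e(1)
      have km: "(\<lambda>x. k x - average Q k) \<in> L1_space"
        by (rule L1_diff_const[OF k])
      have si: "set_integrable lebesgue Q (\<lambda>x. (k x - average Q k) * h Q x)"
        using h1 by (intro set_integrable_cube[OF QD(1)[OF Q] FD(2)[OF Q]] L1_mult_bounded[OF km hm, of _ 1] AE_I2)
      have "cmod (LINT x:Q|lebesgue. (k x - average Q k) * h Q x) \<le> (LINT x:Q|lebesgue. cmod ((k x - average Q k) * h Q x))"
        by (rule set_integral_norm_bound[OF si])
      also have "\<dots> \<le> (LINT x:Q|lebesgue. cmod (k x - average Q k))"
        using h1 by (intro set_integral_mono set_integrable_norm si cube_set_integrable_dist[OF c k])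
          (auto simp: norm_mult mult_left_le)
      finally show "cmod (of_real w * (LINT x:Q|lebesgue. (k x - average Q k) * h Q x)) \<le> w * (LINT x:Q|lebesgue. cmod (k x - average Q k))"
        using w0 by (simp add: norm_mult mult_left_mono)
    qed
  qed
qed

subsection \<open>The seminorms \<open>[f]\<^sub>\<epsilon>\<close> and the spaces \<open>B\<close> and \<open>B\<^sub>0\<close>\<close>

text \<open>No information is lost by passing to real values: on L^1 each positive scale gives a
  finite value, see \<open>ennreal_rosc\<close>. Only the supremum over all scales may be
  infinite.\<close>

definition rosc :: "real \<Rightarrow> 'n::finite cfun \<Rightarrow> real" where
  "rosc r f = enn2real (osc r f)"

lemma empty_cube_family: "{} \<in> cube_families r"
  unfolding cube_families_def by (auto simp: disjoint_def)

lemma osc_le_L1: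
  assumes "0 < r" "f \<in> L1_space"
  shows "osc r f \<le> ennreal (2 / r * (CINT x. cmod (f x)))"
  unfolding osc_eq by (intro SUP_least ennreal_leI osc_sum_le_L1 assms)

lemma ennreal_rosc:
  assumes "0 < r" "f \<in> L1_space"
  shows "ennreal (rosc r f) = osc r f"
proof -
  have "osc r f < \<infinity>"
    using osc_le_L1[OF assms] by (rule le_less_trans) simp
  then show ?thesis by (simp add: rosc_def less_top)
qed

lemma rosc_nonneg: "0 \<le> rosc r f"
  by (simp add: rosc_def)

lemma osc_sum_le_rosc:
  assumes "0 < r" "f \<in> L1_space" "\<F> \<in> cube_families r"
  shows "osc_sum r \<F> f \<le> rosc r f"
proof -
  have "ennreal (osc_sum r \<F> f) \<le> ennreal (rosc r f)"
    unfolding ennreal_rosc[OF assms(1,2)] osc_eq using assms(3) by (intro SUP_upper)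
  then show ?thesis by (simp add: ennreal_le_iff rosc_nonneg)
qed

lemma rosc_le:
  assumes "0 < r" "f \<in> L1_space" "\<And>\<F>. \<F> \<in> cube_families r \<Longrightarrow> osc_sum r \<F> f \<le> K"
  shows "rosc r f \<le> K"
proof -
  have K: "0 \<le> K"
    using assms(3)[OF empty_cube_family] by (simp add: osc_sum_def)
  have "ennreal (rosc r f) \<le> ennreal K"
    unfolding ennreal_rosc[OF assms(1,2)] osc_eq using assms(3) by (intro SUP_least ennreal_leI)
  then show ?thesis using K by (simp add: ennreal_le_iff)
qed

lemma rosc_le_L1:
  assumes "0 < r" "f \<in> L1_space"
  shows "rosc r f \<le> 2 / r * (CINT x. cmod (f x))"
  by (intro rosc_le osc_sum_le_L1 assms)

lemma cseminorm_rosc: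
  assumes "0 < r"
  shows "cseminorm_on L1_space (rosc r)"
proof (rule cseminorm_onI)
  fix f g :: "'n::finite cfun" and a b assume fg: "f \<in> L1_space" "g \<in> L1_space"
  then show "(\<lambda>x. a * f x + b * g x) \<in> L1_space" by (rule L1_lincomb)
  show "rosc r (\<lambda>x. a * f x + b * g x) \<le> cmod a * rosc r f + cmod b * rosc r g"
  proof (rule rosc_le[OF assms L1_lincomb[OF fg]])
    fix \<F> :: "(real^'n) set set" assume F: "\<F> \<in> cube_families r"
    have "osc_sum r \<F> (\<lambda>x. a * f x + b * g x) \<le> cmod a * osc_sum r \<F> f + cmod b * osc_sum r \<F> g"
      by (rule osc_sum_lincomb[OF F assms fg])
    also have "\<dots> \<le> cmod a * rosc r f + cmod b * rosc r g"
      using fg F assms by (intro add_mono mult_left_mono osc_sum_le_rosc) auto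
    finally show "osc_sum r \<F> (\<lambda>x. a * f x + b * g x) \<le> cmod a * rosc r f + cmod b * rosc r g" .
  qed
qed (auto intro: rosc_nonneg L1_const)

lemma rosc_zero: "0 < r \<Longrightarrow> rosc r (\<lambda>x. 0) = 0"
  by (rule cseminorm_zero[OF cseminorm_rosc])

lemma B_spaceD:
  assumes "f \<in> B_space"
  shows "f \<in> L1_space" "ennreal (B_norm f) = B_enorm f"
  using assms by (auto simp: B_space_def B_norm_def less_top)

lemma B_norm_nonneg: "0 \<le> B_norm f"
  by (simp add: B_norm_def)

lemma rosc_le_B_norm:
  assumes "f \<in> B_space" "0 < r" "r \<le> 1"
  shows "rosc r f \<le> B_norm f"
proof -
  have "osc r f \<le> B_enorm f"
    unfolding B_enorm_def using assms by (intro SUP_upper) auto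
  then have "ennreal (rosc r f) \<le> ennreal (B_norm f)"
    using assms B_spaceD[OF assms(1)] ennreal_rosc[of r f] by simp
  then show ?thesis by (simp add: ennreal_le_iff B_norm_nonneg)
qed

lemma osc_sum_le_B_norm:
  assumes "f \<in> B_space" "0 < r" "r \<le> 1" "\<F> \<in> cube_families r"
  shows "osc_sum r \<F> f \<le> B_norm f"
  using osc_sum_le_rosc[of r f \<F>] rosc_le_B_norm[of f r] assms B_spaceD(1)[of f] by auto

lemma B_enorm_le:
  assumes "f \<in> L1_space" "\<And>r. 0 < r \<Longrightarrow> r \<le> 1 \<Longrightarrow> rosc r f \<le> K"
  shows "B_enorm f \<le> ennreal K"
  unfolding B_enorm_def using assms by (intro SUP_least) (auto simp: ennreal_rosc[symmetric] intro!: ennreal_leI)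

lemma B_spaceI:
  assumes "f \<in> L1_space" "\<And>r. 0 < r \<Longrightarrow> r \<le> 1 \<Longrightarrow> rosc r f \<le> K"
  shows "f \<in> B_space" "B_norm f \<le> K"
proof -
  have K: "0 \<le> K"
    using assms(2)[of 1] rosc_nonneg[of 1 f] by simp
  note le = B_enorm_le[OF assms]
  have "B_enorm f < \<infinity>"
    using le ennreal_less_top[of K] by (metis infinity_ennreal_def le_less_trans)
  then show "f \<in> B_space"
    using assms(1) by (simp add: B_space_def)
  show "B_norm f \<le> K"
    unfolding B_norm_def using le K by (metis enn2real_ennreal enn2real_mono ennreal_less_top)
qed

lemma B_spaceI_osc_sum:
  assumes "f \<in> L1_space"
    "\<And>r \<F>. 0 < r \<Longrightarrow> r \<le> 1 \<Longrightarrow> \<F> \<in> cube_families r \<Longrightarrow> osc_sum r \<F> f \<le> K"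
  shows "f \<in> B_space" "B_norm f \<le> K"
  by (rule B_spaceI[OF assms(1)], rule rosc_le, auto intro: assms)+

lemma cseminorm_B: "cseminorm_on (B_space :: 'n::finite cfun set) B_norm"
proof -
  have *: "rosc r (\<lambda>x. a * f x + b * g x) \<le> cmod a * B_norm f + cmod b * B_norm g"
    if "f \<in> B_space" "g \<in> B_space" "0 < r" "r \<le> 1" for f g :: "'n cfun" and a b r
  proof -
    have "rosc r (\<lambda>x. a * f x + b * g x) \<le> cmod a * rosc r f + cmod b * rosc r g"
      using that by (intro cseminorm_lincomb[OF cseminorm_rosc] B_spaceD)
    also have "\<dots> \<le> cmod a * B_norm f + cmod b * B_norm g"
      using that by (intro add_mono mult_left_mono rosc_le_B_norm) auto
    finally show ?thesis .
  qed
  show ?thesis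
  proof (rule cseminorm_onI)
    show "(\<lambda>x :: real^'n. 0) \<in> B_space"
      by (intro B_spaceI(1)[where K=0] L1_const) (simp add: rosc_zero)
    fix f g :: "'n cfun" and a b assume fg: "f \<in> B_space" "g \<in> B_space"
    note B_spaceI[OF L1_lincomb[OF B_spaceD(1)[OF fg(1)] B_spaceD(1)[OF fg(2)]] *[OF fg]]
    then show "(\<lambda>x. a * f x + b * g x) \<in> B_space"
      "B_norm (\<lambda>x. a * f x + b * g x) \<le> cmod a * B_norm f + cmod b * B_norm g" by blast+
  qed (rule B_norm_nonneg)
qed

lemma limsup_osc_less:
  assumes f: "f \<in> L1_space" and "limsup_osc f < ennreal K"
  obtains e where "0 < e" "e \<le> 1" "\<And>r. 0 < r \<Longrightarrow> r \<le> e \<Longrightarrow> rosc r f \<le> K"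
proof -
  have "\<forall>\<^sub>F r in at_right 0. osc r f < ennreal K"
    using assms(2) unfolding limsup_osc_def by (rule Limsup_lessD)
  then obtain e where e: "0 < e" "\<And>r. 0 < r \<Longrightarrow> r < e \<Longrightarrow> osc r f < ennreal K"
    unfolding eventually_at_right_field by auto
  \<comment> \<open>Halving turns the strict range of scales into a closed one, and the cap 1 keeps
    the scales inside the range of \<open>B_norm\<close>.\<close>
  show thesis
  proof (rule that[of "min (e / 2) 1"])
    fix r :: real assume "0 < r" "r \<le> min (e / 2) 1"
    then have "ennreal (rosc r f) < ennreal K"
      using e f by (simp add: ennreal_rosc)
    then show "rosc r f \<le> K"
      using ennreal_leI[of K "rosc r f"] by (meson linorder_not_le nle_le)
  qed (use e in auto)
qed

lemma limsup_osc_le: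
  assumes f: "f \<in> L1_space" and e: "0 < e" "\<And>r. 0 < r \<Longrightarrow> r \<le> e \<Longrightarrow> rosc r f \<le> K"
  shows "limsup_osc f \<le> ennreal K"
  unfolding limsup_osc_def
proof (rule Limsup_bounded)
  show "\<forall>\<^sub>F r in at_right 0. osc r f \<le> ennreal K"
    unfolding eventually_at_right_field
    using e f by (intro exI[of _ e]) (auto simp: ennreal_rosc[symmetric] intro!: ennreal_leI)
qed

lemma limsup_osc_le_B_enorm:
  assumes "f \<in> L1_space"
  shows "limsup_osc f \<le> B_enorm f"
  unfolding limsup_osc_def
proof (rule Limsup_bounded)
  have "osc r f \<le> B_enorm f" if "0 < r" "r < 1" for r
    unfolding B_enorm_def using that by (intro SUP_upper) auto
  then show "\<forall>\<^sub>F r in at_right 0. osc r f \<le> B_enorm f"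
    unfolding eventually_at_right_field by (intro exI[of _ 1]) auto
qed

lemma B0_spaceD:
  assumes "f \<in> B0_space"
  shows "f \<in> B_space" "limsup_osc f = 0"
  using assms by (auto simp: B0_space_def)

lemma B0_small_scales:
  assumes "f \<in> B0_space" "0 < \<eta>"
  obtains e where "0 < e" "e \<le> 1" "\<And>r. 0 < r \<Longrightarrow> r \<le> e \<Longrightarrow> rosc r f \<le> \<eta>"
  using limsup_osc_less[of f \<eta>] B0_spaceD[OF assms(1)] B_spaceD(1)[of f] assms(2) by auto

lemma B0_spaceI:
  assumes "f \<in> B_space" "\<And>\<eta>. 0 < \<eta> \<Longrightarrow> \<exists>e>0. \<forall>r. 0 < r \<longrightarrow> r \<le> e \<longrightarrow> rosc r f \<le> \<eta>"
  shows "f \<in> B0_space"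
proof -
  have "limsup_osc f \<le> ennreal \<eta>" if "0 < \<eta>" for \<eta>
    using assms(2)[OF that] limsup_osc_le[OF B_spaceD(1)[OF assms(1)]] by blast
  then have "limsup_osc f \<le> 0"
    using ennreal_le_epsilon[of 0 "limsup_osc f"] by simp
  then show ?thesis
    using assms(1) by (simp add: B0_space_def)
qed

lemma cseminorm_B0: "cseminorm_on (B0_space :: 'n::finite cfun set) B_norm"
proof (rule cseminorm_onI)
  show "(\<lambda>x :: real^'n. 0) \<in> B0_space"
    using cseminorm_zero_mem[OF cseminorm_B] by (intro B0_spaceI) (auto simp: rosc_zero intro: exI[of _ 1])
  fix f g :: "'n cfun" and a b assume fg: "f \<in> B0_space" "g \<in> B0_space"
  note fgB = B0_spaceD(1)[OF fg(1)] B0_spaceD(1)[OF fg(2)]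
  show "B_norm (\<lambda>x. a * f x + b * g x) \<le> cmod a * B_norm f + cmod b * B_norm g"
    by (rule cseminorm_lincomb[OF cseminorm_B fgB])
  show "(\<lambda>x. a * f x + b * g x) \<in> B0_space"
  proof (rule B0_spaceI)
    show "(\<lambda>x. a * f x + b * g x) \<in> B_space"
      by (rule cseminorm_lincomb_mem[OF cseminorm_B fgB])
    fix \<eta> :: real assume \<eta>: "0 < \<eta>"
    define s where "s = cmod a + cmod b + 1"
    have s: "0 < s" "cmod a + cmod b \<le> s"
      by (simp_all add: s_def add_nonneg_pos)
    obtain e1 where e1: "0 < e1" "\<And>r. 0 < r \<Longrightarrow> r \<le> e1 \<Longrightarrow> rosc r f \<le> \<eta> / s"
      using B0_small_scales[OF fg(1) divide_pos_pos[OF \<eta> s(1)]] by blast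
    obtain e2 where e2: "0 < e2" "\<And>r. 0 < r \<Longrightarrow> r \<le> e2 \<Longrightarrow> rosc r g \<le> \<eta> / s"
      using B0_small_scales[OF fg(2) divide_pos_pos[OF \<eta> s(1)]] by blast
    show "\<exists>e>0. \<forall>r. 0 < r \<longrightarrow> r \<le> e \<longrightarrow> rosc r (\<lambda>x. a * f x + b * g x) \<le> \<eta>"
    proof (intro exI[of _ "min e1 e2"] conjI allI impI)
      fix r :: real assume r: "0 < r" "r \<le> min e1 e2"
      have "rosc r (\<lambda>x. a * f x + b * g x) \<le> cmod a * rosc r f + cmod b * rosc r g"
        using fgB r by (intro cseminorm_lincomb[OF cseminorm_rosc] B_spaceD)
      also have "\<dots> \<le> cmod a * (\<eta> / s) + cmod b * (\<eta> / s)"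
        using e1 e2 r by (intro add_mono mult_left_mono) auto
      also have "\<dots> = (cmod a + cmod b) * (\<eta> / s)"
        by (rule distrib_right[symmetric])
      also have "\<dots> \<le> s * (\<eta> / s)"
        using s \<eta> by (intro mult_right_mono) auto
      finally show "rosc r (\<lambda>x. a * f x + b * g x) \<le> \<eta>"
        using s by simp
    qed (use e1 e2 in auto)
  qed
qed (rule B_norm_nonneg)

text \<open>At scale 1 the unit cube alone is an admissible family. This is how
  \<open>B_norm\<close> controls the function modulo constants and not merely its local
  oscillation.\<close>

lemma mean_deviation_le_B_norm:
  fixes f :: "'n::finite cfun"
  assumes f: "f \<in> B_space"
  shows "(CINT x. cmod (f x - (CINT y. f y))) \<le> B_norm f"
proof -
  have F: "{unit_cube} \<in> (cube_families 1 :: (real^'n) set set set)"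
    unfolding cube_families_def using eps_cube_unit_cube by auto
  have LINT: "(LINT x:unit_cube|lebesgue. h x) = (CINT x. h x)" for h :: "real^'n \<Rightarrow> 'b :: {banach, second_countable_topology}"
    by (simp add: set_lebesgue_integral_def integral_restrict_space)
  have "osc_sum 1 {unit_cube} f = (CINT x. cmod (f x - (CINT y. f y)))"
    using measure_unit_cube[where 'n='n] by (simp add: osc_sum_def cube_osc_def average_def LINT)
  then show ?thesis
    using osc_sum_le_B_norm[OF f _ _ F] by simp
qed

subsection \<open>Uniformly continuous functions\<close>

lemma UC_bounded:
  assumes "f \<in> UC_space"
  obtains K where "0 \<le> K" "\<And>x. x \<in> unit_cube \<Longrightarrow> cmod (f x) \<le> K"
proof -
  have "bounded (f ` unit_cube)"
    using assms by (intro bounded_uniformly_continuous_image) (auto simp: UC_space_def)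
  then show thesis
    using that unfolding bounded_pos by (metis imageI less_imp_le)
qed

lemma UC_L1:
  assumes "f \<in> UC_space"
  shows "f \<in> L1_space"
proof -
  obtain K where K: "\<And>x. x \<in> unit_cube \<Longrightarrow> cmod (f x) \<le> K"
    using UC_bounded[OF assms] by blast
  have "continuous_on unit_cube f"
    using assms by (auto simp: UC_space_def uniformly_continuous_imp_continuous)
  then have "f \<in> borel_measurable cube_measure"
    by (intro continuous_imp_measurable_on_sets_lebesgue) auto
  with K show ?thesis
    unfolding L1_space_def by (auto intro: integrable_bounded_cube)
qed

lemma dist_in_eps_cube:
  fixes x y :: "real^'n"
  assumes "eps_cube r Q" "x \<in> Q" "y \<in> Q"
  shows "dist x y \<le> real CARD('n) * r"
proof -
  obtain a where Q: "Q = box a (\<chi> i. a $ i + r)"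
    using assms(1) unfolding eps_cube_def by (elim exE)
  have "dist x y \<le> (\<Sum>i\<in>UNIV. \<bar>(x - y) $ i\<bar>)"
    unfolding dist_norm by (rule norm_le_l1_cart)
  also have "\<dots> \<le> (\<Sum>i\<in>(UNIV :: 'n set). r)"
  proof (rule sum_mono)
    fix i :: 'n
    have "a $ i < x $ i" "x $ i < a $ i + r" "a $ i < y $ i" "y $ i < a $ i + r"
      using assms(2,3) unfolding Q mem_box_cart by auto
    then show "\<bar>(x - y) $ i\<bar> \<le> r" by simp
  qed
  finally show ?thesis by simp
qed

lemma UC_B0:
  fixes f :: "'n::finite cfun"
  assumes f: "f \<in> UC_space"
  shows "f \<in> B0_space"
proof (rule B0_spaceI)
  note L1 = UC_L1[OF f]
  obtain K where K: "0 \<le> K" "\<And>x. x \<in> unit_cube \<Longrightarrow> cmod (f x) \<le> K"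
    using UC_bounded[OF f] by blast
  show "f \<in> B_space"
  proof (rule B_spaceI_osc_sum(1)[OF L1, where K="2 * K"])
    fix r and \<F> :: "(real^'n) set set" assume e: "0 < r" and F: "\<F> \<in> cube_families r"
    show "osc_sum r \<F> f \<le> 2 * K"
    proof (rule osc_sum_le_sup[OF F e])
      fix Q assume Q: "Q \<in> \<F>"
      show "cube_osc Q f \<le> 2 * K"
      proof (rule cube_osc_le_sup[OF cube_familiesD(1)[OF F Q] cube_familiesD(2)[OF F Q] e L1])
        fix x y assume "x \<in> Q" "y \<in> Q"
        then have "x \<in> unit_cube" "y \<in> unit_cube"
          using cube_familiesD(2)[OF F Q] by auto
        then show "cmod (f x - f y) \<le> 2 * K"
          using K(2)[of x] K(2)[of y] norm_triangle_ineq4[of "f x" "f y"] by simp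
      qed
    qed (use K in simp)
  qed
  fix \<eta> :: real assume \<eta>: "0 < \<eta>"
  have "uniformly_continuous_on unit_cube f"
    using f by (simp add: UC_space_def)
  then obtain d where d: "0 < d" "\<And>x y. x \<in> unit_cube \<Longrightarrow> y \<in> unit_cube \<Longrightarrow> dist y x < d \<Longrightarrow> dist (f y) (f x) < \<eta>"
    using \<eta> unfolding uniformly_continuous_on_def by blast
  show "\<exists>e>0. \<forall>r. 0 < r \<longrightarrow> r \<le> e \<longrightarrow> rosc r f \<le> \<eta>"
  proof (intro exI[of _ "d / (2 * real CARD('n))"] conjI allI impI)
    fix r :: real assume e: "0 < r" "r \<le> d / (2 * real CARD('n))"
    then have small: "real CARD('n) * r < d"
      using d(1) by (simp add: field_simps)
    show "rosc r f \<le> \<eta>"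
    proof (rule rosc_le[OF e(1) L1])
      fix \<F> :: "(real^'n) set set" assume F: "\<F> \<in> cube_families r"
      show "osc_sum r \<F> f \<le> \<eta>"
      proof (rule osc_sum_le_sup[OF F e(1)])
        fix Q assume Q: "Q \<in> \<F>"
        show "cube_osc Q f \<le> \<eta>"
        proof (rule cube_osc_le_sup[OF cube_familiesD(1)[OF F Q] cube_familiesD(2)[OF F Q] e(1) L1])
          fix x y assume xy: "x \<in> Q" "y \<in> Q"
          then have "x \<in> unit_cube" "y \<in> unit_cube"
            using cube_familiesD(2)[OF F Q] by auto
          then show "cmod (f x - f y) \<le> \<eta>"
            using d(2)[of y x] dist_in_eps_cube[OF cube_familiesD(1)[OF F Q] xy] small by (simp add: dist_norm)
        qed
      qed (use \<eta> in simp)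
    qed
  qed (use d in auto)
qed

lemma continuous_UC:
  assumes "continuous_on UNIV h"
  shows "h \<in> UC_space"
proof -
  have "uniformly_continuous_on (cbox 0 1) h"
    using assms by (intro compact_uniformly_continuous continuous_on_subset[OF assms]) auto
  then show ?thesis
    using box_subset_cbox[of 0 1] unfolding UC_space_def uniformly_continuous_on_def mem_Collect_eq by (meson subsetD)
qed

text \<open>Measurability in the sense of \<open>measurable_on\<close> provides continuous functions
  converging almost everywhere. Composed with a continuous truncation they are uniformly bounded, so
  dominated convergence applies; the truncation error of \<open>f\<close> itself is small for a high
  level.\<close>

lemma L1_continuous_dense:
  fixes f :: "'n::finite cfun"
  assumes f: "f \<in> L1_space" and e: "0 < e"
  obtains h where "continuous_on UNIV h" "(CINT x. cmod (f x - h x)) < e"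
proof -
  \<comment> \<open>Radial retraction onto the disc of radius k: it fixes the disc, is continuous
    for each k, and is 0 for k = 0.\<close>
  define tr where "tr k z = of_real (real k / max (real k) (cmod z)) * z" for k :: nat and z :: complex
  have fi: "integrable cube_measure f" and [measurable]: "f \<in> borel_measurable cube_measure"
    using f by (auto simp: L1_space_def)
  have tr_eq: "tr k z = z" if "cmod z \<le> real k" for k z
    using that by (cases "k = 0") (auto simp: tr_def max_def)
  have tr_le: "cmod (tr k z) \<le> cmod z" for k z
  proof -
    have "real k / max (real k) (cmod z) \<le> 1"
      by (cases "max (real k) (cmod z) = 0") (auto simp: divide_le_eq max_def)
    then show ?thesis
      using mult_right_mono[of "real k / max (real k) (cmod z)" 1 "cmod z"] by (simp add: tr_def norm_mult norm_divide)
  qed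
  have tr_k: "cmod (tr k z) \<le> real k" for k z
  proof (cases "cmod z \<le> real k")
    case True
    then show ?thesis by (simp add: tr_eq)
  next
    case False
    then show ?thesis by (auto simp: tr_def norm_mult norm_divide max_def)
  qed
  have tr_cont: "continuous_on UNIV (tr k)" for k
  proof (cases "k = 0")
    case True
    then show ?thesis by (simp add: tr_def[abs_def])
  next
    case False
    then have "max (real k) (cmod z) \<noteq> 0" for z by (metis max.cobounded1 not_le of_nat_0_less_iff gr0I)
    then show ?thesis
      unfolding tr_def[abs_def] by (intro continuous_intros) auto
  qed
  have [measurable]: "tr k \<in> borel_measurable borel" for k
    by (rule borel_measurable_continuous_onI[OF tr_cont])
  have "(\<lambda>k. \<integral>x. cmod (f x - tr k (f x)) \<partial>cube_measure) \<longlonglongrightarrow> (\<integral>x. 0 \<partial>(cube_measure :: (real^'n) measure))"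
  proof (rule integral_dominated_convergence)
    show "integrable cube_measure (\<lambda>x. 2 * cmod (f x))"
      using fi by auto
    show "AE x in cube_measure. (\<lambda>k. cmod (f x - tr k (f x))) \<longlonglongrightarrow> 0"
    proof (rule AE_I2)
      fix x
      have "\<forall>\<^sub>F k in sequentially. cmod (f x) \<le> real k"
        using filterlim_real_sequentially by (simp add: filterlim_at_top)
      then have "\<forall>\<^sub>F k in sequentially. cmod (f x - tr k (f x)) = 0"
        by eventually_elim (simp add: tr_eq)
      then show "(\<lambda>k. cmod (f x - tr k (f x))) \<longlonglongrightarrow> 0"
        by (rule tendsto_eventually)
    qed
    show "AE x in cube_measure. norm (cmod (f x - tr k (f x))) \<le> 2 * cmod (f x)" for k
      using norm_triangle_ineq4[of "f _" "tr k (f _)"] tr_le[of k "f _"] by (intro AE_I2) (smt (verit) real_norm_def norm_ge_zero)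
  qed measurable
  then have "(\<lambda>k. \<integral>x. cmod (f x - tr k (f x)) \<partial>cube_measure) \<longlonglongrightarrow> 0"
    by simp
  then obtain k where k: "(CINT x. cmod (f x - tr k (f x))) < e / 2"
    using order_tendstoD(2)[of _ 0 sequentially "e / 2"] e by (metis (no_types, lifting) eventually_sequentially half_gt_zero order_refl)
  have "f measurable_on unit_cube"
    by (subst measurable_on_iff_borel_measurable) (auto simp: \<open>f \<in> borel_measurable cube_measure\<close>)
  then obtain N g where N: "negligible N" and g: "\<And>n :: nat. continuous_on UNIV (g n)"
    "\<And>x. x \<notin> N \<Longrightarrow> (\<lambda>n. g n x) \<longlonglongrightarrow> (if x \<in> unit_cube then f x else 0)"
    unfolding measurable_on_def by blast
  have [measurable]: "g n \<in> borel_measurable cube_measure" for n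
    using continuous_imp_measurable_on_sets_lebesgue[OF continuous_on_subset[OF g(1)[of n], of unit_cube]] by simp
  have AEN: "AE x in cube_measure. x \<notin> N"
  proof -
    have "AE x in lebesgue. x \<notin> N"
      using N by (intro AE_not_in) (simp add: negligible_iff_null_sets)
    then show ?thesis
      by (auto simp: AE_restrict_space_iff elim!: eventually_mono)
  qed
  have "(\<lambda>n. \<integral>x. cmod (tr k (f x) - tr k (g n x)) \<partial>cube_measure) \<longlonglongrightarrow> (\<integral>x. 0 \<partial>(cube_measure :: (real^'n) measure))"
  proof (rule integral_dominated_convergence)
    show "integrable cube_measure (\<lambda>x. 2 * real k :: real)"
      by (rule integrable_const_cube)
    show "AE x in cube_measure. (\<lambda>n. cmod (tr k (f x) - tr k (g n x))) \<longlonglongrightarrow> 0"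
      using AEN AE_space
    proof eventually_elim
      fix x :: "real^'n" assume x: "x \<notin> N" "x \<in> space cube_measure"
      then have "(\<lambda>n. g n x) \<longlonglongrightarrow> f x"
        using g(2)[OF x(1)] by simp
      then have "(\<lambda>n. tr k (g n x)) \<longlonglongrightarrow> tr k (f x)"
        using continuous_on_tendsto_compose[OF tr_cont, of _ "f x" sequentially] by simp
      then have "(\<lambda>n. cmod (tr k (f x) - tr k (g n x))) \<longlonglongrightarrow> cmod (tr k (f x) - tr k (f x))"
        by (intro tendsto_intros)
      then show "(\<lambda>n. cmod (tr k (f x) - tr k (g n x))) \<longlonglongrightarrow> 0" by simp
    qed
    show "AE x in cube_measure. norm (cmod (tr k (f x) - tr k (g n x))) \<le> 2 * real k" for n
    proof (rule AE_I2)
      fix x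
      show "norm (cmod (tr k (f x) - tr k (g n x))) \<le> 2 * real k"
        using norm_triangle_ineq4[of "tr k (f x)" "tr k (g n x)"] tr_k[of k "f x"] tr_k[of k "g n x"] by simp
    qed
  qed measurable
  then have "(\<lambda>n. \<integral>x. cmod (tr k (f x) - tr k (g n x)) \<partial>cube_measure) \<longlonglongrightarrow> 0"
    by simp
  then obtain n where n: "(CINT x. cmod (tr k (f x) - tr k (g n x))) < e / 2"
    using order_tendstoD(2)[of _ 0 sequentially "e / 2"] e by (metis (no_types, lifting) eventually_sequentially half_gt_zero order_refl)
  show thesis
  proof
    show c: "continuous_on UNIV (\<lambda>x. tr k (g n x))"
      using g(1)[of n] by (intro continuous_on_compose2[OF tr_cont]) auto
    have i1: "(\<lambda>x. tr k (f x)) \<in> L1_space"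
      unfolding L1_space_def by (intro CollectI integrable_bounded_cube[where K="real k"] tr_k) measurable
    have i2: "(\<lambda>x. tr k (g n x)) \<in> L1_space"
      by (rule UC_L1[OF continuous_UC[OF c]])
    have "(CINT x. cmod (f x - tr k (g n x))) = (CINT x. cmod ((f x - tr k (f x)) + (tr k (f x) - tr k (g n x))))"
      by simp
    also have "\<dots> \<le> (CINT x. cmod (f x - tr k (f x))) + (CINT x. cmod (tr k (f x) - tr k (g n x)))"
      by (intro cseminorm_add[OF cseminorm_L1] L1_diff f i1 i2)
    finally show "(CINT x. cmod (f x - tr k (g n x))) < e"
      using k n by simp
  qed
qed

subsection \<open>Affine contractions of the cube\<close>

lemma lebesgue_affine_cart:
  fixes f :: "real^'n \<Rightarrow> 'b :: {banach, second_countable_topology}"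
  assumes c: "c \<noteq> 0" and f: "integrable lebesgue f"
  shows "integrable lebesgue (\<lambda>x. f (t + c *\<^sub>R x))"
    and "(\<integral>x. f x \<partial>lebesgue) = \<bar>c\<bar> ^ CARD('n) *\<^sub>R (\<integral>x. f (t + c *\<^sub>R x) \<partial>lebesgue)"
proof -
  define T where "T = (\<lambda>x :: real^'n. t + (\<Sum>j\<in>Basis. (c * (x \<bullet> j)) *\<^sub>R j))"
  have T: "T = (\<lambda>x. t + c *\<^sub>R x)"
    unfolding T_def scaleR_scaleR[symmetric] scaleR_sum_right[symmetric] euclidean_representation ..
  have meas: "T \<in> lebesgue \<rightarrow>\<^sub>M lebesgue"
    unfolding T_def using c by (intro lebesgue_affine_measurable) auto
  have "lebesgue = density (distr lebesgue lebesgue T) (\<lambda>_. ennreal (\<Prod>j\<in>(Basis :: (real^'n) set). \<bar>c\<bar>))"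
    unfolding T_def using c by (intro lebesgue_affine_euclidean) auto
  then have D: "lebesgue = density (distr lebesgue lebesgue T) (\<lambda>_. ennreal (\<bar>c\<bar> ^ CARD('n)))"
    by (simp add: prod_constant)
  have fm: "f \<in> borel_measurable lebesgue" using f by simp
  then have fT: "(\<lambda>x. f (T x)) \<in> borel_measurable lebesgue"
    using meas by (rule measurable_compose[rotated])
  have "integrable (density (distr lebesgue lebesgue T) (\<lambda>_. ennreal (\<bar>c\<bar> ^ CARD('n)))) f"
    using f D by simp
  then have "integrable (distr lebesgue lebesgue T) (\<lambda>x. \<bar>c\<bar> ^ CARD('n) *\<^sub>R f x)"
    using fm by (subst (asm) integrable_density) auto
  then have "integrable lebesgue (\<lambda>x. \<bar>c\<bar> ^ CARD('n) *\<^sub>R f (T x))"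
    using meas fm by (subst (asm) integrable_distr_eq) auto
  then have "integrable lebesgue (\<lambda>x. (1 / \<bar>c\<bar> ^ CARD('n)) *\<^sub>R \<bar>c\<bar> ^ CARD('n) *\<^sub>R f (T x))"
    by (rule integrable_scaleR_right)
  then have int: "integrable lebesgue (\<lambda>x. f (T x))"
    using c by simp
  then show "integrable lebesgue (\<lambda>x. f (t + c *\<^sub>R x))"
    unfolding T .
  have "(\<integral>x. f x \<partial>lebesgue) = (\<integral>x. f x \<partial>density (distr lebesgue lebesgue T) (\<lambda>_. ennreal (\<bar>c\<bar> ^ CARD('n))))"
    using D by simp
  also have "\<dots> = (\<integral>x. \<bar>c\<bar> ^ CARD('n) *\<^sub>R f x \<partial>distr lebesgue lebesgue T)"
    using fm by (subst integral_density) auto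
  also have "\<dots> = (\<integral>x. \<bar>c\<bar> ^ CARD('n) *\<^sub>R f (T x) \<partial>lebesgue)"
    using meas fm by (subst integral_distr) auto
  also have "\<dots> = \<bar>c\<bar> ^ CARD('n) *\<^sub>R (\<integral>x. f (T x) \<partial>lebesgue)"
    by simp
  finally show "(\<integral>x. f x \<partial>lebesgue) = \<bar>c\<bar> ^ CARD('n) *\<^sub>R (\<integral>x. f (t + c *\<^sub>R x) \<partial>lebesgue)"
    unfolding T .
qed

lemma cube_affine:
  fixes f :: "real^'n \<Rightarrow> 'b :: {banach, second_countable_topology}"
  defines "A t c x \<equiv> t + c *\<^sub>R x"
  assumes c: "0 < c" and Q: "open Q" "A t c ` Q \<subseteq> unit_cube" and f: "integrable cube_measure f"
  shows "set_integrable lebesgue Q (\<lambda>x. f (A t c x))"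
    and "(LINT x:A t c ` Q|lebesgue. f x) = c ^ CARD('n) *\<^sub>R (LINT x:Q|lebesgue. f (A t c x))"
proof -
  have "open (A t c ` Q)"
    unfolding A_def using c Q(1) by (intro open_affinity) auto
  then have sets: "A t c ` Q \<in> sets lebesgue" by simp
  have "integrable lebesgue (\<lambda>x. indicator (A t c ` Q) x *\<^sub>R f x)"
    using set_integrable_cube[OF sets Q(2) f] by (simp add: set_integrable_def)
  note aff = lebesgue_affine_cart[OF _ this, of c t, folded A_def]
  have "indicator (A t c ` Q) (A t c x) = (indicator Q x :: real)" for x
    using c by (auto simp: indicator_def A_def)
  with aff c show "set_integrable lebesgue Q (\<lambda>x. f (A t c x))"
    "(LINT x:A t c ` Q|lebesgue. f x) = c ^ CARD('n) *\<^sub>R (LINT x:Q|lebesgue. f (A t c x))"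
    by (simp_all add: set_integrable_def set_lebesgue_integral_def)
qed

lemma LINT_unit_cube:
  fixes h :: "real^'n \<Rightarrow> 'b :: {banach, second_countable_topology}"
  shows "(LINT x:unit_cube|lebesgue. h x) = (CINT x. h x)"
    and "set_integrable lebesgue unit_cube h \<longleftrightarrow> integrable cube_measure h"
  by (simp_all add: set_lebesgue_integral_def integral_restrict_space set_integrable_def integrable_restrict_space)

lemma LINT_subset_le:
  fixes h :: "real^'n \<Rightarrow> real"
  assumes "Q \<in> sets lebesgue" "Q \<subseteq> unit_cube" "integrable cube_measure h" "\<And>x. 0 \<le> h x"
  shows "(LINT x:Q|lebesgue. h x) \<le> (CINT x. h x)"
proof -
  have "integrable cube_measure (\<lambda>x. indicator Q x *\<^sub>R h x)"
    using set_integrable_cube[OF assms(1-3)] cube_measure_cases(2)[OF assms(1,2)] by blast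
  then show ?thesis
    unfolding cube_measure_cases(1)[OF assms(1,2)]
    using assms(3,4) by (intro integral_mono) (auto simp: indicator_def)
qed

context
  fixes t :: "real^'n" and c :: real
  assumes c: "0 < c" "c \<le> 1" and maps: "\<And>x. x \<in> unit_cube \<Longrightarrow> t + c *\<^sub>R x \<in> unit_cube"
begin

lemma affine_L1:
  assumes f: "f \<in> L1_space"
  shows "(\<lambda>x. f (t + c *\<^sub>R x)) \<in> L1_space"
    and "(CINT x. cmod (f (t + c *\<^sub>R x))) \<le> (1 / c ^ CARD('n)) * (CINT x. cmod (f x))"
proof -
  have fi: "integrable cube_measure f" "integrable cube_measure (\<lambda>x. cmod (f x))"
    using f by (auto simp: L1_space_def)
  have im: "(\<lambda>x. t + c *\<^sub>R x) ` unit_cube \<subseteq> unit_cube"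
    using maps by auto
  show "(\<lambda>x. f (t + c *\<^sub>R x)) \<in> L1_space"
    using cube_affine(1)[OF c(1) open_box im fi(1)] by (simp add: L1_space_def LINT_unit_cube)
  have op: "open ((\<lambda>x. t + c *\<^sub>R x) ` unit_cube)"
    using c by (intro open_affinity) auto
  have "c ^ CARD('n) * (CINT x. cmod (f (t + c *\<^sub>R x))) = (LINT x:(\<lambda>x. t + c *\<^sub>R x) ` unit_cube|lebesgue. cmod (f x))"
    using cube_affine(2)[OF c(1) open_box im fi(2)] by (simp add: LINT_unit_cube)
  also have "\<dots> \<le> (CINT x. cmod (f x))"
    using op by (intro LINT_subset_le fi im) auto
  finally show "(CINT x. cmod (f (t + c *\<^sub>R x))) \<le> (1 / c ^ CARD('n)) * (CINT x. cmod (f x))"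
    using c by (simp add: field_simps)
qed

lemma affine_eps_cube:
  assumes "eps_cube r Q"
  shows "eps_cube (c * r) ((\<lambda>x. t + c *\<^sub>R x) ` Q)"
proof -
  obtain a where Q: "Q = box a (\<chi> i. a $ i + r)"
    using assms unfolding eps_cube_def by (elim exE)
  have "(\<lambda>x. t + c *\<^sub>R x) ` Q = box (t + c *\<^sub>R a) (\<chi> i. (t + c *\<^sub>R a) $ i + c * r)"
  proof (intro equalityI subsetI)
    fix y assume "y \<in> (\<lambda>x. t + c *\<^sub>R x) ` Q"
    then show "y \<in> box (t + c *\<^sub>R a) (\<chi> i. (t + c *\<^sub>R a) $ i + c * r)"
      using c unfolding Q by (auto simp: mem_box_cart distrib_left[symmetric] add.assoc)
  next
    fix y assume y: "y \<in> box (t + c *\<^sub>R a) (\<chi> i. (t + c *\<^sub>R a) $ i + c * r)"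
    have "(1 / c) *\<^sub>R (y - t) \<in> Q"
      unfolding Q mem_box_cart
    proof (intro allI conjI)
      fix i
      have "t $ i + c * a $ i < y $ i" "y $ i < t $ i + c * a $ i + c * r"
        using y by (auto simp: mem_box_cart)
      then show "a $ i < ((1 / c) *\<^sub>R (y - t)) $ i" "((1 / c) *\<^sub>R (y - t)) $ i < (\<chi> i. a $ i + r) $ i"
        using c by (auto simp: field_simps)
    qed
    moreover have "y = t + c *\<^sub>R ((1 / c) *\<^sub>R (y - t))"
      using c by simp
    ultimately show "y \<in> (\<lambda>x. t + c *\<^sub>R x) ` Q" by blast
  qed
  then show ?thesis
    unfolding eps_cube_def by blast
qed

lemma affine_cube_osc:
  assumes Q: "eps_cube r Q" "Q \<subseteq> unit_cube" and eps: "0 < r" and f: "f \<in> L1_space"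
  shows "cube_osc Q (\<lambda>x. f (t + c *\<^sub>R x)) = cube_osc ((\<lambda>x. t + c *\<^sub>R x) ` Q) f"
proof -
  note QD = eps_cubeD[OF Q(1) eps]
  have im: "(\<lambda>x. t + c *\<^sub>R x) ` Q \<subseteq> unit_cube"
    using maps Q(2) by auto
  have ceps: "0 < c * r" using c eps by simp
  have m: "measure lebesgue ((\<lambda>x. t + c *\<^sub>R x) ` Q) = c ^ CARD('n) * measure lebesgue Q"
    using eps_cubeD(2)[OF affine_eps_cube[OF Q(1)] ceps] QD(2) by (simp add: power_mult_distrib)
  have fi: "integrable cube_measure f" using f by (simp add: L1_space_def)
  have avg: "average ((\<lambda>x. t + c *\<^sub>R x) ` Q) f = average Q (\<lambda>x. f (t + c *\<^sub>R x))"
    unfolding average_def m cube_affine(2)[OF c(1) QD(4) im fi] scaleR_conv_of_real[where 'a=complex]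
    using c by simp
  have "integrable cube_measure (\<lambda>x. cmod (f x - k))" for k
    using L1_diff_const[OF f] by (simp add: L1_space_def)
  from cube_affine(2)[OF c(1) QD(4) im this[of "average Q (\<lambda>x. f (t + c *\<^sub>R x))"]]
  show ?thesis
    using c by (simp add: cube_osc_def avg m)
qed

text \<open>The contraction carries a family at scale r to one at scale c r with the same mean
  oscillations and the same number of cubes, which remains admissible since the exponent 1 - d is at
  most 0. The factor is the quotient of the weights r^(d-1) and (c r)^(d-1).\<close>

lemma affine_rosc:
  assumes eps: "0 < r" and f: "f \<in> L1_space"
  shows "rosc r (\<lambda>x. f (t + c *\<^sub>R x)) \<le> (1 / c ^ (CARD('n) - 1)) * rosc (c * r) f"
proof (rule rosc_le[OF eps affine_L1(1)[OF f]])
  fix \<F> :: "(real^'n) set set" assume F: "\<F> \<in> cube_families r"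
  note FD = cube_familiesD[OF F]
  let ?A = "\<lambda>x. t + c *\<^sub>R x"
  let ?G = "(\<lambda>Q. ?A ` Q) ` \<F>"
  have inj: "inj ?A" using c by (auto simp: inj_on_def)
  have injF: "inj_on (\<lambda>Q. ?A ` Q) \<F>"
    using inj by (auto intro!: inj_onI simp: inj_image_eq_iff)
  have ceps: "0 < c * r" using c eps by simp
  have G: "?G \<in> cube_families (c * r)"
    unfolding cube_families_def
  proof (intro CollectI conjI ballI)
    fix R assume "R \<in> ?G"
    then obtain Q where Q: "Q \<in> \<F>" "R = ?A ` Q" by auto
    then show "eps_cube (c * r) R"
      using affine_eps_cube[OF FD(1)] by simp
    show "R \<subseteq> unit_cube"
      using Q FD(2)[OF Q(1)] maps by auto
  next
    show "disjoint ?G"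
      using FD(3) inj unfolding disjoint_def by (auto simp: image_Int[symmetric] inj_image_eq_iff)
    have "real (card ?G) = real (card \<F>)"
      using card_image[OF injF] by simp
    also have "\<dots> \<le> r powr (1 - real CARD('n))" by (rule FD)
    also have "\<dots> \<le> (c * r) powr (1 - real CARD('n))"
      using c eps by (intro powr_mono2') (auto simp: Suc_le_eq)
    finally show "real (card ?G) \<le> (c * r) powr (1 - real CARD('n))" .
  qed (use FD in auto)
  have "osc_sum r \<F> (\<lambda>x. f (?A x)) = r ^ (CARD('n) - 1) * (\<Sum>Q\<in>\<F>. cube_osc (?A ` Q) f)"
    unfolding osc_sum_def using affine_cube_osc[OF FD(1,2) eps f] by simp
  also have "(\<Sum>Q\<in>\<F>. cube_osc (?A ` Q) f) = (\<Sum>R\<in>?G. cube_osc R f)"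
    by (simp add: sum.reindex[OF injF])
  also have "r ^ (CARD('n) - 1) * \<dots> = (1 / c ^ (CARD('n) - 1)) * osc_sum (c * r) ?G f"
    using c by (simp add: osc_sum_def power_mult_distrib)
  also have "\<dots> \<le> (1 / c ^ (CARD('n) - 1)) * rosc (c * r) f"
    using c by (intro mult_left_mono osc_sum_le_rosc ceps f G) auto
  finally show "osc_sum r \<F> (\<lambda>x. f (?A x)) \<le> (1 / c ^ (CARD('n) - 1)) * rosc (c * r) f" .
qed

end

subsection \<open>Smoothing\<close>

text \<open>
  Averaging over all the contractions \<open>x \<mapsto> (1 - u) x + u y\<close> of the cube into itself regularizes
  without leaving the cube and, up to a factor tending to \<open>1\<close>, without increasing the norm.
\<close>

definition smooth :: "real \<Rightarrow> 'n::finite cfun \<Rightarrow> 'n cfun" where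
  "smooth u f x = (CINT y. f ((1 - u) *\<^sub>R x + u *\<^sub>R y))"

context
  fixes u :: real
  assumes u: "0 < u" "u < 1"
begin

lemma smooth_maps:
  fixes x y :: "real^'n"
  assumes "x \<in> unit_cube" "y \<in> unit_cube"
  shows "(1 - u) *\<^sub>R x + u *\<^sub>R y \<in> unit_cube"
  using convexD_alt[OF convex_box(2) assms, of u] u by simp

lemma smooth_maps':
  fixes x y :: "real^'n"
  assumes "y \<in> unit_cube" "x \<in> unit_cube"
  shows "u *\<^sub>R y + (1 - u) *\<^sub>R x \<in> unit_cube"
  using smooth_maps[OF assms(2,1)] by (simp add: add.commute)

lemma smooth_integrable:
  fixes x :: "real^'n"
  assumes "f \<in> L1_space" "x \<in> unit_cube"
  shows "integrable cube_measure (\<lambda>y. f ((1 - u) *\<^sub>R x + u *\<^sub>R y))"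
    and "(CINT y. cmod (f ((1 - u) *\<^sub>R x + u *\<^sub>R y))) \<le> (1 / u ^ CARD('n)) * (CINT x. cmod (f x))"
  using affine_L1[of u "(1 - u) *\<^sub>R x" f] u assms smooth_maps[OF assms(2)] by (auto simp: L1_space_def)

text \<open>The map y -> (1 - u) x + u y has Jacobian u^d, so smoothing takes L^1 into bounded
  functions, at a price that explodes as u tends to 0.\<close>

lemma smooth_diff_le:
  fixes x :: "real^'n"
  assumes f: "f \<in> L1_space" and h: "h \<in> L1_space" and x: "x \<in> unit_cube"
  shows "cmod (smooth u f x - smooth u h x) \<le> (1 / u ^ CARD('n)) * (CINT x. cmod (f x - h x))"
proof -
  have "smooth u f x - smooth u h x = (CINT y. f ((1 - u) *\<^sub>R x + u *\<^sub>R y) - h ((1 - u) *\<^sub>R x + u *\<^sub>R y))"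
    unfolding smooth_def using smooth_integrable(1)[OF f x] smooth_integrable(1)[OF h x] by simp
  also have "cmod \<dots> \<le> (CINT y. cmod (f ((1 - u) *\<^sub>R x + u *\<^sub>R y) - h ((1 - u) *\<^sub>R x + u *\<^sub>R y)))"
    by (rule integral_norm_bound)
  also have "\<dots> \<le> (1 / u ^ CARD('n)) * (CINT x. cmod (f x - h x))"
    by (rule smooth_integrable(2)[OF L1_diff[OF f h] x])
  finally show ?thesis .
qed

lemma smooth_UC_continuous:
  fixes h :: "'n::finite cfun"
  assumes h: "h \<in> UC_space"
  shows "smooth u h \<in> UC_space"
  unfolding UC_space_def uniformly_continuous_on_def
proof (intro CollectI allI impI)
  fix e :: real assume e: "0 < e"
  have "uniformly_continuous_on unit_cube h"
    using h by (simp add: UC_space_def)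
  then obtain d where d: "0 < d" "\<And>x y. x \<in> unit_cube \<Longrightarrow> y \<in> unit_cube \<Longrightarrow> dist y x < d \<Longrightarrow> dist (h y) (h x) < e / 2"
    unfolding uniformly_continuous_on_def using e by (metis half_gt_zero)
  show "\<exists>d>0. \<forall>x\<in>unit_cube. \<forall>y\<in>unit_cube. dist y x < d \<longrightarrow> dist (smooth u h y) (smooth u h x) < e"
  proof (intro exI[of _ d] conjI d(1) ballI impI)
    fix x y :: "real^'n" assume xy: "x \<in> unit_cube" "y \<in> unit_cube" "dist y x < d"
    note i = smooth_integrable(1)[OF UC_L1[OF h] xy(1)] smooth_integrable(1)[OF UC_L1[OF h] xy(2)]
    have "smooth u h y - smooth u h x = (CINT z. h ((1 - u) *\<^sub>R y + u *\<^sub>R z) - h ((1 - u) *\<^sub>R x + u *\<^sub>R z))"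
      unfolding smooth_def using i by simp
    also have "cmod \<dots> \<le> (CINT z. cmod (h ((1 - u) *\<^sub>R y + u *\<^sub>R z) - h ((1 - u) *\<^sub>R x + u *\<^sub>R z)))"
      by (rule integral_norm_bound)
    also have "\<dots> \<le> (\<integral>z. e / 2 \<partial>(cube_measure :: (real^'n) measure))"
    proof (rule integral_mono)
      fix z :: "real^'n" assume "z \<in> space cube_measure"
      then have z: "z \<in> unit_cube" by simp
      have "dist ((1 - u) *\<^sub>R y + u *\<^sub>R z) ((1 - u) *\<^sub>R x + u *\<^sub>R z) = (1 - u) * dist y x"
        using u by (simp add: dist_norm scaleR_diff_right[symmetric])
      also have "\<dots> \<le> 1 * dist y x"
        using u by (intro mult_right_mono) auto
      also have "\<dots> < d" using xy by simp
      finally have "dist (h ((1 - u) *\<^sub>R y + u *\<^sub>R z)) (h ((1 - u) *\<^sub>R x + u *\<^sub>R z)) < e / 2"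
        by (intro d smooth_maps xy z)
      then show "cmod (h ((1 - u) *\<^sub>R y + u *\<^sub>R z) - h ((1 - u) *\<^sub>R x + u *\<^sub>R z)) \<le> e / 2"
        by (simp add: dist_norm)
    qed (use i integrable_const_cube in auto)
    also have "\<dots> = e / 2"
      by (rule integral_const_cube)
    finally show "dist (smooth u h y) (smooth u h x) < e"
      using e by (simp add: dist_norm)
  qed
qed

text \<open>For fixed u the bound \<open>smooth_diff_le\<close> makes the smoothing of an L^1
  function a uniform limit of smoothings of continuous functions.\<close>

lemma smooth_UC:
  fixes f :: "'n::finite cfun"
  assumes f: "f \<in> L1_space"
  shows "smooth u f \<in> UC_space"
  unfolding UC_space_def
proof (intro CollectI, unfold uniformly_continuous_on_def, intro allI impI)
  fix e :: real assume e: "0 < e"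
  have pos: "0 < e / 4 * u ^ CARD('n)"
    using e u by simp
  obtain h where h: "continuous_on UNIV h" "(CINT x. cmod (f x - h x)) < e / 4 * u ^ CARD('n)"
    using L1_continuous_dense[OF f pos] by blast
  note hU = continuous_UC[OF h(1)]
  have close: "cmod (smooth u f x - smooth u h x) \<le> e / 4" if "x \<in> unit_cube" for x
  proof -
    have "cmod (smooth u f x - smooth u h x) \<le> (1 / u ^ CARD('n)) * (CINT x. cmod (f x - h x))"
      by (rule smooth_diff_le[OF f UC_L1[OF hU] that])
    also have "\<dots> \<le> (1 / u ^ CARD('n)) * (e / 4 * u ^ CARD('n))"
      using h(2) u by (intro mult_left_mono) auto
    also have "\<dots> = e / 4" using u by simp
    finally show ?thesis .
  qed
  have "uniformly_continuous_on unit_cube (smooth u h)"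
    using smooth_UC_continuous[OF hU] by (simp add: UC_space_def)
  then obtain d where d: "0 < d" "\<And>x y. x \<in> unit_cube \<Longrightarrow> y \<in> unit_cube \<Longrightarrow> dist y x < d \<Longrightarrow> dist (smooth u h y) (smooth u h x) < e / 2"
    unfolding uniformly_continuous_on_def using e by (metis half_gt_zero)
  show "\<exists>d>0. \<forall>x\<in>unit_cube. \<forall>y\<in>unit_cube. dist y x < d \<longrightarrow> dist (smooth u f y) (smooth u f x) < e"
  proof (intro exI[of _ d] conjI d(1) ballI impI)
    fix x y :: "real^'n" assume xy: "x \<in> unit_cube" "y \<in> unit_cube" "dist y x < d"
    have "smooth u f y - smooth u f x = (smooth u f y - smooth u h y) + (smooth u h y - smooth u h x) - (smooth u f x - smooth u h x)"
      by simp
    also have "cmod \<dots> \<le> cmod (smooth u f y - smooth u h y) + cmod (smooth u h y - smooth u h x) + cmod (smooth u f x - smooth u h x)"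
      by (intro order_trans[OF norm_triangle_ineq4] add_right_mono norm_triangle_ineq)
    also have "\<dots> < e"
      using close[OF xy(1)] close[OF xy(2)] d(2)[OF xy] by (simp add: dist_norm)
    finally show "dist (smooth u f y) (smooth u f x) < e"
      by (simp add: dist_norm)
  qed
qed

text \<open>Fubini's theorem is applied to continuous \<open>h\<close>, for which joint
  measurability in x and y is clear. For a merely Lebesgue measurable function, measurability of the
  composite for the product sigma-algebra is delicate; density in L^1 is used instead to pass to
  general functions.\<close>

lemma smooth_pairing:
  fixes h :: "'n::finite cfun"
  assumes h: "continuous_on UNIV h" and g: "g \<in> borel_measurable cube_measure" "AE x in cube_measure. cmod (g x) \<le> K"
  shows "(CINT x. smooth u h x * g x) = (CINT y. \<integral>x. h (u *\<^sub>R y + (1 - u) *\<^sub>R x) * g x \<partial>cube_measure)"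
    and "integrable cube_measure (\<lambda>y. \<integral>x. h (u *\<^sub>R y + (1 - u) *\<^sub>R x) * g x \<partial>cube_measure)"
proof -
  let ?M = "cube_measure :: (real^'n) measure"
  interpret finite_measure ?M by (rule finite_cube_measure)
  interpret P: pair_sigma_finite ?M ?M ..
  interpret PF: finite_measure "?M \<Otimes>\<^sub>M ?M"
    by (rule finite_measure_pair_measure[OF finite_cube_measure finite_cube_measure])
  obtain H where H: "0 \<le> H" "\<And>x. x \<in> unit_cube \<Longrightarrow> cmod (h x) \<le> H"
    using UC_bounded[OF continuous_UC[OF h]] by blast
  have [measurable]: "h \<in> borel_measurable borel"
    by (rule borel_measurable_continuous_onI[OF h])
  have idm[measurable]: "(\<lambda>x :: real^'n. x) \<in> borel_measurable ?M"
    by (intro continuous_imp_measurable_on_sets_lebesgue continuous_on_id) auto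
  note [measurable] = g(1)
  define k where "k y x = h (u *\<^sub>R y + (1 - u) *\<^sub>R x) * g x" for y x
  have "(\<lambda>p. k (fst p) (snd p)) \<in> borel_measurable (?M \<Otimes>\<^sub>M ?M)"
    unfolding k_def by measurable
  then have km: "case_prod k \<in> borel_measurable (?M \<Otimes>\<^sub>M ?M)"
    by (simp add: case_prod_beta')
  have AEx: "AE p in ?M \<Otimes>\<^sub>M ?M. cmod (g (snd p)) \<le> K"
  proof -
    have [measurable]: "Measurable.pred ?M (\<lambda>x. cmod (g x) \<le> K)" by measurable
    have "AE y in ?M. AE x in ?M. cmod (g (snd (y, x))) \<le> K"
      using g(2) by simp
    then show ?thesis
      by (subst P.AE_pair_iff[symmetric]) measurable
  qed
  have "AE p in ?M \<Otimes>\<^sub>M ?M. norm (case_prod k p) \<le> H * \<bar>K\<bar>"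
    using AEx AE_space
  proof eventually_elim
    fix p assume p: "cmod (g (snd p)) \<le> K" "p \<in> space (?M \<Otimes>\<^sub>M ?M)"
    obtain y x where yx: "p = (y, x)" by force
    have "y \<in> unit_cube" "x \<in> unit_cube"
      using p(2) by (auto simp: yx space_pair_measure)
    then have "cmod (h (u *\<^sub>R y + (1 - u) *\<^sub>R x)) \<le> H"
      using H smooth_maps' by blast
    then have "cmod (h (u *\<^sub>R y + (1 - u) *\<^sub>R x)) * cmod (g x) \<le> H * \<bar>K\<bar>"
      using p(1) H(1) by (intro mult_mono) (auto simp: yx)
    then show "norm (case_prod k p) \<le> H * \<bar>K\<bar>"
      by (simp add: yx k_def norm_mult)
  qed
  then have int: "integrable (?M \<Otimes>\<^sub>M ?M) (case_prod k)"
    by (intro PF.integrable_const_bound km)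
  have "(CINT x. smooth u h x * g x) = (CINT x. (CINT y. k y x))"
    by (simp add: smooth_def k_def add.commute)
  also have "\<dots> = (CINT y. (CINT x. k y x))"
    by (rule P.Fubini_integral[OF int])
  finally show "(CINT x. smooth u h x * g x) = (CINT y. \<integral>x. h (u *\<^sub>R y + (1 - u) *\<^sub>R x) * g x \<partial>cube_measure)"
    by (simp add: k_def)
  show "integrable cube_measure (\<lambda>y. \<integral>x. h (u *\<^sub>R y + (1 - u) *\<^sub>R x) * g x \<partial>cube_measure)"
    using P.integrable_fst[OF int] by (simp add: k_def)
qed

lemma smooth_pairing_le:
  fixes h :: "'n::finite cfun"
  assumes h: "continuous_on UNIV h" and g: "g \<in> borel_measurable cube_measure" "AE x in cube_measure. cmod (g x) \<le> K"
    and C: "\<And>y. y \<in> unit_cube \<Longrightarrow> cmod (CINT x. h (u *\<^sub>R y + (1 - u) *\<^sub>R x) * g x) \<le> C"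
  shows "cmod (CINT x. smooth u h x * g x) \<le> C"
proof -
  have "cmod (CINT x. smooth u h x * g x) \<le> (CINT y. cmod (CINT x. h (u *\<^sub>R y + (1 - u) *\<^sub>R x) * g x))"
    unfolding smooth_pairing(1)[OF h g] by (rule integral_norm_bound)
  also have "\<dots> \<le> (\<integral>y. C \<partial>(cube_measure :: (real^'n) measure))"
    using C smooth_pairing(2)[OF h g] by (intro integral_mono integrable_norm integrable_const_cube) auto
  also have "\<dots> = C" by (rule integral_const_cube)
  finally show ?thesis .
qed

text \<open>An oscillation sum is a pairing with twice an atom. The pairing of an average is the
  average of the pairings with contracted copies of \<open>h\<close>, and each of these is bounded
  by \<open>affine_rosc\<close>.\<close>

lemma smooth_rosc_continuous:
  fixes h :: "'n::finite cfun"
  assumes h: "continuous_on UNIV h" and e: "0 < r" "r \<le> 1"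
  shows "rosc r (smooth u h) \<le> (1 / (1 - u) ^ (CARD('n) - 1)) * rosc ((1 - u) * r) h"
proof -
  note hU = continuous_UC[OF h]
  note hL1 = UC_L1[OF hU] and sL1 = UC_L1[OF smooth_UC_continuous[OF hU]]
  show ?thesis
  proof (rule rosc_le[OF e(1) sL1])
    fix \<F> :: "(real^'n) set set" assume F: "\<F> \<in> cube_families r"
    obtain g where g: "atom g" "2 * (CINT x. smooth u h x * g x) = of_real (osc_sum r \<F> (smooth u h))"
      "\<And>k. k \<in> L1_space \<Longrightarrow> cmod (2 * (CINT x. k x * g x)) \<le> osc_sum r \<F> k"
      using norming_atom[OF e F sL1] by blast
    obtain K where K: "AE x in cube_measure. cmod (g x) \<le> K"
      using atom_bounded(2)[OF g(1)] by blast
    let ?C = "(1 / (1 - u) ^ (CARD('n) - 1)) * rosc ((1 - u) * r) h"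
    have "cmod (CINT x. smooth u h x * g x) \<le> ?C / 2"
    proof (rule smooth_pairing_le[OF h atom_bounded(1)[OF g(1)] K])
      fix y :: "real^'n" assume y: "y \<in> unit_cube"
      have c: "0 < 1 - u" "1 - u \<le> 1" using u by auto
      note aff = affine_L1[OF c smooth_maps'[OF y] hL1] affine_rosc[OF c smooth_maps'[OF y] e(1) hL1]
      have "cmod (2 * (CINT x. h (u *\<^sub>R y + (1 - u) *\<^sub>R x) * g x)) \<le> osc_sum r \<F> (\<lambda>x. h (u *\<^sub>R y + (1 - u) *\<^sub>R x))"
        by (rule g(3)[OF aff(1)])
      also have "\<dots> \<le> rosc r (\<lambda>x. h (u *\<^sub>R y + (1 - u) *\<^sub>R x))"
        by (rule osc_sum_le_rosc[OF e(1) aff(1) F])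
      also have "\<dots> \<le> ?C" by (rule aff(3))
      finally show "cmod (CINT x. h (u *\<^sub>R y + (1 - u) *\<^sub>R x) * g x) \<le> ?C / 2"
        by (simp add: norm_mult)
    qed
    then have "cmod (2 * (CINT x. smooth u h x * g x)) \<le> ?C"
      by (simp add: norm_mult)
    then show "osc_sum r \<F> (smooth u h) \<le> ?C"
      unfolding g(2) by simp
  qed
qed

lemma smooth_L1_diff:
  fixes f h :: "'n::finite cfun"
  assumes f: "f \<in> L1_space" and h: "h \<in> L1_space"
  shows "(CINT x. cmod (smooth u f x - smooth u h x)) \<le> (1 / u ^ CARD('n)) * (CINT x. cmod (f x - h x))"
    (is "_ \<le> ?C")
proof -
  have "(CINT x. cmod (smooth u f x - smooth u h x)) \<le> (\<integral>x. ?C \<partial>(cube_measure :: (real^'n) measure))"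
    using L1_diff[OF UC_L1[OF smooth_UC[OF f]] UC_L1[OF smooth_UC[OF h]]] smooth_diff_le[OF f h]
    by (intro integral_mono integrable_const_cube) (auto simp: L1_space_def)
  also have "\<dots> = ?C" by (rule integral_const_cube)
  finally show ?thesis .
qed

lemma smooth_rosc:
  fixes f :: "'n::finite cfun"
  assumes f: "f \<in> L1_space" and e: "0 < r" "r \<le> 1"
  shows "rosc r (smooth u f) \<le> (1 / (1 - u) ^ (CARD('n) - 1)) * rosc ((1 - u) * r) f"
proof -
  let ?d = "\<lambda>h. \<integral>x. cmod (f x - h x) \<partial>cube_measure"
  define a where "a = 1 / (1 - u) ^ (CARD('n) - 1)"
  have a: "0 < a" using u by (simp add: a_def)
  have ce: "0 < (1 - u) * r" using u e by simp
  note sf = UC_L1[OF smooth_UC[OF f]]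
  \<comment> \<open>Collects the errors of replacing f by a continuous function on both sides. It
    depends on r and u, which are fixed while the L^1 error tends to 0.\<close>
  define C where "C = a * (2 / ((1 - u) * r)) + 2 / r * (1 / u ^ CARD('n))"
  have C: "0 < C" using a e ce u by (auto simp: C_def intro!: add_pos_pos)
  have "rosc r (smooth u f) \<le> a * rosc ((1 - u) * r) f + \<eta>" if \<eta>: "0 < \<eta>" for \<eta>
  proof -
    obtain h where h: "continuous_on UNIV h" "?d h < \<eta> / C"
      using L1_continuous_dense[OF f divide_pos_pos[OF \<eta> C]] by blast
    note hL1 = UC_L1[OF continuous_UC[OF h(1)]]
    note sh = UC_L1[OF smooth_UC[OF hL1]]
    have "rosc r (smooth u f) = rosc r (\<lambda>x. smooth u h x + (smooth u f x - smooth u h x))"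
      by simp
    also have "\<dots> \<le> rosc r (smooth u h) + rosc r (\<lambda>x. smooth u f x - smooth u h x)"
      by (intro cseminorm_add[OF cseminorm_rosc[OF e(1)]] L1_diff sf sh)
    also have "rosc r (\<lambda>x. smooth u f x - smooth u h x) \<le> 2 / r * (CINT x. cmod (smooth u f x - smooth u h x))"
      by (intro rosc_le_L1 e L1_diff sf sh)
    also have "\<dots> \<le> 2 / r * ((1 / u ^ CARD('n)) * ?d h)"
      using e by (intro mult_left_mono smooth_L1_diff f hL1) auto
    also have "rosc r (smooth u h) \<le> a * rosc ((1 - u) * r) h"
      unfolding a_def by (rule smooth_rosc_continuous[OF h(1) e])
    also have "rosc ((1 - u) * r) h = rosc ((1 - u) * r) (\<lambda>x. f x - (f x - h x))"
      by simp
    also have "\<dots> \<le> rosc ((1 - u) * r) f + rosc ((1 - u) * r) (\<lambda>x. f x - h x)"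
      by (intro cseminorm_diff[OF cseminorm_rosc[OF ce]] L1_diff f hL1)
    also have "rosc ((1 - u) * r) (\<lambda>x. f x - h x) \<le> 2 / ((1 - u) * r) * ?d h"
      by (intro rosc_le_L1 ce L1_diff f hL1)
    finally have "rosc r (smooth u f) \<le> a * (rosc ((1 - u) * r) f + 2 / ((1 - u) * r) * ?d h) + 2 / r * ((1 / u ^ CARD('n)) * ?d h)"
      using a by (simp add: mult_left_mono)
    also have "\<dots> = a * rosc ((1 - u) * r) f + C * ?d h"
      by (simp add: C_def algebra_simps)
    also have "C * ?d h \<le> C * (\<eta> / C)"
      using h(2) C by (intro mult_left_mono) auto
    finally show ?thesis using C by simp
  qed
  then show ?thesis
    unfolding a_def by (rule field_le_epsilon)
qed

text \<open>Needed because the bound of \<open>smooth_L1_diff\<close> degenerates like u^(-d).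
  Pairing with the conjugate sign and averaging over the contractions gives a constant that stays
  bounded as u tends to 0.\<close>

lemma smooth_L1_norm_continuous:
  fixes h :: "'n::finite cfun"
  assumes h: "continuous_on UNIV h"
  shows "(CINT x. cmod (smooth u h x)) \<le> (1 / (1 - u) ^ CARD('n)) * (CINT x. cmod (h x))"
proof -
  note hL1 = UC_L1[OF continuous_UC[OF h]]
  have sm: "smooth u h \<in> borel_measurable cube_measure"
    using UC_L1[OF smooth_UC[OF hL1]] by (simp add: L1_space_def)
  define g where "g x = cnj (sgn (smooth u h x))" for x
  have gm: "g \<in> borel_measurable cube_measure"
    unfolding g_def by (rule measurable_compose[OF sm borel_measurable_cnj_sgn])
  have g1: "cmod (g x) \<le> 1" for x
    by (simp add: g_def norm_sgn)
  have gK: "AE x in cube_measure. cmod (g x) \<le> 1"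
    using g1 by simp
  have "smooth u h x * g x = of_real (cmod (smooth u h x))" for x
    using complex_norm_square[of "smooth u h x"]
    by (cases "smooth u h x = 0") (auto simp: g_def sgn_div_norm scaleR_conv_of_real power2_eq_square field_simps)
  then have "(CINT x. cmod (smooth u h x)) = cmod (CINT x. smooth u h x * g x)"
    by (simp add: integral_nonneg_AE)
  also have "\<dots> \<le> (1 / (1 - u) ^ CARD('n)) * (CINT x. cmod (h x))"
  proof (rule smooth_pairing_le[OF h gm gK])
    fix y :: "real^'n" assume y: "y \<in> unit_cube"
    have c: "0 < 1 - u" "1 - u \<le> 1" using u by auto
    note aff = affine_L1[OF c smooth_maps'[OF y] hL1]
    have "cmod (CINT x. h (u *\<^sub>R y + (1 - u) *\<^sub>R x) * g x) \<le> (CINT x. cmod (h (u *\<^sub>R y + (1 - u) *\<^sub>R x) * g x))"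
      by (rule integral_norm_bound)
    also have "\<dots> \<le> (CINT x. cmod (h (u *\<^sub>R y + (1 - u) *\<^sub>R x)))"
      using aff(1) g1 L1_mult_bounded[OF aff(1) gm gK]
      by (intro integral_mono integrable_norm) (auto simp: L1_space_def norm_mult mult_left_le)
    also have "\<dots> \<le> (1 / (1 - u) ^ CARD('n)) * (CINT x. cmod (h x))"
      by (rule aff(2))
    finally show "cmod (CINT x. h (u *\<^sub>R y + (1 - u) *\<^sub>R x) * g x) \<le> (1 / (1 - u) ^ CARD('n)) * (CINT x. cmod (h x))" .
  qed
  finally show ?thesis .
qed

lemma smooth_diff:
  assumes f: "f \<in> L1_space" and h: "h \<in> L1_space" and x: "x \<in> unit_cube"
  shows "smooth u (\<lambda>x. f x - h x) x = smooth u f x - smooth u h x"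
  unfolding smooth_def using smooth_integrable(1)[OF f x] smooth_integrable(1)[OF h x] by simp

lemma smooth_L1_norm:
  fixes f :: "'n::finite cfun"
  assumes f: "f \<in> L1_space"
  shows "(CINT x. cmod (smooth u f x)) \<le> (1 / (1 - u) ^ CARD('n)) * (CINT x. cmod (f x))"
proof -
  let ?N = "\<lambda>h :: 'n cfun. \<integral>x. cmod (h x) \<partial>cube_measure"
  define a where "a = 1 / (1 - u) ^ CARD('n)"
  have a: "0 < a" using u by (simp add: a_def)
  define C where "C = a + 1 / u ^ CARD('n)"
  have C: "0 < C" using a u by (auto simp: C_def intro!: add_pos_pos)
  note sf = UC_L1[OF smooth_UC[OF f]]
  have "?N (smooth u f) \<le> a * ?N f + \<eta>" if \<eta>: "0 < \<eta>" for \<eta>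
  proof -
    obtain h where h: "continuous_on UNIV h" "?N (\<lambda>x. f x - h x) < \<eta> / C"
      using L1_continuous_dense[OF f divide_pos_pos[OF \<eta> C]] by blast
    note hL1 = UC_L1[OF continuous_UC[OF h(1)]]
    note sh = UC_L1[OF smooth_UC[OF hL1]]
    have "?N (smooth u f) = ?N (\<lambda>x. smooth u h x + (smooth u f x - smooth u h x))"
      by simp
    also have "\<dots> \<le> ?N (smooth u h) + ?N (\<lambda>x. smooth u f x - smooth u h x)"
      by (intro cseminorm_add[OF cseminorm_L1] L1_diff sf sh)
    also have "?N (\<lambda>x. smooth u f x - smooth u h x) \<le> 1 / u ^ CARD('n) * ?N (\<lambda>x. f x - h x)"
      by (rule smooth_L1_diff[OF f hL1])
    also have "?N (smooth u h) \<le> a * ?N h"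
      unfolding a_def by (rule smooth_L1_norm_continuous[OF h(1)])
    also have "?N h = ?N (\<lambda>x. f x - (f x - h x))"
      by simp
    also have "\<dots> \<le> ?N f + ?N (\<lambda>x. f x - h x)"
      by (intro cseminorm_diff[OF cseminorm_L1] L1_diff f hL1)
    finally have "?N (smooth u f) \<le> a * (?N f + ?N (\<lambda>x. f x - h x)) + 1 / u ^ CARD('n) * ?N (\<lambda>x. f x - h x)"
      using a by (simp add: mult_left_mono)
    also have "\<dots> = a * ?N f + C * ?N (\<lambda>x. f x - h x)"
      by (simp add: C_def algebra_simps)
    also have "C * ?N (\<lambda>x. f x - h x) \<le> C * (\<eta> / C)"
      using h(2) C by (intro mult_left_mono) auto
    finally show ?thesis using C by simp
  qed
  then show ?thesis
    unfolding a_def by (rule field_le_epsilon)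
qed

lemma smooth_dist_UC:
  fixes h :: "'n::finite cfun"
  assumes h: "h \<in> UC_space" and e: "0 \<le> e"
    and d: "\<And>x y. x \<in> unit_cube \<Longrightarrow> y \<in> unit_cube \<Longrightarrow> dist y x < d \<Longrightarrow> dist (h y) (h x) \<le> e"
    and small: "u * real CARD('n) < d"
  shows "(CINT x. cmod (smooth u h x - h x)) \<le> e"
proof -
  have pt: "cmod (smooth u h x - h x) \<le> e" if x: "x \<in> unit_cube" for x
  proof -
    note i = smooth_integrable(1)[OF UC_L1[OF h] x]
    have "smooth u h x - h x = (CINT y. h ((1 - u) *\<^sub>R x + u *\<^sub>R y)) - (\<integral>y. h x \<partial>(cube_measure :: (real^'n) measure))"
      unfolding smooth_def integral_const_cube ..
    also have "\<dots> = (CINT y. h ((1 - u) *\<^sub>R x + u *\<^sub>R y) - h x)"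
      by (rule Bochner_Integration.integral_diff[symmetric, OF i integrable_const_cube])
    also have "cmod \<dots> \<le> (CINT y. cmod (h ((1 - u) *\<^sub>R x + u *\<^sub>R y) - h x))"
      by (rule integral_norm_bound)
    also have "\<dots> \<le> (\<integral>y. e \<partial>(cube_measure :: (real^'n) measure))"
    proof (rule integral_mono)
      show "integrable cube_measure (\<lambda>y. cmod (h ((1 - u) *\<^sub>R x + u *\<^sub>R y) - h x))"
        by (intro integrable_norm Bochner_Integration.integrable_diff i integrable_const_cube)
      fix y :: "real^'n" assume "y \<in> space cube_measure"
      then have y: "y \<in> unit_cube" by simp
      have "(1 - u) *\<^sub>R x + u *\<^sub>R y - x = u *\<^sub>R (y - x)"
        by (simp add: algebra_simps)
      then have "dist ((1 - u) *\<^sub>R x + u *\<^sub>R y) x = u * dist y x"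
        using u by (simp add: dist_norm)
      also have "\<dots> \<le> u * (real CARD('n) * 1)"
        using u y x by (intro mult_left_mono dist_in_eps_cube[OF eps_cube_unit_cube]) auto
      also have "\<dots> < d" using small by simp
      finally show "cmod (h ((1 - u) *\<^sub>R x + u *\<^sub>R y) - h x) \<le> e"
        using d[OF x smooth_maps[OF x y]] by (simp add: dist_norm)
    qed (rule integrable_const_cube)
    also have "\<dots> = e" by (rule integral_const_cube)
    finally show ?thesis .
  qed
  have "(CINT x. cmod (smooth u h x - h x)) \<le> (\<integral>x. e \<partial>(cube_measure :: (real^'n) measure))"
    using L1_diff[OF UC_L1[OF smooth_UC_continuous[OF h]] UC_L1[OF h]] pt
    by (intro integral_mono integrable_const_cube) (auto simp: L1_space_def)
  also have "\<dots> = e" by (rule integral_const_cube)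
  finally show ?thesis .
qed

end

lemma smooth_tendsto_L1:
  fixes f :: "'n::finite cfun"
  assumes f: "f \<in> L1_space" and u: "\<And>k. 0 < u k" "\<And>k. u k \<le> 1 / 2" "u \<longlonglongrightarrow> 0"
  shows "(\<lambda>k. \<integral>x. cmod (smooth (u k) f x - f x) \<partial>cube_measure) \<longlonglongrightarrow> 0"
proof (rule LIMSEQ_I)
  fix e :: real assume e: "0 < e"
  let ?N = "\<lambda>h :: 'n cfun. \<integral>x. cmod (h x) \<partial>cube_measure"
  \<comment> \<open>The smoothing error of f - h has norm at most 2^d times that of f - h, since (1
    - u)^(-d) <= 2^d for u <= 1/2; one more copy of f - h appears in the triangle
    inequality.\<close>
  define C :: real where "C = 2 ^ CARD('n) + 1"
  have C: "0 < C" by (simp add: C_def add_pos_pos)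
  have pos: "0 < e / (2 * C)" using e C by simp
  obtain h where h: "continuous_on UNIV h" "?N (\<lambda>x. f x - h x) < e / (2 * C)"
    using L1_continuous_dense[OF f pos] by blast
  note hU = continuous_UC[OF h(1)]
  note hL1 = UC_L1[OF hU]
  have "uniformly_continuous_on unit_cube h"
    using hU by (simp add: UC_space_def)
  then obtain d where d: "0 < d" "\<And>x y. x \<in> unit_cube \<Longrightarrow> y \<in> unit_cube \<Longrightarrow> dist y x < d \<Longrightarrow> dist (h y) (h x) < e / 4"
    unfolding uniformly_continuous_on_def using e by (metis zero_less_divide_iff zero_less_numeral)
  have "\<forall>\<^sub>F k in sequentially. u k < d / real CARD('n)"
    using u(3) d(1) by (intro order_tendstoD(2)) auto
  then obtain k0 where k0: "\<And>k. k \<ge> k0 \<Longrightarrow> u k < d / real CARD('n)"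
    unfolding eventually_sequentially by blast
  show "\<exists>k0. \<forall>k\<ge>k0. norm (?N (\<lambda>x. smooth (u k) f x - f x) - 0) < e"
  proof (intro exI[of _ k0] allI impI)
    fix k assume k: "k \<ge> k0"
    have dk: "0 < u k" "u k < 1" using u(1)[of k] u(2)[of k] by auto
    let ?S = "smooth (u k)"
    note sf = UC_L1[OF smooth_UC[OF dk f]] and sh = UC_L1[OF smooth_UC[OF dk hL1]]
    have "?N (\<lambda>x. ?S f x - f x) = ?N (\<lambda>x. (?S f x - ?S h x) + ((?S h x - h x) - (f x - h x)))"
      by simp
    also have "\<dots> \<le> ?N (\<lambda>x. ?S f x - ?S h x) + ?N (\<lambda>x. (?S h x - h x) - (f x - h x))"
      by (intro cseminorm_add[OF cseminorm_L1] L1_diff sf sh hL1 f)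
    also have "?N (\<lambda>x. (?S h x - h x) - (f x - h x)) \<le> ?N (\<lambda>x. ?S h x - h x) + ?N (\<lambda>x. f x - h x)"
      by (intro cseminorm_diff[OF cseminorm_L1] L1_diff sf sh hL1 f)
    also have "?N (\<lambda>x. ?S h x - h x) \<le> e / 4"
    proof (rule smooth_dist_UC[OF dk hU])
      show "u k * real CARD('n) < d"
        using k0[OF k] by (simp add: pos_less_divide_eq)
    qed (use e d in \<open>auto intro: less_imp_le\<close>)
    also have "?N (\<lambda>x. ?S f x - ?S h x) = ?N (?S (\<lambda>x. f x - h x))"
      by (intro Bochner_Integration.integral_cong refl) (simp add: smooth_diff[OF dk f hL1])
    also have "\<dots> \<le> (1 / (1 - u k) ^ CARD('n)) * ?N (\<lambda>x. f x - h x)"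
      by (rule smooth_L1_norm[OF dk L1_diff[OF f hL1]])
    also have "\<dots> \<le> 2 ^ CARD('n) * ?N (\<lambda>x. f x - h x)"
    proof (rule mult_right_mono)
      have "1 / (1 - u k) \<le> 2"
        using u(2)[of k] by (simp add: divide_le_eq)
      then have "(1 / (1 - u k)) ^ CARD('n) \<le> 2 ^ CARD('n)"
        using dk by (intro power_mono) auto
      then show "1 / (1 - u k) ^ CARD('n) \<le> 2 ^ CARD('n)"
        by (simp add: power_one_over)
    qed (auto intro: integral_nonneg_AE)
    finally have "?N (\<lambda>x. ?S f x - f x) \<le> C * ?N (\<lambda>x. f x - h x) + e / 4"
      by (simp add: C_def algebra_simps)
    also have "C * ?N (\<lambda>x. f x - h x) \<le> C * (e / (2 * C))"
      using h(2) C by (intro mult_left_mono) auto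
    finally have "?N (\<lambda>x. ?S f x - f x) < e"
      using C e by simp
    moreover have "0 \<le> ?N (\<lambda>x. ?S f x - f x)"
      by (intro integral_nonneg_AE) auto
    ultimately show "norm (?N (\<lambda>x. smooth (u k) f x - f x) - 0) < e"
      by simp
  qed
qed

lemma smooth_B_norm:
  fixes f :: "'n::finite cfun"
  assumes u: "0 < u" "u < 1" and f: "f \<in> B_space"
  shows "B_norm (smooth u f) \<le> (1 / (1 - u) ^ (CARD('n) - 1)) * B_norm f"
proof (rule B_spaceI(2)[OF UC_L1[OF smooth_UC[OF u B_spaceD(1)[OF f]]]])
  fix r :: real assume e: "0 < r" "r \<le> 1"
  have ce: "0 < (1 - u) * r" "(1 - u) * r \<le> 1"
    using e u mult_mono[of "1 - u" 1 r 1] by auto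
  have "rosc r (smooth u f) \<le> (1 / (1 - u) ^ (CARD('n) - 1)) * rosc ((1 - u) * r) f"
    by (rule smooth_rosc[OF u B_spaceD(1)[OF f] e])
  also have "\<dots> \<le> (1 / (1 - u) ^ (CARD('n) - 1)) * B_norm f"
    using u by (intro mult_left_mono rosc_le_B_norm f ce) auto
  finally show "rosc r (smooth u f) \<le> (1 / (1 - u) ^ (CARD('n) - 1)) * B_norm f" .
qed

text \<open>Convergence holds in L^1, with asymptotically no loss of norm. Convergence in
  \<open>B_norm\<close> cannot be expected: uniformly continuous functions stay at distance at least
  \<open>limsup_osc f\<close>.\<close>

lemma UC_approximation:
  fixes f :: "'n::finite cfun"
  assumes f: "f \<in> B_space"
  obtains s a where "\<And>k :: nat. s k \<in> UC_space" "\<And>k. B_norm (s k) \<le> a k * B_norm f"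
    "a \<longlonglongrightarrow> (1 :: real)" "(\<lambda>k. \<integral>x. cmod (s k x - f x) \<partial>cube_measure) \<longlonglongrightarrow> 0"
proof -
  define u where "u k = 1 / real (Suc (Suc k))" for k
  have u: "0 < u k" "u k \<le> 1 / 2" "u k < 1" for k
    by (auto simp: u_def field_simps)
  have lim: "u \<longlonglongrightarrow> 0"
    unfolding u_def using LIMSEQ_Suc[OF LIMSEQ_inverse_real_of_nat] by (simp add: inverse_eq_divide)
  show thesis
  proof
    show "smooth (u k) f \<in> UC_space" for k
      by (rule smooth_UC[OF u(1,3) B_spaceD(1)[OF f]])
    show "B_norm (smooth (u k) f) \<le> (1 / (1 - u k) ^ (CARD('n) - 1)) * B_norm f" for k
      by (rule smooth_B_norm[OF u(1,3) f])
    have "(\<lambda>k. 1 / (1 - u k) ^ (CARD('n) - 1)) \<longlonglongrightarrow> 1 / (1 - 0) ^ (CARD('n) - 1)"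
      by (intro tendsto_intros lim) auto
    then show "(\<lambda>k. 1 / (1 - u k) ^ (CARD('n) - 1)) \<longlonglongrightarrow> 1" by simp
    show "(\<lambda>k. \<integral>x. cmod (smooth (u k) f x - f x) \<partial>cube_measure) \<longlonglongrightarrow> 0"
      by (rule smooth_tendsto_L1[OF B_spaceD(1)[OF f] u(1,2) lim])
  qed
qed

subsection \<open>Dyadic cubes\<close>

text \<open>Open cubes, as members of \<open>cube_families\<close> must be. The price is that a
  generation covers the unit cube only up to a null set, see \<open>dyadic_cover\<close>.\<close>

definition dyadic_box :: "nat \<Rightarrow> ('n \<Rightarrow> nat) \<Rightarrow> (real^'n) set" where
  "dyadic_box j k = box (\<chi> i. real (k i) / 2 ^ j) (\<chi> i. (real (k i) + 1) / 2 ^ j)"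

definition dyadic :: "nat \<Rightarrow> (real^'n) set set" where
  "dyadic j = dyadic_box j ` {k. \<forall>i. k i < 2 ^ j}"

lemma mem_dyadic_box:
  "x \<in> dyadic_box j k \<longleftrightarrow> (\<forall>i. real (k i) < 2 ^ j * x $ i \<and> 2 ^ j * x $ i < real (k i) + 1)"
  by (simp add: dyadic_box_def mem_box_cart field_simps)

lemma finite_dyadic: "finite (dyadic j :: (real^'n) set set)"
proof -
  have "{k :: 'n \<Rightarrow> nat. \<forall>i. k i < 2 ^ j} = (\<Pi>\<^sub>E i\<in>UNIV. {..<2 ^ j})"
    by (auto simp: PiE_UNIV_domain)
  moreover have "finite (\<Pi>\<^sub>E i\<in>(UNIV :: 'n set). {..<2 ^ j :: nat})"
    by (intro finite_PiE) auto
  ultimately show ?thesis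
    unfolding dyadic_def by simp
qed

lemma dyadic_cube:
  fixes Q :: "(real^'n) set"
  assumes "Q \<in> dyadic j"
  shows "eps_cube (1 / 2 ^ j) Q" "Q \<subseteq> unit_cube"
proof -
  obtain k where k: "\<And>i. k i < 2 ^ j" and Q: "Q = dyadic_box j k"
    using assms unfolding dyadic_def by auto
  have "(\<chi> i. (real (k i) + 1) / 2 ^ j) = (\<chi> i. (\<chi> i. real (k i) / 2 ^ j) $ i + 1 / 2 ^ j)"
    by (simp add: vec_eq_iff add_divide_distrib)
  then show "eps_cube (1 / 2 ^ j) Q"
    unfolding eps_cube_def Q dyadic_box_def by metis
  show "Q \<subseteq> unit_cube"
  proof
    fix x assume x: "x \<in> Q"
    show "x \<in> unit_cube"
      unfolding mem_box_cart
    proof (intro allI conjI)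
      fix i
      have "real (k i) < 2 ^ j * x $ i" "2 ^ j * x $ i < real (k i) + 1"
        using x by (auto simp: Q mem_dyadic_box)
      moreover have "real (k i) + 1 \<le> 2 ^ j"
        using k[of i] by (metis Suc_eq_plus1 Suc_leI of_nat_1 of_nat_add of_nat_le_iff of_nat_numeral of_nat_power)
      ultimately have "0 < 2 ^ j * x $ i" "2 ^ j * x $ i < 2 ^ j * 1"
        by linarith+
      then show "(0 :: real^'n) $ i < x $ i" "x $ i < (1 :: real^'n) $ i"
        by (simp_all add: zero_less_mult_iff)
    qed
  qed
qed

lemma measure_dyadic:
  fixes Q :: "(real^'n) set"
  assumes "Q \<in> dyadic j"
  shows "measure lebesgue Q = (1 / 2 ^ j) ^ CARD('n)" "0 < measure lebesgue Q" "Q \<in> sets lebesgue"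
  using eps_cubeD(1,2)[OF dyadic_cube(1)[OF assms]] by auto

lemma dyadic_level_unique:
  fixes Q :: "(real^'n) set"
  assumes "Q \<in> dyadic i" "Q \<in> dyadic j"
  shows "i = j"
proof -
  have "(1 / 2 ^ i :: real) ^ CARD('n) = (1 / 2 ^ j) ^ CARD('n)"
    using measure_dyadic(1)[OF assms(1)] measure_dyadic(1)[OF assms(2)] by simp
  then have "(1 / 2 ^ i :: real) = 1 / 2 ^ j"
    by (subst (asm) power_eq_iff_eq_base) auto
  then show ?thesis by simp
qed

lemma dyadic_nested:
  fixes Q R :: "(real^'n) set"
  assumes Q: "Q \<in> dyadic i" and R: "R \<in> dyadic j" and ij: "i \<le> j" and ne: "Q \<inter> R \<noteq> {}"
  shows "R \<subseteq> Q"
proof -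
  obtain k where Qk: "Q = dyadic_box i k"
    using Q unfolding dyadic_def by auto
  obtain l where Rl: "R = dyadic_box j l"
    using R unfolding dyadic_def by auto
  obtain x where x: "x \<in> dyadic_box i k" "x \<in> dyadic_box j l"
    using ne Qk Rl by auto
  define m :: nat where "m = 2 ^ (j - i)"
  have m: "2 ^ j = real m * 2 ^ i" "0 < real m"
    using ij by (auto simp: m_def power_add[symmetric])
  have bounds: "real m * real (k s) \<le> real (l s) \<and> real (l s) + 1 \<le> real m * real (k s) + real m" for s
  proof -
    have 1: "real (k s) < 2 ^ i * x $ s" "2 ^ i * x $ s < real (k s) + 1"
      and 2: "real (l s) < 2 ^ j * x $ s" "2 ^ j * x $ s < real (l s) + 1"
      using x by (auto simp: mem_dyadic_box)
    have "real m * real (k s) < real m * (2 ^ i * x $ s)" "real m * (2 ^ i * x $ s) < real m * (real (k s) + 1)"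
      using 1 m(2) by (auto intro: mult_strict_left_mono)
    then have "real m * real (k s) < real (l s) + 1" "real (l s) < real m * real (k s) + real m"
      using 2 by (auto simp: m(1) algebra_simps)
    \<comment> \<open>A common point gives strict inequalities with an error of one unit; as all
      quantities are integers, they improve to the exact comparison of the corners.\<close>
    then have "real (m * k s) < real (l s + 1)" "real (l s) < real (m * k s + m)"
      by simp_all
    then have "m * k s < l s + 1" "l s < m * k s + m"
      by (simp_all only: of_nat_less_iff)
    then have "m * k s \<le> l s" "l s + 1 \<le> m * k s + m"
      by simp_all
    then have "real (m * k s) \<le> real (l s)" "real (l s + 1) \<le> real (m * k s + m)"
      by (simp_all only: of_nat_le_iff)
    then show ?thesis by simp
  qed
  show "R \<subseteq> Q"
  proof
    fix y assume y: "y \<in> R"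
    show "y \<in> Q"
      unfolding Qk mem_dyadic_box
    proof (intro allI)
      fix s
      have "real (l s) < real m * (2 ^ i * y $ s)" "real m * (2 ^ i * y $ s) < real (l s) + 1"
        using y unfolding Rl mem_dyadic_box m(1) by (auto simp: mult.assoc)
      moreover have "real m * (real (k s) + 1) = real m * real (k s) + real m"
        by (simp add: distrib_left)
      ultimately have "real m * real (k s) < real m * (2 ^ i * y $ s)" "real m * (2 ^ i * y $ s) < real m * (real (k s) + 1)"
        using bounds[of s] by linarith+
      then show "real (k s) < 2 ^ i * y $ s \<and> 2 ^ i * y $ s < real (k s) + 1"
        using m(2) by (simp only: mult_less_cancel_left_pos)
    qed
  qed
qed

lemma dyadic_disjoint_level:
  assumes "Q \<in> dyadic j" "R \<in> dyadic j" "Q \<inter> R \<noteq> {}"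
  shows "Q = R"
  using dyadic_nested[OF assms(1,2) order_refl assms(3)] dyadic_nested[OF assms(2,1) order_refl] assms(3) by blast

lemma dyadic_parent:
  fixes Q :: "(real^'n) set"
  assumes "Q \<in> dyadic (Suc j)"
  obtains P where "P \<in> dyadic j" "Q \<subseteq> P"
proof -
  obtain k where k: "\<And>i. k i < 2 ^ Suc j" and Q: "Q = dyadic_box (Suc j) k"
    using assms unfolding dyadic_def by auto
  define l where "l i = k i div 2" for i
  have "l i < 2 ^ j" for i
    using k[of i] unfolding l_def by (simp add: less_mult_imp_div_less mult.commute)
  then have P: "dyadic_box j l \<in> dyadic j"
    unfolding dyadic_def by blast
  moreover have "Q \<subseteq> dyadic_box j l"
  proof
    fix x assume x: "x \<in> Q"
    show "x \<in> dyadic_box j l"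
      unfolding mem_dyadic_box
    proof (intro allI)
      fix i
      have "real (k i) < 2 * (2 ^ j * x $ i)" "2 * (2 ^ j * x $ i) < real (k i) + 1"
        using x by (auto simp: Q mem_dyadic_box mult.assoc)
      moreover have "2 * l i \<le> k i" "k i + 1 \<le> 2 * l i + 2"
        unfolding l_def by auto
      then have "2 * real (l i) \<le> real (k i)" "real (k i) + 1 \<le> 2 * real (l i) + 2"
        by linarith+
      ultimately show "real (l i) < 2 ^ j * x $ i \<and> 2 ^ j * x $ i < real (l i) + 1"
        by linarith
    qed
  qed
  ultimately show thesis by (rule that)
qed

lemma dyadic_0: "dyadic 0 = {unit_cube :: (real^'n) set}"
proof -
  have "{k :: 'n \<Rightarrow> nat. \<forall>i. k i < 2 ^ 0} = {\<lambda>i. 0}"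
    by auto
  moreover have "dyadic_box 0 (\<lambda>i. 0) = (unit_cube :: (real^'n) set)"
    by (auto simp: mem_dyadic_box mem_box_cart)
  ultimately show ?thesis
    unfolding dyadic_def by simp
qed

lemma dyadic_cover: "AE x in (cube_measure :: (real^'n) measure). x \<in> \<Union>(dyadic n)"
proof -
  define N :: "(real^'n) set" where "N = (\<Union>i\<in>UNIV. \<Union>k\<in>{..2 ^ n}. {x. x $ i = real k / 2 ^ n})"
  have "negligible N"
  proof -
    have "negligible {x :: real^'n. x $ i = c}" for i c
    proof -
      have "axis i (1 :: real) \<in> Basis"
        by (auto simp: Basis_vec_def)
      from negligible_standard_hyperplane[OF this, of c] show ?thesis
        by (simp add: cart_eq_inner_axis)
    qed
    then show ?thesis
      unfolding N_def by (auto intro!: negligible_Union)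
  qed
  then have "AE x in lebesgue. x \<notin> N"
    by (intro AE_not_in) (simp add: negligible_iff_null_sets)
  moreover have "x \<in> \<Union>(dyadic n)" if x: "x \<in> unit_cube" "x \<notin> N" for x :: "real^'n"
  proof -
    define k where "k i = nat \<lfloor>2 ^ n * x $ i\<rfloor>" for i
    have xi: "0 < x $ i" "x $ i < 1" for i
      using x(1) by (auto simp: mem_box_cart)
    have fl: "0 \<le> \<lfloor>2 ^ n * x $ i\<rfloor>" for i
      using xi[of i] by simp
    have rk: "real (k i) = of_int \<lfloor>2 ^ n * x $ i\<rfloor>" for i
      using fl[of i] by (simp add: k_def)
    have le: "real (k i) \<le> 2 ^ n * x $ i" "2 ^ n * x $ i < real (k i) + 1" for i
      unfolding rk by linarith+
    have k2: "k i < 2 ^ n" for i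
    proof -
      have "2 ^ n * x $ i < 2 ^ n * 1"
        using xi[of i] by (intro mult_strict_left_mono) auto
      then have "real (k i) < 2 ^ n" using le(1)[of i] by linarith
      then show ?thesis by (metis of_nat_less_iff of_nat_numeral of_nat_power)
    qed
    have "real (k i) \<noteq> 2 ^ n * x $ i" for i
    proof
      assume "real (k i) = 2 ^ n * x $ i"
      then have "x $ i = real (k i) / 2 ^ n" by simp
      then have "x \<in> N"
        unfolding N_def using less_imp_le[OF k2[of i]] by blast
      then show False using x(2) by simp
    qed
    then have "x \<in> dyadic_box n k"
      unfolding mem_dyadic_box using le by (metis order_le_less)
    then show ?thesis
      unfolding dyadic_def using k2 by blast
  qed
  ultimately show ?thesis
    by (auto simp: AE_restrict_space_iff elim!: eventually_mono)
qed

text \<open>The number 2^(j (d-1)) is the cardinality bound eps^(1-d) at eps = 2^(-j).\<close>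

lemma dyadic_family:
  fixes \<G> :: "(real^'n) set set"
  assumes "\<G> \<subseteq> dyadic j" "card \<G> \<le> 2 ^ (j * (CARD('n) - 1))"
  shows "\<G> \<in> cube_families (1 / 2 ^ j)"
  unfolding cube_families_def
proof (intro CollectI conjI ballI)
  fix Q assume "Q \<in> \<G>"
  then show "eps_cube (1 / 2 ^ j) Q" "Q \<subseteq> unit_cube"
    using assms(1) dyadic_cube by blast+
next
  show "disjoint \<G>"
    unfolding disjoint_def using assms(1) dyadic_disjoint_level by blast
  show "finite \<G>"
    using assms(1) finite_dyadic finite_subset by blast
  have "real (card \<G>) \<le> real (2 ^ (j * (CARD('n) - 1)))"
    using assms(2) by (simp only: of_nat_le_iff)
  also have "\<dots> = (2 ^ j) ^ (CARD('n) - 1)"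
    by (simp add: power_mult)
  also have "\<dots> = (2 ^ j :: real) powr (real CARD('n) - 1)"
    by (simp add: powr_realpow[symmetric] of_nat_diff Suc_le_eq)
  also have "\<dots> = (1 / 2 ^ j) powr (1 - real CARD('n))"
    by (simp add: powr_divide powr_minus_divide[symmetric])
  finally show "real (card \<G>) \<le> (1 / 2 ^ j) powr (1 - real CARD('n))" .
qed

lemma sum_integral_disjoint_le:
  fixes h :: "real^'n \<Rightarrow> real"
  assumes fin: "finite \<G>" and disj: "disjoint \<G>" and sub: "\<And>R. R \<in> \<G> \<Longrightarrow> R \<subseteq> Q"
    and meas: "\<And>R. R \<in> \<G> \<Longrightarrow> R \<in> sets lebesgue" and h: "set_integrable lebesgue Q h" and nn: "\<And>x. 0 \<le> h x"
  shows "(\<Sum>R\<in>\<G>. LINT x:R|lebesgue. h x) \<le> (LINT x:Q|lebesgue. h x)"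
proof -
  have int: "set_integrable lebesgue R h" if "R \<in> \<G>" for R
    using set_integrable_subset[OF h meas[OF that] sub[OF that]] .
  have "(\<Sum>R\<in>\<G>. LINT x:R|lebesgue. h x) = (\<integral>x. (\<Sum>R\<in>\<G>. indicator R x *\<^sub>R h x) \<partial>lebesgue)"
    unfolding set_lebesgue_integral_def using int
    by (intro Bochner_Integration.integral_sum[symmetric]) (auto simp: set_integrable_def)
  also have "\<dots> \<le> (LINT x:Q|lebesgue. h x)"
    unfolding set_lebesgue_integral_def
  proof (rule integral_mono)
    show "integrable lebesgue (\<lambda>x. \<Sum>R\<in>\<G>. indicator R x *\<^sub>R h x)"
      using int by (intro Bochner_Integration.integrable_sum) (auto simp: set_integrable_def)
    show "integrable lebesgue (\<lambda>x. indicator Q x *\<^sub>R h x)"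
      using h by (simp add: set_integrable_def)
    fix x
    show "(\<Sum>R\<in>\<G>. indicator R x *\<^sub>R h x) \<le> indicator Q x *\<^sub>R h x"
    proof (cases "x \<in> \<Union>\<G>")
      case True
      then obtain S where S: "S \<in> \<G>" "x \<in> S" by auto
      have "(\<Sum>R\<in>\<G>. indicator R x *\<^sub>R h x) = (\<Sum>R\<in>\<G>. if R = S then h x else 0)"
      proof (rule sum.cong[OF refl])
        fix R assume "R \<in> \<G>"
        then have "R = S \<or> x \<notin> R"
          using S disj unfolding disjoint_def by blast
        then show "indicator R x *\<^sub>R h x = (if R = S then h x else 0)"
          using S by auto
      qed
      then show ?thesis
        using S fin sub[OF S(1)] by auto
    next
      case False
      then have "(\<Sum>R\<in>\<G>. indicator R x *\<^sub>R h x) = 0"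
        by (intro sum.neutral) auto
      then show ?thesis
        using nn[of x] by (simp add: indicator_def)
    qed
  qed
  finally show ?thesis .
qed

subsection \<open>Embedding of \<open>B\<close> into \<open>L\<^sup>p\<close>\<close>

text \<open>
  A Calderon--Zygmund argument: for disjoint dyadic cubes of arbitrary sizes, the mean
  oscillations satisfy a Garsia--Rodemich estimate, which turns into a recursive inequality
  between the measures of the level sets of the (truncated) dyadic maximal function.
\<close>

context
  fixes f :: "'n::finite cfun" and \<beta> :: real
  assumes f: "f \<in> B_space" and \<beta>: "B_norm f \<le> \<beta>" "0 < \<beta>"
begin

lemma dyadic_osc_sum_small:
  assumes "\<G> \<subseteq> dyadic j" "card \<G> \<le> 2 ^ (j * (CARD('n) - 1))"
  shows "(\<Sum>Q\<in>\<G>. cube_osc Q f) \<le> 2 ^ (j * (CARD('n) - 1)) * \<beta>"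
proof -
  have "osc_sum (1 / 2 ^ j) \<G> f \<le> \<beta>"
    using osc_sum_le_B_norm[OF f _ _ dyadic_family[OF assms]] \<beta>(1) by (auto simp: divide_le_eq)
  moreover have "(1 / 2 ^ j :: real) ^ (CARD('n) - 1) = 1 / 2 ^ (j * (CARD('n) - 1))"
    by (simp add: power_one_over power_mult)
  ultimately have "(\<Sum>Q\<in>\<G>. cube_osc Q f) / 2 ^ (j * (CARD('n) - 1)) \<le> \<beta>"
    by (simp add: osc_sum_def)
  then show ?thesis
    by (simp add: divide_le_eq mult.commute)
qed

text \<open>A family that is too large is cut into blocks of the largest admissible size N = 2^(j
  (d-1)), each contributing at most N \<open>\<beta>\<close>. The possibly incomplete last block
  accounts for the extra N.\<close>

lemma dyadic_osc_sum:
  assumes "\<G> \<subseteq> dyadic j"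
  shows "(\<Sum>Q\<in>\<G>. cube_osc Q f) \<le> (real (card \<G>) + 2 ^ (j * (CARD('n) - 1))) * \<beta>"
  using assms
proof (induction "card \<G>" arbitrary: \<G> rule: less_induct)
  case less
  define N :: nat where "N = 2 ^ (j * (CARD('n) - 1))"
  have N: "0 < N" "real N = 2 ^ (j * (CARD('n) - 1))"
    by (auto simp: N_def)
  have fin: "finite \<G>"
    using less.prems finite_dyadic finite_subset by blast
  show ?case
  proof (cases "card \<G> \<le> N")
    case True
    then have "(\<Sum>Q\<in>\<G>. cube_osc Q f) \<le> real N * \<beta>"
      using dyadic_osc_sum_small[OF less.prems] by (simp add: N_def)
    also have "\<dots> \<le> (real (card \<G>) + real N) * \<beta>"
      using \<beta> by (intro mult_right_mono) auto
    finally show ?thesis by (simp add: N)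
  next
    case False
    then obtain H where H: "H \<subseteq> \<G>" "card H = N"
      using obtain_subset_with_card_n[of N \<G>] by auto
    have finH: "finite H" using H fin finite_subset by blast
    have cardD: "card (\<G> - H) = card \<G> - N"
      using H finH by (simp add: card_Diff_subset)
    have "(\<Sum>Q\<in>\<G>. cube_osc Q f) = (\<Sum>Q\<in>\<G> - H. cube_osc Q f) + (\<Sum>Q\<in>H. cube_osc Q f)"
      by (rule sum.subset_diff[OF H(1) fin])
    also have "(\<Sum>Q\<in>\<G> - H. cube_osc Q f) \<le> (real (card (\<G> - H)) + 2 ^ (j * (CARD('n) - 1))) * \<beta>"
      using False N cardD less.prems by (intro less.hyps) auto
    also have "(\<Sum>Q\<in>H. cube_osc Q f) \<le> real N * \<beta>"
      using dyadic_osc_sum_small[of H j] H less.prems by (auto simp: N_def)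
    finally show ?thesis
      using False unfolding cardD by (simp add: of_nat_diff N(2)[symmetric] algebra_simps)
  qed
qed

section \<open>Stopping cubes and the decay of level sets\<close>

definition mean_dev :: "(real^'n) set \<Rightarrow> real" where
  "mean_dev Q = 1 / measure lebesgue Q * (LINT x:Q|lebesgue. cmod (f x - (CINT y. f y)))"

text \<open>Restricting to generations up to n makes the collection finite, so every big cube lies
  in a maximal one. For uniformly continuous functions a suitable n is found in
  \<open>UC_level_set\<close>.\<close>

definition big_cubes :: "nat \<Rightarrow> real \<Rightarrow> (real^'n) set set" where
  "big_cubes n \<tau> = {Q \<in> (\<Union>j\<le>n. dyadic j). \<tau> < mean_dev Q}"

definition stopping_cubes :: "nat \<Rightarrow> real \<Rightarrow> (real^'n) set set" where
  "stopping_cubes n \<tau> = {Q \<in> big_cubes n \<tau>. \<forall>P\<in>big_cubes n \<tau>. Q \<subseteq> P \<longrightarrow> Q = P}"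

text \<open>As the stopping cubes are disjoint, this is the measure of the set where the dyadic
  maximal function of f - mean, truncated at generation n, exceeds \<open>\<tau>\<close>.\<close>

definition level_measure :: "nat \<Rightarrow> real \<Rightarrow> real" where
  "level_measure n \<tau> = (\<Sum>Q\<in>stopping_cubes n \<tau>. measure lebesgue Q)"

lemma dyadic_dev_integrable:
  assumes "Q \<in> dyadic j"
  shows "set_integrable lebesgue Q (\<lambda>x. cmod (f x - c))"
  by (rule cube_set_integrable_dist[OF dyadic_cube[OF assms] _ B_spaceD(1)[OF f]]) simp

lemma finite_big_cubes: "finite (big_cubes n \<tau>)"
  unfolding big_cubes_def by (rule finite_subset[of _ "\<Union>j\<le>n. dyadic j"]) (auto simp: finite_dyadic)

lemma finite_stopping: "finite (stopping_cubes n \<tau>)"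
  unfolding stopping_cubes_def using finite_big_cubes by auto

lemma stopping_cubesD:
  assumes "Q \<in> stopping_cubes n \<tau>"
  obtains j where "j \<le> n" "Q \<in> dyadic j" "\<tau> < mean_dev Q"
  using assms unfolding stopping_cubes_def big_cubes_def by auto

lemma disjoint_stopping: "disjoint (stopping_cubes n \<tau>)"
  unfolding disjoint_def
proof (intro ballI impI)
  fix Q R assume Q: "Q \<in> stopping_cubes n \<tau>" and R: "R \<in> stopping_cubes n \<tau>" and ne: "Q \<noteq> R"
  obtain i where i: "Q \<in> dyadic i" by (rule stopping_cubesD[OF Q])
  obtain j where j: "R \<in> dyadic j" by (rule stopping_cubesD[OF R])
  show "Q \<inter> R = {}"
  proof (rule ccontr)
    assume "Q \<inter> R \<noteq> {}"
    then have "Q \<subseteq> R \<or> R \<subseteq> Q"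
      using dyadic_nested[OF i j] dyadic_nested[OF j i] by (cases "i \<le> j") auto
    then show False
      using Q R ne unfolding stopping_cubes_def by auto
  qed
qed

lemma stopping_above:
  assumes "Q \<in> big_cubes n \<tau>"
  obtains P where "P \<in> stopping_cubes n \<tau>" "Q \<subseteq> P"
  using finite_has_maximal2[OF finite_big_cubes assms] unfolding stopping_cubes_def by blast

lemma level_measure_nonneg: "0 \<le> level_measure n \<tau>"
  unfolding level_measure_def by (intro sum_nonneg) auto

lemma level_measure_le_1: "level_measure n \<tau> \<le> 1"
proof -
  have one: "(LINT x:Q|lebesgue. (1 :: real)) = measure lebesgue Q" if "Q \<in> dyadic j" for Q :: "(real^'n) set" and j
    using set_integral_const_cube[OF dyadic_cube(1)[OF that], of "1 :: real"] by simp
  have "level_measure n \<tau> = (\<Sum>Q\<in>stopping_cubes n \<tau>. LINT x:Q|lebesgue. (1 :: real))"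
    unfolding level_measure_def by (intro sum.cong refl) (metis one stopping_cubesD)
  also have "\<dots> \<le> (LINT x:(unit_cube :: (real^'n) set)|lebesgue. (1 :: real))"
  proof (rule sum_integral_disjoint_le[OF finite_stopping disjoint_stopping])
    show "R \<subseteq> unit_cube" "R \<in> sets lebesgue" if "R \<in> stopping_cubes n \<tau>" for R
      using stopping_cubesD[OF that] dyadic_cube(2) measure_dyadic(3) by metis+
    show "set_integrable lebesgue unit_cube (\<lambda>x :: real^'n. 1 :: real)"
      by (intro set_integrable_const_cube) auto
  qed auto
  also have "\<dots> = 1"
    using one[of unit_cube 0] measure_unit_cube[where 'n='n] by (simp add: dyadic_0)
  finally show ?thesis .
qed

text \<open>The parent of a stopping cube is not big, and passing to the parent multiplies the
  volume by 2^d. The unit cube has no parent, but for \<open>\<beta>\<close> <=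
  \<open>\<tau>\<close> it is never big, since its mean deviation is at most
  \<open>B_norm f\<close>.\<close>

lemma stopping_mean_dev:
  assumes Q: "Q \<in> stopping_cubes n \<tau>" and \<tau>: "\<beta> \<le> \<tau>"
  shows "mean_dev Q \<le> 2 ^ CARD('n) * \<tau>"
proof -
  obtain j where j: "j \<le> n" "Q \<in> dyadic j" "\<tau> < mean_dev Q"
    by (rule stopping_cubesD[OF Q])
  show ?thesis
  proof (cases j)
    case 0
    then have "Q = unit_cube" using j(2) by (simp add: dyadic_0)
    then have "mean_dev Q = (CINT x. cmod (f x - (CINT y. f y)))"
      using measure_unit_cube[where 'n='n] by (simp add: mean_dev_def LINT_unit_cube)
    then have "mean_dev Q \<le> \<tau>"
      using mean_deviation_le_B_norm[OF f] \<beta> \<tau> by simp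
    then show ?thesis using j(3) by simp
  next
    case (Suc i)
    then obtain P where P: "P \<in> dyadic i" "Q \<subseteq> P"
      using dyadic_parent j(2) by blast
    have "i \<noteq> j" using Suc by simp
    then have "Q \<noteq> P"
      using dyadic_level_unique P(1) j(2) by blast
    then have "P \<notin> big_cubes n \<tau>"
      using Q P(2) unfolding stopping_cubes_def by auto
    then have PA: "mean_dev P \<le> \<tau>"
      using P(1) j(1) Suc unfolding big_cubes_def by auto
    have "(1 / 2 ^ i :: real) = 2 * (1 / 2 ^ j)"
      using Suc by simp
    then have mP: "measure lebesgue P = 2 ^ CARD('n) * measure lebesgue Q"
      unfolding measure_dyadic(1)[OF P(1)] measure_dyadic(1)[OF j(2)] by (simp only: power_mult_distrib)
    have "(LINT x:Q|lebesgue. cmod (f x - (CINT y. f y))) \<le> (LINT x:P|lebesgue. cmod (f x - (CINT y. f y)))"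
      using sum_integral_disjoint_le[of "{Q}" P, OF _ _ _ _ dyadic_dev_integrable[OF P(1)]] P(2) measure_dyadic(3)[OF j(2)]
      by (auto simp: disjoint_def)
    also have "\<dots> = measure lebesgue P * mean_dev P"
      using measure_dyadic(2)[OF P(1)] by (simp add: mean_dev_def)
    also have "\<dots> \<le> measure lebesgue P * \<tau>"
      using PA by (intro mult_left_mono) auto
    finally show ?thesis
      using measure_dyadic(2)[OF j(2)] by (simp add: mP mean_dev_def divide_le_eq mult.commute mult.left_commute)
  qed
qed

lemma measure_times_cube_osc:
  assumes "Q \<in> dyadic j"
  shows "(LINT x:Q|lebesgue. cmod (f x - average Q f)) = measure lebesgue Q * cube_osc Q f"
  using measure_dyadic(2)[OF assms] by (simp add: cube_osc_def)

text \<open>In generation j, \<open>dyadic_osc_sum\<close> yields \<open>\<beta>\<close> times the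
  volume plus an excess \<open>\<beta>\<close> 2^(-j). The excesses form a geometric series
  dominated by twice the term of the coarsest occurring generation j0. A single cube of that
  generation has volume 2^(-j0 d), which is at most the total volume M, so 2^(-j0) <= M^(1/d). As M
  <= 1, the volume part is also at most \<open>\<beta>\<close> M^(1/d); this makes 1 + 2 =
  3.\<close>

lemma Garsia_Rodemich:
  "(\<Sum>Q\<in>stopping_cubes n \<tau>. LINT x:Q|lebesgue. cmod (f x - average Q f)) \<le> 3 * \<beta> * level_measure n \<tau> powr (1 / real CARD('n))"
proof (cases "stopping_cubes n \<tau> = {}")
  case True
  then show ?thesis using \<beta> by simp
next
  case False
  let ?S = "stopping_cubes n \<tau>"
  let ?M = "level_measure n \<tau>"
  have split: "(\<Sum>Q\<in>?S. w Q) = (\<Sum>j\<le>n. \<Sum>Q\<in>?S \<inter> dyadic j. w Q)" for w :: "(real^'n) set \<Rightarrow> real"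
  proof -
    have "?S = (\<Union>j\<in>{..n}. ?S \<inter> dyadic j)"
      unfolding stopping_cubes_def big_cubes_def by auto
    then have "(\<Sum>Q\<in>?S. w Q) = (\<Sum>Q\<in>(\<Union>j\<in>{..n}. ?S \<inter> dyadic j). w Q)"
      by simp
    also have "\<dots> = (\<Sum>j\<le>n. \<Sum>Q\<in>?S \<inter> dyadic j. w Q)"
      using finite_stopping by (intro sum.UNION_disjoint) (auto dest: dyadic_level_unique)
    finally show ?thesis .
  qed
  obtain Q0 where Q0: "Q0 \<in> ?S" using False by auto
  obtain j1 where j1: "Q0 \<in> dyadic j1" by (rule stopping_cubesD[OF Q0])
  define j0 where "j0 = (LEAST j. ?S \<inter> dyadic j \<noteq> {})"
  have j0: "?S \<inter> dyadic j0 \<noteq> {}"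
    unfolding j0_def by (rule LeastI[of _ j1]) (use Q0 j1 in auto)
  have j0_le: "j0 \<le> j" if "?S \<inter> dyadic j \<noteq> {}" for j
    unfolding j0_def using that by (rule Least_le)
  obtain Q1 where Q1: "Q1 \<in> ?S" "Q1 \<in> dyadic j0" using j0 by auto
  have "measure lebesgue Q1 \<le> ?M"
    unfolding level_measure_def using Q1 finite_stopping by (intro member_le_sum) auto
  then have "(1 / 2 ^ j0) ^ CARD('n) \<le> ?M"
    using measure_dyadic(1)[OF Q1(2)] by simp
  then have "((1 / 2 ^ j0) ^ CARD('n)) powr (1 / real CARD('n)) \<le> ?M powr (1 / real CARD('n))"
    by (intro powr_mono2) auto
  moreover have "((1 / 2 ^ j0 :: real) ^ CARD('n)) powr (1 / real CARD('n)) = 1 / 2 ^ j0"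
    by (subst powr_realpow[symmetric]) (auto simp: powr_powr)
  ultimately have scale: "1 / 2 ^ j0 \<le> ?M powr (1 / real CARD('n))"
    by simp
  have "?M powr 1 \<le> ?M powr (1 / real CARD('n))"
    using level_measure_nonneg level_measure_le_1 by (intro powr_mono') (auto simp: divide_le_eq)
  then have M_le: "?M \<le> ?M powr (1 / real CARD('n))"
    using level_measure_nonneg by simp
  have level: "(\<Sum>Q\<in>?S \<inter> dyadic j. LINT x:Q|lebesgue. cmod (f x - average Q f))
      \<le> \<beta> * (\<Sum>Q\<in>?S \<inter> dyadic j. measure lebesgue Q) + (if j0 \<le> j then \<beta> * (1 / 2 ^ j) else 0)" for j
  proof (cases "?S \<inter> dyadic j = {}")
    case True
    then show ?thesis using \<beta> by simp
  next
    case ne: False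
    let ?q = "(1 / 2 ^ j :: real) ^ CARD('n)"
    have "(\<Sum>Q\<in>?S \<inter> dyadic j. LINT x:Q|lebesgue. cmod (f x - average Q f)) = (\<Sum>Q\<in>?S \<inter> dyadic j. ?q * cube_osc Q f)"
    proof (rule sum.cong[OF refl])
      fix Q assume Q: "Q \<in> ?S \<inter> dyadic j"
      then show "(LINT x:Q|lebesgue. cmod (f x - average Q f)) = ?q * cube_osc Q f"
        using measure_times_cube_osc[of Q j] measure_dyadic(1)[of Q j] by auto
    qed
    also have "\<dots> = ?q * (\<Sum>Q\<in>?S \<inter> dyadic j. cube_osc Q f)"
      by (simp only: sum_distrib_left)
    also have "\<dots> \<le> ?q * ((real (card (?S \<inter> dyadic j)) + 2 ^ (j * (CARD('n) - 1))) * \<beta>)"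
      by (intro mult_left_mono dyadic_osc_sum) auto
    also have "\<dots> = \<beta> * (real (card (?S \<inter> dyadic j)) * ?q) + \<beta> * (?q * 2 ^ (j * (CARD('n) - 1)))"
      by (simp add: algebra_simps)
    also have "real (card (?S \<inter> dyadic j)) * ?q = (\<Sum>Q\<in>?S \<inter> dyadic j. ?q)"
      by simp
    also have "\<dots> = (\<Sum>Q\<in>?S \<inter> dyadic j. measure lebesgue Q)"
      by (intro sum.cong refl) (metis IntE measure_dyadic(1))
    also have "?q * 2 ^ (j * (CARD('n) - 1)) = 1 / 2 ^ j"
      unfolding power_card[where 'n='n, of "1 / 2 ^ j"] by (simp add: power_one_over power_mult)
    finally show ?thesis
      using j0_le[OF ne] by simp
  qed
  have geo: "(\<Sum>j\<le>n. if j0 \<le> j then \<beta> * (1 / 2 ^ j) else 0) \<le> 2 * \<beta> * (1 / 2 ^ j0)"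
  proof -
    \<comment> \<open>Keeping the remainder of the geometric series in the claim makes the induction
      on n close.\<close>
    have g: "(\<Sum>j\<le>n. if j0 \<le> j then (1 / 2 ^ j :: real) else 0) \<le> 2 / 2 ^ j0 - (if j0 \<le> n then 1 / 2 ^ n else 0)"
    proof (induction n)
      case (Suc n)
      then show ?case
        by (cases "j0 \<le> n"; cases "j0 = Suc n") auto
    qed auto
    have "(\<Sum>j\<le>n. if j0 \<le> j then \<beta> * (1 / 2 ^ j) else 0) = \<beta> * (\<Sum>j\<le>n. if j0 \<le> j then (1 / 2 ^ j :: real) else 0)"
      unfolding sum_distrib_left by (intro sum.cong) auto
    also have "(\<Sum>j\<le>n. if j0 \<le> j then (1 / 2 ^ j :: real) else 0) \<le> 2 / 2 ^ j0"
      using g by (rule order_trans) auto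
    finally show ?thesis
      using \<beta> by (simp add: mult.commute)
  qed
  have "(\<Sum>Q\<in>?S. LINT x:Q|lebesgue. cmod (f x - average Q f))
      \<le> (\<Sum>j\<le>n. \<beta> * (\<Sum>Q\<in>?S \<inter> dyadic j. measure lebesgue Q) + (if j0 \<le> j then \<beta> * (1 / 2 ^ j) else 0))"
    unfolding split[of "\<lambda>Q. LINT x:Q|lebesgue. cmod (f x - average Q f)"] by (intro sum_mono level)
  also have "\<dots> = \<beta> * ?M + (\<Sum>j\<le>n. if j0 \<le> j then \<beta> * (1 / 2 ^ j) else 0)"
    unfolding sum.distrib level_measure_def split[of "measure lebesgue"] by (simp only: sum_distrib_left)
  also have "\<dots> \<le> \<beta> * ?M powr (1 / real CARD('n)) + 2 * \<beta> * ?M powr (1 / real CARD('n))"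
    using geo M_le scale \<beta>
    by (intro add_mono mult_left_mono order_trans[OF geo]) auto
  finally show ?thesis by simp
qed

text \<open>Every stopping cube R of the higher level lies in one of level \<open>\<tau>\<close>,
  whose average differs from the mean of f by at most 2^d \<open>\<tau>\<close>. Of the level (2^d +
  3) \<open>\<tau>\<close> reached on R, at least 3 \<open>\<tau>\<close> is therefore oscillation
  about that average. Summing with \<open>Garsia_Rodemich\<close> bounds 3 \<open>\<tau>\<close>
  times the new volume by 3 \<open>\<beta>\<close> times the power of the old one.\<close>

lemma level_measure_step:
  assumes \<tau>: "\<beta> \<le> \<tau>"
  shows "\<tau> * level_measure n ((2 ^ CARD('n) + 3) * \<tau>) \<le> \<beta> * level_measure n \<tau> powr (1 / real CARD('n))"
proof -
  let ?K = "2 ^ CARD('n) + 3 :: real"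
  let ?S = "stopping_cubes n \<tau>" and ?S' = "stopping_cubes n (?K * \<tau>)"
  let ?m = "CINT y. f y"
  have \<tau>0: "0 < \<tau>" using \<tau> \<beta> by simp
  have "\<exists>Q\<in>?S. R \<subseteq> Q" if R: "R \<in> ?S'" for R
  proof -
    obtain j where j: "j \<le> n" "R \<in> dyadic j" "?K * \<tau> < mean_dev R"
      by (rule stopping_cubesD[OF R])
    have "\<tau> \<le> ?K * \<tau>"
      using \<tau>0 by (simp add: algebra_simps)
    then have "R \<in> big_cubes n \<tau>"
      using j unfolding big_cubes_def by auto
    then show ?thesis using stopping_above by metis
  qed
  then obtain q where q: "\<And>R. R \<in> ?S' \<Longrightarrow> q R \<in> ?S" "\<And>R. R \<in> ?S' \<Longrightarrow> R \<subseteq> q R"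
    by metis
  have each: "?K * \<tau> * measure lebesgue R \<le> (LINT x:R|lebesgue. cmod (f x - average (q R) f)) + 2 ^ CARD('n) * \<tau> * measure lebesgue R"
    if R: "R \<in> ?S'" for R
  proof -
    obtain j where j: "j \<le> n" "R \<in> dyadic j" "?K * \<tau> < mean_dev R"
      by (rule stopping_cubesD[OF R])
    obtain i where i: "q R \<in> dyadic i"
      by (rule stopping_cubesD[OF q(1)[OF R]])
    have "cmod (average (q R) f - ?m) \<le> mean_dev (q R)"
      unfolding mean_dev_def by (rule average_dist_le[OF dyadic_cube[OF i] _ B_spaceD(1)[OF f]]) simp
    also have "\<dots> \<le> 2 ^ CARD('n) * \<tau>"
      by (rule stopping_mean_dev[OF q(1)[OF R] \<tau>])
    finally have avg: "cmod (average (q R) f - ?m) \<le> 2 ^ CARD('n) * \<tau>" .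
    have const: "set_integrable lebesgue R (\<lambda>x. 2 ^ CARD('n) * \<tau> :: real)"
      by (intro set_integrable_const_cube measure_dyadic(3)[OF j(2)] dyadic_cube(2)[OF j(2)])
    have "?K * \<tau> * measure lebesgue R \<le> mean_dev R * measure lebesgue R"
      using j(3) by (intro mult_right_mono) auto
    also have "\<dots> = (LINT x:R|lebesgue. cmod (f x - ?m))"
      using measure_dyadic(2)[OF j(2)] by (simp add: mean_dev_def)
    also have "\<dots> \<le> (LINT x:R|lebesgue. cmod (f x - average (q R) f) + 2 ^ CARD('n) * \<tau>)"
    proof (rule set_integral_mono)
      show "cmod (f x - ?m) \<le> cmod (f x - average (q R) f) + 2 ^ CARD('n) * \<tau>" for x
        using norm_triangle_ineq[of "f x - average (q R) f" "average (q R) f - ?m"] avg by simp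
    qed (intro set_integral_add dyadic_dev_integrable[OF j(2)] const)+
    also have "\<dots> = (LINT x:R|lebesgue. cmod (f x - average (q R) f)) + (LINT x:R|lebesgue. 2 ^ CARD('n) * \<tau>)"
      by (intro set_integral_add(2) dyadic_dev_integrable[OF j(2)] const)
    also have "(LINT x:R|lebesgue. 2 ^ CARD('n) * \<tau>) = 2 ^ CARD('n) * \<tau> * measure lebesgue R"
      by (subst set_integral_const_cube[OF dyadic_cube(1)[OF j(2)]]) (simp_all add: mult.commute)
    finally show ?thesis .
  qed
  have "?K * \<tau> * level_measure n (?K * \<tau>) = (\<Sum>R\<in>?S'. ?K * \<tau> * measure lebesgue R)"
    unfolding level_measure_def by (rule sum_distrib_left)
  also have "\<dots> \<le> (\<Sum>R\<in>?S'. (LINT x:R|lebesgue. cmod (f x - average (q R) f)) + 2 ^ CARD('n) * \<tau> * measure lebesgue R)"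
    by (intro sum_mono each)
  also have "\<dots> = (\<Sum>R\<in>?S'. LINT x:R|lebesgue. cmod (f x - average (q R) f)) + 2 ^ CARD('n) * \<tau> * level_measure n (?K * \<tau>)"
    unfolding sum.distrib level_measure_def by (simp only: sum_distrib_left)
  also have "(\<Sum>R\<in>?S'. LINT x:R|lebesgue. cmod (f x - average (q R) f))
      = (\<Sum>Q\<in>?S. \<Sum>R\<in>{R \<in> ?S'. q R = Q}. LINT x:R|lebesgue. cmod (f x - average (q R) f))"
    using q(1) by (intro sum.group[symmetric] finite_stopping) auto
  also have "\<dots> \<le> (\<Sum>Q\<in>?S. LINT x:Q|lebesgue. cmod (f x - average Q f))"
  proof (rule sum_mono)
    fix Q assume Q: "Q \<in> ?S"
    obtain i where i: "Q \<in> dyadic i" by (rule stopping_cubesD[OF Q])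
    have "(\<Sum>R\<in>{R \<in> ?S'. q R = Q}. LINT x:R|lebesgue. cmod (f x - average (q R) f))
        = (\<Sum>R\<in>{R \<in> ?S'. q R = Q}. LINT x:R|lebesgue. cmod (f x - average Q f))"
      by (intro sum.cong) auto
    also have "\<dots> \<le> (LINT x:Q|lebesgue. cmod (f x - average Q f))"
    proof (rule sum_integral_disjoint_le[OF _ _ _ _ dyadic_dev_integrable[OF i]])
      show "disjoint {R \<in> ?S'. q R = Q}"
        using disjoint_stopping[of n "?K * \<tau>"] unfolding disjoint_def by auto
      show "R \<in> sets lebesgue" if R: "R \<in> {R \<in> ?S'. q R = Q}" for R
      proof -
        have "R \<in> ?S'" using R by simp
        then show ?thesis using stopping_cubesD measure_dyadic(3) by metis
      qed
      show "R \<subseteq> Q" if "R \<in> {R \<in> ?S'. q R = Q}" for R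
        using q(2)[of R] that by auto
    qed (use finite_stopping in auto)
    finally show "(\<Sum>R\<in>{R \<in> ?S'. q R = Q}. LINT x:R|lebesgue. cmod (f x - average (q R) f)) \<le> (LINT x:Q|lebesgue. cmod (f x - average Q f))" .
  qed
  also have "\<dots> \<le> 3 * \<beta> * level_measure n \<tau> powr (1 / real CARD('n))"
    by (rule Garsia_Rodemich)
  finally show ?thesis
    by (simp add: algebra_simps)
qed

text \<open>Iterating M(m+1) <= K^(-m) M(m)^\<open>\<theta>\<close>, the rate K^(-m t) reproduces
  itself exactly when 1 + t \<open>\<theta>\<close> = t. The prefactor K^(t t) is stable too,
  because t^2 \<open>\<theta>\<close> = t^2 - t. The exponent 1/d is lowered to some
  \<open>\<theta>\<close> < 1 so that t is finite also in dimension 1.\<close>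

lemma level_measure_decay:
  assumes \<theta>: "0 \<le> \<theta>" "\<theta> < 1" "\<theta> \<le> 1 / real CARD('n)"
  defines "K \<equiv> 2 ^ CARD('n) + 3 :: real" and "t \<equiv> 1 / (1 - \<theta>)"
  shows "level_measure n (K ^ m * \<beta>) \<le> K powr (t * t) * K powr (- (real m * t))"
proof (induction m)
  case 0
  have K: "1 \<le> K" by (simp add: K_def)
  have "1 \<le> K powr (t * t)"
    using K \<theta> by (intro ge_one_powr_ge_zero) (auto simp: t_def)
  then show ?case
    using level_measure_le_1[of n \<beta>] K by simp
next
  case (Suc m)
  have K: "1 \<le> K" "0 < K" by (auto simp: K_def add_pos_pos)
  have t1: "t * (1 - \<theta>) = 1" "0 < t"
    using \<theta> by (auto simp: t_def)
  then have t2: "1 + t * \<theta> = t"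
    by (simp add: algebra_simps)
  have "t * (1 + t * \<theta>) = t * t"
    by (simp only: t2)
  then have t3: "t * t * \<theta> = t * t - t"
    by (simp add: algebra_simps)
  note t = t1(2) t2 t3
  have lam: "\<beta> \<le> K ^ m * \<beta>"
    using K \<beta> by (simp add: one_le_power)
  have pos: "0 < K ^ m * \<beta>" using K \<beta> by simp
  let ?M = "level_measure n (K ^ m * \<beta>)"
  have "?M powr (1 / real CARD('n)) \<le> ?M powr \<theta>"
    using \<theta> level_measure_nonneg level_measure_le_1 by (intro powr_mono') auto
  also have "\<dots> \<le> (K powr (t * t) * K powr (- (real m * t))) powr \<theta>"
    using Suc \<theta> level_measure_nonneg by (intro powr_mono2) auto
  also have "\<dots> = K powr (t * t * \<theta> - real m * t * \<theta>)"
    using K by (simp add: powr_add[symmetric] powr_powr algebra_simps)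
  finally have M: "?M powr (1 / real CARD('n)) \<le> K powr (t * t * \<theta> - real m * t * \<theta>)" .
  have "K ^ m * \<beta> * level_measure n (K * (K ^ m * \<beta>)) \<le> \<beta> * ?M powr (1 / real CARD('n))"
    using level_measure_step[OF lam] by (simp add: K_def)
  also have "\<dots> \<le> \<beta> * K powr (t * t * \<theta> - real m * t * \<theta>)"
    using M \<beta> by (intro mult_left_mono) auto
  finally have "K ^ m * level_measure n (K ^ Suc m * \<beta>) \<le> K powr (t * t * \<theta> - real m * t * \<theta>)"
    using \<beta> by (simp add: mult.assoc)
  then have "level_measure n (K ^ Suc m * \<beta>) \<le> K powr (t * t * \<theta> - real m * t * \<theta>) / K ^ m"
    using K by (simp add: pos_le_divide_eq mult.commute)
  also have "\<dots> = K powr (t * t * \<theta> - real m * t * \<theta> - real m)"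
    using K by (simp add: powr_diff powr_realpow)
  also have "t * t * \<theta> - real m * t * \<theta> - real m = t * t - t - real m * (1 + t * \<theta>)"
    unfolding t(3) by (simp add: algebra_simps)
  also have "\<dots> = t * t - real (Suc m) * t"
    unfolding t(2) by (simp add: algebra_simps)
  also have "K powr (t * t - real (Suc m) * t) = K powr (t * t) * K powr (- (real (Suc m) * t))"
    using K by (simp only: powr_add[symmetric]) simp
  finally show ?case .
qed

text \<open>Uniform continuity takes the place of a differentiation theorem. In a fine enough
  generation f varies by less than \<open>\<beta>\<close> on each cube, so one point with deviation
  above 2 \<open>\<tau>\<close> gives the whole cube a mean deviation above 2 \<open>\<tau>\<close>
  - \<open>\<beta>\<close> >= \<open>\<tau>\<close>.\<close>

lemma UC_level_set:
  assumes UC: "f \<in> UC_space" and \<tau>: "\<beta> \<le> \<tau>"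
  obtains n where "measure cube_measure {x \<in> unit_cube. 2 * \<tau> < cmod (f x - (CINT y. f y))} \<le> level_measure n \<tau>"
proof -
  let ?m = "CINT y. f y"
  have "uniformly_continuous_on unit_cube f"
    using UC by (simp add: UC_space_def)
  then obtain d where d: "0 < d" "\<And>x y. x \<in> unit_cube \<Longrightarrow> y \<in> unit_cube \<Longrightarrow> dist y x < d \<Longrightarrow> dist (f y) (f x) < \<beta>"
    using \<beta>(2) unfolding uniformly_continuous_on_def by blast
  have "(\<lambda>n. (1 / 2 :: real) ^ n) \<longlonglongrightarrow> 0"
    by (intro LIMSEQ_power_zero) auto
  then have "\<forall>\<^sub>F n in sequentially. (1 / 2 :: real) ^ n < d / real CARD('n)"
    using d(1) by (intro order_tendstoD(2)) auto
  then obtain n where n: "(1 / 2 :: real) ^ n < d / real CARD('n)"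
    unfolding eventually_sequentially by blast
  let ?E = "{x \<in> unit_cube. 2 * \<tau> < cmod (f x - ?m)}"
  have fm[measurable]: "f \<in> borel_measurable cube_measure"
    using B_spaceD(1)[OF f] by (simp add: L1_space_def)
  have "{x \<in> space cube_measure. 2 * \<tau> < cmod (f x - ?m)} \<in> sets cube_measure"
    by measurable
  then have E: "?E \<in> sets cube_measure"
    by simp
  have in_stop: "x \<in> \<Union>(stopping_cubes n \<tau>)" if x: "x \<in> ?E" "x \<in> \<Union>(dyadic n)" for x
  proof -
    obtain Q where Q: "Q \<in> dyadic n" "x \<in> Q" using x(2) by auto
    have "\<tau> < mean_dev Q"
    proof -
      have const: "set_integrable lebesgue Q (\<lambda>x. cmod (f y - ?m) - \<beta> :: real)" for y
        by (intro set_integrable_const_cube measure_dyadic(3)[OF Q(1)] dyadic_cube(2)[OF Q(1)])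
      have "measure lebesgue Q * (cmod (f x - ?m) - \<beta>) = (LINT y:Q|lebesgue. cmod (f x - ?m) - \<beta>)"
        using set_integral_const_cube[OF dyadic_cube(1)[OF Q(1)], of "cmod (f x - ?m) - \<beta>"] by simp
      also have "\<dots> \<le> (LINT y:Q|lebesgue. cmod (f y - ?m))"
      proof (rule set_integral_mono[OF const dyadic_dev_integrable[OF Q(1)]])
        fix y assume y: "y \<in> Q"
        have "dist y x \<le> real CARD('n) * (1 / 2 ^ n)"
          by (rule dist_in_eps_cube[OF dyadic_cube(1)[OF Q(1)] y Q(2)])
        also have "\<dots> < d"
          using n by (simp add: power_one_over pos_less_divide_eq field_simps)
        finally have "dist (f y) (f x) < \<beta>"
          using d(2)[of x y] y Q dyadic_cube(2)[OF Q(1)] by blast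
        then show "cmod (f x - ?m) - \<beta> \<le> cmod (f y - ?m)"
          using norm_triangle_ineq4[of "f y - ?m" "f y - f x"] by (simp add: dist_norm)
      qed
      also have "\<dots> = measure lebesgue Q * mean_dev Q"
        using measure_dyadic(2)[OF Q(1)] by (simp add: mean_dev_def)
      finally have "cmod (f x - ?m) - \<beta> \<le> mean_dev Q"
        using measure_dyadic(2)[OF Q(1)] by simp
      then show ?thesis using x(1) \<tau> by simp
    qed
    then have "Q \<in> big_cubes n \<tau>"
      using Q unfolding big_cubes_def by auto
    then obtain P where "P \<in> stopping_cubes n \<tau>" "Q \<subseteq> P"
      by (rule stopping_above)
    then show ?thesis using Q by auto
  qed
  have Ssets: "Q \<in> sets cube_measure" "measure cube_measure Q = measure lebesgue Q" if Q: "Q \<in> stopping_cubes n \<tau>" for Q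
  proof -
    obtain j where j: "Q \<in> dyadic j" by (rule stopping_cubesD[OF Q])
    show "Q \<in> sets cube_measure"
      using measure_dyadic(3)[OF j] dyadic_cube(2)[OF j] by (auto simp: sets_restrict_space_iff)
    show "measure cube_measure Q = measure lebesgue Q"
      using dyadic_cube(2)[OF j] by (simp add: measure_restrict_space)
  qed
  interpret finite_measure "cube_measure :: (real^'n) measure"
    by (rule finite_cube_measure)
  have U: "\<Union>(stopping_cubes n \<tau>) \<in> sets cube_measure"
    using Ssets(1) finite_stopping by (intro sets.finite_Union) auto
  have "measure cube_measure ?E \<le> measure cube_measure (\<Union>(stopping_cubes n \<tau>))"
  proof (rule finite_measure_mono_AE[OF _ U])
    show "AE x in cube_measure. x \<in> ?E \<longrightarrow> x \<in> \<Union>(stopping_cubes n \<tau>)"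
      using dyadic_cover[of n] by eventually_elim (use in_stop in blast)
  qed
  also have "\<dots> \<le> (\<Sum>Q\<in>stopping_cubes n \<tau>. measure cube_measure Q)"
    using measure_UNION_le[OF finite_stopping, of n \<tau> "\<lambda>Q. Q" cube_measure] Ssets(1) by simp
  also have "\<dots> = level_measure n \<tau>"
    unfolding level_measure_def using Ssets(2) by (intro sum.cong) auto
  finally show thesis by (rule that)
qed

text \<open>Layers between the levels 2 K^m \<open>\<beta>\<close> carry weight about K^(m p) and
  measure about K^(-m t), a convergent geometric series as p < t. Boundedness of f leaves finitely
  many layers. The resulting constant does not depend on the modulus of continuity.\<close>

lemma UC_Lp_bound:
  assumes UC: "f \<in> UC_space" and p: "1 < p" and \<theta>: "0 \<le> \<theta>" "\<theta> < 1" "\<theta> \<le> 1 / real CARD('n)" "p * (1 - \<theta>) < 1"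
  defines "K \<equiv> 2 ^ CARD('n) + 3 :: real" and "t \<equiv> 1 / (1 - \<theta>)"
  shows "(CINT x. cmod (f x - (CINT y. f y)) powr p) \<le>
    (2 * \<beta>) powr p * (1 + K powr (p + t * t) / (1 - K powr (p - t)))"
proof -
  let ?M = "cube_measure :: (real^'n) measure"
  let ?m = "CINT y. f y"
  define F where "F x = cmod (f x - ?m)" for x
  define E where "E m = {x \<in> unit_cube. 2 * (K ^ m * \<beta>) < F x}" for m :: nat
  interpret finite_measure ?M by (rule finite_cube_measure)
  have K: "1 < K" "0 < K" by (auto simp: K_def add_pos_pos)
  have t: "p < t"
    using \<theta> by (simp add: t_def pos_less_divide_eq)
  have fm[measurable]: "f \<in> borel_measurable ?M"
    using B_spaceD(1)[OF f] by (simp add: L1_space_def)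
  have Fm[measurable]: "F \<in> borel_measurable ?M"
    unfolding F_def by measurable
  have Em: "E m \<in> sets ?M" for m
  proof -
    have "{x \<in> space ?M. 2 * (K ^ m * \<beta>) < F x} \<in> sets ?M" by measurable
    then show ?thesis by (simp add: E_def)
  qed
  have ME: "measure ?M (E m) \<le> K powr (t * t) * K powr (- (real m * t))" for m
  proof -
    have "\<beta> \<le> K ^ m * \<beta>"
      using K \<beta> by (simp add: one_le_power)
    then obtain n where "measure ?M (E m) \<le> level_measure n (K ^ m * \<beta>)"
      using UC_level_set[OF UC, of "K ^ m * \<beta>"] unfolding E_def F_def by blast
    also have "\<dots> \<le> K powr (t * t) * K powr (- (real m * t))"
      unfolding K_def t_def by (rule level_measure_decay[OF \<theta>(1-3)])
    finally show ?thesis .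
  qed
  obtain H where H: "\<And>x. x \<in> unit_cube \<Longrightarrow> F x \<le> H"
  proof -
    obtain H where "\<And>x. x \<in> unit_cube \<Longrightarrow> cmod (f x) \<le> H"
      using UC_bounded[OF UC] by blast
    then have "F x \<le> H + cmod ?m" if "x \<in> unit_cube" for x
      using norm_triangle_ineq4[of "f x" ?m] that unfolding F_def by (meson add_right_mono order_trans)
    then show thesis using that by blast
  qed
  obtain L where L: "H / (2 * \<beta>) < K ^ L"
    using real_arch_pow[OF K(1)] by blast
  have FL: "F x \<le> 2 * (K ^ L * \<beta>)" if "x \<in> unit_cube" for x
    using H[OF that] L \<beta> by (simp add: divide_less_eq field_simps)
  define w where "w m = (2 * (K ^ Suc m * \<beta>)) powr p" for m
  have pt: "F x powr p \<le> (2 * \<beta>) powr p + (\<Sum>m<L. indicator (E m) x * w m)" if x: "x \<in> unit_cube" "F x \<le> 2 * (K ^ L * \<beta>)" for x L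
    using x(2)
  proof (induction L)
    case 0
    then show ?case using p by (auto intro!: powr_mono2 simp: F_def)
  next
    case (Suc L)
    show ?case
    proof (cases "F x \<le> 2 * (K ^ L * \<beta>)")
      case True
      have "0 \<le> indicator (E L) x * w L"
        by (simp add: w_def)
      then show ?thesis using Suc.IH[OF True] by simp
    next
      case False
      then have "x \<in> E L"
        using x(1) by (simp add: E_def)
      have "F x powr p \<le> w L"
        unfolding w_def using Suc.prems p by (intro powr_mono2) (auto simp: F_def)
      moreover have "0 \<le> (\<Sum>m<L. indicator (E m) x * w m)"
        by (intro sum_nonneg) (simp add: w_def)
      moreover have ind: "indicator (E L) x = (1 :: real)"
        using \<open>x \<in> E L\<close> by simp
      ultimately show ?thesis
        unfolding sum.lessThan_Suc ind using powr_ge_zero[of "2 * \<beta>" p] by linarith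
    qed
  qed
  have indint: "integrable ?M (\<lambda>x. indicator (E m) x * w m)" for m
    using Em[of m] by (intro integrable_mult_left integrable_real_indicator) (auto simp: less_top[symmetric])
  have "(CINT x. F x powr p) \<le> (CINT x. (2 * \<beta>) powr p + (\<Sum>m<L. indicator (E m) x * w m))"
  proof (rule integral_mono)
    show "integrable ?M (\<lambda>x. F x powr p)"
    proof (rule integrable_bounded_cube)
      show "norm (F x powr p) \<le> H powr p" if "x \<in> unit_cube" for x
        using H[OF that] p by (auto intro!: powr_mono2 simp: F_def)
    qed measurable
    show "integrable ?M (\<lambda>x. (2 * \<beta>) powr p + (\<Sum>m<L. indicator (E m) x * w m))"
      by (intro Bochner_Integration.integrable_add Bochner_Integration.integrable_sum integrable_const_cube indint)
  qed (use pt FL in auto)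
  also have "\<dots> = (\<integral>x. (2 * \<beta>) powr p \<partial>?M) + (CINT x. (\<Sum>m<L. indicator (E m) x * w m))"
    by (intro Bochner_Integration.integral_add Bochner_Integration.integrable_sum integrable_const_cube indint)
  also have "(\<integral>x. (2 * \<beta>) powr p \<partial>?M) = (2 * \<beta>) powr p"
    by (rule integral_const_cube)
  also have "(CINT x. (\<Sum>m<L. indicator (E m) x * w m)) = (\<Sum>m<L. measure ?M (E m) * w m)"
    using indint Em sets.sets_into_space[OF Em] by (subst Bochner_Integration.integral_sum) (auto simp: Int_absorb2)
  also have "\<dots> \<le> (\<Sum>m<L. (2 * \<beta>) powr p * K powr (p + t * t) * (K powr (p - t)) ^ m)"
  proof (rule sum_mono)
    fix m
    have "w m = (K ^ Suc m * (2 * \<beta>)) powr p" by (simp add: w_def mult.commute mult.left_commute)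
    also have "\<dots> = (K ^ Suc m) powr p * (2 * \<beta>) powr p" by (rule powr_mult)
    also have "(K ^ Suc m) powr p = K powr (real (Suc m) * p)"
      using K by (simp only: powr_realpow[symmetric] powr_powr)
    finally have weq: "w m = (2 * \<beta>) powr p * K powr (real (Suc m) * p)" by (simp only: mult.commute)
    have "(K powr (t * t) * K powr (- (real m * t))) * w m =
        (2 * \<beta>) powr p * (K powr (t * t) * K powr (- (real m * t)) * K powr (real (Suc m) * p))"
      unfolding weq by (simp only: mult_ac)
    also have "K powr (t * t) * K powr (- (real m * t)) * K powr (real (Suc m) * p) = K powr (p + t * t) * K powr ((p - t) * real m)"
      by (simp only: powr_add[symmetric]) (simp add: algebra_simps)
    also have "K powr ((p - t) * real m) = (K powr (p - t)) ^ m"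
      using K by (simp add: powr_powr[symmetric] powr_realpow)
    finally have "(K powr (t * t) * K powr (- (real m * t))) * w m = (2 * \<beta>) powr p * K powr (p + t * t) * (K powr (p - t)) ^ m"
      by (simp only: mult.assoc)
    moreover have "measure ?M (E m) * w m \<le> (K powr (t * t) * K powr (- (real m * t))) * w m"
      by (intro mult_right_mono ME) (simp add: w_def)
    ultimately show "measure ?M (E m) * w m \<le> (2 * \<beta>) powr p * K powr (p + t * t) * (K powr (p - t)) ^ m"
      by simp
  qed
  also have "\<dots> = (2 * \<beta>) powr p * K powr (p + t * t) * (\<Sum>m<L. (K powr (p - t)) ^ m)"
    by (simp only: sum_distrib_left)
  also have "\<dots> \<le> (2 * \<beta>) powr p * K powr (p + t * t) * (1 / (1 - K powr (p - t)))"
  proof (rule mult_left_mono)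
    have r: "0 \<le> K powr (p - t)" "K powr (p - t) < 1"
      using powr_less_mono[of "p - t" 0 K] K t by auto
    have "(\<Sum>m<L. (K powr (p - t)) ^ m) = (1 - (K powr (p - t)) ^ L) / (1 - K powr (p - t))"
      using r one_diff_power_eq[of "K powr (p - t)" L] by simp
    also have "\<dots> \<le> 1 / (1 - K powr (p - t))"
      using r by (intro divide_right_mono) auto
    finally show "(\<Sum>m<L. (K powr (p - t)) ^ m) \<le> 1 / (1 - K powr (p - t))" .
  qed simp
  finally show ?thesis
    by (simp add: F_def algebra_simps)
qed

end

text \<open>The bound for uniformly continuous functions depends only on the norm, so it passes to f
  by Fatou's lemma along an almost everywhere convergent subsequence of its approximations.\<close>

theorem B_embedding:
  assumes p: "1 < p" "CARD('n) = 1 \<or> p < real CARD('n) / (real CARD('n) - 1)"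
  obtains D where "0 \<le> D" "\<And>f :: 'n::finite cfun. f \<in> B_space \<Longrightarrow> f \<in> Lp_space p"
    "\<And>f :: 'n cfun. f \<in> B_space \<Longrightarrow> Lp_mod_norm p f \<le> D * B_norm f"
proof -
  let ?M = "cube_measure :: (real^'n) measure"
  \<comment> \<open>The condition p (1 - \<open>\<theta>\<close>) < 1 says p < t. With
    \<open>\<theta>\<close> = 1/d it is p < d / (d - 1); for d = 1 any \<open>\<theta>\<close> below
    1 is allowed, and 1 - 1/(2 p) gives p (1 - \<open>\<theta>\<close>) = 1/2.\<close>
  obtain \<theta> where \<theta>: "0 \<le> \<theta>" "\<theta> < 1" "\<theta> \<le> 1 / real CARD('n)" "p * (1 - \<theta>) < 1"
  proof (cases "CARD('n) = 1")
    case True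
    show ?thesis
      by (rule that[of "1 - 1 / (2 * p)"]) (use p(1) True in \<open>auto simp: divide_le_eq\<close>)
  next
    case False
    moreover have "0 < CARD('n)" by simp
    ultimately have d: "2 \<le> CARD('n)" by linarith
    then have "p * (real CARD('n) - 1) < real CARD('n)"
      using p(2) False by (simp add: pos_less_divide_eq)
    then have "p * (1 - 1 / real CARD('n)) < 1"
      using d by (simp add: field_simps)
    then show ?thesis
      using d by (intro that[of "1 / real CARD('n)"]) auto
  qed
  define K where "K = (2 ^ CARD('n) + 3 :: real)"
  define t where "t = 1 / (1 - \<theta>)"
  define G where "G = 1 + K powr (p + t * t) / (1 - K powr (p - t))"
  have K1: "1 < K" by (simp add: K_def add_pos_pos)
  have pt: "p < t"
    using \<theta> by (simp add: t_def pos_less_divide_eq)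
  have G: "0 \<le> G"
  proof -
    have "K powr (p - t) < 1"
      using powr_less_mono[of "p - t" 0 K] K1 pt by simp
    then show ?thesis by (simp add: G_def)
  qed
  define D where "D = 2 * G powr (1 / p)"
  have Dp: "(2 * \<beta>) powr p * G = (D * \<beta>) powr p" if "0 < \<beta>" for \<beta>
    using that p G by (simp add: D_def powr_mult powr_powr)
  have D0: "0 \<le> D" by (simp add: D_def)
  have main: "f \<in> Lp_space p \<and> Lp_mod_norm p f \<le> D * B_norm f" if f: "f \<in> B_space" for f :: "'n cfun"
  proof -
    have fL1: "f \<in> L1_space" and fi: "integrable ?M f"
      using B_spaceD(1)[OF f] by (auto simp: L1_space_def)
    note [measurable] = borel_measurable_integrable[OF fi]
    obtain s a where s: "\<And>k :: nat. s k \<in> UC_space" "\<And>k. B_norm (s k) \<le> a k * B_norm f"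
      "a \<longlonglongrightarrow> 1" "(\<lambda>k. \<integral>x. cmod (s k x - f x) \<partial>?M) \<longlonglongrightarrow> 0"
      using UC_approximation[OF f] by blast
    have sL1: "s k \<in> L1_space" for k by (rule UC_L1[OF s(1)])
    have si: "integrable ?M (s k)" for k using sL1 by (simp add: L1_space_def)
    note [measurable] = borel_measurable_integrable[OF si]
    have di: "integrable ?M (\<lambda>x. s k x - f x)" for k using si fi by simp
    obtain r where r: "strict_mono r" "AE x in ?M. (\<lambda>k. s (r k) x - f x) \<longlonglongrightarrow> 0"
      using tendsto_L1_AE_subseq[OF di s(4)] by blast
    let ?m = "CINT y. f y"
    define m where "m k = (CINT y. s k y)" for k
    have mlim: "m \<longlonglongrightarrow> ?m"
    proof -
      have "(\<lambda>k. m k - ?m) \<longlonglongrightarrow> 0"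
      proof (rule Lim_null_comparison[OF _ s(4)], intro always_eventually allI)
        fix k
        have "m k - ?m = (CINT x. s k x - f x)"
          unfolding m_def using si fi by simp
        then show "norm (m k - ?m) \<le> (CINT x. cmod (s k x - f x))"
          by (simp only: integral_norm_bound)
      qed
      then show ?thesis by (rule LIM_zero_cancel)
    qed
    define u where "u k x = cmod (s (r k) x - m (r k)) powr p" for k x
    have um[measurable]: "u k \<in> borel_measurable ?M" for k
      unfolding u_def by measurable
    have ui: "integrable ?M (u k)" for k
    proof -
      obtain H where H: "\<And>x. x \<in> unit_cube \<Longrightarrow> cmod (s (r k) x) \<le> H"
        using UC_bounded[OF s(1)[of "r k"]] by blast
      show ?thesis
      proof (rule integrable_bounded_cube[OF um])
        show "norm (u k x) \<le> (H + cmod (m (r k))) powr p" if "x \<in> unit_cube" for x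
        proof -
          have "cmod (s (r k) x - m (r k)) \<le> H + cmod (m (r k))"
            using norm_triangle_ineq4[of "s (r k) x" "m (r k)"] H[OF that] by simp
          then show ?thesis
            unfolding u_def using p by (auto intro!: powr_mono2)
        qed
      qed
    qed
    \<comment> \<open>The margin e absorbs the factors a (r k), which tend to 1, and keeps
      \<open>\<beta>\<close> positive when f has norm 0.\<close>
    have bound: "(\<integral>\<^sup>+x. ennreal (cmod (f x - ?m) powr p) \<partial>?M) \<le> ennreal ((D * (B_norm f + e)) powr p)" if e: "0 < e" for e
    proof -
      define \<beta> where "\<beta> = B_norm f + e"
      have \<beta>: "0 < \<beta>" using e B_norm_nonneg[of f] by (simp add: \<beta>_def)
      have "(\<lambda>k. a (r k) * B_norm f) \<longlonglongrightarrow> 1 * B_norm f"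
        using LIMSEQ_subseq_LIMSEQ[OF s(3) r(1)] by (intro tendsto_intros) (simp add: o_def)
      then have ev: "\<forall>\<^sub>F k in sequentially. a (r k) * B_norm f < \<beta>"
        using e by (intro order_tendstoD(2)) (auto simp: \<beta>_def)
      have "(\<integral>\<^sup>+x. ennreal (cmod (f x - ?m) powr p) \<partial>?M) = (\<integral>\<^sup>+x. liminf (\<lambda>k. ennreal (u k x)) \<partial>?M)"
      proof (rule nn_integral_cong_AE)
        show "AE x in ?M. ennreal (cmod (f x - ?m) powr p) = liminf (\<lambda>k. ennreal (u k x))"
          using r(2)
        proof eventually_elim
          fix x assume "(\<lambda>k. s (r k) x - f x) \<longlonglongrightarrow> 0"
          then have "(\<lambda>k. s (r k) x) \<longlonglongrightarrow> f x" by (rule LIM_zero_cancel)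
          then have "(\<lambda>k. cmod (s (r k) x - m (r k))) \<longlonglongrightarrow> cmod (f x - ?m)"
            using LIMSEQ_subseq_LIMSEQ[OF mlim r(1)] by (intro tendsto_intros) (simp_all add: o_def)
          from tendsto_powr'[OF this tendsto_const, of p] have "(\<lambda>k. u k x) \<longlonglongrightarrow> cmod (f x - ?m) powr p"
            unfolding u_def using p by auto
          then have "(\<lambda>k. ennreal (u k x)) \<longlonglongrightarrow> ennreal (cmod (f x - ?m) powr p)"
            by (rule tendsto_ennrealI)
          then show "ennreal (cmod (f x - ?m) powr p) = liminf (\<lambda>k. ennreal (u k x))"
            by (intro lim_imp_Liminf[symmetric]) auto
        qed
      qed
      also have "\<dots> \<le> liminf (\<lambda>k. \<integral>\<^sup>+x. ennreal (u k x) \<partial>?M)"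
        by (rule nn_integral_liminf) measurable
      also have "\<dots> \<le> liminf (\<lambda>k. ennreal ((D * \<beta>) powr p))"
      proof (rule Liminf_mono)
        show "\<forall>\<^sub>F k in sequentially. (\<integral>\<^sup>+x. ennreal (u k x) \<partial>?M) \<le> ennreal ((D * \<beta>) powr p)"
          using ev
        proof eventually_elim
          fix k assume k: "a (r k) * B_norm f < \<beta>"
          have "B_norm (s (r k)) \<le> \<beta>"
            using s(2)[of "r k"] k by simp
          note UC_Lp_bound[OF B0_spaceD(1)[OF UC_B0[OF s(1)]] this \<beta> s(1) p(1) \<theta>]
          then have "(CINT x. u k x) \<le> (2 * \<beta>) powr p * G"
            unfolding u_def m_def G_def K_def t_def .
          then have "(CINT x. u k x) \<le> (D * \<beta>) powr p"
            unfolding Dp[OF \<beta>] .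
          moreover have "(\<integral>\<^sup>+x. ennreal (u k x) \<partial>?M) = ennreal (CINT x. u k x)"
            by (intro nn_integral_eq_integral ui) (simp add: u_def)
          ultimately show "(\<integral>\<^sup>+x. ennreal (u k x) \<partial>?M) \<le> ennreal ((D * \<beta>) powr p)"
            by (simp add: ennreal_leI)
        qed
      qed
      also have "\<dots> = ennreal ((D * \<beta>) powr p)"
        by (simp add: Liminf_const)
      finally show ?thesis unfolding \<beta>_def .
    qed
    have int: "integrable ?M (\<lambda>x. cmod (f x - ?m) powr p)"
    proof (rule integrableI_nonneg)
      show "(\<integral>\<^sup>+x. ennreal (cmod (f x - ?m) powr p) \<partial>?M) < \<infinity>"
        using bound[of 1] by (rule le_less_trans) simp_all
    qed auto
    have fm: "(\<lambda>x. f x - ?m) \<in> Lp_space p"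
      unfolding Lp_space_def using int by simp
    have fL: "f \<in> Lp_space p"
    proof -
      have "(\<lambda>x. (f x - ?m) + ?m) \<in> Lp_space p"
        using p by (intro cseminorm_add_mem[OF cseminorm_Lp] fm Lp_const) auto
      then show ?thesis by simp
    qed
    have "Lp_mod_norm p f \<le> D * B_norm f + \<eta>" if \<eta>: "0 < \<eta>" for \<eta>
    proof -
      define e where "e = \<eta> / (D + 1)"
      have e: "0 < e" using \<eta> D0 by (simp add: e_def)
      have "ennreal (CINT x. cmod (f x - ?m) powr p) \<le> ennreal ((D * (B_norm f + e)) powr p)"
        using bound[OF e] by (subst nn_integral_eq_integral[symmetric, OF int]) auto
      then have "(CINT x. cmod (f x - ?m) powr p) \<le> (D * (B_norm f + e)) powr p"
        by (simp add: ennreal_le_iff)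
      then have "Lp_norm p (\<lambda>x. f x - ?m) \<le> D * (B_norm f + e)"
        using p e D0 B_norm_nonneg[of f] by (intro Lp_norm_le) auto
      moreover have "Lp_mod_norm p f \<le> Lp_norm p (\<lambda>x. f x - ?m)"
        using Lp_mod_norm_le[of p f "- ?m"] by simp
      moreover have "D * e \<le> \<eta>"
        using \<eta> D0 by (simp add: e_def divide_le_eq)
      ultimately show ?thesis by (simp add: distrib_left)
    qed
    then show ?thesis
      using fL by (auto intro: field_le_epsilon)
  qed
  show thesis
    by (rule that[OF D0]) (use main in auto)
qed

subsection \<open>Finite combinations of atoms\<close>

text \<open>Serves as padding when finite lists of atoms are turned into a sequence.\<close>

lemma atom_zero: "atom (\<lambda>x. 0)"
  unfolding atom_def using empty_cube_family by (intro conjI exI[of _ 1] bexI[of _ "{}"]) auto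

lemma atom_mean_zero:
  assumes "atom g" "1 < q"
  shows "g \<in> Lp_mean_zero q"
proof -
  obtain \<epsilon> \<F> where e: "0 < \<epsilon>" and F: "\<F> \<in> cube_families \<epsilon>"
    and g: "g \<in> borel_measurable cube_measure" "AE x in cube_measure. x \<notin> \<Union>\<F> \<longrightarrow> g x = 0"
      "\<And>Q. Q \<in> \<F> \<Longrightarrow> (LINT x:Q|lebesgue. g x) = 0"
    using assms(1) unfolding atom_def by blast
  obtain K where K: "AE x in cube_measure. cmod (g x) \<le> K"
    using atom_bounded(2)[OF assms(1)] by blast
  note [measurable] = g(1)
  have "integrable cube_measure (\<lambda>x. cmod (g x) powr q)"
  proof (rule finite_measure.integrable_const_bound[OF finite_cube_measure, of _ "K powr q"])
    show "AE x in cube_measure. norm (cmod (g x) powr q) \<le> K powr q"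
      using K by eventually_elim (use assms(2) in \<open>auto intro!: powr_mono2\<close>)
  qed measurable
  then have gq: "g \<in> Lp_space q"
    using g(1) by (simp add: Lp_space_def)
  then have "integrable cube_measure g"
    using Lp_L1(1)[OF assms(2)] by (simp add: L1_space_def)
  from integral_eq_sum_cubes[OF F e this g(2)] have "(CINT x. g x) = 0"
    using g(3) by simp
  then show ?thesis
    using gq by (simp add: Lp_mean_zero_def)
qed

lemma atom_pairing_le:
  assumes "atom g" "f \<in> B_space"
  shows "cmod (CINT x. f x * g x) \<le> B_norm f"
proof -
  obtain \<epsilon> \<F> where e: "0 < \<epsilon>" "\<epsilon> \<le> 1" "\<F> \<in> cube_families \<epsilon>"
    and le: "\<And>f. f \<in> L1_space \<Longrightarrow> cmod (CINT x. f x * g x) \<le> osc_sum \<epsilon> \<F> f"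
    using atom_pairing[OF assms(1)] by blast
  show ?thesis
    using le[OF B_spaceD(1)[OF assms(2)]] osc_sum_le_B_norm[OF assms(2) e] by simp
qed

text \<open>By \<open>norming_atom\<close>, each oscillation sum is a pairing with twice an atom
  that has norm at most 1 on \<open>B_space\<close>. Restricting the test to such functions is what
  gives the exact constant, and thereby all isometries.\<close>

lemma B_norm_le_atoms:
  fixes f :: "'n::finite cfun"
  assumes f: "f \<in> L1_space"
    and K: "\<And>g. atom g \<Longrightarrow> (\<And>k. k \<in> B_space \<Longrightarrow> cmod (CINT x. k x * (2 * g x)) \<le> B_norm k) \<Longrightarrow>
      cmod (CINT x. f x * (2 * g x)) \<le> K"
  shows "f \<in> B_space" "B_norm f \<le> K"
proof -
  have two: "(CINT x. k x * (2 * g x)) = 2 * (CINT x. k x * g x)" for k g :: "'n cfun"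
    by (simp only: mult.left_commute[of _ 2] integral_mult_right_zero)
  have le: "osc_sum \<epsilon> \<F> f \<le> K" if e: "0 < \<epsilon>" "\<epsilon> \<le> 1" "\<F> \<in> cube_families \<epsilon>" for \<epsilon> \<F>
  proof -
    obtain g where g: "atom g" "2 * (CINT x. f x * g x) = of_real (osc_sum \<epsilon> \<F> f)"
      "\<And>k. k \<in> L1_space \<Longrightarrow> cmod (2 * (CINT x. k x * g x)) \<le> osc_sum \<epsilon> \<F> k"
      using norming_atom[OF e f] by blast
    have "cmod (CINT x. f x * (2 * g x)) \<le> K"
    proof (rule K[OF g(1)])
      fix k :: "'n cfun" assume k: "k \<in> B_space"
      show "cmod (CINT x. k x * (2 * g x)) \<le> B_norm k"
        unfolding two using g(3)[OF B_spaceD(1)[OF k]] osc_sum_le_B_norm[OF k e] by simp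
    qed
    then show ?thesis unfolding two g(2) by simp
  qed
  show "f \<in> B_space" "B_norm f \<le> K"
    using B_spaceI_osc_sum[OF f le] by blast+
qed

text \<open>Coefficients and atoms are kept in lists: concatenation adds combinations and weights,
  with no need to collect repeated atoms.\<close>

definition combination :: "(complex \<times> ('x \<Rightarrow> complex)) list \<Rightarrow> 'x \<Rightarrow> complex" where
  "combination xs x = (\<Sum>(c, g)\<leftarrow>xs. c * g x)"

definition weight :: "(complex \<times> ('x \<Rightarrow> complex)) list \<Rightarrow> real" where
  "weight xs = (\<Sum>(c, g)\<leftarrow>xs. cmod c)"

definition atomic_lists :: "(complex \<times> ('n::finite cfun)) list set" where
  "atomic_lists = {xs. \<forall>(c, g)\<in>set xs. atom g}"

lemma weight_nonneg: "0 \<le> weight xs"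
  unfolding weight_def by (intro sum_list_nonneg) auto

lemma atomic_list_scale:
  assumes "xs \<in> atomic_lists"
  shows "map (\<lambda>(c, g). (a * c, g)) xs \<in> atomic_lists" "weight (map (\<lambda>(c, g). (a * c, g)) xs) = cmod a * weight xs"
    "combination (map (\<lambda>(c, g). (a * c, g)) xs) = (\<lambda>x. a * combination xs x)"
proof -
  show "map (\<lambda>(c, g). (a * c, g)) xs \<in> atomic_lists"
    using assms by (force simp: atomic_lists_def)
  show "weight (map (\<lambda>(c, g). (a * c, g)) xs) = cmod a * weight xs"
    by (induction xs) (auto simp: weight_def norm_mult algebra_simps)
  show "combination (map (\<lambda>(c, g). (a * c, g)) xs) = (\<lambda>x. a * combination xs x)"
  proof
    fix x
    show "combination (map (\<lambda>(c, g). (a * c, g)) xs) x = a * combination xs x"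
      by (induction xs) (auto simp: combination_def algebra_simps)
  qed
qed

lemma combination_mean_zero:
  fixes xs :: "(complex \<times> ('n::finite cfun)) list"
  assumes "xs \<in> atomic_lists" "1 < q"
  shows "combination xs \<in> Lp_mean_zero q"
  using assms(1)
proof (induction xs)
  case Nil
  then show ?case
    using cseminorm_zero_mem[OF cseminorm_Lp_mean_zero[OF assms(2)]] by (simp add: combination_def)
next
  case (Cons y xs)
  obtain c g where y: "y = (c, g)" by force
  have "g \<in> Lp_mean_zero q" "combination xs \<in> Lp_mean_zero q"
    using Cons atom_mean_zero[OF _ assms(2)] by (auto simp: atomic_lists_def y)
  from cseminorm_lincomb_mem[OF cseminorm_Lp_mean_zero[OF assms(2)] this, of c 1] show ?case
    by (simp add: combination_def y)
qed

lemma combination_bounded: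
  assumes "xs \<in> atomic_lists"
  shows "\<exists>K. AE x in cube_measure. cmod (combination xs x) \<le> K"
  using assms
proof (induction xs)
  case Nil
  then show ?case by (auto simp: combination_def)
next
  case (Cons y xs)
  obtain c g where y: "y = (c, g)" by force
  have "atom g" "xs \<in> atomic_lists"
    using Cons by (auto simp: atomic_lists_def y)
  then obtain K L where K: "AE x in cube_measure. cmod (g x) \<le> K" and L: "AE x in cube_measure. cmod (combination xs x) \<le> L"
    using atom_bounded(2) Cons.IH by blast
  have "AE x in cube_measure. cmod (combination (y # xs) x) \<le> cmod c * K + L"
    using K L
  proof eventually_elim
    fix x assume x: "cmod (g x) \<le> K" "cmod (combination xs x) \<le> L"
    have "cmod (combination (y # xs) x) \<le> cmod (c * g x) + cmod (combination xs x)"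
      unfolding combination_def y by (simp add: norm_triangle_ineq)
    also have "\<dots> \<le> cmod c * K + L"
      using x by (simp add: norm_mult add_mono mult_left_mono)
    finally show "cmod (combination (y # xs) x) \<le> cmod c * K + L" .
  qed
  then show ?case by blast
qed

subsection \<open>The predual as a closure\<close>

text \<open>Distance at most \<open>\<eta>\<close> in the dual norm, written out on
  \<open>B_space\<close> so that the difference need not be shown to be a bounded functional
  beforehand.\<close>

definition approximates :: "real \<Rightarrow> real \<Rightarrow> ('n::finite cfun \<Rightarrow> complex) \<Rightarrow> 'n cfun \<Rightarrow> bool" where
  "approximates q \<eta> \<phi> g \<longleftrightarrow> g \<in> Lp_mean_zero q \<and>
     (\<forall>f\<in>B_space. cmod (\<phi> f - (CINT x. f x * g x)) \<le> \<eta> * B_norm f)"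

lemma approximatesD:
  assumes "approximates q \<eta> \<phi> g"
  shows "g \<in> Lp_mean_zero q" "\<And>f. f \<in> B_space \<Longrightarrow> cmod (\<phi> f - (CINT x. f x * g x)) \<le> \<eta> * B_norm f"
  using assms unfolding approximates_def by auto

lemma B_predualD:
  assumes "\<phi> \<in> B_predual"
  shows "\<phi> \<in> dual_space B_space B_norm"
  using assms unfolding B_predual_def by blast

text \<open>The rows are finite, padded by zeros. Absolute summability over all pairs makes the
  enumeration by \<open>prod_decode\<close> converge to the iterated sum.\<close>

lemma double_series:
  fixes a :: "nat \<Rightarrow> nat \<Rightarrow> complex"
  assumes supp: "\<And>m i. len m \<le> i \<Longrightarrow> a m i = 0"
    and summ: "summable (\<lambda>m. \<Sum>i<len m. cmod (a m i))"
  shows "summable (\<lambda>n. cmod (a (fst (prod_decode n)) (snd (prod_decode n))))"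
    and "(\<lambda>n. a (fst (prod_decode n)) (snd (prod_decode n))) sums (\<Sum>m. \<Sum>i<len m. a m i)"
proof -
  define h where "h z = a (fst z) (snd z)" for z
  have fin: "(\<lambda>i. norm (h (m, i))) summable_on UNIV" "infsum (\<lambda>i. norm (h (m, i))) UNIV = (\<Sum>i<len m. cmod (a m i))"
    "infsum (\<lambda>i. h (m, i)) UNIV = (\<Sum>i<len m. a m i)" for m
  proof -
    have "(\<lambda>i. norm (h (m, i))) summable_on UNIV \<longleftrightarrow> (\<lambda>i. norm (h (m, i))) summable_on {..<len m}"
      by (rule summable_on_cong_neutral) (auto simp: h_def supp)
    then show "(\<lambda>i. norm (h (m, i))) summable_on UNIV" by simp
    have "infsum (\<lambda>i. norm (h (m, i))) UNIV = infsum (\<lambda>i. norm (h (m, i))) {..<len m}"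
      by (rule infsum_cong_neutral) (auto simp: h_def supp)
    then show "infsum (\<lambda>i. norm (h (m, i))) UNIV = (\<Sum>i<len m. cmod (a m i))" by (simp add: h_def)
    have "infsum (\<lambda>i. h (m, i)) UNIV = infsum (\<lambda>i. h (m, i)) {..<len m}"
      by (rule infsum_cong_neutral) (auto simp: h_def supp)
    then show "infsum (\<lambda>i. h (m, i)) UNIV = (\<Sum>i<len m. a m i)" by (simp add: h_def)
  qed
  have "(\<lambda>m. norm (infsum (\<lambda>i. norm (h (m, i))) UNIV)) summable_on UNIV"
    unfolding fin(2) using summ by (subst summable_on_UNIV_nonneg_real_iff) (auto simp: sum_nonneg)
  then have "(\<lambda>z. norm (h z)) summable_on Sigma UNIV (\<lambda>_. UNIV)"
    using fin(1) by (subst Infinite_Sum.abs_summable_on_Sigma_iff) auto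
  then have abs: "(\<lambda>z. norm (h z)) summable_on UNIV" by simp
  have s: "h summable_on UNIV" by (rule abs_summable_summable[OF abs])
  have "(\<lambda>n. norm (h (prod_decode n))) summable_on UNIV"
    using abs summable_on_reindex_bij_betw[OF bij_prod_decode, of "\<lambda>z. norm (h z)"] by simp
  then show "summable (\<lambda>n. cmod (a (fst (prod_decode n)) (snd (prod_decode n))))"
    by (auto simp: h_def intro: summable_on_imp_summable)
  have "(\<lambda>n. h (prod_decode n)) summable_on UNIV" "infsum (\<lambda>n. h (prod_decode n)) UNIV = infsum h UNIV"
    using s summable_on_reindex_bij_betw[OF bij_prod_decode, of h] infsum_reindex_bij_betw[OF bij_prod_decode, of h] by simp_all
  then have 1: "(\<lambda>n. h (prod_decode n)) sums infsum h UNIV"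
    by (metis has_sum_imp_sums has_sum_infsum)
  have s': "h summable_on Sigma UNIV (\<lambda>_. UNIV)"
    using s by simp
  have "(\<lambda>m. infsum (\<lambda>i. h (m, i)) UNIV) summable_on UNIV"
    using summable_on_Sigma_banach[of "\<lambda>x y. h (x, y)" UNIV "\<lambda>_. UNIV"] s' by simp
  then have "(\<lambda>m. \<Sum>i<len m. a m i) sums infsum (\<lambda>m. infsum (\<lambda>i. h (m, i)) UNIV) UNIV"
    unfolding fin(3) by (intro has_sum_imp_sums has_sum_infsum)
  moreover have "infsum (\<lambda>m. infsum (\<lambda>i. h (m, i)) UNIV) UNIV = infsum h UNIV"
    using infsum_Sigma'_banach[of "\<lambda>x y. h (x, y)" UNIV "\<lambda>_. UNIV"] s' by simp
  ultimately have "infsum h UNIV = (\<Sum>m. \<Sum>i<len m. a m i)"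
    by (simp add: sums_iff)
  with 1 show "(\<lambda>n. a (fst (prod_decode n)) (snd (prod_decode n))) sums (\<Sum>m. \<Sum>i<len m. a m i)"
    by (simp add: h_def)
qed

context
  fixes p q D :: real
  assumes p: "1 < p" and q: "1 / p + 1 / q = 1" and D: "0 \<le> D"
    and B_sub: "(B_space :: 'n::finite cfun set) \<subseteq> Lp_space p"
    and B_bound: "\<forall>f\<in>(B_space :: 'n cfun set). Lp_mod_norm p f \<le> D * B_norm f"
begin

lemma emb:
  fixes f :: "'n::finite cfun"
  assumes "f \<in> B_space"
  shows "f \<in> Lp_space p" "Lp_mod_norm p f \<le> D * B_norm f"
  using assms B_sub B_bound by auto

lemma q1: "1 < q"
  by (rule conjugate_exponent(1)[OF p q])

lemma pairing_integrable:
  fixes f :: "'n::finite cfun"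
  assumes "f \<in> B_space" "g \<in> Lp_mean_zero q"
  shows "integrable cube_measure (\<lambda>x. f x * g x)"
  by (rule Holder(1)[OF p q emb(1)[OF assms(1)] Lp_mean_zeroD(1)[OF assms(2)]])

lemma pairing_bound:
  fixes f :: "'n::finite cfun"
  assumes "f \<in> B_space" "g \<in> Lp_mean_zero q"
  shows "cmod (CINT x. f x * g x) \<le> D * Lp_norm q g * B_norm f"
proof -
  have "cmod (CINT x. f x * g x) \<le> Lp_norm q g * Lp_mod_norm p f"
    by (rule pairing_mod_norm[OF p q emb(1)[OF assms(1)] assms(2)])
  also have "\<dots> \<le> Lp_norm q g * (D * B_norm f)"
    by (intro mult_left_mono emb(2) assms Lp_norm_nonneg)
  finally show ?thesis by (simp add: mult_ac)
qed

lemma pairing_lincomb: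
  fixes f :: "'n::finite cfun"
  assumes "f \<in> B_space" "g \<in> Lp_mean_zero q" "h \<in> Lp_mean_zero q"
  shows "(CINT x. f x * (a * g x + b * h x)) = a * (CINT x. f x * g x) + b * (CINT x. f x * h x)"
proof -
  have "(CINT x. f x * (a * g x + b * h x)) = (CINT x. a * (f x * g x) + b * (f x * h x))"
    by (simp add: algebra_simps)
  also have "\<dots> = a * (CINT x. f x * g x) + b * (CINT x. f x * h x)"
    using pairing_integrable[OF assms(1,2)] pairing_integrable[OF assms(1,3)] by simp
  finally show ?thesis .
qed

lemma pairing_diff:
  fixes f :: "'n::finite cfun"
  assumes "f \<in> B_space" "g \<in> Lp_mean_zero q" "h \<in> Lp_mean_zero q"
  shows "(CINT x. f x * (g x - h x)) = (CINT x. f x * g x) - (CINT x. f x * h x)"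
  using pairing_lincomb[OF assms, of 1 "-1"] by simp

lemma pairing_combination:
  fixes f :: "'n::finite cfun"
  assumes f: "f \<in> B_space" and "xs \<in> atomic_lists"
  shows "(CINT x. f x * combination xs x) = (\<Sum>(c, g)\<leftarrow>xs. c * (CINT x. f x * g x))"
  using assms(2)
proof (induction xs)
  case Nil
  then show ?case by (simp add: combination_def)
next
  case (Cons y xs)
  obtain c g where y: "y = (c, g)" by force
  have g: "g \<in> Lp_mean_zero q" and xs: "xs \<in> atomic_lists"
    using Cons atom_mean_zero[OF _ q1] by (auto simp: atomic_lists_def y)
  have "(CINT x. f x * combination (y # xs) x) = (CINT x. f x * (c * g x + 1 * combination xs x))"
    by (simp add: combination_def y)
  also have "\<dots> = c * (CINT x. f x * g x) + 1 * (CINT x. f x * combination xs x)"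
    by (rule pairing_lincomb[OF f g combination_mean_zero[OF xs q1]])
  finally show ?case
    using Cons.IH[OF xs] by (simp add: y)
qed

lemma pairing_B_dual:
  assumes g: "(g :: 'n::finite cfun) \<in> Lp_mean_zero q"
  shows "pairing_functional B_space g \<in> dual_space B_space B_norm"
proof (rule dual_spaceI)
  show "clinear_functional_on B_space (pairing_functional B_space g)"
    by (intro clinear_pairing pairing_integrable[OF _ g] cseminorm_lincomb_mem[OF cseminorm_B])
  show "cmod (pairing_functional B_space g f) \<le> D * Lp_norm q g * B_norm f" if "f \<in> B_space" for f
    using pairing_bound[OF that g] that by (simp add: pairing_functional_def)
qed (simp add: pairing_functional_def)

text \<open>
  The bipolar argument: if \<open>g\<close> were not approximable, then by Hahn--Banach and the duality of
  \<open>L\<^sup>p\<close> and \<open>L\<^sup>q\<close> some \<open>f \<in> L\<^sup>p\<close> would separate it from the combinations of atoms, and being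
  small on atoms forces \<open>f \<in> B\<close>.
\<close>

lemma atomic_approximation:
  fixes g :: "'n::finite cfun"
  assumes g: "g \<in> Lp_mean_zero q" and r: "0 < r"
    and bd: "\<And>f. f \<in> B_space \<Longrightarrow> cmod (CINT x. f x * g x) \<le> r * B_norm f" and \<eta>: "0 < \<eta>"
  obtains xs where "xs \<in> atomic_lists" "weight xs \<le> 4 * r" "Lp_norm q (\<lambda>x. g x - combination xs x) \<le> \<eta>"
proof -
  let ?X = "Lp_mean_zero q :: 'n cfun set"
  note snX = cseminorm_Lp_mean_zero[OF q1, where 'n='n]
  note comb = combination_mean_zero[OF _ q1]
  \<comment> \<open>\<open>P\<close> is the infimal convolution of the atomic weight divided by 2 r
    and the L^q norm divided by \<open>\<eta>\<close> / 2. A cost below 2 gives the two bounds 4 r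
    and \<open>\<eta>\<close>, and since an infimum need not be attained, P g <= 1 is what has to be
    shown.\<close>
  define cost where "cost h xs = weight xs / (2 * r) + Lp_norm q (\<lambda>x. h x - combination xs x) / (\<eta> / 2)" for h and xs :: "(complex \<times> ('n cfun)) list"
  define P where "P h = (INF xs\<in>atomic_lists. cost h xs)" for h
  have cost0: "0 \<le> cost h xs" for h xs
    unfolding cost_def using r \<eta> weight_nonneg Lp_norm_nonneg by (intro add_nonneg_nonneg divide_nonneg_nonneg) auto
  have nil: "[] \<in> atomic_lists" by (simp add: atomic_lists_def)
  have P_le: "P h \<le> cost h xs" if "xs \<in> atomic_lists" for h xs
    unfolding P_def using that cost0 by (intro cINF_lower bdd_belowI2[where m=0]) auto
  have P_ex: "\<exists>xs\<in>atomic_lists. cost h xs < P h + e" if "0 < e" for h e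
    using cINF_lessD[of atomic_lists "cost h" "P h + e"] nil that unfolding P_def by auto
  have P_norm: "P h \<le> Lp_norm q h / (\<eta> / 2)" for h
    using P_le[OF nil, of h] by (simp add: cost_def weight_def combination_def)
  have snP: "cseminorm_on ?X P"
  proof (rule cseminorm_onI)
    show "(\<lambda>x. 0) \<in> ?X" by (rule cseminorm_zero_mem[OF snX])
    show "0 \<le> P h" for h
      unfolding P_def using nil cost0 by (intro cINF_greatest) auto
    fix h k :: "'n cfun" and a b assume h: "h \<in> ?X" and k: "k \<in> ?X"
    show "(\<lambda>x. a * h x + b * k x) \<in> ?X" by (rule cseminorm_lincomb_mem[OF snX h k])
    show "P (\<lambda>x. a * h x + b * k x) \<le> cmod a * P h + cmod b * P k"
    proof (rule tendsto_lowerbound)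
      show "((\<lambda>e. cmod a * (P h + e) + cmod b * (P k + e)) \<longlongrightarrow> cmod a * P h + cmod b * P k) (at_right 0)"
        by (auto intro!: tendsto_eq_intros)
      show "\<forall>\<^sub>F e in at_right 0. P (\<lambda>x. a * h x + b * k x) \<le> cmod a * (P h + e) + cmod b * (P k + e)"
        using eventually_at_right_less[of 0]
      proof eventually_elim
        fix e :: real assume e: "0 < e"
        obtain xs where xs: "xs \<in> atomic_lists" "cost h xs < P h + e" using P_ex[OF e] by blast
        obtain ys where ys: "ys \<in> atomic_lists" "cost k ys < P k + e" using P_ex[OF e] by blast
        define zs where "zs = map (\<lambda>(c, g). (a * c, g)) xs @ map (\<lambda>(c, g). (b * c, g)) ys"
        note sx = atomic_list_scale[OF xs(1), of a] and sy = atomic_list_scale[OF ys(1), of b]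
        have zs: "zs \<in> atomic_lists"
          using sx(1) sy(1) by (auto simp: zs_def atomic_lists_def)
        have wz: "weight zs = cmod a * weight xs + cmod b * weight ys"
          using sx(2) sy(2) by (simp add: zs_def weight_def)
        have cz: "combination zs = (\<lambda>x. a * combination xs x + b * combination ys x)"
          using sx(3) sy(3) by (auto simp: zs_def combination_def fun_eq_iff)
        have "Lp_norm q (\<lambda>x. (a * h x + b * k x) - combination zs x) = Lp_norm q (\<lambda>x. a * (h x - combination xs x) + b * (k x - combination ys x))"
          unfolding cz by (simp add: algebra_simps)
        also have "\<dots> \<le> cmod a * Lp_norm q (\<lambda>x. h x - combination xs x) + cmod b * Lp_norm q (\<lambda>x. k x - combination ys x)"
          by (intro cseminorm_lincomb[OF snX] cseminorm_diff_mem[OF snX] h k comb xs ys)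
        finally have "cost (\<lambda>x. a * h x + b * k x) zs \<le> (cmod a * weight xs + cmod b * weight ys) / (2 * r) +
            (cmod a * Lp_norm q (\<lambda>x. h x - combination xs x) + cmod b * Lp_norm q (\<lambda>x. k x - combination ys x)) / (\<eta> / 2)"
          unfolding cost_def wz using \<eta> by (intro add_left_mono divide_right_mono) auto
        also have "\<dots> = cmod a * cost h xs + cmod b * cost k ys"
          by (simp add: cost_def add_divide_distrib distrib_left)
        also have "\<dots> \<le> cmod a * (P h + e) + cmod b * (P k + e)"
          using xs ys by (intro add_mono mult_left_mono) auto
        finally show "P (\<lambda>x. a * h x + b * k x) \<le> cmod a * (P h + e) + cmod b * (P k + e)"
          using P_le[OF zs] order_trans by blast
      qed
    qed simp
  qed
  have "P g \<le> 1"
  proof (rule ccontr)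
    assume "\<not> P g \<le> 1"
    then have Pg: "1 < P g" by simp
    have gne: "g \<noteq> (\<lambda>x. 0)"
      using Pg cseminorm_zero[OF snP] by auto
    \<comment> \<open>The line through \<open>g\<close>, with a functional taking the value P g at
      \<open>g\<close>. It is well defined because P g > 1 excludes g = 0.\<close>
    define W where "W = {\<lambda>x. c * g x | c. True}"
    have uniq: "c = d" if "(\<lambda>x. c * g x) = (\<lambda>x. d * g x)" for c d
    proof -
      obtain x where "g x \<noteq> 0" using gne by auto
      then show ?thesis using fun_cong[OF that, of x] by simp
    qed
    define \<phi> where "\<phi> w = of_real (P g) * (THE c. w = (\<lambda>x. c * g x))" for w
    have \<phi>: "\<phi> (\<lambda>x. c * g x) = of_real (P g) * c" for c
      unfolding \<phi>_def using uniq by (intro arg_cong[where f="\<lambda>t. of_real (P g) * t"] the_equality) auto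
    have WX: "W \<subseteq> ?X"
      using cseminorm_scale_mem[OF snX g] by (auto simp: W_def)
    have Wlin: "(\<lambda>x. a * w x + b * v x) \<in> W" if "w \<in> W" "v \<in> W" for w v a b
    proof -
      obtain c d where "w = (\<lambda>x. c * g x)" "v = (\<lambda>x. d * g x)"
        using \<open>w \<in> W\<close> \<open>v \<in> W\<close> unfolding W_def by auto
      then have "(\<lambda>x. a * w x + b * v x) = (\<lambda>x. (a * c + b * d) * g x)"
        by (auto simp: algebra_simps)
      then show ?thesis unfolding W_def by blast
    qed
    have W0: "(\<lambda>x. 0) \<in> W"
      unfolding W_def by (intro CollectI exI[of _ 0]) auto
    have snW: "cseminorm_on W P"
      using Wlin W0 WX cseminorm_lincomb[OF snP] cseminorm_nonneg[OF snP] by (intro cseminorm_onI) (simp_all add: subset_iff)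
    have lin: "clinear_functional_on W \<phi>"
      unfolding clinear_functional_on_def
    proof (intro ballI allI)
      fix w v a b assume "w \<in> W" "v \<in> W"
      then obtain c d where cd: "w = (\<lambda>x. c * g x)" "v = (\<lambda>x. d * g x)"
        unfolding W_def by auto
      have "(\<lambda>x. a * w x + b * v x) = (\<lambda>x. (a * c + b * d) * g x)"
        unfolding cd by (auto simp: algebra_simps)
      then show "\<phi> (\<lambda>x. a * w x + b * v x) = a * \<phi> w + b * \<phi> v"
        unfolding cd by (simp only: \<phi>) (simp add: algebra_simps)
    qed
    have P_scale: "cmod c * P g \<le> P (\<lambda>x. c * g x)" for c
    proof (cases "c = 0")
      case False
      have "P (\<lambda>x. (1 / c) * (c * g x)) \<le> cmod (1 / c) * P (\<lambda>x. c * g x)"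
        by (intro cseminorm_scale_le[OF snP] cseminorm_scale_mem[OF snX] g)
      then show ?thesis
        using False by (simp add: norm_divide field_simps)
    qed (simp add: cseminorm_zero[OF snP])
    have bd\<phi>: "cmod (\<phi> w) \<le> P w" if "w \<in> W" for w
    proof -
      obtain c where c: "w = (\<lambda>x. c * g x)" using \<open>w \<in> W\<close> unfolding W_def by auto
      show ?thesis
        unfolding c \<phi> using P_scale[of c] Pg by (simp add: norm_mult mult.commute)
    qed
    obtain \<Phi> where \<Phi>: "clinear_functional_on ?X \<Phi>" "\<And>h. h \<in> ?X \<Longrightarrow> cmod (\<Phi> h) \<le> P h" "\<And>w. w \<in> W \<Longrightarrow> \<Phi> w = \<phi> w"
      using complex_Hahn_Banach[OF snP snW WX lin bd\<phi>] by blast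
    have "g \<in> W" unfolding W_def by (intro CollectI exI[of _ 1]) auto
    then have \<Phi>g: "\<Phi> g = of_real (P g)"
      using \<Phi>(3)[of g] \<phi>[of 1] by simp
    have "cmod (\<Phi> h) \<le> (1 / (\<eta> / 2)) * Lp_norm q h" if "h \<in> ?X" for h
      using order_trans[OF \<Phi>(2)[OF that] P_norm[of h]] by (simp add: mult.commute)
    then obtain f where f: "f \<in> Lp_space p" "\<And>h. h \<in> ?X \<Longrightarrow> \<Phi> h = (CINT x. f x * h x)"
      using Lp_mean_zero_Riesz[OF p q \<Phi>(1)] by blast
    \<comment> \<open>An atom costs at most 1/(2 r), so the separating f pairs with twice an atom to
      at most 1/r. Hence f lies in \<open>B_space\<close> with norm at most 1/r, and the hypothesis
      on \<open>g\<close> gives P g <= r (1/r) = 1, a contradiction.\<close>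
    have atom_small: "cmod (CINT x. f x * (2 * a x)) \<le> 1 / r" if a: "atom a" for a
    proof -
      have aX: "a \<in> ?X" by (rule atom_mean_zero[OF a q1])
      have l: "[(1, a)] \<in> atomic_lists" using a by (simp add: atomic_lists_def)
      have "Lp_norm q (\<lambda>x. a x - combination [(1, a)] x) = Lp_norm q (\<lambda>x :: real^'n. 0)"
        by (simp add: combination_def)
      also have "\<dots> = 0" by (rule cseminorm_zero[OF snX])
      finally have "P a \<le> 1 / (2 * r)"
        using P_le[OF l, of a] by (simp add: cost_def weight_def)
      then have "cmod (CINT x. f x * a x) \<le> 1 / (2 * r)"
        using \<Phi>(2)[OF aX] f(2)[OF aX] by simp
      moreover have "(CINT x. f x * (2 * a x)) = 2 * (CINT x. f x * a x)"
        by (simp only: mult.left_commute[of _ 2] integral_mult_right_zero)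
      ultimately show ?thesis by (simp add: norm_mult)
    qed
    note fB = B_norm_le_atoms[OF Lp_L1(1)[OF p f(1)] atom_small]
    have "P g = cmod (CINT x. f x * g x)"
      using \<Phi>g f(2)[OF g] Pg by simp
    also have "\<dots> \<le> r * B_norm f" by (rule bd[OF fB(1)])
    also have "\<dots> \<le> r * (1 / r)" using fB(2) r by (intro mult_left_mono) auto
    finally show False using Pg r by simp
  qed
  then obtain xs where xs: "xs \<in> atomic_lists" "cost g xs < 2"
    using P_ex[of 1 g] by auto
  have parts: "0 \<le> weight xs / (2 * r)" "0 \<le> Lp_norm q (\<lambda>x. g x - combination xs x) / (\<eta> / 2)"
    using r \<eta> weight_nonneg[of xs] Lp_norm_nonneg[of q "\<lambda>x. g x - combination xs x"] by simp_all
  show thesis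
  proof (rule that[OF xs(1)])
    have "weight xs / (2 * r) \<le> 2"
      using xs(2) parts unfolding cost_def by linarith
    then show "weight xs \<le> 4 * r" using r by (simp add: divide_le_eq)
    have "Lp_norm q (\<lambda>x. g x - combination xs x) / (\<eta> / 2) \<le> 2"
      using xs(2) parts unfolding cost_def by linarith
    then show "Lp_norm q (\<lambda>x. g x - combination xs x) \<le> \<eta>" using \<eta> by (simp add: divide_le_eq)
  qed
qed

text \<open>Approximation of \<open>\<psi>\<close> by \<open>g\<close> costs \<open>\<rho>\<close>/4
  and keeps the norm of \<open>g\<close> below 2 \<open>\<rho>\<close>, whence the weight 4 (2
  \<open>\<rho>\<close>). Replacing \<open>g\<close> by a combination of atoms in L^q costs another
  \<open>\<rho>\<close>/4 through the embedding constant D; D + 1 guards against D = 0. The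
  remainder stays approximable because the subtracted combination is itself a mean-zero L^q
  function.\<close>

lemma atomic_reduction_step:
  fixes \<psi> :: "'n::finite cfun \<Rightarrow> complex"
  assumes approx: "\<And>\<eta>. 0 < \<eta> \<Longrightarrow> \<exists>g. approximates q \<eta> \<psi> g"
    and bd: "\<And>f. f \<in> B_space \<Longrightarrow> cmod (\<psi> f) \<le> \<rho> * B_norm f" and \<rho>: "0 < \<rho>"
  obtains xs where "xs \<in> atomic_lists" "weight xs \<le> 8 * \<rho>"
    "\<And>f. f \<in> B_space \<Longrightarrow> cmod (\<psi> f - (CINT x. f x * combination xs x)) \<le> \<rho> / 2 * B_norm f"
    "\<And>\<eta>. 0 < \<eta> \<Longrightarrow> \<exists>g. approximates q \<eta> (\<lambda>f. \<psi> f - (CINT x. f x * combination xs x)) g"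
proof -
  obtain g where g: "approximates q (\<rho> / 4) \<psi> g"
    using approx[of "\<rho> / 4"] \<rho> by auto
  note gX = approximatesD[OF g]
  have "cmod (CINT x. f x * g x) \<le> (2 * \<rho>) * B_norm f" if f: "f \<in> B_space" for f
  proof -
    have "cmod (CINT x. f x * g x) \<le> cmod (\<psi> f) + cmod (\<psi> f - (CINT x. f x * g x))"
      using norm_triangle_ineq4[of "\<psi> f" "\<psi> f - (CINT x. f x * g x)"] by simp
    also have "\<dots> \<le> \<rho> * B_norm f + \<rho> / 4 * B_norm f"
      by (intro add_mono bd gX f)
    also have "\<dots> \<le> (2 * \<rho>) * B_norm f"
      using \<rho> B_norm_nonneg[of f] by (simp add: algebra_simps)
    finally show ?thesis .
  qed
  then obtain xs where xs: "xs \<in> atomic_lists" "weight xs \<le> 4 * (2 * \<rho>)"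
    "Lp_norm q (\<lambda>x. g x - combination xs x) \<le> \<rho> / 4 / (D + 1)"
    using atomic_approximation[OF gX(1), of "2 * \<rho>" "\<rho> / 4 / (D + 1)"] \<rho> D by (auto simp: divide_pos_pos)
  note cX = combination_mean_zero[OF xs(1) q1]
  show thesis
  proof (rule that[OF xs(1)])
    show "weight xs \<le> 8 * \<rho>" using xs(2) by simp
    show "cmod (\<psi> f - (CINT x. f x * combination xs x)) \<le> \<rho> / 2 * B_norm f" if f: "f \<in> B_space" for f
    proof -
      have "cmod (CINT x. f x * (g x - combination xs x)) \<le> D * Lp_norm q (\<lambda>x. g x - combination xs x) * B_norm f"
        by (intro pairing_bound f cseminorm_diff_mem[OF cseminorm_Lp_mean_zero[OF q1]] gX cX)
      also have "\<dots> \<le> \<rho> / 4 * B_norm f"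
      proof (rule mult_right_mono[OF _ B_norm_nonneg])
        have "D * Lp_norm q (\<lambda>x. g x - combination xs x) \<le> D * (\<rho> / 4 / (D + 1))"
          using D xs(3) by (intro mult_left_mono) auto
        also have "\<dots> \<le> \<rho> / 4" using D \<rho> by (simp add: field_simps)
        finally show "D * Lp_norm q (\<lambda>x. g x - combination xs x) \<le> \<rho> / 4" .
      qed
      finally have "cmod ((CINT x. f x * g x) - (CINT x. f x * combination xs x)) \<le> \<rho> / 4 * B_norm f"
        unfolding pairing_diff[OF f gX(1) cX] .
      moreover have "cmod (\<psi> f - (CINT x. f x * g x)) \<le> \<rho> / 4 * B_norm f"
        by (rule gX(2)[OF f])
      ultimately show ?thesis
        using norm_triangle_ineq[of "\<psi> f - (CINT x. f x * g x)"
          "(CINT x. f x * g x) - (CINT x. f x * combination xs x)"] by simp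
    qed
    show "\<exists>g. approximates q \<eta> (\<lambda>f. \<psi> f - (CINT x. f x * combination xs x)) g" if \<eta>: "0 < \<eta>" for \<eta>
    proof -
      obtain h where h: "approximates q \<eta> \<psi> h" using approx[OF \<eta>] by blast
      note hX = approximatesD[OF h]
      have "approximates q \<eta> (\<lambda>f. \<psi> f - (CINT x. f x * combination xs x)) (\<lambda>x. h x - combination xs x)"
        unfolding approximates_def
        using hX cX by (simp add: pairing_diff cseminorm_diff_mem[OF cseminorm_Lp_mean_zero[OF q1]])
      then show ?thesis by blast
    qed
  qed
qed

text \<open>Each reduction halves the remainder with atoms of weight proportional to it, so the
  weights are summable and the remainders vanish. The constant 8 is irrelevant: membership asks for
  an absolutely summable coefficient sequence, not for a sharp bound.\<close>

lemma closure_in_predual: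
  fixes \<phi> :: "'n::finite cfun \<Rightarrow> complex"
  assumes \<phi>: "\<phi> \<in> dual_space B_space B_norm" and approx: "\<And>\<eta>. 0 < \<eta> \<Longrightarrow> \<exists>g. approximates q \<eta> \<phi> g"
  shows "\<phi> \<in> B_predual"
proof -
  \<comment> \<open>The summand 1 keeps the bound positive for \<open>\<phi>\<close> = 0, as the
    reduction step requires.\<close>
  define R where "R = dual_norm B_space B_norm \<phi> + 1"
  have R: "0 < R" using dual_norm_nonneg[OF cseminorm_B \<phi>] by (simp add: R_def)
  define good where "good m \<psi> \<longleftrightarrow> (\<forall>\<eta>>0. \<exists>g. approximates q \<eta> \<psi> g) \<and>
    (\<forall>f\<in>B_space. cmod (\<psi> f) \<le> R / 2 ^ m * B_norm f)" for m and \<psi> :: "'n cfun \<Rightarrow> complex"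
  define step where "step m \<psi> \<psi>' \<longleftrightarrow> (\<exists>xs. xs \<in> atomic_lists \<and> weight xs \<le> 8 * (R / 2 ^ m) \<and>
    \<psi>' = (\<lambda>f. \<psi> f - (CINT x. f x * combination xs x)))" for m and \<psi> \<psi>' :: "'n cfun \<Rightarrow> complex"
  \<comment> \<open>The conjunct about m = 0 pins the start of the sequence to
    \<open>\<phi>\<close>, which dependent choice alone would leave open.\<close>
  have "\<exists>\<Psi>. \<forall>m. (good m (\<Psi> m) \<and> (m = 0 \<longrightarrow> \<Psi> m = \<phi>)) \<and> step m (\<Psi> m) (\<Psi> (Suc m))"
  proof (rule dependent_nat_choice)
    have "cmod (\<phi> f) \<le> R / 2 ^ 0 * B_norm f" if "f \<in> B_space" for f
      using dual_bound[OF cseminorm_B \<phi> that] B_norm_nonneg[of f] by (simp add: R_def distrib_right)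
    then show "\<exists>\<psi>. good 0 \<psi> \<and> ((0::nat) = 0 \<longrightarrow> \<psi> = \<phi>)"
      using approx unfolding good_def by blast
  next
    fix \<psi> m assume \<psi>: "good m \<psi> \<and> (m = 0 \<longrightarrow> \<psi> = \<phi>)"
    obtain xs where xs: "xs \<in> atomic_lists" "weight xs \<le> 8 * (R / 2 ^ m)"
      "\<And>f. f \<in> B_space \<Longrightarrow> cmod (\<psi> f - (CINT x. f x * combination xs x)) \<le> R / 2 ^ m / 2 * B_norm f"
      "\<And>\<eta>. 0 < \<eta> \<Longrightarrow> \<exists>g. approximates q \<eta> (\<lambda>f. \<psi> f - (CINT x. f x * combination xs x)) g"
      using atomic_reduction_step[of \<psi> "R / 2 ^ m"] \<psi> R unfolding good_def by auto
    let ?\<psi>' = "\<lambda>f. \<psi> f - (CINT x. f x * combination xs x)"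
    have "good (Suc m) ?\<psi>'"
      unfolding good_def using xs(3,4) by (simp add: mult.commute)
    moreover have "step m \<psi> ?\<psi>'"
      unfolding step_def using xs(1,2) by blast
    ultimately show "\<exists>\<psi>'. (good (Suc m) \<psi>' \<and> (Suc m = 0 \<longrightarrow> \<psi>' = \<phi>)) \<and> step m \<psi> \<psi>'"
      by auto
  qed
  then obtain \<Psi> where \<Psi>: "\<And>m. good m (\<Psi> m)" "\<Psi> 0 = \<phi>" "\<And>m. step m (\<Psi> m) (\<Psi> (Suc m))"
    by blast
  have "\<exists>xs. \<forall>m. xs m \<in> atomic_lists \<and> weight (xs m) \<le> 8 * (R / 2 ^ m) \<and>
      \<Psi> (Suc m) = (\<lambda>f. \<Psi> m f - (CINT x. f x * combination (xs m) x))"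
    using \<Psi>(3) unfolding step_def by (intro choice allI)
  then obtain xs where xs: "\<And>m. xs m \<in> atomic_lists" "\<And>m. weight (xs m) \<le> 8 * (R / 2 ^ m)"
    "\<And>m. \<Psi> (Suc m) = (\<lambda>f. \<Psi> m f - (CINT x. f x * combination (xs m) x))"
    by blast
  have sums: "(\<lambda>m. \<integral>x. f x * combination (xs m) x \<partial>cube_measure) sums \<phi> f" if f: "f \<in> B_space" for f
  proof -
    have part: "(\<Sum>i<m. CINT x. f x * combination (xs i) x) = \<phi> f - \<Psi> m f" for m
      by (induction m) (simp_all add: \<Psi>(2) xs(3))
    have "(\<lambda>m. \<Psi> m f) \<longlonglongrightarrow> 0"
    proof (rule Lim_null_comparison)
      show "\<forall>\<^sub>F m in sequentially. cmod (\<Psi> m f) \<le> R * B_norm f * (1 / 2) ^ m"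
        using \<Psi>(1) f unfolding good_def by (intro always_eventually allI) (auto simp: power_one_over)
      have "(\<lambda>m. R * B_norm f * (1 / 2) ^ m) \<longlonglongrightarrow> R * B_norm f * 0"
        by (intro tendsto_intros LIMSEQ_power_zero) auto
      then show "(\<lambda>m. R * B_norm f * (1 / 2) ^ m) \<longlonglongrightarrow> 0" by simp
    qed
    then have "(\<lambda>m. \<phi> f - \<Psi> m f) \<longlonglongrightarrow> \<phi> f - 0"
      by (intro tendsto_intros)
    then show ?thesis unfolding sums_def part by simp
  qed
  define c where "c m i = (if i < length (xs m) then fst (xs m ! i) else 0)" for m i
  define a where "a m i = (if i < length (xs m) then snd (xs m ! i) else (\<lambda>x. 0))" for m i
  have "atom (snd y)" if "y \<in> set (xs m)" for y m
    using xs(1)[of m] that by (auto simp: atomic_lists_def)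
  then have atoms: "atom (a m i)" for m i
    using atom_zero nth_mem by (metis a_def)
  have wt: "(\<Sum>i<length (xs m). cmod (c m i)) = weight (xs m)" for m
    unfolding weight_def by (simp add: c_def sum_list_sum_nth lessThan_atLeast0 case_prod_beta)
  have comb: "(\<Sum>i<length (xs m). c m i * (CINT x. f x * a m i x)) = (CINT x. f x * combination (xs m) x)"
    if f: "f \<in> B_space" for f m
    unfolding pairing_combination[OF f xs(1)] by (simp add: c_def a_def sum_list_sum_nth lessThan_atLeast0 case_prod_beta)
  have geo: "summable (\<lambda>m. 8 * R * (1 / 2) ^ m)"
    by (intro summable_mult summable_geometric) auto
  have summ: "summable (\<lambda>m. \<Sum>i<length (xs m). cmod (c m i))"
    unfolding wt using xs(2)
    by (intro summable_comparison_test'[OF geo, where N=0]) (simp add: power_one_over abs_of_nonneg[OF weight_nonneg])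
  show ?thesis
    unfolding B_predual_def
  proof (intro CollectI conjI \<phi> exI ballI allI)
    show "summable (\<lambda>n. cmod (c (fst (prod_decode n)) (snd (prod_decode n))))"
      by (rule double_series(1)[OF _ summ]) (simp add: c_def)
    show "atom (a (fst (prod_decode n)) (snd (prod_decode n)))" for n
      by (rule atoms)
    fix f :: "'n cfun" assume f: "f \<in> B_space"
    define w where "w m i = c m i * (CINT x. f x * a m i x)" for m i
    have "summable (\<lambda>m. \<Sum>i<length (xs m). cmod (w m i))"
    proof (rule summable_comparison_test'[OF summable_mult[OF summ, of "B_norm f"]])
      fix m
      have "(\<Sum>i<length (xs m). cmod (w m i)) \<le> (\<Sum>i<length (xs m). B_norm f * cmod (c m i))"
        unfolding w_def norm_mult mult.commute[of "cmod (c m _)"] by (intro sum_mono mult_right_mono atom_pairing_le[OF atoms f]) auto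
      then show "norm (\<Sum>i<length (xs m). cmod (w m i)) \<le> B_norm f * (\<Sum>i<length (xs m). cmod (c m i))"
        by (simp add: sum_distrib_left sum_nonneg)
    qed
    then have "(\<lambda>n. w (fst (prod_decode n)) (snd (prod_decode n))) sums (\<Sum>m. \<Sum>i<length (xs m). w m i)"
      by (intro double_series(2)) (auto simp: w_def c_def)
    moreover have "(\<Sum>m. \<Sum>i<length (xs m). w m i) = \<phi> f"
      unfolding w_def comb[OF f] using sums[OF f] by (simp add: sums_iff)
    ultimately show "\<phi> f = (\<Sum>n. c (fst (prod_decode n)) (snd (prod_decode n)) *
        (CINT x. f x * a (fst (prod_decode n)) (snd (prod_decode n)) x))"
      by (simp add: w_def sums_iff)
  qed
qed

lemma predual_approximable:
  fixes \<phi> :: "'n::finite cfun \<Rightarrow> complex"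
  assumes \<phi>: "\<phi> \<in> B_predual" and \<eta>: "0 < \<eta>"
  obtains xs where "xs \<in> atomic_lists" "approximates q \<eta> \<phi> (combination xs)"
proof -
  obtain c g where cg: "summable (\<lambda>n. cmod (c n))" "\<And>n. atom (g n)"
    "\<And>f. f \<in> B_space \<Longrightarrow> \<phi> f = (\<Sum>n::nat. c n * (CINT x. f x * g n x))"
    using \<phi> unfolding B_predual_def by blast
  obtain N where N: "(\<Sum>n. cmod (c (n + N))) < \<eta>"
    using suminf_exist_split[OF \<eta> cg(1)] by (auto simp: suminf_nonneg summable_ignore_initial_segment[OF cg(1)])
  define xs where "xs = map (\<lambda>n. (c n, g n)) [0..<N]"
  have xs: "xs \<in> atomic_lists"
    using cg(2) by (auto simp: xs_def atomic_lists_def)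
  have "cmod (\<phi> f - (CINT x. f x * combination xs x)) \<le> \<eta> * B_norm f" if f: "f \<in> B_space" for f
  proof -
    let ?t = "\<lambda>n. c n * (CINT x. f x * g n x)"
    have le: "cmod (?t n) \<le> cmod (c n) * B_norm f" for n
      using atom_pairing_le[OF cg(2) f, of n] by (simp add: norm_mult mult_left_mono)
    have st: "summable (\<lambda>n. cmod (?t n))"
      by (rule summable_comparison_test'[OF summable_mult2[OF cg(1), of "B_norm f"], where N=0]) (use le in simp)
    have "(CINT x. f x * combination xs x) = (\<Sum>n<N. ?t n)"
      unfolding pairing_combination[OF f xs] by (simp add: xs_def o_def interv_sum_list_conv_sum_set_nat lessThan_atLeast0)
    then have "\<phi> f - (CINT x. f x * combination xs x) = (\<Sum>n. ?t (n + N))"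
      using suminf_split_initial_segment[OF summable_norm_cancel[OF st], of N] by (simp add: cg(3)[OF f])
    also have "cmod \<dots> \<le> (\<Sum>n. cmod (?t (n + N)))"
      by (intro summable_norm summable_ignore_initial_segment st)
    also have "\<dots> \<le> (\<Sum>n. cmod (c (n + N)) * B_norm f)"
      by (intro suminf_le le summable_ignore_initial_segment st summable_mult2 cg(1))
    also have "\<dots> = (\<Sum>n. cmod (c (n + N))) * B_norm f"
      by (intro suminf_mult2[symmetric] summable_ignore_initial_segment cg(1))
    also have "\<dots> \<le> \<eta> * B_norm f"
      using N B_norm_nonneg by (intro mult_right_mono) auto
    finally show ?thesis .
  qed
  then show thesis
    using that[OF xs] combination_mean_zero[OF xs q1] unfolding approximates_def by blast
qed

text \<open>A mean-zero L^q function approximates its own functional with error 0, so the closure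
  lemma applies at once.\<close>

lemma pairing_in_predual:
  assumes g: "(g :: 'n::finite cfun) \<in> Lp_mean_zero q"
  shows "pairing_functional B_space g \<in> B_predual"
proof (rule closure_in_predual[OF pairing_B_dual[OF g]])
  fix \<eta> :: real assume "0 < \<eta>"
  then have "approximates q \<eta> (pairing_functional B_space g) g"
    using g B_norm_nonneg by (auto simp: approximates_def pairing_functional_def intro!: mult_nonneg_nonneg)
  then show "\<exists>h. approximates q \<eta> (pairing_functional B_space g) h" by blast
qed

text \<open>Closure under linear combinations is obtained from approximability by L^q functions,
  which spares interleaving two atomic series.\<close>

lemma cseminorm_predual: "cseminorm_on (B_predual :: ('n::finite cfun \<Rightarrow> complex) set) B_predual_norm"
proof -
  note snB = cseminorm_B[where 'n='n]
  note snd = cseminorm_dual[OF snB]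
  note snX = cseminorm_Lp_mean_zero[OF q1, where 'n='n]
  show ?thesis
  proof (rule cseminorm_onI)
    have z: "(\<lambda>x. 0) \<in> (Lp_mean_zero q :: 'n cfun set)"
      by (rule cseminorm_zero_mem[OF snX])
    have "pairing_functional B_space (\<lambda>x :: real^'n. 0) = (\<lambda>f. 0)"
      by (auto simp: pairing_functional_def)
    then show "(\<lambda>f :: 'n cfun. 0) \<in> B_predual"
      using pairing_in_predual[OF z] by simp
    show "0 \<le> B_predual_norm \<phi>" if "\<phi> \<in> B_predual" for \<phi> :: "'n cfun \<Rightarrow> complex"
      by (rule dual_norm_nonneg[OF snB B_predualD[OF that]])
    fix \<phi> \<psi> :: "'n cfun \<Rightarrow> complex" and a b assume \<phi>: "\<phi> \<in> B_predual" and \<psi>: "\<psi> \<in> B_predual"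
    show "B_predual_norm (\<lambda>f. a * \<phi> f + b * \<psi> f) \<le> cmod a * B_predual_norm \<phi> + cmod b * B_predual_norm \<psi>"
      by (rule cseminorm_lincomb[OF snd B_predualD[OF \<phi>] B_predualD[OF \<psi>]])
    show "(\<lambda>f. a * \<phi> f + b * \<psi> f) \<in> B_predual"
    proof (rule closure_in_predual[OF cseminorm_lincomb_mem[OF snd B_predualD[OF \<phi>] B_predualD[OF \<psi>]]])
      fix \<eta> :: real assume \<eta>: "0 < \<eta>"
      define s where "s = cmod a + cmod b + 1"
      have s: "0 < s" "cmod a + cmod b \<le> s" by (simp_all add: s_def add_nonneg_pos)
      have \<eta>s: "0 < \<eta> / s" using \<eta> s by simp
      obtain xs where xs: "approximates q (\<eta> / s) \<phi> (combination xs)"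
        using predual_approximable[OF \<phi> \<eta>s] by blast
      obtain ys where ys: "approximates q (\<eta> / s) \<psi> (combination ys)"
        using predual_approximable[OF \<psi> \<eta>s] by blast
      note X = approximatesD[OF xs] and Y = approximatesD[OF ys]
      have "approximates q \<eta> (\<lambda>f. a * \<phi> f + b * \<psi> f) (\<lambda>x. a * combination xs x + b * combination ys x)"
        unfolding approximates_def
      proof (intro conjI ballI)
        show "(\<lambda>x. a * combination xs x + b * combination ys x) \<in> Lp_mean_zero q"
          by (rule cseminorm_lincomb_mem[OF snX X(1) Y(1)])
        fix f :: "'n cfun" assume f: "f \<in> B_space"
        let ?x = "\<phi> f - (CINT x. f x * combination xs x)" and ?y = "\<psi> f - (CINT x. f x * combination ys x)"
        have "a * \<phi> f + b * \<psi> f - (CINT x. f x * (a * combination xs x + b * combination ys x)) = a * ?x + b * ?y"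
          unfolding pairing_lincomb[OF f X(1) Y(1)] by (simp add: algebra_simps)
        also have "cmod \<dots> \<le> cmod a * cmod ?x + cmod b * cmod ?y"
          using norm_triangle_ineq[of "a * ?x" "b * ?y"] by (simp only: norm_mult)
        also have "\<dots> \<le> cmod a * (\<eta> / s * B_norm f) + cmod b * (\<eta> / s * B_norm f)"
          by (intro add_mono mult_left_mono X Y f) auto
        also have "\<dots> = (cmod a + cmod b) * (\<eta> / s * B_norm f)"
          by (rule distrib_right[symmetric])
        also have "\<dots> \<le> s * (\<eta> / s * B_norm f)"
          using s by (intro mult_right_mono mult_nonneg_nonneg B_norm_nonneg less_imp_le[OF \<eta>s])
        also have "\<dots> = \<eta> * B_norm f" using s by simp
        finally show "cmod (a * \<phi> f + b * \<psi> f - (CINT x. f x * (a * combination xs x + b * combination ys x))) \<le> \<eta> * B_norm f" .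
      qed
      then show "\<exists>g. approximates q \<eta> (\<lambda>f. a * \<phi> f + b * \<psi> f) g" by blast
    qed
  qed
qed

lemma pairing_in_predual_bound:
  assumes g: "(g :: 'n::finite cfun) \<in> Lp_mean_zero q" and "0 \<le> C"
    and "\<And>f. f \<in> B_space \<Longrightarrow> cmod (CINT x. f x * g x) \<le> C * B_norm f"
  shows "B_predual_norm (pairing_functional B_space g) \<le> C"
  using assms by (intro dual_norm_le[OF cseminorm_B]) (auto simp: pairing_functional_def)

subsection \<open>The dual of the predual\<close>

text \<open>One inequality is the definition of the dual norm. For the other, twice a norming atom
  is an element of the unit ball of \<open>B_predual\<close>, and such elements determine
  \<open>B_norm f\<close> by \<open>B_norm_le_atoms\<close>.\<close>

lemma evaluation_isometry:
  fixes f :: "'n::finite cfun"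
  assumes f: "f \<in> B_space"
  shows "(\<lambda>\<phi>. if \<phi> \<in> B_predual then \<phi> f else 0) \<in> dual_space B_predual B_predual_norm"
    and "dual_norm B_predual B_predual_norm (\<lambda>\<phi>. if \<phi> \<in> B_predual then \<phi> f else 0) = B_norm f"
proof -
  let ?J = "\<lambda>\<phi> :: 'n cfun \<Rightarrow> complex. if \<phi> \<in> B_predual then \<phi> f else 0"
  have bd: "cmod (?J \<phi>) \<le> B_norm f * B_predual_norm \<phi>" if "\<phi> \<in> B_predual" for \<phi>
    using dual_bound[OF cseminorm_B B_predualD[OF that] f] that by (simp add: mult.commute)
  show mem: "?J \<in> dual_space B_predual B_predual_norm"
  proof (rule dual_spaceI[OF _ bd])
    show "clinear_functional_on B_predual ?J"
      using cseminorm_lincomb_mem[OF cseminorm_predual] by (simp add: clinear_functional_on_def)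
  qed auto
  show "dual_norm B_predual B_predual_norm ?J = B_norm f"
  proof (rule antisym)
    show "dual_norm B_predual B_predual_norm ?J \<le> B_norm f"
      by (rule dual_norm_le[OF cseminorm_predual B_norm_nonneg bd])
    show "B_norm f \<le> dual_norm B_predual B_predual_norm ?J"
    proof (rule B_norm_le_atoms(2)[OF B_spaceD(1)[OF f]])
      fix g :: "'n cfun"
      assume g: "atom g" and le: "\<And>k. k \<in> B_space \<Longrightarrow> cmod (CINT x. k x * (2 * g x)) \<le> B_norm k"
      have X: "(\<lambda>x. 2 * g x) \<in> Lp_mean_zero q"
        by (rule cseminorm_scale_mem[OF cseminorm_Lp_mean_zero[OF q1] atom_mean_zero[OF g q1]])
      have le1: "B_predual_norm (pairing_functional B_space (\<lambda>x. 2 * g x)) \<le> 1"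
        using le by (intro pairing_in_predual_bound[OF X]) auto
      have "cmod (?J (pairing_functional B_space (\<lambda>x. 2 * g x))) \<le> dual_norm B_predual B_predual_norm ?J"
        by (rule dual_norm_upper[where N=B_predual_norm, OF cseminorm_predual mem pairing_in_predual[OF X] le1])
      then show "cmod (CINT x. f x * (2 * g x)) \<le> dual_norm B_predual B_predual_norm ?J"
        using pairing_in_predual[OF X] f by (simp add: pairing_functional_def)
    qed
  qed
qed

text \<open>On mean-zero L^q functions \<open>\<Psi>\<close> is bounded by the embedding, so it is
  integration against some f in L^p. Boundedness of \<open>\<Psi>\<close> on the norming functions
  puts f into \<open>B_space\<close>, and approximability extends the identity to all of
  \<open>B_predual\<close>.\<close>

lemma evaluation_surjective:
  assumes \<Psi>: "\<Psi> \<in> dual_space (B_predual :: ('n::finite cfun \<Rightarrow> complex) set) B_predual_norm"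
  obtains f where "f \<in> B_space" "\<Psi> = (\<lambda>\<phi>. if \<phi> \<in> B_predual then \<phi> f else 0)"
proof -
  note snX = cseminorm_Lp_mean_zero[OF q1, where 'n='n]
  define C where "C = dual_norm B_predual B_predual_norm \<Psi>"
  have C0: "0 \<le> C" unfolding C_def by (rule dual_norm_nonneg[OF cseminorm_predual \<Psi>])
  have C: "cmod (\<Psi> \<phi>) \<le> C * B_predual_norm \<phi>" if "\<phi> \<in> B_predual" for \<phi>
    unfolding C_def by (rule dual_bound[OF cseminorm_predual \<Psi> that])
  note lin\<Psi> = dual_spaceD(1)[OF \<Psi>]
  define \<Lambda> where "\<Lambda> g = \<Psi> (pairing_functional B_space g)" for g :: "'n cfun"
  have pair_lin: "pairing_functional B_space (\<lambda>x. a * g x + b * h x) =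
      (\<lambda>f. a * pairing_functional B_space g f + b * pairing_functional B_space h f)"
    if "g \<in> Lp_mean_zero q" "h \<in> Lp_mean_zero q" for g h :: "'n cfun" and a b
    using pairing_lincomb[OF _ that, of _ a b] by (auto simp: pairing_functional_def fun_eq_iff)
  have lin: "clinear_functional_on (Lp_mean_zero q) \<Lambda>"
    unfolding clinear_functional_on_def \<Lambda>_def
    using pair_lin clinear_functional_onD[OF lin\<Psi> pairing_in_predual pairing_in_predual] by simp
  have "cmod (\<Lambda> g) \<le> (C * D) * Lp_norm q g" if g: "g \<in> Lp_mean_zero q" for g
  proof -
    have "cmod (\<Lambda> g) \<le> C * B_predual_norm (pairing_functional B_space g)"
      unfolding \<Lambda>_def by (rule C[OF pairing_in_predual[OF g]])
    also have "\<dots> \<le> C * (D * Lp_norm q g)"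
      using pairing_bound[OF _ g] D by (intro mult_left_mono C0 pairing_in_predual_bound[OF g] mult_nonneg_nonneg Lp_norm_nonneg)
    finally show ?thesis by simp
  qed
  then obtain f where f: "f \<in> Lp_space p" "\<And>g. g \<in> Lp_mean_zero q \<Longrightarrow> \<Lambda> g = (CINT x. f x * g x)"
    using Lp_mean_zero_Riesz[OF p q lin] by blast
  have fB: "f \<in> B_space"
  proof (rule B_norm_le_atoms(1)[OF Lp_L1(1)[OF p f(1)]])
    fix g :: "'n cfun"
    assume g: "atom g" and le: "\<And>k. k \<in> B_space \<Longrightarrow> cmod (CINT x. k x * (2 * g x)) \<le> B_norm k"
    have X: "(\<lambda>x. 2 * g x) \<in> Lp_mean_zero q"
      by (rule cseminorm_scale_mem[OF snX atom_mean_zero[OF g q1]])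
    have "cmod (\<Psi> (pairing_functional B_space (\<lambda>x. 2 * g x))) \<le> C * B_predual_norm (pairing_functional B_space (\<lambda>x. 2 * g x))"
      by (rule C[OF pairing_in_predual[OF X]])
    also have "\<dots> \<le> C * 1"
      using le by (intro mult_left_mono C0 pairing_in_predual_bound[OF X]) auto
    finally show "cmod (CINT x. f x * (2 * g x)) \<le> C"
      using f(2)[OF X] by (simp add: \<Lambda>_def)
  qed
  have "\<Psi> \<phi> = \<phi> f" if \<phi>: "\<phi> \<in> B_predual" for \<phi>
  proof -
    have "cmod (\<Psi> \<phi> - \<phi> f) \<le> (C + B_norm f) * \<eta>" if \<eta>: "0 < \<eta>" for \<eta>
    proof -
      obtain xs where xs: "approximates q \<eta> \<phi> (combination xs)"
        using predual_approximable[OF \<phi> \<eta>] by blast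
      note X = approximatesD[OF xs]
      let ?g = "pairing_functional B_space (combination xs)"
      have d: "(\<lambda>k. \<phi> k - ?g k) \<in> B_predual"
        by (rule cseminorm_diff_mem[OF cseminorm_predual \<phi> pairing_in_predual[OF X(1)]])
      have "\<Psi> \<phi> - \<phi> f = \<Psi> (\<lambda>k. \<phi> k - ?g k) - (\<phi> f - (CINT x. f x * combination xs x))"
        using clinear_functional_on_diff[OF lin\<Psi> \<phi> pairing_in_predual[OF X(1)]] f(2)[OF X(1)] by (simp add: \<Lambda>_def)
      also have "cmod \<dots> \<le> cmod (\<Psi> (\<lambda>k. \<phi> k - ?g k)) + cmod (\<phi> f - (CINT x. f x * combination xs x))"
        by (rule norm_triangle_ineq4)
      also have "\<dots> \<le> C * B_predual_norm (\<lambda>k. \<phi> k - ?g k) + \<eta> * B_norm f"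
        by (intro add_mono C d X fB)
      also have "C * B_predual_norm (\<lambda>k. \<phi> k - ?g k) \<le> C * \<eta>"
        using \<eta> X(2) by (intro mult_left_mono[OF _ C0] dual_norm_le[OF cseminorm_B]) (auto simp: pairing_functional_def)
      finally show ?thesis
        by (simp add: algebra_simps)
    qed
    then have "cmod (\<Psi> \<phi> - \<phi> f) \<le> 0"
    proof (intro tendsto_lowerbound[where F="at_right 0" and f="\<lambda>\<eta>. (C + B_norm f) * \<eta>"])
      show "((\<lambda>\<eta>. (C + B_norm f) * \<eta>) \<longlongrightarrow> 0) (at_right 0)"
        by (auto intro!: tendsto_eq_intros)
      show "\<forall>\<^sub>F \<eta> in at_right 0. cmod (\<Psi> \<phi> - \<phi> f) \<le> (C + B_norm f) * \<eta>"
        using eventually_at_right_less[of 0] by eventually_elim (fact \<open>\<And>\<eta>. 0 < \<eta> \<Longrightarrow> cmod (\<Psi> \<phi> - \<phi> f) \<le> (C + B_norm f) * \<eta>\<close>)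
    qed auto
    then show ?thesis by simp
  qed
  then have "\<Psi> = (\<lambda>\<phi>. if \<phi> \<in> B_predual then \<phi> f else 0)"
    using dual_spaceD(3)[OF \<Psi>] by auto
  with fB show thesis by (rule that)
qed

lemma B_isometric_predual_dual:
  "isometric_isomorphism (B_space :: 'n::finite cfun set) B_norm (dual_space B_predual B_predual_norm)
     (dual_norm B_predual B_predual_norm) (\<lambda>f \<phi>. if \<phi> \<in> B_predual then \<phi> f else 0)"
  unfolding isometric_isomorphism_def
proof (intro conjI ballI)
  show "clinear_map_on (B_space :: 'n cfun set) (\<lambda>f \<phi>. if \<phi> \<in> B_predual then \<phi> f else 0)"
    unfolding clinear_map_on_def
    using clinear_functional_onD[OF dual_spaceD(1)[OF B_predualD]] by (auto simp: fun_eq_iff)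
  show "(\<lambda>f \<phi>. if \<phi> \<in> B_predual then \<phi> f else 0) ` (B_space :: 'n cfun set) = dual_space B_predual B_predual_norm"
    using evaluation_isometry(1) evaluation_surjective by (auto simp: image_iff) blast
qed (rule evaluation_isometry(2))

subsection \<open>The dual of \<open>B\<^sub>0\<close>\<close>

text \<open>Restriction to \<open>B0_space\<close> is written as the adjoint of the identity map.
  The codomain does not occur in \<open>adjoint_op\<close>, so the same term is also the adjoint of
  the inclusion into L^p.\<close>

lemma restriction_dual:
  assumes \<phi>: "\<phi> \<in> dual_space (B_space :: 'n::finite cfun set) B_norm"
  shows "adjoint_op B0_space (\<lambda>f. f) \<phi> \<in> dual_space B0_space B_norm"
    and "dual_norm B0_space B_norm (adjoint_op B0_space (\<lambda>f. f) \<phi>) \<le> B_predual_norm \<phi>"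
proof -
  have bd: "cmod (adjoint_op B0_space (\<lambda>f. f) \<phi> f) \<le> B_predual_norm \<phi> * B_norm f" if "f \<in> B0_space" for f
    using dual_bound[OF cseminorm_B \<phi> B0_spaceD(1)[OF that]] that by (simp add: adjoint_op_def)
  show "adjoint_op B0_space (\<lambda>f. f) \<phi> \<in> dual_space B0_space B_norm"
  proof (rule dual_spaceI[OF _ bd])
    show "clinear_functional_on B0_space (adjoint_op B0_space (\<lambda>f. f) \<phi>)"
      unfolding clinear_functional_on_def adjoint_op_def
    proof (intro ballI allI)
      fix f g :: "'n cfun" and a b assume fg: "f \<in> B0_space" "g \<in> B0_space"
      show "(if (\<lambda>x. a * f x + b * g x) \<in> B0_space then \<phi> (\<lambda>x. a * f x + b * g x) else 0) =
          a * (if f \<in> B0_space then \<phi> f else 0) + b * (if g \<in> B0_space then \<phi> g else 0)"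
        using fg cseminorm_lincomb_mem[OF cseminorm_B0 fg]
          clinear_functional_onD[OF dual_spaceD(1)[OF \<phi>] B0_spaceD(1)[OF fg(1)] B0_spaceD(1)[OF fg(2)]] by simp
    qed
  qed (auto simp: adjoint_op_def)
  show "dual_norm B0_space B_norm (adjoint_op B0_space (\<lambda>f. f) \<phi>) \<le> B_predual_norm \<phi>"
    by (rule dual_norm_le[OF cseminorm_B0 dual_norm_nonneg[OF cseminorm_B \<phi>] bd])
qed

text \<open>Smoothings of f lie in \<open>B0_space\<close> with nearly the norm of f, but converge
  only in L^1. A functional in the predual is therefore first replaced by a finite combination of
  atoms, which is a bounded function, so that L^1 convergence suffices in the pairing.\<close>

lemma restriction_isometry:
  fixes \<phi> :: "'n::finite cfun \<Rightarrow> complex"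
  assumes \<phi>: "\<phi> \<in> B_predual"
  shows "dual_norm B0_space B_norm (adjoint_op B0_space (\<lambda>f. f) \<phi>) = B_predual_norm \<phi>"
proof (rule antisym)
  note \<phi>d = B_predualD[OF \<phi>]
  note T = restriction_dual[OF \<phi>d]
  show "dual_norm B0_space B_norm (adjoint_op B0_space (\<lambda>f. f) \<phi>) \<le> B_predual_norm \<phi>" by (rule T(2))
  define M where "M = dual_norm B0_space B_norm (adjoint_op B0_space (\<lambda>f. f) \<phi>)"
  have M0: "0 \<le> M" unfolding M_def by (rule dual_norm_nonneg[OF cseminorm_B0 T(1)])
  have MB0: "cmod (\<phi> s) \<le> M * B_norm s" if "s \<in> B0_space" for s
    using dual_bound[OF cseminorm_B0 T(1) that] that by (simp add: M_def adjoint_op_def)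
  show "B_predual_norm \<phi> \<le> dual_norm B0_space B_norm (adjoint_op B0_space (\<lambda>f. f) \<phi>)"
    unfolding M_def[symmetric]
  proof (rule dual_norm_le[OF cseminorm_B M0])
    fix f :: "'n cfun" assume f: "f \<in> B_space"
    obtain s a where s: "\<And>k :: nat. s k \<in> UC_space" "\<And>k. B_norm (s k) \<le> a k * B_norm f"
      "a \<longlonglongrightarrow> 1" "(\<lambda>k. \<integral>x. cmod (s k x - f x) \<partial>cube_measure) \<longlonglongrightarrow> 0"
      using UC_approximation[OF f] by blast
    note sB0 = UC_B0[OF s(1)] and sB = B0_spaceD(1)[OF UC_B0[OF s(1)]]
    have le: "cmod (\<phi> f) \<le> \<eta> * B_norm f + (\<eta> + M) * B_norm f" if \<eta>: "0 < \<eta>" for \<eta>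
    proof -
      obtain xs where xs: "xs \<in> atomic_lists" "approximates q \<eta> \<phi> (combination xs)"
        using predual_approximable[OF \<phi> \<eta>] by blast
      let ?g = "combination xs"
      note X = approximatesD[OF xs(2)]
      obtain K where K: "AE x in cube_measure. cmod (?g x) \<le> K"
        using combination_bounded[OF xs(1)] by blast
      have gm: "?g \<in> borel_measurable cube_measure"
        using Lp_spaceD(1)[OF Lp_mean_zeroD(1)[OF X(1)]] .
      have step: "cmod (\<phi> f) \<le> \<eta> * B_norm f + \<bar>K\<bar> * (CINT x. cmod (s k x - f x)) + (\<eta> + M) * (a k * B_norm f)" for k
      proof -
        have d: "(\<lambda>x. f x - s k x) \<in> L1_space"
          by (rule L1_diff[OF B_spaceD(1)[OF f] B_spaceD(1)[OF sB]])
        have dg: "integrable cube_measure (\<lambda>x. (f x - s k x) * ?g x)"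
          by (rule L1_mult_bounded[OF d gm K])
        have "(CINT x. f x * ?g x) - (CINT x. s k x * ?g x) = (CINT x. (f x - s k x) * ?g x)"
          using pairing_integrable[OF f X(1)] pairing_integrable[OF sB X(1)] by (simp add: left_diff_distrib)
        also have "cmod \<dots> \<le> (CINT x. cmod ((f x - s k x) * ?g x))"
          by (rule integral_norm_bound)
        also have "\<dots> \<le> (CINT x. \<bar>K\<bar> * cmod (s k x - f x))"
        proof (rule integral_mono_AE)
          show "integrable cube_measure (\<lambda>x. \<bar>K\<bar> * cmod (s k x - f x))"
            using d by (simp add: L1_space_def norm_minus_commute)
          show "AE x in cube_measure. cmod ((f x - s k x) * ?g x) \<le> \<bar>K\<bar> * cmod (s k x - f x)"
            using K
          proof eventually_elim
            fix x assume "cmod (?g x) \<le> K"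
            then have "cmod (f x - s k x) * cmod (?g x) \<le> cmod (f x - s k x) * \<bar>K\<bar>"
              by (intro mult_left_mono) auto
            then show "cmod ((f x - s k x) * ?g x) \<le> \<bar>K\<bar> * cmod (s k x - f x)"
              by (simp add: norm_mult norm_minus_commute mult.commute)
          qed
        qed (use dg in simp)
        finally have I: "cmod ((CINT x. f x * ?g x) - (CINT x. s k x * ?g x)) \<le> \<bar>K\<bar> * (CINT x. cmod (s k x - f x))"
          by simp
        have "cmod (\<phi> f) = cmod ((\<phi> f - (CINT x. f x * ?g x)) + ((CINT x. f x * ?g x) - (CINT x. s k x * ?g x))
            - (\<phi> (s k) - (CINT x. s k x * ?g x)) + \<phi> (s k))"
          by simp
        also have "\<dots> \<le> cmod (\<phi> f - (CINT x. f x * ?g x)) + cmod ((CINT x. f x * ?g x) - (CINT x. s k x * ?g x))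
            + cmod (\<phi> (s k) - (CINT x. s k x * ?g x)) + cmod (\<phi> (s k))"
          by (intro order_trans[OF norm_triangle_ineq] add_right_mono order_trans[OF norm_triangle_ineq4] norm_triangle_ineq)
        also have "\<dots> \<le> \<eta> * B_norm f + \<bar>K\<bar> * (CINT x. cmod (s k x - f x)) + \<eta> * B_norm (s k) + M * B_norm (s k)"
          by (intro add_mono X f I sB MB0 sB0)
        also have "\<dots> = \<eta> * B_norm f + \<bar>K\<bar> * (CINT x. cmod (s k x - f x)) + (\<eta> + M) * B_norm (s k)"
          by (simp add: algebra_simps)
        also have "\<dots> \<le> \<eta> * B_norm f + \<bar>K\<bar> * (CINT x. cmod (s k x - f x)) + (\<eta> + M) * (a k * B_norm f)"
          using \<eta> M0 by (intro add_left_mono mult_left_mono s) auto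
        finally show ?thesis .
      qed
      have "(\<lambda>k. \<eta> * B_norm f + \<bar>K\<bar> * (CINT x. cmod (s k x - f x)) + (\<eta> + M) * (a k * B_norm f))
          \<longlonglongrightarrow> \<eta> * B_norm f + \<bar>K\<bar> * 0 + (\<eta> + M) * (1 * B_norm f)"
        by (intro tendsto_intros s)
      from LIMSEQ_le_const[OF this] step show ?thesis by auto
    qed
    show "cmod (\<phi> f) \<le> M * B_norm f"
    proof (rule tendsto_lowerbound)
      show "((\<lambda>\<eta>. \<eta> * B_norm f + (\<eta> + M) * B_norm f) \<longlongrightarrow> M * B_norm f) (at_right 0)"
        by (auto intro!: tendsto_eq_intros)
      show "\<forall>\<^sub>F \<eta> in at_right 0. cmod (\<phi> f) \<le> \<eta> * B_norm f + (\<eta> + M) * B_norm f"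
        using eventually_at_right_less[of 0] by eventually_elim (rule le)
    qed simp
  qed
qed

text \<open>
  To represent a functional on \<open>B\<^sub>0\<close>, embed \<open>B\<^sub>0\<close> diagonally into the \<open>c\<^sub>0\<close>-sum of copies of
  \<open>L\<^sup>1\<close>, the \<open>j\<close>-th copy carrying the seminorm \<open>sup [f]\<^sub>\<epsilon>\<close> over \<open>2\<^sup>-\<^sup>j\<^sup>-\<^sup>1 \<le> \<epsilon> \<le> 2\<^sup>-\<^sup>j\<close>. A Hahn--Banach
  extension to the \<open>c\<^sub>0\<close>-sum splits into an absolutely convergent series of functionals on the
  single copies, and each of these is given by a function in \<open>L\<^sup>q\<close>.
\<close>

definition band_norm :: "nat \<Rightarrow> 'n::finite cfun \<Rightarrow> real" where
  "band_norm j f = (SUP \<epsilon>\<in>{(1 / 2) ^ Suc j..(1 / 2) ^ j}. rosc \<epsilon> f)"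

lemma band_pos: "\<epsilon> \<in> {(1 / 2) ^ Suc j..(1 / 2) ^ j} \<Longrightarrow> 0 < \<epsilon>" "\<epsilon> \<in> {(1 / 2) ^ Suc j..(1 / 2) ^ j} \<Longrightarrow> \<epsilon> \<le> (1 :: real)"
  using order_less_le_trans[of 0 "(1 / 2 :: real) ^ Suc j" \<epsilon>] power_le_one[of "1 / 2 :: real" j] by auto

lemma band_ne: "{(1 / 2) ^ Suc j..(1 / 2 :: real) ^ j} \<noteq> {}"
  by simp

lemma rosc_band_bound:
  assumes "f \<in> L1_space" "\<epsilon> \<in> {(1 / 2) ^ Suc j..(1 / 2) ^ j}"
  shows "rosc \<epsilon> f \<le> 4 * 2 ^ j * (CINT x. cmod (f x))"
proof -
  have e: "0 < \<epsilon>" by (rule band_pos[OF assms(2)])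
  have "2 / \<epsilon> \<le> 2 / (1 / 2) ^ Suc j"
    using assms(2) e by (intro divide_left_mono mult_pos_pos) simp_all
  also have "\<dots> = 4 * 2 ^ j"
    by (simp add: power_one_over)
  finally have "2 / \<epsilon> * (CINT x. cmod (f x)) \<le> 4 * 2 ^ j * (CINT x. cmod (f x))"
    by (rule mult_right_mono) (auto intro: integral_nonneg_AE)
  then show ?thesis
    using rosc_le_L1[OF e assms(1)] by simp
qed

lemma rosc_le_band:
  assumes "f \<in> L1_space" "\<epsilon> \<in> {(1 / 2) ^ Suc j..(1 / 2) ^ j}"
  shows "rosc \<epsilon> f \<le> band_norm j f"
  unfolding band_norm_def using assms rosc_band_bound[OF assms(1)] by (intro cSUP_upper bdd_aboveI2) auto

lemma band_norm_least: "(\<And>\<epsilon>. \<epsilon> \<in> {(1 / 2) ^ Suc j..(1 / 2) ^ j} \<Longrightarrow> rosc \<epsilon> f \<le> K) \<Longrightarrow> band_norm j f \<le> K"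
  unfolding band_norm_def by (intro cSUP_least band_ne)

lemma band_norm_le_L1: "f \<in> L1_space \<Longrightarrow> band_norm j f \<le> 4 * 2 ^ j * (CINT x. cmod (f x))"
  by (intro band_norm_least rosc_band_bound)

lemma band_norm_le_B: "f \<in> B_space \<Longrightarrow> band_norm j f \<le> B_norm f"
  by (intro band_norm_least rosc_le_B_norm band_pos)

lemma cseminorm_band: "cseminorm_on (L1_space :: 'n::finite cfun set) (band_norm j)"
proof (rule cseminorm_onI)
  show "0 \<le> band_norm j f" if "f \<in> L1_space" for f :: "'n cfun"
    using rosc_nonneg[of "(1 / 2) ^ j" f] rosc_le_band[OF that, of "(1 / 2) ^ j" j] by (simp add: field_simps)
  fix f g :: "'n cfun" and a b assume fg: "f \<in> L1_space" "g \<in> L1_space"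
  show "band_norm j (\<lambda>x. a * f x + b * g x) \<le> cmod a * band_norm j f + cmod b * band_norm j g"
  proof (rule band_norm_least)
    fix \<epsilon> :: real assume e: "\<epsilon> \<in> {(1 / 2) ^ Suc j..(1 / 2) ^ j}"
    have "rosc \<epsilon> (\<lambda>x. a * f x + b * g x) \<le> cmod a * rosc \<epsilon> f + cmod b * rosc \<epsilon> g"
      by (rule cseminorm_lincomb[OF cseminorm_rosc[OF band_pos(1)[OF e]] fg])
    also have "\<dots> \<le> cmod a * band_norm j f + cmod b * band_norm j g"
      using fg e by (intro add_mono mult_left_mono rosc_le_band) auto
    finally show "rosc \<epsilon> (\<lambda>x. a * f x + b * g x) \<le> cmod a * band_norm j f + cmod b * band_norm j g" .
  qed
  show "(\<lambda>x. a * f x + b * g x) \<in> L1_space" by (rule L1_lincomb[OF fg])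
qed (rule L1_const)

lemma band_norm_tendsto:
  assumes f: "f \<in> B0_space"
  shows "(\<lambda>j. band_norm j f) \<longlonglongrightarrow> 0"
proof (rule LIMSEQ_I)
  fix r :: real assume r: "0 < r"
  obtain e where e: "0 < e" "\<And>\<epsilon>. 0 < \<epsilon> \<Longrightarrow> \<epsilon> \<le> e \<Longrightarrow> rosc \<epsilon> f \<le> r / 2"
    using B0_small_scales[OF f half_gt_zero[OF r]] by blast
  have "(\<lambda>n. (1 / 2 :: real) ^ n) \<longlonglongrightarrow> 0"
    by (intro LIMSEQ_power_zero) auto
  then have "\<forall>\<^sub>F n in sequentially. (1 / 2 :: real) ^ n < e"
    using e(1) by (rule order_tendstoD(2))
  then obtain n where n: "\<And>j. n \<le> j \<Longrightarrow> (1 / 2 :: real) ^ j < e"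
    unfolding eventually_sequentially by blast
  have "norm (band_norm j f - 0) < r" if "n \<le> j" for j
  proof -
    have "band_norm j f \<le> r / 2"
      using n[OF that] by (intro band_norm_least e(2) band_pos) auto
    then show ?thesis
      using r cseminorm_nonneg[OF cseminorm_band B_spaceD(1)[OF B0_spaceD(1)[OF f]], of j] by simp
  qed
  then show "\<exists>n. \<forall>j\<ge>n. norm (band_norm j f - 0) < r" by blast
qed

lemma B_norm_le_bands:
  assumes f: "f \<in> L1_space" and K: "\<And>j. band_norm j f \<le> K"
  shows "B_norm f \<le> K"
proof (rule B_spaceI(2)[OF f])
  fix \<epsilon> :: real assume e: "0 < \<epsilon>" "\<epsilon> \<le> 1"
  have "\<exists>n. (1 / 2 :: real) ^ n < \<epsilon>"
    using real_arch_pow_inv[OF e(1), of "1 / 2"] by simp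
  \<comment> \<open>The least such exponent is positive because \<open>\<epsilon>\<close> <= 1, so
    its predecessor indexes the band containing \<open>\<epsilon>\<close>.\<close>
  then have L: "(1 / 2) ^ (LEAST n. (1 / 2 :: real) ^ n < \<epsilon>) < \<epsilon>"
    by (rule LeastI_ex)
  define n where "n = (LEAST n. (1 / 2 :: real) ^ n < \<epsilon>)"
  have "n \<noteq> 0" using L e by (metis n_def not_less power_0)
  then obtain j where j: "n = Suc j" by (cases n) auto
  have "\<not> (1 / 2 :: real) ^ j < \<epsilon>"
    using not_less_Least[of j "\<lambda>n. (1 / 2 :: real) ^ n < \<epsilon>"] j by (simp add: n_def)
  then have "\<epsilon> \<in> {(1 / 2) ^ Suc j..(1 / 2) ^ j}"
    using L j by (simp add: n_def)
  then show "rosc \<epsilon> f \<le> K"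
    using rosc_le_band[OF f] K[of j] by force
qed

text \<open>Sequences of functions are encoded as functions on pairs, so that the Hahn--Banach
  theorem for complex function spaces applies to the sum as it stands.\<close>

definition c0_sum :: "(nat \<times> (real^'n) \<Rightarrow> complex) set" where
  "c0_sum = {F. (\<forall>j. (\<lambda>x. F (j, x)) \<in> L1_space) \<and> (\<lambda>j. band_norm j (\<lambda>x. F (j, x))) \<longlonglongrightarrow> 0}"

definition c0_norm :: "(nat \<times> (real^'n) \<Rightarrow> complex) \<Rightarrow> real" where
  "c0_norm F = (SUP j. band_norm j (\<lambda>x. F (j, x)))"

lemma band_le_c0:
  assumes "F \<in> c0_sum"
  shows "band_norm j (\<lambda>x. F (j, x)) \<le> c0_norm F"
proof -
  have "Bseq (\<lambda>j. band_norm j (\<lambda>x. F (j, x)))"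
    using assms by (intro convergent_imp_Bseq convergentI) (auto simp: c0_sum_def)
  then obtain K where "\<And>j. norm (band_norm j (\<lambda>x. F (j, x))) \<le> K"
    unfolding Bseq_def by blast
  then show ?thesis
    unfolding c0_norm_def by (intro cSUP_upper bdd_aboveI2[where M=K]) (auto simp: abs_le_iff)
qed

lemma c0_least: "(\<And>j. band_norm j (\<lambda>x. F (j, x)) \<le> K) \<Longrightarrow> c0_norm F \<le> K"
  unfolding c0_norm_def by (intro cSUP_least) auto

text \<open>The constant is carried inside the seminorm because \<open>complex_Hahn_Banach\<close>
  extends functionals dominated by the seminorm itself.\<close>

lemma cseminorm_c0:
  assumes C: "0 \<le> C"
  shows "cseminorm_on (c0_sum :: (nat \<times> (real^'n) \<Rightarrow> complex) set) (\<lambda>F. C * c0_norm F)"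
proof (rule cseminorm_onI)
  have z: "band_norm j (\<lambda>x :: real^'n. 0) = 0" for j
    by (rule cseminorm_zero[OF cseminorm_band])
  show "(\<lambda>x. 0) \<in> (c0_sum :: (nat \<times> (real^'n) \<Rightarrow> complex) set)"
    by (simp add: c0_sum_def z L1_const)
  show "0 \<le> C * c0_norm F" if F: "F \<in> c0_sum" for F :: "nat \<times> (real^'n) \<Rightarrow> complex"
  proof -
    have "(\<lambda>x. F (0, x)) \<in> L1_space" using F by (simp add: c0_sum_def)
    from cseminorm_nonneg[OF cseminorm_band this, of 0] show ?thesis
      using band_le_c0[OF F, of 0] C by simp
  qed
  fix F G :: "nat \<times> (real^'n) \<Rightarrow> complex" and a b assume F: "F \<in> c0_sum" and G: "G \<in> c0_sum"
  have L1: "(\<lambda>x. F (j, x)) \<in> L1_space" "(\<lambda>x. G (j, x)) \<in> L1_space" for j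
    using F G by (auto simp: c0_sum_def)
  have lc: "band_norm j (\<lambda>x. a * F (j, x) + b * G (j, x)) \<le> cmod a * band_norm j (\<lambda>x. F (j, x)) + cmod b * band_norm j (\<lambda>x. G (j, x))"
    and nn: "0 \<le> band_norm j (\<lambda>x. a * F (j, x) + b * G (j, x))" for j
    by (rule cseminorm_lincomb[OF cseminorm_band L1]) (rule cseminorm_nonneg[OF cseminorm_band L1_lincomb[OF L1]])
  show "(\<lambda>x. a * F x + b * G x) \<in> c0_sum"
    unfolding c0_sum_def
  proof (intro CollectI conjI allI)
    show "(\<lambda>x. a * F (j, x) + b * G (j, x)) \<in> L1_space" for j
      by (rule L1_lincomb[OF L1])
    show "(\<lambda>j. band_norm j (\<lambda>x. a * F (j, x) + b * G (j, x))) \<longlonglongrightarrow> 0"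
    proof (rule Lim_null_comparison)
      show "\<forall>\<^sub>F j in sequentially. norm (band_norm j (\<lambda>x. a * F (j, x) + b * G (j, x))) \<le>
          cmod a * band_norm j (\<lambda>x. F (j, x)) + cmod b * band_norm j (\<lambda>x. G (j, x))"
        using lc nn by (intro always_eventually allI) simp
      have "(\<lambda>j. cmod a * band_norm j (\<lambda>x. F (j, x)) + cmod b * band_norm j (\<lambda>x. G (j, x))) \<longlonglongrightarrow> cmod a * 0 + cmod b * 0"
        using F G by (intro tendsto_intros) (auto simp: c0_sum_def)
      then show "(\<lambda>j. cmod a * band_norm j (\<lambda>x. F (j, x)) + cmod b * band_norm j (\<lambda>x. G (j, x))) \<longlonglongrightarrow> 0"
        by simp
    qed
  qed
  have "c0_norm (\<lambda>x. a * F x + b * G x) \<le> cmod a * c0_norm F + cmod b * c0_norm G"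
  proof (rule c0_least)
    fix j
    have "cmod a * band_norm j (\<lambda>x. F (j, x)) + cmod b * band_norm j (\<lambda>x. G (j, x)) \<le> cmod a * c0_norm F + cmod b * c0_norm G"
      by (intro add_mono mult_left_mono band_le_c0 F G) auto
    then show "band_norm j (\<lambda>x. a * F (j, x) + b * G (j, x)) \<le> cmod a * c0_norm F + cmod b * c0_norm G"
      using lc[of j] by simp
  qed
  then have "C * c0_norm (\<lambda>x. a * F x + b * G x) \<le> C * (cmod a * c0_norm F + cmod b * c0_norm G)"
    using C by (rule mult_left_mono)
  then show "C * c0_norm (\<lambda>x. a * F x + b * G x) \<le> cmod a * (C * c0_norm F) + cmod b * (C * c0_norm G)"
    by (simp add: algebra_simps)
qed

lemma restriction_surjective:
  fixes \<phi> :: "'n::finite cfun \<Rightarrow> complex"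
  assumes \<phi>: "\<phi> \<in> dual_space B0_space B_norm"
  obtains \<chi>' where "\<chi>' \<in> B_predual" "adjoint_op B0_space (\<lambda>f. f) \<chi>' = \<phi>"
proof -
  let ?L1 = "L1_space :: 'n cfun set"
  define C where "C = dual_norm B0_space B_norm \<phi>"
  have C: "0 \<le> C" unfolding C_def by (rule dual_norm_nonneg[OF cseminorm_B0 \<phi>])
  note lin\<phi> = dual_spaceD(1)[OF \<phi>]
  note snV = cseminorm_c0[OF C]
  define diag where "diag f = (\<lambda>z :: nat \<times> (real^'n). (f (snd z) :: complex))" for f
  define W where "W = diag ` B0_space"
  have diag_V: "diag f \<in> c0_sum" if "f \<in> B0_space" for f
    using band_norm_tendsto[OF that] B_spaceD(1)[OF B0_spaceD(1)[OF that]] by (simp add: c0_sum_def diag_def)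
  then have WV: "W \<subseteq> c0_sum" unfolding W_def by auto
  have diag_lin: "(\<lambda>z. a * diag f z + b * diag g z) = diag (\<lambda>x. a * f x + b * g x)" for a b f g
    by (simp add: diag_def)
  have snW: "cseminorm_on W (\<lambda>F. C * c0_norm F)"
  proof (rule cseminorm_onI)
    show "(\<lambda>z. 0) \<in> W"
      unfolding W_def using cseminorm_zero_mem[OF cseminorm_B0] by (intro image_eqI[of _ _ "\<lambda>x. 0"]) (auto simp: diag_def)
    fix F G a b assume "F \<in> W" "G \<in> W"
    then obtain f g where fg: "f \<in> B0_space" "g \<in> B0_space" "F = diag f" "G = diag g"
      unfolding W_def by auto
    show "(\<lambda>z. a * F z + b * G z) \<in> W"
      unfolding W_def fg(3,4) diag_lin using cseminorm_lincomb_mem[OF cseminorm_B0 fg(1,2)] by (rule imageI)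
    show "C * c0_norm (\<lambda>z. a * F z + b * G z) \<le> cmod a * (C * c0_norm F) + cmod b * (C * c0_norm G)"
      using \<open>F \<in> W\<close> \<open>G \<in> W\<close> WV by (intro cseminorm_lincomb[OF snV]) auto
  next
    show "0 \<le> C * c0_norm F" if "F \<in> W" for F
      using that WV by (intro cseminorm_nonneg[OF snV]) auto
  qed
  \<comment> \<open>A diagonal element has all rows equal, so any single row recovers the function;
    row 0 is used.\<close>
  define \<omega> where "\<omega> F = \<phi> (\<lambda>x. F (0, x))" for F :: "nat \<times> (real^'n) \<Rightarrow> complex"
  have \<omega>_diag: "\<omega> (diag f) = \<phi> f" for f
    by (simp add: \<omega>_def diag_def)
  have lin\<omega>: "clinear_functional_on W \<omega>"
    unfolding clinear_functional_on_def W_def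
    by (auto simp: diag_lin \<omega>_diag clinear_functional_onD[OF lin\<phi>])
  have bd\<omega>: "cmod (\<omega> F) \<le> C * c0_norm F" if "F \<in> W" for F
  proof -
    obtain f where f: "f \<in> B0_space" "F = diag f" using \<open>F \<in> W\<close> unfolding W_def by auto
    have "B_norm f \<le> c0_norm F"
      using band_le_c0[OF diag_V[OF f(1)]] by (intro B_norm_le_bands B_spaceD(1)[OF B0_spaceD(1)[OF f(1)]]) (simp add: f(2) diag_def)
    then have "C * B_norm f \<le> C * c0_norm F" using C by (intro mult_left_mono)
    then show ?thesis
      using dual_bound[OF cseminorm_B0 \<phi> f(1)] by (simp add: f(2) \<omega>_diag C_def)
  qed
  obtain \<Phi> where \<Phi>: "clinear_functional_on c0_sum \<Phi>" "\<And>F. F \<in> c0_sum \<Longrightarrow> cmod (\<Phi> F) \<le> C * c0_norm F"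
    "\<And>F. F \<in> W \<Longrightarrow> \<Phi> F = \<omega> F"
    using complex_Hahn_Banach[OF snV snW WV lin\<omega> bd\<omega>] by blast
  define inj where "inj j h = (\<lambda>z :: nat \<times> (real^'n). if fst z = j then (h (snd z) :: complex) else 0)" for j h
  have row: "(\<lambda>x. inj j h (i, x)) = (if i = j then h else (\<lambda>x. 0))" for i j h
    by (auto simp: inj_def)
  have zero_band: "band_norm i (\<lambda>x :: real^'n. 0) = 0" for i
    by (rule cseminorm_zero[OF cseminorm_band])
  have inj_V: "inj j h \<in> c0_sum" if h: "h \<in> ?L1" for j h
  proof -
    have "\<forall>\<^sub>F i in sequentially. band_norm i (\<lambda>x. inj j h (i, x)) = 0"
      using eventually_gt_at_top[of j] by eventually_elim (simp add: row zero_band)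
    then have "(\<lambda>i. band_norm i (\<lambda>x. inj j h (i, x))) \<longlonglongrightarrow> 0"
      by (rule tendsto_eventually)
    moreover have "(\<lambda>x :: real^'n. 0) \<in> ?L1" by (rule L1_const)
    then have "(\<lambda>x. inj j h (i, x)) \<in> L1_space" for i
      using h by (simp add: row)
    ultimately show ?thesis by (simp add: c0_sum_def)
  qed
  have inj_norm: "c0_norm (inj j h) \<le> band_norm j h" if h: "h \<in> ?L1" for j h
    using cseminorm_nonneg[OF cseminorm_band h] by (intro c0_least) (auto simp: row zero_band)
  define \<phi>j where "\<phi>j j h = \<Phi> (inj j h)" for j h
  have \<phi>j_bd: "cmod (\<phi>j j h) \<le> C * band_norm j h" if h: "h \<in> ?L1" for j h
    using \<Phi>(2)[OF inj_V[OF h], of j] mult_left_mono[OF inj_norm[OF h] C, of j] by (simp add: \<phi>j_def)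
  have inj_lin: "inj j (\<lambda>x. a * h x + b * k x) = (\<lambda>z. a * inj j h z + b * inj j k z)" for j a b h k
    by (auto simp: inj_def)
  have LpL1: "h \<in> ?L1" if "h \<in> Lp_space p" for h
    by (rule Lp_L1(1)[OF p that])
  have "\<exists>g. \<forall>j. g j \<in> Lp_mean_zero q \<and> (\<forall>h\<in>Lp_space p. \<phi>j j h = (CINT x. h x * g j x))"
  proof (intro choice allI)
    fix j
    define \<psi> where "\<psi> h = (if h \<in> Lp_space p then \<phi>j j h else 0)" for h
    have "\<psi> \<in> dual_space (Lp_space p) (Lp_mod_norm p)"
    proof (rule dual_spaceI)
      show "clinear_functional_on (Lp_space p) \<psi>"
        unfolding clinear_functional_on_def
        using Lp_lincomb[of p] p clinear_functional_onD[OF \<Phi>(1) inj_V[OF LpL1] inj_V[OF LpL1]]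
        by (auto simp: \<psi>_def \<phi>j_def inj_lin)
      show "\<psi> h = 0" if "h \<notin> Lp_space p" for h
        using that by (simp add: \<psi>_def)
      fix h :: "'n cfun" assume h: "h \<in> Lp_space p"
      \<comment> \<open>A single band is controlled by the L^1 norm, with a constant depending on j,
        and ignores constants. Hence each component functional factors through L^p modulo constants
        and is given by a mean-zero function.\<close>
      have "band_norm j h / (4 * 2 ^ j) \<le> Lp_mod_norm p h"
        unfolding Lp_mod_norm_def
      proof (rule cINF_greatest)
        fix c
        have hc: "(\<lambda>x. h x + c) \<in> Lp_space p"
          using p by (intro cseminorm_add_mem[OF cseminorm_Lp] h Lp_const) auto
        have c0: "band_norm j (\<lambda>x :: real^'n. c) \<le> 0"
        proof (rule band_norm_least)
          fix \<epsilon> :: real assume e: "\<epsilon> \<in> {(1 / 2) ^ Suc j..(1 / 2) ^ j}"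
          show "rosc \<epsilon> (\<lambda>x :: real^'n. c) \<le> 0"
          proof (rule rosc_le[OF band_pos(1)[OF e] L1_const])
            fix \<F> :: "(real^'n) set set" assume F: "\<F> \<in> cube_families \<epsilon>"
            show "osc_sum \<epsilon> \<F> (\<lambda>x. c) \<le> 0"
              using cube_osc_le_sup[OF cube_familiesD(1,2)[OF F] band_pos(1)[OF e] L1_const]
              by (intro osc_sum_le_sup[OF F band_pos(1)[OF e]]) auto
          qed
        qed
        have "band_norm j h = band_norm j (\<lambda>x. (h x + c) - c)" by simp
        also have "\<dots> \<le> band_norm j (\<lambda>x. h x + c) + band_norm j (\<lambda>x :: real^'n. c)"
          by (rule cseminorm_diff[OF cseminorm_band LpL1[OF hc] L1_const])
        also have "\<dots> \<le> band_norm j (\<lambda>x. h x + c)" using c0 by simp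
        also have "\<dots> \<le> 4 * 2 ^ j * (CINT x. cmod (h x + c))"
          by (rule band_norm_le_L1[OF LpL1[OF hc]])
        also have "\<dots> \<le> 4 * 2 ^ j * Lp_norm p (\<lambda>x. h x + c)"
          by (intro mult_left_mono Lp_L1(2)[OF p hc]) auto
        finally show "band_norm j h / (4 * 2 ^ j) \<le> Lp_norm p (\<lambda>x. h x + c)"
          by (simp add: divide_le_eq mult_ac)
      qed simp
      then have "band_norm j h \<le> 4 * 2 ^ j * Lp_mod_norm p h"
        by (simp add: divide_le_eq mult_ac)
      then have "C * band_norm j h \<le> C * (4 * 2 ^ j * Lp_mod_norm p h)"
        using C by (rule mult_left_mono)
      then show "cmod (\<psi> h) \<le> (C * (4 * 2 ^ j)) * Lp_mod_norm p h"
        using \<phi>j_bd[OF LpL1[OF h], of j] h by (simp add: \<psi>_def mult.assoc)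
    qed
    then obtain g where g: "g \<in> Lp_mean_zero q" "\<psi> = pairing_functional (Lp_space p) g"
      unfolding Lp_mod_dual[OF p q, symmetric] by auto
    have "\<phi>j j h = (CINT x. h x * g x)" if "h \<in> Lp_space p" for h
      using fun_cong[OF g(2), of h] that by (simp add: \<psi>_def pairing_functional_def)
    then show "\<exists>g. g \<in> Lp_mean_zero q \<and> (\<forall>h\<in>Lp_space p. \<phi>j j h = (CINT x. h x * g x))"
      using g(1) by blast
  qed
  then obtain g where gX: "\<And>j. g j \<in> Lp_mean_zero q" and g: "\<And>j h. h \<in> Lp_space p \<Longrightarrow> \<phi>j j h = (CINT x. h x * g j x)"
    by blast
  have gB: "\<phi>j j f = (CINT x. f x * g j x)" if "f \<in> B_space" for f j
    by (rule g[OF emb(1)[OF that]])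
  define n where "n j = B_predual_norm (pairing_functional B_space (g j))" for j
  note gd = pairing_B_dual[OF gX]
  have n0: "0 \<le> n j" for j
    unfolding n_def by (rule dual_norm_nonneg[OF cseminorm_B gd])
  have n_bd: "cmod (CINT x. f x * g j x) \<le> n j * B_norm f" if "f \<in> B_space" for f j
    using dual_bound[OF cseminorm_B gd that, of j] that by (simp add: n_def pairing_functional_def)
  \<comment> \<open>The l^1 bound of c_0-duality: nearly norming functions, with aligned phases, are
    placed in different rows of an element of norm at most 1. They may be taken from all of
    \<open>B_space\<close>, since finitely many rows impose no decay; hence the norms n j over
    \<open>B_space\<close>, and not just over \<open>B0_space\<close>, are summable.\<close>
  have fin_sum: "(\<Sum>j<J. n j) \<le> C" for J
  proof (rule field_le_epsilon)
    fix e :: real assume e: "0 < e"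
    define e' where "e' = e / (real J + 1)"
    have e': "0 < e'" using e by (simp add: e'_def)
    have "\<exists>f. f \<in> B_space \<and> B_norm f \<le> 1 \<and> n j - e' \<le> cmod (CINT x. f x * g j x)" for j
    proof (rule ccontr)
      assume no: "\<not> ?thesis"
      have "n j \<le> n j - e'"
        unfolding n_def dual_norm_def
      proof (rule cSUP_least)
        show "{f \<in> B_space. B_norm f \<le> 1} \<noteq> ({} :: 'n cfun set)"
          using cseminorm_zero_mem[OF cseminorm_B[where 'n='n]] cseminorm_zero[OF cseminorm_B[where 'n='n]]
          by (auto intro!: exI[of _ "\<lambda>x. 0"])
        fix f :: "'n cfun" assume "f \<in> {f \<in> B_space. B_norm f \<le> 1}"
        with no have "cmod (CINT x. f x * g j x) \<le> n j - e'" by force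
        then show "cmod (pairing_functional B_space (g j) f) \<le> (SUP f\<in>{f \<in> B_space. B_norm f \<le> 1}. cmod (pairing_functional B_space (g j) f)) - e'"
          using \<open>f \<in> _\<close> by (simp add: n_def dual_norm_def pairing_functional_def)
      qed
      then show False using e' by simp
    qed
    then obtain f where f: "\<And>j. f j \<in> B_space" "\<And>j. B_norm (f j) \<le> 1"
      "\<And>j. n j - e' \<le> cmod (CINT x. f j x * g j x)"
      by metis
    have "\<exists>u. \<forall>j. cmod (u j) = 1 \<and> u j * (CINT x. f j x * g j x) = of_real (cmod (CINT x. f j x * g j x))"
    proof (rule choice, rule allI)
      fix j
      obtain w where "cmod w = 1" "w * (CINT x. f j x * g j x) = of_real (cmod (CINT x. f j x * g j x))"
        by (rule unimodular_rotation)
      then show "\<exists>w. cmod w = 1 \<and> w * (CINT x. f j x * g j x) = of_real (cmod (CINT x. f j x * g j x))"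
        by (intro exI conjI)
    qed
    then obtain u where u: "\<And>j. cmod (u j) = 1"
      "\<And>j. u j * (CINT x. f j x * g j x) = of_real (cmod (CINT x. f j x * g j x))"
      by blast
    note fL1 = B_spaceD(1)[OF f(1)]
    define F where "F = (\<lambda>z. \<Sum>j<J. u j * inj j (f j) z)"
    have FV: "F \<in> c0_sum"
      unfolding F_def by (intro cseminorm_lincomb_sum_mem[OF snV] inj_V fL1)
    have "c0_norm F \<le> 1"
    proof (rule c0_least)
      fix i
      have "(\<lambda>x. F (i, x)) = (if i < J then (\<lambda>x. u i * f i x) else (\<lambda>x. 0))"
        by (auto simp: F_def inj_def if_distrib[of "\<lambda>t. _ * t"] fun_eq_iff cong: if_cong)
      moreover have "band_norm i (\<lambda>x. u i * f i x) \<le> 1"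
        using cseminorm_scale_le[OF cseminorm_band fL1, of i "u i" i] u(1)[of i] band_norm_le_B[OF f(1), of i i] f(2)[of i] by simp
      ultimately show "band_norm i (\<lambda>x. F (i, x)) \<le> 1" by (simp add: zero_band)
    qed
    then have "C * c0_norm F \<le> C * 1" using C by (intro mult_left_mono)
    then have FC: "cmod (\<Phi> F) \<le> C" using \<Phi>(2)[OF FV] by simp
    have "\<Phi> F = (\<Sum>j<J. u j * \<Phi> (inj j (f j)))"
      unfolding F_def by (intro clinear_functional_on_lincomb_sum[OF snV \<Phi>(1)] inj_V fL1)
    also have "\<dots> = (\<Sum>j<J. of_real (cmod (CINT x. f j x * g j x)))"
      using gB[OF f(1)] u(2) by (simp add: \<phi>j_def)
    also have "\<dots> = of_real (\<Sum>j<J. cmod (CINT x. f j x * g j x))"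
      by simp
    finally have "(\<Sum>j<J. cmod (CINT x. f j x * g j x)) \<le> C"
      using FC by (simp add: sum_nonneg del: of_real_sum)
    moreover have "(\<Sum>j<J. n j) \<le> (\<Sum>j<J. cmod (CINT x. f j x * g j x) + e')"
      using f(3) by (intro sum_mono) (simp add: algebra_simps)
    moreover have "(\<Sum>j<J. cmod (CINT x. f j x * g j x) + e') = (\<Sum>j<J. cmod (CINT x. f j x * g j x)) + real J * e'"
      by (simp add: sum.distrib)
    moreover have "real J * e' \<le> e" using e by (simp add: e'_def divide_le_eq)
    ultimately show "(\<Sum>j<J. n j) \<le> C + e" by linarith
  qed
  have nsum: "summable n"
    using n0 fin_sum by (intro summableI_nonneg_bounded) auto
  \<comment> \<open>Summability of the norms \<open>n j\<close> lets the series define a functional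
    on all of \<open>B_space\<close>; this is the extension of \<open>\<phi>\<close> that will lie
    in the predual.\<close>
  define \<chi>' where "\<chi>' f = (if f \<in> B_space then (\<Sum>j. CINT x. f x * g j x) else 0)" for f
  have abs_sum: "summable (\<lambda>j. cmod (CINT x. f x * g j x))" if "f \<in> B_space" for f
    by (rule summable_comparison_test'[OF summable_mult2[OF nsum, of "B_norm f"], where N=0]) (use n_bd[OF that] in simp)
  note summ = summable_norm_cancel[OF abs_sum]
  have tail: "cmod (\<chi>' f - (\<Sum>j<J. CINT x. f x * g j x)) \<le> (\<Sum>j. n (j + J)) * B_norm f" if f: "f \<in> B_space" for f J
  proof -
    have "\<chi>' f - (\<Sum>j<J. CINT x. f x * g j x) = (\<Sum>j. CINT x. f x * g (j + J) x)"
      using suminf_split_initial_segment[OF summ[OF f], of J] f by (simp add: \<chi>'_def)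
    also have "cmod \<dots> \<le> (\<Sum>j. cmod (CINT x. f x * g (j + J) x))"
      using summable_ignore_initial_segment[OF abs_sum[OF f], of J] by (intro summable_norm) simp
    also have "\<dots> \<le> (\<Sum>j. n (j + J) * B_norm f)"
      by (intro suminf_le n_bd f summable_mult2 summable_ignore_initial_segment[OF nsum]
        summable_ignore_initial_segment[OF abs_sum[OF f]])
    also have "\<dots> = (\<Sum>j. n (j + J)) * B_norm f"
      by (intro suminf_mult2[symmetric] summable_ignore_initial_segment nsum)
    finally show ?thesis .
  qed
  note snX = cseminorm_Lp_mean_zero[OF q1, where 'n='n]
  have part: "(CINT x. f x * (\<Sum>j<J. g j x)) = (\<Sum>j<J. CINT x. f x * g j x)" if f: "f \<in> B_space" for f J
    unfolding sum_distrib_left by (intro Bochner_Integration.integral_sum pairing_integrable f gX)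
  have \<chi>d: "\<chi>' \<in> dual_space B_space B_norm"
  proof (rule dual_spaceI)
    show "clinear_functional_on B_space \<chi>'"
      unfolding clinear_functional_on_def
    proof (intro ballI allI)
      fix f h :: "'n cfun" and a b assume fh: "f \<in> B_space" "h \<in> B_space"
      have "(CINT x. (a * f x + b * h x) * g j x) = a * (CINT x. f x * g j x) + b * (CINT x. h x * g j x)" for j
      proof -
        have "(CINT x. (a * f x + b * h x) * g j x) = (CINT x. a * (f x * g j x) + b * (h x * g j x))"
          by (simp add: algebra_simps)
        then show ?thesis
          using pairing_integrable[OF fh(1) gX] pairing_integrable[OF fh(2) gX] by simp
      qed
      then show "\<chi>' (\<lambda>x. a * f x + b * h x) = a * \<chi>' f + b * \<chi>' h"
        using fh cseminorm_lincomb_mem[OF cseminorm_B fh] summ[OF fh(1)] summ[OF fh(2)]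
        by (simp add: \<chi>'_def suminf_add[symmetric] suminf_mult[symmetric] summable_mult)
    qed
    show "cmod (\<chi>' f) \<le> (\<Sum>j. n (j + 0)) * B_norm f" if "f \<in> B_space" for f
      using tail[OF that, of 0] by simp
  qed (simp add: \<chi>'_def)
  have "\<chi>' \<in> B_predual"
  proof (rule closure_in_predual[OF \<chi>d])
    fix \<eta> :: real assume "0 < \<eta>"
    then obtain J where "norm (\<Sum>j. n (j + J)) < \<eta>"
      using suminf_exist_split[OF _ nsum, of \<eta>] by blast
    then have J: "(\<Sum>j. n (j + J)) < \<eta>" by simp
    have "approximates q \<eta> \<chi>' (\<lambda>x. \<Sum>j<J. g j x)"
      unfolding approximates_def
    proof (intro conjI ballI)
      show "(\<lambda>x. \<Sum>j<J. g j x) \<in> Lp_mean_zero q"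
        by (rule cseminorm_sum_mem[OF snX gX])
      fix f :: "'n cfun" assume f: "f \<in> B_space"
      have "(\<Sum>j. n (j + J)) * B_norm f \<le> \<eta> * B_norm f"
        using J by (intro mult_right_mono B_norm_nonneg) auto
      then show "cmod (\<chi>' f - (CINT x. f x * (\<Sum>j<J. g j x))) \<le> \<eta> * B_norm f"
        using tail[OF f, of J] part[OF f] by simp
    qed
    then show "\<exists>g. approximates q \<eta> \<chi>' g" by blast
  qed
  moreover have "adjoint_op B0_space (\<lambda>f. f) \<chi>' = \<phi>"
  proof
    fix f
    show "adjoint_op B0_space (\<lambda>f. f) \<chi>' f = \<phi> f"
    proof (cases "f \<in> B0_space")
      case True
      note fB = B0_spaceD(1)[OF True]
      note fL = B_spaceD(1)[OF fB]
      \<comment> \<open>Cutting the diagonal element after J rows leaves an error governed by the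
        bands beyond J. These tend to 0 because f belongs to \<open>B0_space\<close>.\<close>
      have "(\<lambda>J. \<Sum>j<J. CINT x. f x * g j x) \<longlonglongrightarrow> \<phi> f"
      proof (rule LIMSEQ_I)
        fix r :: real assume r: "0 < r"
        have "0 < r / (C + 1)" using r C by simp
        then obtain J0 where J0: "\<And>j. J0 \<le> j \<Longrightarrow> norm (band_norm j f - 0) < r / (C + 1)"
          using LIMSEQ_D[OF band_norm_tendsto[OF True]] by blast
        have "norm ((\<Sum>j<J. CINT x. f x * g j x) - \<phi> f) < r" if J: "J0 \<le> J" for J
        proof -
          define G where "G = (\<lambda>z. \<Sum>j<J. 1 * inj j f z)"
          have GV: "G \<in> c0_sum"
            unfolding G_def by (intro cseminorm_lincomb_sum_mem[OF snV] inj_V fL)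
          have "\<Phi> G = (\<Sum>j<J. 1 * \<Phi> (inj j f))"
            unfolding G_def by (intro clinear_functional_on_lincomb_sum[OF snV \<Phi>(1)] inj_V fL)
          then have \<Phi>G: "\<Phi> G = (\<Sum>j<J. CINT x. f x * g j x)"
            using gB[OF fB] by (simp add: \<phi>j_def)
          have "diag f \<in> W" using True by (simp add: W_def)
          then have \<Phi>d: "\<Phi> (diag f) = \<phi> f" using \<Phi>(3) \<omega>_diag by simp
          have dV: "(\<lambda>z. diag f z - G z) \<in> c0_sum"
            by (rule cseminorm_diff_mem[OF snV diag_V[OF True] GV])
          have "c0_norm (\<lambda>z. diag f z - G z) \<le> r / (C + 1)"
          proof (rule c0_least)
            fix i
            have "(\<lambda>x. diag f (i, x) - G (i, x)) = (if i < J then (\<lambda>x. 0) else f)"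
              by (auto simp: G_def inj_def diag_def fun_eq_iff)
            then show "band_norm i (\<lambda>x. diag f (i, x) - G (i, x)) \<le> r / (C + 1)"
              using J0[of i] J r C by (auto simp: zero_band)
          qed
          then have "C * c0_norm (\<lambda>z. diag f z - G z) \<le> C * (r / (C + 1))"
            using C by (rule mult_left_mono)
          also have "\<dots> < r" using C r by (simp add: field_simps)
          finally have "cmod (\<Phi> (\<lambda>z. diag f z - G z)) < r"
            using \<Phi>(2)[OF dV] by simp
          then show ?thesis
            using clinear_functional_on_diff[OF \<Phi>(1) diag_V[OF True] GV] by (simp add: \<Phi>d \<Phi>G norm_minus_commute)
        qed
        then show "\<exists>J0. \<forall>J\<ge>J0. norm ((\<Sum>j<J. CINT x. f x * g j x) - \<phi> f) < r" by blast
      qed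
      then have "(\<lambda>j. \<integral>x. f x * g j x \<partial>cube_measure) sums \<phi> f"
        by (simp add: sums_def)
      then show ?thesis
        using True fB by (simp add: adjoint_op_def \<chi>'_def sums_iff)
    qed (simp add: adjoint_op_def dual_spaceD(3)[OF \<phi>])
  qed
  ultimately show thesis by (rule that)
qed

lemma predual_isometric_B0_dual:
  "isometric_isomorphism (B_predual :: ('n::finite cfun \<Rightarrow> complex) set) B_predual_norm
     (dual_space B0_space B_norm) (dual_norm B0_space B_norm) (adjoint_op B0_space (\<lambda>f. f))"
  unfolding isometric_isomorphism_def
proof (intro conjI ballI)
  show "clinear_map_on (B_predual :: ('n cfun \<Rightarrow> complex) set) (adjoint_op B0_space (\<lambda>f. f))"
    by (auto simp: clinear_map_on_def adjoint_op_def)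
  show "adjoint_op B0_space (\<lambda>f. f) ` (B_predual :: ('n cfun \<Rightarrow> complex) set) = dual_space B0_space B_norm"
  proof (intro equalityI subsetI)
    fix \<phi> :: "'n cfun \<Rightarrow> complex"
    assume "\<phi> \<in> dual_space B0_space B_norm"
    then obtain \<psi> where "\<psi> \<in> B_predual" "adjoint_op B0_space (\<lambda>f. f) \<psi> = \<phi>"
      by (rule restriction_surjective)
    then show "\<phi> \<in> adjoint_op B0_space (\<lambda>f. f) ` B_predual" by blast
  qed (use restriction_dual(1)[OF B_predualD] in auto)
qed (rule restriction_isometry)

lemma restriction_pairing:
  "adjoint_op B0_space (\<lambda>f. f) (pairing_functional B_space g) = pairing_functional B0_space g"
  by (auto simp: adjoint_op_def pairing_functional_def fun_eq_iff dest: B0_spaceD(1))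

subsection \<open>The bidual of \<open>B\<^sub>0\<close>\<close>

text \<open>Along the isometry \<open>R\<close>, a bidual functional of \<open>B0_space\<close>
  becomes a functional on \<open>B_predual\<close>, hence evaluation at some f in
  \<open>B_space\<close>. The adjoint of the inclusion sends pairings on L^p to restrictions of
  elements of \<open>B_predual\<close>, so the biadjoint yields evaluation at that same f.\<close>

lemma bidual_representation:
  defines "R \<equiv> adjoint_op B0_space (\<lambda>f. f)" and "X \<equiv> Lp_space p :: 'n::finite cfun set"
  defines "X_dual \<equiv> dual_space X (Lp_mod_norm p)"
  defines "B0d \<equiv> dual_space (B0_space :: 'n cfun set) B_norm" and "B0n \<equiv> dual_norm (B0_space :: 'n cfun set) B_norm"
  shows "adjoint_op X_dual R ` dual_space B0d B0n = canonical_embedding X (Lp_mod_norm p) ` B_space"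
    and "\<And>\<Phi> f. \<Phi> \<in> dual_space B0d B0n \<Longrightarrow> f \<in> B_space \<Longrightarrow>
      adjoint_op X_dual R \<Phi> = canonical_embedding X (Lp_mod_norm p) f \<Longrightarrow> dual_norm B0d B0n \<Phi> = B_norm f"
proof -
  have iso: "clinear_map_on B_predual R" "R ` B_predual = B0d" "\<And>\<phi>. \<phi> \<in> B_predual \<Longrightarrow> B0n (R \<phi>) = B_predual_norm \<phi>"
    using predual_isometric_B0_dual unfolding isometric_isomorphism_def R_def B0d_def B0n_def by blast+
  note snB0d = cseminorm_dual[OF cseminorm_B0[where 'n='n], folded B0d_def B0n_def]
  have RX: "R \<psi> = R (pairing_functional B_space g)" "pairing_functional B_space g \<in> B_predual" "R \<psi> \<in> B0d"
    if "\<psi> = pairing_functional X g" "g \<in> Lp_mean_zero q" for \<psi> g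
  proof -
    show "pairing_functional B_space g \<in> B_predual" by (rule pairing_in_predual[OF that(2)])
    show "R \<psi> = R (pairing_functional B_space g)"
      by (auto simp: R_def adjoint_op_def that(1) pairing_functional_def X_def fun_eq_iff dest: B0_spaceD(1) emb(1))
    then show "R \<psi> \<in> B0d"
      using iso(2) \<open>pairing_functional B_space g \<in> B_predual\<close> by auto
  qed
  have X_dual: "X_dual = pairing_functional X ` Lp_mean_zero q"
    unfolding X_dual_def X_def by (rule Lp_mod_dual[OF p q, symmetric])
  have rep: "\<exists>f\<in>B_space. (\<forall>\<phi>\<in>B_predual. \<Phi> (R \<phi>) = \<phi> f) \<and> dual_norm B0d B0n \<Phi> = B_norm f \<and>
      adjoint_op X_dual R \<Phi> = canonical_embedding X (Lp_mod_norm p) f" if \<Phi>: "\<Phi> \<in> dual_space B0d B0n" for \<Phi>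
  proof -
    define \<Psi> where "\<Psi> \<phi> = (if \<phi> \<in> B_predual then \<Phi> (R \<phi>) else 0)" for \<phi> :: "'n cfun \<Rightarrow> complex"
    have bd: "cmod (\<Psi> \<phi>) \<le> dual_norm B0d B0n \<Phi> * B_predual_norm \<phi>" if "\<phi> \<in> B_predual" for \<phi> :: "'n cfun \<Rightarrow> complex"
      using dual_bound[OF snB0d \<Phi>, of "R \<phi>"] iso(2,3) that by (auto simp: \<Psi>_def)
    have "clinear_functional_on B_predual \<Psi>"
      unfolding clinear_functional_on_def
    proof (intro ballI allI)
      fix \<phi> \<psi> :: "'n cfun \<Rightarrow> complex" and a b
      assume "\<phi> \<in> B_predual" "\<psi> \<in> B_predual"
      moreover from this have "R \<phi> \<in> B0d" "R \<psi> \<in> B0d" using iso(2) by auto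
      ultimately show "\<Psi> (\<lambda>x. a * \<phi> x + b * \<psi> x) = a * \<Psi> \<phi> + b * \<Psi> \<psi>"
        using cseminorm_lincomb_mem[OF cseminorm_predual] iso(1) clinear_functional_onD[OF dual_spaceD(1)[OF \<Phi>]]
        by (simp add: \<Psi>_def clinear_map_on_def)
    qed
    then have \<Psi>: "\<Psi> \<in> dual_space B_predual B_predual_norm"
      by (rule dual_spaceI[OF _ bd]) (auto simp: \<Psi>_def)
    obtain f where f: "f \<in> B_space" "\<Psi> = (\<lambda>\<phi>. if \<phi> \<in> B_predual then \<phi> f else 0)"
      by (rule evaluation_surjective[OF \<Psi>])
    have val: "\<Phi> (R \<phi>) = \<phi> f" if "\<phi> \<in> B_predual" for \<phi>
      using fun_cong[OF f(2), of \<phi>] that by (simp add: \<Psi>_def)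
    have nf: "dual_norm B_predual B_predual_norm \<Psi> = B_norm f"
      unfolding f(2) by (rule evaluation_isometry(2)[OF f(1)])
    have "dual_norm B0d B0n \<Phi> = B_norm f"
    proof (rule antisym)
      show "dual_norm B0d B0n \<Phi> \<le> B_norm f"
      proof (rule dual_norm_le[OF snB0d B_norm_nonneg])
        fix \<psi> assume "\<psi> \<in> B0d"
        then obtain \<phi> where \<phi>: "\<phi> \<in> B_predual" "\<psi> = R \<phi>" using iso(2) by auto
        then show "cmod (\<Phi> \<psi>) \<le> B_norm f * B0n \<psi>"
          using dual_bound[OF cseminorm_predual \<Psi> \<phi>(1)] iso(3) by (simp add: \<Psi>_def nf)
      qed
      show "B_norm f \<le> dual_norm B0d B0n \<Phi>"
        unfolding nf[symmetric] by (rule dual_norm_le[OF cseminorm_predual dual_norm_nonneg[OF snB0d \<Phi>] bd])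
    qed
    moreover have "adjoint_op X_dual R \<Phi> = canonical_embedding X (Lp_mod_norm p) f"
    proof
      fix \<psi>
      show "adjoint_op X_dual R \<Phi> \<psi> = canonical_embedding X (Lp_mod_norm p) f \<psi>"
      proof (cases "\<psi> \<in> X_dual")
        case True
        then obtain g where g: "\<psi> = pairing_functional X g" "g \<in> Lp_mean_zero q"
          unfolding X_dual by auto
        have "\<Phi> (R \<psi>) = pairing_functional B_space g f"
          unfolding RX(1)[OF g] by (rule val[OF RX(2)[OF g]])
        also have "\<dots> = \<psi> f"
          using f(1) emb(1)[OF f(1)] by (simp add: g(1) pairing_functional_def X_def)
        finally show ?thesis
          using True by (simp add: adjoint_op_def canonical_embedding_def X_dual_def)
      qed (simp add: adjoint_op_def canonical_embedding_def X_dual_def)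
    qed
    ultimately show ?thesis using f(1) val by blast
  qed
  show "adjoint_op X_dual R ` dual_space B0d B0n = canonical_embedding X (Lp_mod_norm p) ` B_space"
  proof (intro equalityI subsetI)
    fix \<Theta> assume "\<Theta> \<in> adjoint_op X_dual R ` dual_space B0d B0n"
    then show "\<Theta> \<in> canonical_embedding X (Lp_mod_norm p) ` B_space"
      using rep by blast
  next
    fix \<Theta> assume "\<Theta> \<in> canonical_embedding X (Lp_mod_norm p) ` B_space"
    then obtain f where f: "f \<in> B_space" "\<Theta> = canonical_embedding X (Lp_mod_norm p) f" by auto
    \<comment> \<open>The preimage under \<open>R\<close> is an arbitrary choice. It does not
      matter: \<open>R\<close> preserves norms, so two preimages differ by a functional of norm 0,
      and their values at f agree.\<close>
    define inv where "inv \<psi> = (SOME \<phi>. \<phi> \<in> B_predual \<and> R \<phi> = \<psi>)" for \<psi>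
    have inv: "inv \<psi> \<in> B_predual" "R (inv \<psi>) = \<psi>" if "\<psi> \<in> B0d" for \<psi>
    proof -
      have "\<exists>\<phi>. \<phi> \<in> B_predual \<and> R \<phi> = \<psi>" using that iso(2) by auto
      then have "inv \<psi> \<in> B_predual \<and> R (inv \<psi>) = \<psi>"
        unfolding inv_def by (rule someI_ex)
      then show "inv \<psi> \<in> B_predual" "R (inv \<psi>) = \<psi>" by auto
    qed
    have uniq: "\<phi> f = \<psi> f" if "\<phi> \<in> B_predual" "\<psi> \<in> B_predual" "R \<phi> = R \<psi>" for \<phi> \<psi>
    proof -
      have d: "(\<lambda>x. \<phi> x - \<psi> x) \<in> B_predual"
        by (rule cseminorm_diff_mem[OF cseminorm_predual that(1,2)])
      have "\<phi> h = \<psi> h" if "h \<in> B0_space" for h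
        using fun_cong[OF \<open>R \<phi> = R \<psi>\<close>, of h] that by (simp add: R_def adjoint_op_def)
      then have "R (\<lambda>x. \<phi> x - \<psi> x) = (\<lambda>x. 0)"
        by (simp add: R_def adjoint_op_def fun_eq_iff)
      then have "B_predual_norm (\<lambda>x. \<phi> x - \<psi> x) = 0"
        using iso(3)[OF d] cseminorm_zero[OF snB0d] by simp
      then show ?thesis
        using dual_bound[OF cseminorm_B B_predualD[OF d] f(1)] by simp
    qed
    define \<Phi> where "\<Phi> \<psi> = (if \<psi> \<in> B0d then inv \<psi> f else 0)" for \<psi>
    have \<Phi>R: "\<Phi> (R \<phi>) = \<phi> f" if "\<phi> \<in> B_predual" for \<phi>
    proof -
      have "R \<phi> \<in> B0d" using that iso(2) by auto
      then show ?thesis using uniq[OF inv(1) that inv(2)] by (simp add: \<Phi>_def)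
    qed
    have "clinear_functional_on B0d \<Phi>"
      unfolding clinear_functional_on_def
    proof (intro ballI allI)
      fix \<psi> \<xi> a b assume m: "\<psi> \<in> B0d" "\<xi> \<in> B0d"
      have l: "(\<lambda>x. a * inv \<psi> x + b * inv \<xi> x) \<in> B_predual"
        by (rule cseminorm_lincomb_mem[OF cseminorm_predual inv(1)[OF m(1)] inv(1)[OF m(2)]])
      have "R (\<lambda>x. a * inv \<psi> x + b * inv \<xi> x) = (\<lambda>x. a * \<psi> x + b * \<xi> x)"
        using iso(1) inv[OF m(1)] inv[OF m(2)] by (simp add: clinear_map_on_def)
      then show "\<Phi> (\<lambda>x. a * \<psi> x + b * \<xi> x) = a * \<Phi> \<psi> + b * \<Phi> \<xi>"
        using \<Phi>R[OF l] m by (simp add: \<Phi>_def)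
    qed
    moreover have "cmod (\<Phi> \<psi>) \<le> B_norm f * B0n \<psi>" if "\<psi> \<in> B0d" for \<psi>
      using dual_bound[OF cseminorm_B B_predualD[OF inv(1)[OF that]] f(1)] iso(3)[OF inv(1)[OF that]] inv(2)[OF that] that
      by (simp add: \<Phi>_def mult.commute)
    ultimately have \<Phi>: "\<Phi> \<in> dual_space B0d B0n"
      by (intro dual_spaceI[where C="B_norm f"]) (auto simp: \<Phi>_def)
    obtain h where h: "h \<in> B_space" "\<forall>\<phi>\<in>B_predual. \<Phi> (R \<phi>) = \<phi> h"
      "adjoint_op X_dual R \<Phi> = canonical_embedding X (Lp_mod_norm p) h"
      using rep[OF \<Phi>] by blast
    have "canonical_embedding X (Lp_mod_norm p) h = \<Theta>"
      unfolding f(2)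
    proof
      fix \<psi>
      show "canonical_embedding X (Lp_mod_norm p) h \<psi> = canonical_embedding X (Lp_mod_norm p) f \<psi>"
      proof (cases "\<psi> \<in> X_dual")
        case True
        then obtain g where g: "\<psi> = pairing_functional X g" "g \<in> Lp_mean_zero q"
          unfolding X_dual by auto
        have "pairing_functional B_space g h = pairing_functional B_space g f"
          using h(2) \<Phi>R RX(2)[OF g] by metis
        then have "\<psi> h = \<psi> f"
          using f(1) h(1) emb(1) by (simp add: g(1) pairing_functional_def X_def)
        then show ?thesis by (simp add: canonical_embedding_def)
      qed (simp add: canonical_embedding_def X_dual_def)
    qed
    then show "\<Theta> \<in> adjoint_op X_dual R ` dual_space B0d B0n"
      using \<Phi> h(3) by force
  qed
  fix \<Phi> f assume \<Phi>: "\<Phi> \<in> dual_space B0d B0n" and f: "f \<in> B_space"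
    and eq: "adjoint_op X_dual R \<Phi> = canonical_embedding X (Lp_mod_norm p) f"
  obtain h where h: "h \<in> B_space" "dual_norm B0d B0n \<Phi> = B_norm h"
    "adjoint_op X_dual R \<Phi> = canonical_embedding X (Lp_mod_norm p) h"
    using rep[OF \<Phi>] by blast
  have pair: "(CINT x. f x * g x) = (CINT x. h x * g x)" if g: "g \<in> Lp_mean_zero q" for g
  proof -
    have m: "pairing_functional X g \<in> X_dual" unfolding X_dual using g by blast
    have "canonical_embedding X (Lp_mod_norm p) f (pairing_functional X g) = canonical_embedding X (Lp_mod_norm p) h (pairing_functional X g)"
      using eq h(3) by simp
    then show ?thesis
      using m f h(1) emb(1) by (simp add: canonical_embedding_def X_dual_def pairing_functional_def X_def)
  qed
  \<comment> \<open>Norms are compared through the same test functions, so functions with equal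
    pairings have equal norm. This makes the norm identity independent of which f represents the
    bidual functional.\<close>
  have le: "B_norm k \<le> B_norm l" if "k \<in> B_space" "l \<in> B_space" and eq: "\<And>g. g \<in> Lp_mean_zero q \<Longrightarrow>
      (CINT x. k x * g x) = (CINT x. l x * g x)" for k l :: "'n cfun"
  proof (rule B_norm_le_atoms(2)[OF B_spaceD(1)[OF that(1)]])
    fix g :: "'n cfun"
    assume g: "atom g" and le: "\<And>k. k \<in> B_space \<Longrightarrow> cmod (CINT x. k x * (2 * g x)) \<le> B_norm k"
    have "(\<lambda>x. 2 * g x) \<in> Lp_mean_zero q"
      by (rule cseminorm_scale_mem[OF cseminorm_Lp_mean_zero[OF q1] atom_mean_zero[OF g q1]])
    then show "cmod (CINT x. k x * (2 * g x)) \<le> B_norm l"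
      using eq le[OF that(2)] by simp
  qed
  show "dual_norm B0d B0n \<Phi> = B_norm f"
    unfolding h(2) using le[OF h(1) f] le[OF f h(1)] pair by (simp add: antisym)
qed

end

subsection \<open>The distance to \<open>B\<^sub>0\<close>\<close>

lemma UC_lincomb: "g \<in> UC_space \<Longrightarrow> h \<in> UC_space \<Longrightarrow> (\<lambda>x. a * g x + b * h x) \<in> UC_space"
  unfolding UC_space_def by (auto intro!: uniformly_continuous_on_add uniformly_continuous_on_cmul_left)

lemma const_UC: "(\<lambda>x :: real^'n. c) \<in> UC_space"
  by (simp add: UC_space_def uniformly_continuous_on_const)

lemma UC_close:
  fixes f :: "'n::finite cfun"
  assumes f: "f \<in> B_space" and \<eta>: "0 < \<eta>" and v: "0 < v"
  shows "\<exists>g\<in>UC_space. B_norm g \<le> (1 + \<eta>) * B_norm f \<and> (CINT x. cmod (g x - f x)) < v"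
proof (rule UC_approximation[OF f])
  fix s :: "nat \<Rightarrow> 'n cfun" and a :: "nat \<Rightarrow> real"
  assume s: "\<And>k. s k \<in> UC_space" "\<And>k. B_norm (s k) \<le> a k * B_norm f"
    "a \<longlonglongrightarrow> 1" "(\<lambda>k. \<integral>x. cmod (s k x - f x) \<partial>cube_measure) \<longlonglongrightarrow> 0"
  have "\<forall>\<^sub>F k in sequentially. (CINT x. cmod (s k x - f x)) < v \<and> a k < 1 + \<eta>"
    using \<eta> v by (intro eventually_conj order_tendstoD(2)[OF s(4)] order_tendstoD(2)[OF s(3)]) auto
  then obtain k where k: "(CINT x. cmod (s k x - f x)) < v" "a k < 1 + \<eta>"
    by (auto simp: eventually_sequentially)
  have "a k * B_norm f \<le> (1 + \<eta>) * B_norm f"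
    using k(2) B_norm_nonneg[of f] by (intro mult_right_mono) auto
  with s(2)[of k] k(1) show ?thesis
    by (intro bexI[OF _ s(1)[of k]]) auto
qed

lemma limsup_osc_diff_B0:
  assumes f: "f \<in> L1_space" and g: "g \<in> B0_space"
  shows "limsup_osc (\<lambda>x. f x - g x) \<le> limsup_osc f"
proof (rule ennreal_le_epsilon)
  fix v :: real assume fin: "limsup_osc f < top" and v: "0 < v"
  note gL1 = B_spaceD(1)[OF B0_spaceD(1)[OF g]]
  obtain l where l: "limsup_osc f = ennreal l" "0 \<le> l" using fin by (cases "limsup_osc f") auto
  have "limsup_osc f < ennreal (l + v / 2)" using l v by (simp add: ennreal_less_iff)
  then obtain e where e: "0 < e" "e \<le> 1" "\<And>r. 0 < r \<Longrightarrow> r \<le> e \<Longrightarrow> rosc r f \<le> l + v / 2"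
    using limsup_osc_less[OF f] by blast
  have "0 < v / 2" using v by simp
  then obtain e' where e': "0 < e'" "\<And>r. 0 < r \<Longrightarrow> r \<le> e' \<Longrightarrow> rosc r g \<le> v / 2"
    using B0_small_scales[OF g] by blast
  have "limsup_osc (\<lambda>x. f x - g x) \<le> ennreal (l + v)"
  proof (rule limsup_osc_le[OF L1_diff[OF f gL1], of "min e e'"])
    fix r :: real assume "0 < r" "r \<le> min e e'"
    then show "rosc r (\<lambda>x. f x - g x) \<le> l + v"
      using cseminorm_diff[OF cseminorm_rosc f gL1, of r] e(3)[of r] e'(2)[of r] by simp
  qed (use e(1) e'(1) in simp)
  then show "limsup_osc (\<lambda>x. f x - g x) \<le> limsup_osc f + ennreal v"
    unfolding l(1) using l(2) v by simp
qed

text \<open>Adding an element of \<open>B0_space\<close> does not raise the upper limit, and the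
  norm dominates the upper limit. This is the lower bound for the distances to
  \<open>B0_space\<close> and \<open>UC_space\<close> and for the minimum.\<close>

lemma limsup_osc_le_dist_B0:
  assumes f: "f \<in> B_space" and g: "g \<in> B0_space"
  shows "limsup_osc f \<le> B_enorm (\<lambda>x. f x - g x)"
proof -
  note fL1 = B_spaceD(1)[OF f] and gL1 = B_spaceD(1)[OF B0_spaceD(1)[OF g]]
  note d = L1_diff[OF fL1 gL1]
  have g': "(\<lambda>x. - g x) \<in> B0_space"
    using cseminorm_scale_mem[OF cseminorm_B0 g, of "-1"] by simp
  have "limsup_osc f \<le> limsup_osc (\<lambda>x. f x - g x)"
    using limsup_osc_diff_B0[OF d g'] by simp
  also have "\<dots> \<le> B_enorm (\<lambda>x. f x - g x)" by (rule limsup_osc_le_B_enorm[OF d])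
  finally show ?thesis .
qed

text \<open>The next summand is chosen close to \<open>f\<close> at all scales above \<open>e\<close>, hence at every scale at most
  one of the summands of \<open>G\<close> is neither close to \<open>f\<close> nor of small oscillation.\<close>

lemma scale_separated_sums:
  fixes f :: "'n::finite cfun"
  assumes f: "f \<in> B_space" and \<eta>: "0 < \<eta>" and e0: "0 < e0" "e0 \<le> 1"
    and L: "\<And>r. 0 < r \<Longrightarrow> r \<le> e0 \<Longrightarrow> rosc r f \<le> L" "0 \<le> L"
  shows "\<exists>G e. G \<in> UC_space \<and> 0 < e \<and> e \<le> e0 \<and> B_norm G \<le> real n * ((1 + \<eta>) * B_norm f) \<and>
    (\<forall>r\<in>{e0..1}. rosc r (\<lambda>x. of_nat n * f x - G x) \<le> real n * \<eta>) \<and>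
    (\<forall>r\<in>{0<..e0}. rosc r (\<lambda>x. of_nat n * f x - G x) \<le> real n * (L + \<eta>) + (2 + \<eta>) * B_norm f) \<and>
    (\<forall>r\<in>{0<..e}. rosc r G \<le> real n * \<eta>)"
proof (induction n)
  case 0
  have "rosc r (\<lambda>x :: real^'n. 0) \<le> (2 + \<eta>) * B_norm f" if "r \<in> {0<..e0}" for r
    using that \<eta> B_norm_nonneg[of f] by (simp add: rosc_zero)
  then show ?case
    using e0 cseminorm_zero[OF cseminorm_B[where 'n='n]]
    by (intro exI[of _ "\<lambda>x. 0"] exI[of _ e0]) (auto simp: rosc_zero const_UC)
next
  case (Suc n)
  then obtain G e where G: "G \<in> UC_space" "0 < e" "e \<le> e0" "B_norm G \<le> real n * ((1 + \<eta>) * B_norm f)"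
    "\<And>r. r \<in> {e0..1} \<Longrightarrow> rosc r (\<lambda>x. of_nat n * f x - G x) \<le> real n * \<eta>"
    "\<And>r. r \<in> {0<..e0} \<Longrightarrow> rosc r (\<lambda>x. of_nat n * f x - G x) \<le> real n * (L + \<eta>) + (2 + \<eta>) * B_norm f"
    "\<And>r. r \<in> {0<..e} \<Longrightarrow> rosc r G \<le> real n * \<eta>"
    by blast
  note fL1 = B_spaceD(1)[OF f]
  \<comment> \<open>The precision that makes the bound (2/r) times the L^1 error at most
    \<open>\<eta>\<close> for all scales r >= e.\<close>
  have "0 < e * \<eta> / 2" using G(2) \<eta> by simp
  from UC_close[OF f \<eta> this] obtain g where g: "g \<in> UC_space" and gN: "B_norm g \<le> (1 + \<eta>) * B_norm f"
    and k: "(CINT x. cmod (g x - f x)) < e * \<eta> / 2"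
    by blast
  note g = g B0_spaceD(1)[OF UC_B0[OF g]] UC_L1[OF g]
  have close: "rosc r (\<lambda>x. f x - g x) \<le> \<eta>" if "e \<le> r" for r
  proof -
    have r: "0 < r" using that G(2) by simp
    have "rosc r (\<lambda>x. f x - g x) \<le> 2 / r * (CINT x. cmod (f x - g x))"
      by (rule rosc_le_L1[OF r L1_diff[OF fL1 g(3)]])
    also have "\<dots> \<le> 2 / e * (e * \<eta> / 2)"
      using that k G(2) r by (intro mult_mono) (simp_all add: frac_le norm_minus_commute)
    finally show ?thesis using G(2) by simp
  qed
  obtain e' where e': "0 < e'" "\<And>r. 0 < r \<Longrightarrow> r \<le> e' \<Longrightarrow> rosc r g \<le> \<eta>"
    using B0_small_scales[OF UC_B0[OF g(1)] \<eta>] by blast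
  note GL1 = UC_L1[OF G(1)]
  have nfL1: "(\<lambda>x. of_nat n * f x) \<in> L1_space" by (rule cseminorm_scale_mem[OF cseminorm_L1 fL1])
  have split: "rosc r (\<lambda>x. of_nat (Suc n) * f x - (G x + g x)) \<le>
      rosc r (\<lambda>x. of_nat n * f x - G x) + rosc r (\<lambda>x. f x - g x)" if "0 < r" for r
  proof -
    have "(\<lambda>x. of_nat (Suc n) * f x - (G x + g x)) = (\<lambda>x. (of_nat n * f x - G x) + (f x - g x))"
      by (auto simp: algebra_simps)
    then show ?thesis
      using cseminorm_add[OF cseminorm_rosc[OF that] L1_diff[OF nfL1 GL1] L1_diff[OF fL1 g(3)]] by simp
  qed
  show ?case
  proof (intro exI[of _ "\<lambda>x. G x + g x"] exI[of _ "min e e'"] conjI ballI)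
    show "(\<lambda>x. G x + g x) \<in> UC_space"
      using UC_lincomb[OF G(1) g(1), of 1 1] by simp
    show "B_norm (\<lambda>x. G x + g x) \<le> real (Suc n) * ((1 + \<eta>) * B_norm f)"
      using cseminorm_add[OF cseminorm_B B0_spaceD(1)[OF UC_B0[OF G(1)]] g(2)] G(4) gN
      by (simp add: algebra_simps)
    show "rosc r (\<lambda>x. of_nat (Suc n) * f x - (G x + g x)) \<le> real (Suc n) * \<eta>" if "r \<in> {e0..1}" for r
      using split[of r] G(5)[OF that] close[of r] that e0 G(2,3) by (simp add: algebra_simps)
    show "rosc r (\<lambda>x. of_nat (Suc n) * f x - (G x + g x)) \<le> real (Suc n) * (L + \<eta>) + (2 + \<eta>) * B_norm f"
      if r: "r \<in> {0<..e0}" for r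
    proof (cases "e \<le> r")
      case True
      then show ?thesis
        using split[of r] G(6)[OF r] close[OF True] r L(2) by (simp add: algebra_simps)
    next
      \<comment> \<open>Below e the earlier sum \<open>G\<close> is flat, so the earlier difference
        oscillates no more than n f does, up to n \<open>\<eta>\<close>. This fresh estimate has no
        summand (2 + \<open>\<eta>\<close>) times the norm; the new difference f - g uses it up, so
        the loss never accumulates.\<close>
      case False
      then have r': "0 < r" "r \<le> 1" "r \<in> {0<..e}" using r e0 by auto
      have "rosc r (\<lambda>x. of_nat n * f x - G x) \<le> real n * rosc r f + rosc r G"
        using cseminorm_lincomb[OF cseminorm_rosc[OF r'(1)] fL1 GL1, of "of_nat n" "-1"] by simp
      also have "\<dots> \<le> real n * L + real n * \<eta>"
        using L(1)[of r] r by (intro add_mono mult_left_mono G(7)[OF r'(3)]) auto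
      finally have "rosc r (\<lambda>x. of_nat n * f x - G x) \<le> real n * (L + \<eta>)" by (simp add: algebra_simps)
      moreover have "rosc r (\<lambda>x. f x - g x) \<le> (2 + \<eta>) * B_norm f"
        using cseminorm_diff[OF cseminorm_rosc[OF r'(1)] fL1 g(3)] rosc_le_B_norm[OF f r'(1,2)]
          rosc_le_B_norm[OF g(2) r'(1,2)] gN by (simp add: algebra_simps)
      ultimately show ?thesis
        using split[OF r'(1)] L(2) \<eta> by (simp add: algebra_simps)
    qed
    show "rosc r (\<lambda>x. G x + g x) \<le> real (Suc n) * \<eta>" if "r \<in> {0<..min e e'}" for r
      using cseminorm_add[OF cseminorm_rosc GL1 g(3), of r] G(7)[of r] e'(2)[of r] that
      by (simp add: algebra_simps)
  qed (use G(2,3) e'(1) in auto)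
qed

text \<open>With \<open>g = G / n\<close>, the corrector is \<open>t g\<close>, \<open>t = \<delta> / (L + \<delta>)\<close>: at the scales where \<open>f\<close> may exceed \<open>L\<close>,
  \<open>g\<close> is close to \<open>f\<close> and \<open>f - t g\<close> about \<open>(1 - t) f\<close>; below them, \<open>f - t g\<close> is a convex combination of
  \<open>f\<close> and \<open>f - g\<close>.\<close>

lemma UC_corrector:
  fixes f :: "'n::finite cfun"
  assumes f: "f \<in> B_space" and L: "limsup_osc f \<le> ennreal L" "0 \<le> L"
    and \<delta>: "0 < \<delta>" "B_norm f \<le> L + \<delta>" and \<delta>': "0 < \<delta>'"
  obtains h where "h \<in> UC_space" "B_norm (\<lambda>x. f x - h x) \<le> L + \<delta>'" "B_norm h \<le> 2 * \<delta>"
    "(CINT x. cmod (h x)) \<le> 2 * \<delta>"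
proof -
  define \<eta> where "\<eta> = min 1 (\<delta>' / 4)"
  have \<eta>: "0 < \<eta>" "\<eta> \<le> 1" "4 * \<eta> \<le> \<delta>'" using \<delta>' by (auto simp: \<eta>_def)
  \<comment> \<open>Chosen so that (1 - t) (L + \<open>\<delta>\<close>) = L: the coarse scales drop
    to the level L. The correction, of norm at most 2 t (L + \<open>\<delta>\<close>), then has size
    2 \<open>\<delta>\<close>, proportional to the excess.\<close>
  define t where "t = \<delta> / (L + \<delta>)"
  have t: "0 \<le> t" "t \<le> 1" "t * (L + \<delta>) = \<delta>" using \<delta>(1) L(2) by (auto simp: t_def)
  \<comment> \<open>So many summands that the single loss of at most three times the norm of f,
    divided by n, is at most \<open>\<delta>'\<close>/2.\<close>
  obtain n0 :: nat where n0: "6 * B_norm f / \<delta>' < real n0" using reals_Archimedean2 by blast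
  define n where "n = Suc n0"
  have n: "0 < real n" "3 * B_norm f \<le> real n * (\<delta>' / 2)"
    using n0 \<delta>' by (auto simp: n_def field_simps)
  note fL1 = B_spaceD(1)[OF f]
  have "limsup_osc f < ennreal (L + \<eta>)"
    using L \<eta>(1) by (intro order_le_less_trans[OF L(1)]) (simp add: ennreal_less_iff)
  then obtain e0 where e0: "0 < e0" "e0 \<le> 1" "\<And>r. 0 < r \<Longrightarrow> r \<le> e0 \<Longrightarrow> rosc r f \<le> L + \<eta>"
    using limsup_osc_less[OF fL1] by blast
  have "0 \<le> L + \<eta>" using L(2) \<eta>(1) by simp
  from scale_separated_sums[OF f \<eta>(1) e0 this, of n]
  obtain G where G: "G \<in> UC_space" "B_norm G \<le> real n * ((1 + \<eta>) * B_norm f)"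
    "\<And>r. r \<in> {e0..1} \<Longrightarrow> rosc r (\<lambda>x. of_nat n * f x - G x) \<le> real n * \<eta>"
    "\<And>r. r \<in> {0<..e0} \<Longrightarrow> rosc r (\<lambda>x. of_nat n * f x - G x) \<le> real n * (L + \<eta> + \<eta>) + (2 + \<eta>) * B_norm f"
    by blast
  note GB = B0_spaceD(1)[OF UC_B0[OF G(1)]]
  define h0 where "h0 = (\<lambda>x. of_real (t / real n) * G x)"
  have h0: "h0 \<in> UC_space" using UC_lincomb[OF G(1) G(1), of "of_real (t / real n)" 0] by (simp add: h0_def)
  note h0B = B0_spaceD(1)[OF UC_B0[OF h0]]
  have "B_norm h0 \<le> t / real n * B_norm G"
    using cseminorm_scale_le[OF cseminorm_B GB, of "of_real (t / real n)"] t(1) n(1) by (simp add: h0_def norm_divide)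
  also have "\<dots> \<le> t / real n * (real n * (2 * (L + \<delta>)))"
  proof (rule mult_left_mono[OF order_trans[OF G(2)]])
    have "(1 + \<eta>) * B_norm f \<le> 2 * (L + \<delta>)"
      using \<eta>(2) \<eta>(1) \<delta>(2) B_norm_nonneg[of f] by (intro mult_mono) auto
    then show "real n * ((1 + \<eta>) * B_norm f) \<le> real n * (2 * (L + \<delta>))" by (intro mult_left_mono) auto
  qed (use t(1) in simp)
  also have "\<dots> = 2 * (t * (L + \<delta>))" using n(1) by simp
  also have "\<dots> = 2 * \<delta>" by (simp only: t(3))
  finally have h0N: "B_norm h0 \<le> 2 * \<delta>" .
  have fh0: "B_norm (\<lambda>x. f x - h0 x) \<le> L + \<delta>'"
  proof (rule B_spaceI(2)[OF L1_diff[OF fL1 B_spaceD(1)[OF h0B]]])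
    fix r :: real assume r: "0 < r" "r \<le> 1"
    have d: "(\<lambda>x. of_nat n * f x - G x) \<in> L1_space"
      by (intro L1_diff cseminorm_scale_mem[OF cseminorm_L1] fL1 UC_L1 G(1))
    have eq: "(\<lambda>x. f x - h0 x) = (\<lambda>x. of_real (1 - t) * f x + of_real (t / real n) * (of_nat n * f x - G x))"
      using n(1) by (auto simp: h0_def field_simps)
    have 1: "rosc r (\<lambda>x. f x - h0 x) \<le> (1 - t) * rosc r f + t / real n * rosc r (\<lambda>x. of_nat n * f x - G x)"
      unfolding eq using cseminorm_lincomb[OF cseminorm_rosc[OF r(1)] fL1 d, of "of_real (1 - t)" "of_real (t / real n)"] t n(1)
      by (simp only: norm_of_real) (simp add: abs_of_nonneg)
    show "rosc r (\<lambda>x. f x - h0 x) \<le> L + \<delta>'"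
    proof (cases "e0 \<le> r")
      case True
      have "(1 - t) * rosc r f \<le> (1 - t) * (L + \<delta>)"
        using rosc_le_B_norm[OF f r] \<delta>(2) t(2) by (intro mult_left_mono) auto
      moreover have "t / real n * rosc r (\<lambda>x. of_nat n * f x - G x) \<le> t / real n * (real n * \<eta>)"
        using True r t(1) by (intro mult_left_mono G(3)) auto
      moreover have "t / real n * (real n * \<eta>) \<le> 1 * \<eta>"
        using n(1) t \<eta>(1) mult_right_mono[of t 1 \<eta>] by simp
      moreover have "(1 - t) * (L + \<delta>) = L" using t(3) by (simp add: algebra_simps)
      ultimately show ?thesis using 1 \<eta> by linarith
    next
      case False
      have "(1 - t) * rosc r f \<le> (1 - t) * (L + \<delta>')"
        using e0(3)[of r] False r \<eta> t(2) by (intro mult_left_mono) auto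
      moreover have "t / real n * rosc r (\<lambda>x. of_nat n * f x - G x) \<le> t / real n * (real n * (L + \<delta>'))"
      proof (intro mult_left_mono)
        have "rosc r (\<lambda>x. of_nat n * f x - G x) \<le> real n * (L + \<eta> + \<eta>) + (2 + \<eta>) * B_norm f"
          using False r by (intro G(4)) auto
        also have "(2 + \<eta>) * B_norm f \<le> 3 * B_norm f"
          using \<eta>(2) B_norm_nonneg[of f] by (intro mult_right_mono) auto
        also note n(2)
        also have "real n * (L + \<eta> + \<eta>) + real n * (\<delta>' / 2) \<le> real n * (L + \<delta>')"
          unfolding distrib_left[symmetric] using \<eta>(3) n(1) by (intro mult_left_mono) auto
        finally show "rosc r (\<lambda>x. of_nat n * f x - G x) \<le> real n * (L + \<delta>')" by simp
      qed (use t(1) in simp)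
      moreover have "t / real n * (real n * (L + \<delta>')) = t * (L + \<delta>')" using n(1) by simp
      moreover have "(1 - t) * (L + \<delta>') + t * (L + \<delta>') = L + \<delta>'" by (simp add: algebra_simps)
      ultimately show ?thesis using 1 by linarith
    qed
  qed
  \<comment> \<open>Removing the mean leaves \<open>B_norm\<close> unchanged and makes the L^1 norm
    at most \<open>B_norm\<close>, so that a sequence of correctors can be summed as
    functions.\<close>
  define c where "c = (CINT x. h0 x)"
  have cB: "(\<lambda>x :: real^'n. c) \<in> B_space" by (rule B0_spaceD(1)[OF UC_B0[OF const_UC]])
  have cN: "B_norm (\<lambda>x :: real^'n. c) = 0" using B_norm_eq_0_iff[OF cB] by auto
  show thesis
  proof (rule that[of "\<lambda>x. h0 x - c"])
    show "(\<lambda>x. h0 x - c) \<in> UC_space"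
      using UC_lincomb[OF h0 const_UC, of 1 "-1" c] by simp
    show "B_norm (\<lambda>x. f x - (h0 x - c)) \<le> L + \<delta>'"
      using cseminorm_add[OF cseminorm_B cseminorm_diff_mem[OF cseminorm_B f h0B] cB] fh0 cN
      by (simp add: algebra_simps)
    show "B_norm (\<lambda>x. h0 x - c) \<le> 2 * \<delta>"
      using cseminorm_diff[OF cseminorm_B h0B cB] h0N cN by simp
    show "(CINT x. cmod (h0 x - c)) \<le> 2 * \<delta>"
      using mean_deviation_le_B_norm[OF h0B] h0N by (simp add: c_def)
  qed
qed

text \<open>Completeness in the form needed for iterated corrections. The L^1 bound is a separate
  hypothesis because \<open>B_norm\<close> ignores constants, whereas the sum has to converge as a
  function.\<close>

lemma B0_series:
  fixes h :: "nat \<Rightarrow> 'n::finite cfun"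
  assumes h: "\<And>j. h j \<in> B0_space" and b: "\<And>j. B_norm (h j) \<le> b j" "\<And>j. (CINT x. cmod (h j x)) \<le> b j"
    and sb: "summable b"
  obtains g where "g \<in> B0_space" "(\<lambda>J. \<integral>x. cmod (g x - (\<Sum>j<J. h j x)) \<partial>cube_measure) \<longlonglongrightarrow> 0"
proof -
  let ?M = "cube_measure :: (real^'n) measure"
  note hB = B0_spaceD(1)[OF h]
  note hL1 = B_spaceD(1)[OF hB]
  have hint: "integrable ?M (h j)" for j using hL1[of j] by (simp add: L1_space_def)
  have b0: "0 \<le> b j" for j using b(1)[of j] B_norm_nonneg[of "h j"] by simp
  have sI: "summable (\<lambda>j. \<integral>x. cmod (h j x) \<partial>?M)"
    using b(2) by (intro summable_comparison_test'[OF sb, of 0]) simp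
  have "(\<integral>\<^sup>+x. (\<Sum>j. ennreal (cmod (h j x))) \<partial>?M) = (\<Sum>j. \<integral>\<^sup>+x. ennreal (cmod (h j x)) \<partial>?M)"
    using hint by (intro nn_integral_suminf) auto
  also have "\<dots> = (\<Sum>j. ennreal (CINT x. cmod (h j x)))"
    using hint by (intro suminf_cong nn_integral_eq_integral) auto
  also have "\<dots> = ennreal (\<Sum>j. CINT x. cmod (h j x))"
    by (intro suminf_ennreal2 sI) simp
  also have "\<dots> \<noteq> \<infinity>" by simp
  finally have "AE x in ?M. (\<Sum>j. ennreal (cmod (h j x))) \<noteq> \<infinity>"
    using hint by (intro nn_integral_PInf_AE) auto
  then have ae: "AE x in ?M. summable (\<lambda>j. cmod (h j x))"
    by eventually_elim (auto intro: summable_suminf_not_top)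
  define g where "g x = (\<Sum>j. h j x)" for x
  define w where "w x = (\<Sum>j. cmod (h j x))" for x
  have gi: "integrable ?M g"
    unfolding g_def using integrable_suminf[OF hint ae sI] .
  have wi: "integrable ?M w"
    unfolding w_def using hint ae sI by (intro integrable_suminf) auto
  have gL1: "g \<in> L1_space" using gi by (simp add: L1_space_def)
  define S where "S J x = (\<Sum>j<J. h j x)" for J x
  have SL1: "S J \<in> L1_space" for J
    unfolding S_def by (intro cseminorm_sum_mem[OF cseminorm_L1] hL1)
  have Si: "integrable ?M (S J)" for J using SL1[of J] by (simp add: L1_space_def)
  have lim: "(\<lambda>J. \<integral>x. cmod (g x - S J x) \<partial>?M) \<longlonglongrightarrow> (\<integral>x. 0 \<partial>?M)"
  proof (rule integral_dominated_convergence)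
    show "integrable ?M w" by (rule wi)
    show "AE x in ?M. (\<lambda>J. cmod (g x - S J x)) \<longlonglongrightarrow> 0"
      using ae
    proof eventually_elim
      case (elim x)
      have "(\<lambda>J. S J x) \<longlonglongrightarrow> g x"
        unfolding S_def g_def by (rule summable_LIMSEQ[OF summable_norm_cancel[OF elim]])
      then have "(\<lambda>J. cmod (g x - S J x)) \<longlonglongrightarrow> cmod (g x - g x)" by (intro tendsto_intros)
      then show ?case by simp
    qed
    show "AE x in ?M. norm (cmod (g x - S J x)) \<le> w x" for J
      using ae
    proof eventually_elim
      case (elim x)
      have "g x - S J x = (\<Sum>j. h (j + J) x)"
        unfolding g_def S_def using suminf_split_initial_segment[OF summable_norm_cancel[OF elim], of J] by simp
      also have "cmod \<dots> \<le> (\<Sum>j. cmod (h (j + J) x))"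
        by (rule summable_norm[OF summable_ignore_initial_segment[OF elim]])
      also have "\<dots> \<le> w x"
        unfolding w_def using suminf_split_initial_segment[OF elim, of J] by (simp add: sum_nonneg)
      finally show ?case by simp
    qed
  qed (use gi Si in auto)
  then have lim: "(\<lambda>J. \<integral>x. cmod (g x - S J x) \<partial>?M) \<longlonglongrightarrow> 0" by simp
  have SB0: "S J \<in> B0_space" for J
    unfolding S_def by (intro cseminorm_sum_mem[OF cseminorm_B0] h)
  \<comment> \<open>A later partial sum J + K separates the tail of the norms from an L^1 remainder;
    at fixed r the remainder disappears as K grows.\<close>
  have tail: "rosc r (\<lambda>x. g x - S J x) \<le> (\<Sum>j. b (j + J))" if r: "0 < r" "r \<le> 1" for r J
  proof -
    have "rosc r (\<lambda>x. g x - S J x) \<le> (\<Sum>j. b (j + J)) + 2 / r * (CINT x. cmod (g x - S (J + K) x))" for K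
    proof -
      have d: "S (J + K) x - S J x = (\<Sum>j<K. h (j + J) x)" for x
        unfolding S_def using sum.nat_group[of "\<lambda>j. h j x" 1 J]
        by (induction K) (auto simp: add.commute)
      have "rosc r (\<lambda>x. S (J + K) x - S J x) \<le> (\<Sum>j<K. rosc r (h (j + J)))"
        unfolding d by (intro cseminorm_sum[OF cseminorm_rosc[OF r(1)]] hL1)
      also have "\<dots> \<le> (\<Sum>j<K. b (j + J))"
        by (intro sum_mono order_trans[OF rosc_le_B_norm[OF hB r] b(1)])
      also have "\<dots> \<le> (\<Sum>j. b (j + J))"
        by (intro sum_le_suminf summable_ignore_initial_segment[OF sb]) (auto simp: b0)
      finally have "rosc r (\<lambda>x. S (J + K) x - S J x) \<le> (\<Sum>j. b (j + J))" .
      moreover have "rosc r (\<lambda>x. g x - S (J + K) x) \<le> 2 / r * (CINT x. cmod (g x - S (J + K) x))"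
        by (rule rosc_le_L1[OF r(1) L1_diff[OF gL1 SL1]])
      ultimately show ?thesis
        using cseminorm_add[OF cseminorm_rosc[OF r(1)] L1_diff[OF gL1 SL1[of "J + K"]] L1_diff[OF SL1[of "J + K"] SL1[of J]]]
        by simp
    qed
    moreover have "(\<lambda>K. (\<Sum>j. b (j + J)) + 2 / r * (CINT x. cmod (g x - S (J + K) x))) \<longlonglongrightarrow> (\<Sum>j. b (j + J)) + 2 / r * 0"
      using LIMSEQ_ignore_initial_segment[OF lim, of J] by (intro tendsto_intros) (simp add: add.commute)
    ultimately show ?thesis
      by (intro LIMSEQ_le_const) auto
  qed
  have "g \<in> B0_space"
  proof (rule B0_spaceI)
    show "g \<in> B_space"
      using tail[of _ 0] by (intro B_spaceI(1)[OF gL1, of "\<Sum>j. b j"]) (simp add: S_def)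
    fix \<eta> :: real assume \<eta>: "0 < \<eta>"
    obtain J where J: "norm (\<Sum>j. b (j + J)) < \<eta> / 2"
      using suminf_exist_split[OF _ sb, of "\<eta> / 2"] \<eta> by auto
    have "0 < \<eta> / 2" using \<eta> by simp
    then obtain e where e: "0 < e" "e \<le> 1" "\<And>r. 0 < r \<Longrightarrow> r \<le> e \<Longrightarrow> rosc r (S J) \<le> \<eta> / 2"
      using B0_small_scales[OF SB0] by blast
    have "rosc r g \<le> \<eta>" if "0 < r" "r \<le> e" for r
      using cseminorm_add[OF cseminorm_rosc[OF that(1)] L1_diff[OF gL1 SL1[of J]] SL1[of J]]
        tail[of r J] e(2) e(3)[OF that] that J by simp
    then show "\<exists>e>0. \<forall>r. 0 < r \<longrightarrow> r \<le> e \<longrightarrow> rosc r g \<le> \<eta>" using e(1) by blast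
  qed
  then show thesis using that lim by (simp add: S_def)
qed

lemma limsup_osc_real:
  assumes "f \<in> B_space"
  obtains L where "limsup_osc f = ennreal L" "0 \<le> L"
proof -
  have "limsup_osc f \<le> ennreal (B_norm f)"
    using limsup_osc_le_B_enorm[OF B_spaceD(1)[OF assms]] B_spaceD(2)[OF assms] by simp
  then show thesis using that by (cases "limsup_osc f") (auto simp: top_unique)
qed

text \<open>Correctors are applied repeatedly, halving the allowed excess over L each time. As a
  corrector costs at most twice the current excess, the corrections sum to an element of
  \<open>B0_space\<close>, and subtracting it leaves exactly L.\<close>

lemma B_best_approximation:
  fixes f :: "'n::finite cfun"
  assumes f: "f \<in> B_space"
  obtains g where "g \<in> B0_space" "B_enorm (\<lambda>x. f x - g x) = limsup_osc f"
proof -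
  obtain L where L: "limsup_osc f = ennreal L" "0 \<le> L" by (rule limsup_osc_real[OF f])
  \<comment> \<open>The initial excess is at least the norm of f, so f itself satisfies the starting
    condition; the summand 1 keeps all excesses positive.\<close>
  define \<delta> where "\<delta> j = (B_norm f + 1) * (1 / 2) ^ j" for j :: nat
  have \<delta>: "0 < \<delta> j" for j using B_norm_nonneg[of f] by (simp add: \<delta>_def)
  define P where "P j F \<longleftrightarrow> F \<in> B_space \<and> limsup_osc F \<le> ennreal L \<and> B_norm F \<le> L + \<delta> j" for j and F :: "'n cfun"
  define Q where "Q j F F' \<longleftrightarrow> (\<lambda>x. F x - F' x) \<in> UC_space \<and> B_norm (\<lambda>x. F x - F' x) \<le> 2 * \<delta> j \<and>
    (CINT x. cmod (F x - F' x)) \<le> 2 * \<delta> j" for j and F F' :: "'n cfun"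
  have "\<exists>F. \<forall>j. (P j (F j) \<and> (j = 0 \<longrightarrow> F j = f)) \<and> Q j (F j) (F (Suc j))"
  proof (rule dependent_nat_choice)
    show "\<exists>F. P 0 F \<and> ((0 :: nat) = 0 \<longrightarrow> F = f)"
      using f L by (auto simp: P_def \<delta>_def)
    fix F j assume "P j F \<and> (j = 0 \<longrightarrow> F = f)"
    then have F: "F \<in> B_space" "limsup_osc F \<le> ennreal L" "B_norm F \<le> L + \<delta> j" by (auto simp: P_def)
    obtain h where h: "h \<in> UC_space" "B_norm (\<lambda>x. F x - h x) \<le> L + \<delta> (Suc j)" "B_norm h \<le> 2 * \<delta> j"
      "(CINT x. cmod (h x)) \<le> 2 * \<delta> j"
      by (rule UC_corrector[OF F(1,2) L(2) \<delta> F(3) \<delta>[of "Suc j"]])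
    have "P (Suc j) (\<lambda>x. F x - h x)"
      using h(2) order_trans[OF limsup_osc_diff_B0[OF B_spaceD(1)[OF F(1)] UC_B0[OF h(1)]] F(2)]
        cseminorm_diff_mem[OF cseminorm_B F(1) B0_spaceD(1)[OF UC_B0[OF h(1)]]] by (simp add: P_def)
    moreover have "Q j F (\<lambda>x. F x - h x)" using h by (simp add: Q_def)
    ultimately show "\<exists>F'. (P (Suc j) F' \<and> (Suc j = 0 \<longrightarrow> F' = f)) \<and> Q j F F'" by blast
  qed
  then obtain F where F: "F 0 = f" "\<And>j. P j (F j)" "\<And>j. Q j (F j) (F (Suc j))" by blast
  define h where "h j x = F j x - F (Suc j) x" for j x
  have hQ: "h j \<in> UC_space" "B_norm (h j) \<le> 2 * \<delta> j" "(CINT x. cmod (h j x)) \<le> 2 * \<delta> j" for j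
    using F(3)[of j] by (auto simp: Q_def h_def[abs_def])
  have "summable (\<lambda>j. 2 * \<delta> j)"
    unfolding \<delta>_def by (intro summable_mult summable_geometric) simp
  then obtain g where g: "g \<in> B0_space" "(\<lambda>J. \<integral>x. cmod (g x - (\<Sum>j<J. h j x)) \<partial>cube_measure) \<longlonglongrightarrow> 0"
    using B0_series[of h "\<lambda>j. 2 * \<delta> j"] UC_B0 hQ by blast
  note gL1 = B_spaceD(1)[OF B0_spaceD(1)[OF g(1)]]
  have FJ: "F J x = f x - (\<Sum>j<J. h j x)" for J x
    by (induction J) (auto simp: F(1) h_def)
  have FB: "F J \<in> B_space" "B_norm (F J) \<le> L + \<delta> J" for J using F(2)[of J] by (auto simp: P_def)
  have "B_enorm (\<lambda>x. f x - g x) \<le> ennreal L"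
  proof (rule B_enorm_le[OF L1_diff[OF B_spaceD(1)[OF f] gL1]])
    fix r :: real assume r: "0 < r" "r \<le> 1"
    have "rosc r (\<lambda>x. f x - g x) \<le> (L + \<delta> J) + 2 / r * (CINT x. cmod (g x - (\<Sum>j<J. h j x)))" for J
    proof -
      have SL1: "(\<lambda>x. \<Sum>j<J. h j x) \<in> L1_space"
        by (intro cseminorm_sum_mem[OF cseminorm_L1] UC_L1 hQ)
      note d = L1_diff[OF gL1 SL1]
      have "(\<lambda>x. f x - g x) = (\<lambda>x. F J x - (g x - (\<Sum>j<J. h j x)))" by (auto simp: FJ)
      then show ?thesis
        using cseminorm_diff[OF cseminorm_rosc[OF r(1)] B_spaceD(1)[OF FB(1)] d, of J]
          rosc_le_B_norm[OF FB(1) r, of J] FB(2)[of J] rosc_le_L1[OF r(1) d] by simp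
    qed
    moreover have "(\<lambda>J. (L + \<delta> J) + 2 / r * (CINT x. cmod (g x - (\<Sum>j<J. h j x)))) \<longlonglongrightarrow>
        (L + (B_norm f + 1) * 0) + 2 / r * 0"
      unfolding \<delta>_def by (intro tendsto_intros g(2) LIMSEQ_power_zero) simp
    ultimately show "rosc r (\<lambda>x. f x - g x) \<le> L"
      using LIMSEQ_le_const[of _ L] by simp
  qed
  with limsup_osc_le_dist_B0[OF f g(1)] show thesis
    using L g(1) by (intro that[of g]) auto
qed

lemma B_dist_UC:
  assumes f: "f \<in> B_space"
  shows "B_dist f UC_space = limsup_osc f"
proof (rule antisym)
  show "limsup_osc f \<le> B_dist f UC_space"
    unfolding B_dist_def by (intro INF_greatest limsup_osc_le_dist_B0[OF f] UC_B0)
  obtain L where L: "limsup_osc f = ennreal L" "0 \<le> L" by (rule limsup_osc_real[OF f])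
  show "B_dist f UC_space \<le> limsup_osc f"
  proof (rule ennreal_le_epsilon)
    fix v :: real assume v: "0 < v"
    obtain h where h: "h \<in> UC_space" "B_norm (\<lambda>x. f x - h x) \<le> L + v"
      using UC_corrector[OF f _ L(2) _ _ v, of "B_norm f + 1"] L B_norm_nonneg[of f] by auto
    have "B_dist f UC_space \<le> B_enorm (\<lambda>x. f x - h x)"
      unfolding B_dist_def by (rule INF_lower[OF h(1)])
    also have "\<dots> = ennreal (B_norm (\<lambda>x. f x - h x))"
      by (rule B_spaceD(2)[symmetric, OF cseminorm_diff_mem[OF cseminorm_B f B0_spaceD(1)[OF UC_B0[OF h(1)]]]])
    also have "\<dots> \<le> limsup_osc f + ennreal v"
      using h(2) L v by (simp add: ennreal_plus[symmetric] ennreal_leI del: ennreal_plus)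
    finally show "B_dist f UC_space \<le> limsup_osc f + ennreal v" .
  qed
qed

lemma B_dist_B0:
  assumes f: "f \<in> B_space"
  shows "B_dist f B0_space = limsup_osc f"
proof (rule antisym)
  show "limsup_osc f \<le> B_dist f B0_space"
    unfolding B_dist_def by (intro INF_greatest limsup_osc_le_dist_B0[OF f])
  obtain g where "g \<in> B0_space" "B_enorm (\<lambda>x. f x - g x) = limsup_osc f"
    by (rule B_best_approximation[OF f])
  then show "B_dist f B0_space \<le> limsup_osc f"
    unfolding B_dist_def by (intro INF_lower2[of g]) auto
qed

text \<open>The biadjoint of the inclusion takes values in the bidual of L^p modulo constants. The
  reflexivity clause identifies this bidual with the image of \<open>\<kappa>\<close>, and the
  inclusion is bounded by the embedding clause. Norms in the bidual clause are compared for every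
  representing f, because \<open>B_space\<close> consists of representatives.\<close>

theorem theorem2:
  shows "(\<forall>p q :: real. 1 < p \<and> (CARD('n) = 1 \<or> p < real CARD('n) / (real CARD('n) - 1)) \<and> 1 / p + 1 / q = 1 \<longrightarrow>
      (let B = B_space :: (real^'n \<Rightarrow> complex) set;
           B0 = B0_space :: (real^'n \<Rightarrow> complex) set;
           X = Lp_space p :: (real^'n \<Rightarrow> complex) set;
           X_norm = Lp_mod_norm p;
           X' = Lp_mean_zero q :: (real^'n \<Rightarrow> complex) set;
           X_dual = dual_space X X_norm;
           B0_dual = dual_space B0 B_norm;
           B0_dual_norm = dual_norm B0 B_norm;
           B0_bidual = dual_space B0_dual B0_dual_norm;
           B0_bidual_norm = dual_norm B0_dual B0_dual_norm;
           \<kappa> = canonical_embedding X X_norm;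
           I_adj = adjoint_op B0 (\<lambda>f. f);
           I_biadj = adjoint_op X_dual I_adj
       in
          (B \<subseteq> X \<and> (\<exists>C. \<forall>f\<in>B. X_norm f \<le> C * B_norm f)) \<and>
          pairing_functional X ` X' = X_dual \<and>
          \<kappa> ` X = dual_space X_dual (dual_norm X X_norm) \<and>
          pairing_functional B ` X' \<subseteq> B_predual \<and>
          (\<exists>T. isometric_isomorphism B_predual B_predual_norm B0_dual B0_dual_norm T \<and>
               (\<forall>g\<in>X'. T (pairing_functional B g) = pairing_functional B0 g)) \<and>
          (\<exists>J. isometric_isomorphism B B_norm
                 (dual_space B_predual B_predual_norm) (dual_norm B_predual B_predual_norm) J \<and>
               (\<forall>f\<in>B. \<forall>g\<in>X'. J f (pairing_functional B g) = (\<integral>x. f x * g x \<partial>cube_measure))) \<and>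
          (I_biadj ` B0_bidual = \<kappa> ` B \<and>
           (\<forall>\<Phi>\<in>B0_bidual. \<forall>f\<in>B. I_biadj \<Phi> = \<kappa> f \<longrightarrow> B0_bidual_norm \<Phi> = B_norm f))))
    \<and> (\<forall>f \<in> (B_space :: (real^'n \<Rightarrow> complex) set).
        B_dist f B0_space = limsup_osc f \<and>
        B_dist f UC_space = limsup_osc f \<and>
        (\<exists>g. is_arg_min (\<lambda>g. B_enorm (\<lambda>x. f x - g x)) (\<lambda>g. g \<in> B0_space) g \<and>
             B_enorm (\<lambda>x. f x - g x) = limsup_osc f))"
  unfolding Let_def
proof (intro conjI allI impI ballI)
  fix p q :: real
  assume "1 < p \<and> (CARD('n) = 1 \<or> p < real CARD('n) / (real CARD('n) - 1)) \<and> 1 / p + 1 / q = 1"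
  then have p: "1 < p" and pd: "CARD('n) = 1 \<or> p < real CARD('n) / (real CARD('n) - 1)" and q: "1 / p + 1 / q = 1"
    by auto
  obtain D where D: "0 \<le> D" and DB: "\<And>f :: 'n cfun. f \<in> B_space \<Longrightarrow> f \<in> Lp_space p"
    "\<And>f :: 'n cfun. f \<in> B_space \<Longrightarrow> Lp_mod_norm p f \<le> D * B_norm f"
    by (rule B_embedding[OF p pd]) blast
  have sub: "(B_space :: 'n cfun set) \<subseteq> Lp_space p"
    and bound: "\<forall>f\<in>(B_space :: 'n cfun set). Lp_mod_norm p f \<le> D * B_norm f"
    using DB by auto
  note ctxt = p q D sub bound
  show "(B_space :: 'n cfun set) \<subseteq> Lp_space p" by (rule sub)
  show "\<exists>C. \<forall>f\<in>(B_space :: 'n cfun set). Lp_mod_norm p f \<le> C * B_norm f" using bound by blast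
  show "pairing_functional (Lp_space p) ` Lp_mean_zero q = dual_space (Lp_space p :: 'n cfun set) (Lp_mod_norm p)"
    by (rule Lp_mod_dual[OF p q])
  show "canonical_embedding (Lp_space p :: 'n cfun set) (Lp_mod_norm p) ` Lp_space p =
      dual_space (dual_space (Lp_space p) (Lp_mod_norm p)) (dual_norm (Lp_space p) (Lp_mod_norm p))"
    by (rule Lp_mod_reflexive[OF p q])
  show PX: "pairing_functional B_space ` (Lp_mean_zero q :: 'n cfun set) \<subseteq> B_predual"
    using pairing_in_predual[OF ctxt] by blast
  show "\<exists>T. isometric_isomorphism (B_predual :: ('n cfun \<Rightarrow> complex) set) B_predual_norm
        (dual_space B0_space B_norm) (dual_norm B0_space B_norm) T \<and>
      (\<forall>g\<in>Lp_mean_zero q. T (pairing_functional B_space g) = pairing_functional B0_space g)"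
    using predual_isometric_B0_dual[OF ctxt] restriction_pairing[OF ctxt] by (intro exI conjI ballI)
  show "\<exists>J. isometric_isomorphism (B_space :: 'n cfun set) B_norm
        (dual_space B_predual B_predual_norm) (dual_norm B_predual B_predual_norm) J \<and>
      (\<forall>f\<in>B_space. \<forall>g\<in>Lp_mean_zero q. J f (pairing_functional B_space g) = (\<integral>x. f x * g x \<partial>cube_measure))"
    using PX by (intro exI[of _ "\<lambda>f \<phi>. if \<phi> \<in> B_predual then \<phi> f else 0"] conjI[OF B_isometric_predual_dual[OF ctxt]])
      (auto simp: pairing_functional_def)
  show "adjoint_op (dual_space (Lp_space p :: 'n cfun set) (Lp_mod_norm p)) (adjoint_op B0_space (\<lambda>f. f)) `
      dual_space (dual_space B0_space B_norm) (dual_norm B0_space B_norm) =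
      canonical_embedding (Lp_space p) (Lp_mod_norm p) ` B_space"
    by (rule bidual_representation(1)[OF ctxt])
  show "dual_norm (dual_space B0_space B_norm) (dual_norm B0_space B_norm) \<Phi> = B_norm f"
    if "\<Phi> \<in> dual_space (dual_space B0_space B_norm) (dual_norm B0_space B_norm)" "f \<in> B_space"
      "adjoint_op (dual_space (Lp_space p) (Lp_mod_norm p)) (adjoint_op B0_space (\<lambda>f. f)) \<Phi> =
       canonical_embedding (Lp_space p) (Lp_mod_norm p) f" for \<Phi> and f :: "'n cfun"
    by (rule bidual_representation(2)[OF ctxt that])
next
  fix f :: "'n cfun" assume f: "f \<in> B_space"
  show "B_dist f B0_space = limsup_osc f" by (rule B_dist_B0[OF f])
  show "B_dist f UC_space = limsup_osc f" by (rule B_dist_UC[OF f])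
  obtain g where g: "g \<in> B0_space" "B_enorm (\<lambda>x. f x - g x) = limsup_osc f"
    by (rule B_best_approximation[OF f])
  then have "is_arg_min (\<lambda>g. B_enorm (\<lambda>x. f x - g x)) (\<lambda>g. g \<in> B0_space) g"
    using limsup_osc_le_dist_B0[OF f] by (simp add: is_arg_min_linorder)
  with g(2) show "\<exists>g. is_arg_min (\<lambda>g. B_enorm (\<lambda>x. f x - g x)) (\<lambda>g. g \<in> B0_space) g \<and>
      B_enorm (\<lambda>x. f x - g x) = limsup_osc f" by blast
qed

end
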